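(* Suppose that, with all notation as defined in the context, the following conditions hold. (Sampling) $\mathbb{C}[U_{i,n},U_{j,n}\mid\mathcal{X}_n,\mathcal{W}_n]=0$ for $i\neq j$, and $\max_{1\le i\le N_n}\#\mathcal{T}_{i,n}=O(1)$, where $\#\mathcal{T}_{i,n}$ is the cardinality of $\mathcal{T}_{i,n}$ and $\{\mathcal{T}_{i,n}:1\le i\le N_n\}$ is a partition of $\{1,\ldots,n\}$ such that $\{(U_{t,n},\mathbf{V}_{t,n}):t\in\mathcal{T}_{i,n}\}$ are independent over $i$ conditional on $\mathcal{W}_n$. (Design) $\mathbb{P}[\lambda_{\min}(\sum_{i=1}^n\mathbf{w}_{i,n}\mathbf{w}_{i,n}')>0]\to1$, $\limsup_{n\to\infty}K_n/n<1$, and $\mathcal{C}_n=O_p(1)$. (Approximations) $\chi_n=O(1)$, $\varrho_n+n(\varrho_n-\rho_n)+n\chi_n\varrho_n=o(1)$, and $\max_{1\le i\le n}\|\hat{\mathbf{v}}_{i,n}\|/\sqrt{n}=o_p(1)$. If $\mathbb{E}[U_{i,n}^2\mid\mathcal{X}_n,\mathcal{W}_n]=\sigma_n^2$ for all $1\le i\le n$, then, as $n\to\infty$, $$\hat{\mathbf{\Omega}}_n^{-1/2}\sqrt{n}(\hat{\boldsymbol{\beta}}_n-\boldsymbol{\beta})\to_d\mathcal{N}(\mathbf{0},\mathbf{I}),\qquad\hat{\mathbf{\Omega}}_n=\hat{\mathbf{\Gamma}}_n^{-1}\hat{\mathbf{\Sigma}}_n\hat{\mathbf{\Gamma}}_n^{-1},$$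 holds with $\hat{\mathbf{\Sigma}}_n=\hat{\mathbf{\Sigma}}_n^{\mathrm{HO}}$, where $$\hat{\mathbf{\Sigma}}_n^{\mathrm{HO}}=\hat\sigma_n^2\hat{\mathbf{\Gamma}}_n,\qquad\hat\sigma_n^2=\frac{1}{n-d-K_n}\sum_{i=1}^n\hat u_{i,n}^2.$$
   Context: Model. For each $n$, $\{(y_{i,n},\mathbf{x}_{i,n}',\mathbf{w}_{i,n}'):1\le i\le n\}$ is generated by $$y_{i,n}=\boldsymbol{\beta}'\mathbf{x}_{i,n}+\boldsymbol{\gamma}_n'\mathbf{w}_{i,n}+u_{i,n},\qquad i=1,\ldots,n,$$ where $y_{i,n}$ is a scalar outcome, $\mathbf{x}_{i,n}$ is a random vector of fixed dimension $d$, $\mathbf{w}_{i,n}$ is a random vector of dimension $K_n$ (which may grow with $n$), and $u_{i,n}$ is an unobserved scalar error. All limits are as $n\to\infty$. $\|\cdot\|$ is the Euclidean norm, $\lambda_{\min}(\cdot)$ the minimum eigenvalue, $\mathbf{1}(\cdot)$ the indicator function, and $\mathbb{C}[\cdot,\cdot\mid\cdot]$ conditional covariance. Estimator. Let $M_{ij,n}=\mathbf{1}(i=j)-\mathbf{w}_{i,n}'(\sum_{k=1}^n\mathbf{w}_{k,n}\mathbf{w}_{k,n}')^{-1}\mathbf{w}_{j,n}$, $\hat{\mathbf{v}}_{i,n}=\sum_{j=1}^nM_{ij,n}\mathbf{x}_{j,n}$, $\hat{\mathbf{\Gamma}}_n=\frac1n\sum_{i=1}^n\hat{\mathbf{v}}_{i,n}\hat{\mathbf{v}}_{i,n}'$,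 and let $$\hat{\boldsymbol{\beta}}_n=\Big(\sum_{i=1}^n\hat{\mathbf{v}}_{i,n}\hat{\mathbf{v}}_{i,n}'\Big)^{-1}\Big(\sum_{i=1}^n\hat{\mathbf{v}}_{i,n}y_{i,n}\Big)$$ be the OLS estimator of $\boldsymbol{\beta}$. The residuals are $\hat u_{i,n}=\sum_{j=1}^nM_{ij,n}(y_{j,n}-\hat{\boldsymbol{\beta}}_n'\mathbf{x}_{j,n})$. The relevant moments and inverses are assumed to exist; sample statistics may be given arbitrary values on events, of probability tending to zero, where an inverse or square root fails to exist. Further quantities. $\mathcal{X}_n=(\mathbf{x}_{1,n},\ldots,\mathbf{x}_{n,n})$, and $\mathcal{W}_n$ is a collection of random variables satisfying $\mathbb{E}[\mathbf{w}_{i,n}\mid\mathcal{W}_n]=\mathbf{w}_{i,n}$. Define $$\varrho_n=\frac1n\sum_{i=1}^n\mathbb{E}[R_{i,n}^2],\quad R_{i,n}=\mathbb{E}[u_{i,n}\mid\mathcal{X}_n,\mathcal{W}_n],$$ $$\rho_n=\frac1n\sum_{i=1}^n\mathbb{E}[r_{i,n}^2],\quad r_{i,n}=\mathbb{E}[u_{i,n}\mid\mathcal{W}_n],$$ $$\chi_n=\frac1n\sum_{i=1}^n\mathbb{E}[\|\mathbf{Q}_{i,n}\|^2],\quad\mathbf{Q}_{i,n}=\mathbb{E}[\mathbf{v}_{i,n}\mid\mathcal{W}_n],$$ where $\mathbf{v}_{i,n}=\mathbf{x}_{i,n}-(\sum_{j=1}^n\mathbb{E}[\mathbf{x}_{j,n}\mathbf{w}_{j,n}'])(\sum_{j=1}^n\mathbb{E}[\mathbf{w}_{j,n}\mathbf{w}_{j,n}'])^{-1}\mathbf{w}_{i,n}$.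 Let $U_{i,n}=y_{i,n}-\mathbb{E}[y_{i,n}\mid\mathcal{X}_n,\mathcal{W}_n]$, $\mathbf{V}_{i,n}=\mathbf{x}_{i,n}-\mathbb{E}[\mathbf{x}_{i,n}\mid\mathcal{W}_n]$, $\tilde{\mathbf{V}}_{i,n}=\sum_{j=1}^nM_{ij,n}\mathbf{V}_{j,n}$, $\tilde{\mathbf{\Gamma}}_n=\frac1n\sum_{i=1}^n\tilde{\mathbf{V}}_{i,n}\tilde{\mathbf{V}}_{i,n}'$, and $$\mathcal{C}_n=\max_{1\le i\le n}\Big\{\mathbb{E}[U_{i,n}^4\mid\mathcal{X}_n,\mathcal{W}_n]+\mathbb{E}[\|\mathbf{V}_{i,n}\|^4\mid\mathcal{W}_n]+\frac{1}{\mathbb{E}[U_{i,n}^2\mid\mathcal{X}_n,\mathcal{W}_n]}\Big\}+\frac{1}{\lambda_{\min}(\mathbb{E}[\tilde{\mathbf{\Gamma}}_n\mid\mathcal{W}_n])}.$$ *)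

theory Defs
  imports
    "HOL-Probability.Probability"
    "Jordan_Normal_Form.Char_Poly"
    "Jordan_Normal_Form.Gauss_Jordan_Elimination"
begin

text \<open>
  Conventions. Regressors of fixed dimension live in \<^typ>\<open>real ^ 'd\<close>. Regressors whose dimension
  \<open>K n\<close> varies live in \<^typ>\<open>real Matrix.vec\<close> with an explicit carrier \<open>carrier_vec (K n)\<close>.
  Every array is indexed by the sample size \<open>n\<close> and then by the observation \<open>i \<in> {1..n}\<close>; the
  probability space \<open>M n\<close> and the conditioning \<open>\<sigma>\<close>-algebra \<open>F n\<close>, generated by the collection
  \<open>\<W>\<^sub>n\<close>, may change with \<open>n\<close>.
\<close>

no_notation Matrix.vec_index (infixl \<open>$\<close> 100)
no_notation Matrix.scalar_prod (infix \<open>\<bullet>\<close> 70)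

section \<open>Linear algebra\<close>

definition outer :: "real ^ 'm \<Rightarrow> real ^ 'n \<Rightarrow> real ^ 'n ^ 'm" where
  "outer a b = (\<chi> i j. a $ i * b $ j)"

text \<open>Both minimum eigenvalues are used for symmetric matrices only, which have a finite nonempty
  set of eigenvalues, except that the \<open>0 \<times> 0\<close> matrix has none.\<close>

definition min_eigenvalue :: "real ^ 'n ^ 'n \<Rightarrow> real" where
  "min_eigenvalue A = Min {l. \<exists>v. v \<noteq> 0 \<and> A *v v = l *\<^sub>R v}"

definition min_eigenvalue_mat :: "real Matrix.mat \<Rightarrow> real" where
  "min_eigenvalue_mat A = Min {l. eigenvalue A l}"

text \<open>The value at a singular matrix is an arbitrary convention, as it is for \<^const>\<open>matrix_inv\<close>.\<close>

definition mat_inv :: "real Matrix.mat \<Rightarrow> real Matrix.mat" where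
  "mat_inv A = (case mat_inverse A of Some B \<Rightarrow> B | None \<Rightarrow> 0\<^sub>m (dim_row A) (dim_col A))"

text \<open>The symmetric positive semidefinite square root. It is unique whenever it exists, and
  otherwise the description denotes a fixed arbitrary matrix.\<close>

definition matrix_sqrt :: "real ^ 'n ^ 'n \<Rightarrow> real ^ 'n ^ 'n" where
  "matrix_sqrt A =
     (THE B. Finite_Cartesian_Product.transpose B = B \<and> (\<forall>v. 0 \<le> v \<bullet> (B *v v)) \<and> B ** B = A)"

section \<open>Probability\<close>

definition vec_cond_exp ::
  "'a measure \<Rightarrow> 'a measure \<Rightarrow> ('a \<Rightarrow> real ^ 'd) \<Rightarrow> 'a \<Rightarrow> real ^ 'd" where
  "vec_cond_exp M F X \<omega> = (\<chi> a. real_cond_exp M F (\<lambda>\<omega>. X \<omega> $ a) \<omega>)"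

definition matrix_cond_exp ::
  "'a measure \<Rightarrow> 'a measure \<Rightarrow> ('a \<Rightarrow> real ^ 'n ^ 'm) \<Rightarrow> 'a \<Rightarrow> real ^ 'n ^ 'm" where
  "matrix_cond_exp M F X \<omega> = (\<chi> a b. real_cond_exp M F (\<lambda>\<omega>. X \<omega> $ a $ b) \<omega>)"

definition cond_cov ::
  "'a measure \<Rightarrow> 'a measure \<Rightarrow> ('a \<Rightarrow> real) \<Rightarrow> ('a \<Rightarrow> real) \<Rightarrow> 'a \<Rightarrow> real" where
  "cond_cov M F X Y =
     real_cond_exp M F
       (\<lambda>\<omega>. (X \<omega> - real_cond_exp M F X \<omega>) * (Y \<omega> - real_cond_exp M F Y \<omega>))"

text \<open>Conditional versions of \<^const>\<open>prob_space.indep_sets\<close> and \<^const>\<open>prob_space.indep_vars\<close>: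
  the probabilities are replaced by conditional probabilities given \<open>F\<close>.\<close>

definition cond_indep_sets ::
  "'a measure \<Rightarrow> 'a measure \<Rightarrow> ('i \<Rightarrow> 'a set set) \<Rightarrow> 'i set \<Rightarrow> bool" where
  "cond_indep_sets M F G I \<longleftrightarrow>
     (\<forall>i\<in>I. G i \<subseteq> sets M) \<and>
     (\<forall>J\<subseteq>I. J \<noteq> {} \<longrightarrow> finite J \<longrightarrow> (\<forall>A\<in>Pi J G. AE \<omega> in M.
        real_cond_exp M F (indicator (\<Inter>j\<in>J. A j)) \<omega> =
        (\<Prod>j\<in>J. real_cond_exp M F (indicator (A j)) \<omega>)))"

definition cond_indep_vars ::
  "'a measure \<Rightarrow> 'a measure \<Rightarrow> ('i \<Rightarrow> 'b measure) \<Rightarrow> ('i \<Rightarrow> 'a \<Rightarrow> 'b) \<Rightarrow> 'i set \<Rightarrow> bool" where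
  "cond_indep_vars M F M' X I \<longleftrightarrow>
     (\<forall>i\<in>I. X i \<in> measurable M (M' i)) \<and>
     cond_indep_sets M F (\<lambda>i. {X i -` A \<inter> space M | A. A \<in> sets (M' i)}) I"

definition bounded_in_prob :: "(nat \<Rightarrow> 'a measure) \<Rightarrow> (nat \<Rightarrow> 'a \<Rightarrow> ennreal) \<Rightarrow> bool" where
  "bounded_in_prob M Z \<longleftrightarrow>
     (\<forall>\<epsilon>>0. \<exists>B::real. \<forall>\<^sub>F n in sequentially.
        measure (M n) {\<omega> \<in> space (M n). Z n \<omega> > ennreal B} < \<epsilon>)"

definition vanishes_in_prob :: "(nat \<Rightarrow> 'a measure) \<Rightarrow> (nat \<Rightarrow> 'a \<Rightarrow> real) \<Rightarrow> bool" where
  "vanishes_in_prob M Z \<longleftrightarrow>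
     (\<forall>\<epsilon>>0. (\<lambda>n. measure (M n) {\<omega> \<in> space (M n). \<bar>Z n \<omega>\<bar> > \<epsilon>}) \<longlonglongrightarrow> 0)"

text \<open>Weak convergence tested on bounded continuous functions, since \<^const>\<open>weak_conv_m\<close> covers
  measures on the real line only.\<close>

definition weak_conv_vec :: "(nat \<Rightarrow> (real ^ 'd) measure) \<Rightarrow> (real ^ 'd) measure \<Rightarrow> bool" where
  "weak_conv_vec \<mu> \<nu> \<longleftrightarrow>
     (\<forall>f :: real ^ 'd \<Rightarrow> real. continuous_on UNIV f \<longrightarrow> bounded (range f) \<longrightarrow>
        (\<lambda>n. \<integral>z. f z \<partial>\<mu> n) \<longlonglongrightarrow> (\<integral>z. f z \<partial>\<nu>))"

definition std_normal_vec :: "(real ^ 'd) measure" where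
  "std_normal_vec = density lborel (\<lambda>z. ennreal (\<Prod>a\<in>UNIV. std_normal_density (z $ a)))"

section \<open>Sample statistics\<close>

definition gram :: "(nat \<Rightarrow> nat) \<Rightarrow> (nat \<Rightarrow> nat \<Rightarrow> 'a \<Rightarrow> real Matrix.vec) \<Rightarrow> nat \<Rightarrow> 'a \<Rightarrow> real Matrix.mat"
  where
  "gram K w n \<omega> = Matrix.mat (K n) (K n)
     (\<lambda>(a, b). \<Sum>i=1..n. vec_index (w n i \<omega>) a * vec_index (w n i \<omega>) b)"

definition annih ::
  "(nat \<Rightarrow> nat) \<Rightarrow> (nat \<Rightarrow> nat \<Rightarrow> 'a \<Rightarrow> real Matrix.vec) \<Rightarrow> nat \<Rightarrow> nat \<Rightarrow> nat \<Rightarrow> 'a \<Rightarrow> real" where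
  "annih K w n i j \<omega> =
     of_bool (i = j) - scalar_prod (w n i \<omega>) (mat_inv (gram K w n \<omega>) *\<^sub>v w n j \<omega>)"

definition v_hat ::
  "(nat \<Rightarrow> nat) \<Rightarrow> (nat \<Rightarrow> nat \<Rightarrow> 'a \<Rightarrow> real Matrix.vec) \<Rightarrow> (nat \<Rightarrow> nat \<Rightarrow> 'a \<Rightarrow> real ^ 'd) \<Rightarrow>
   nat \<Rightarrow> nat \<Rightarrow> 'a \<Rightarrow> real ^ 'd" where
  "v_hat K w x n i \<omega> = (\<Sum>j=1..n. annih K w n i j \<omega> *\<^sub>R x n j \<omega>)"

definition Gamma_hat ::
  "(nat \<Rightarrow> nat) \<Rightarrow> (nat \<Rightarrow> nat \<Rightarrow> 'a \<Rightarrow> real Matrix.vec) \<Rightarrow> (nat \<Rightarrow> nat \<Rightarrow> 'a \<Rightarrow> real ^ 'd) \<Rightarrow>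
   nat \<Rightarrow> 'a \<Rightarrow> real ^ 'd ^ 'd" where
  "Gamma_hat K w x n \<omega> =
     (1 / real n) *\<^sub>R (\<Sum>i=1..n. outer (v_hat K w x n i \<omega>) (v_hat K w x n i \<omega>))"

definition beta_hat ::
  "(nat \<Rightarrow> nat) \<Rightarrow> (nat \<Rightarrow> nat \<Rightarrow> 'a \<Rightarrow> real Matrix.vec) \<Rightarrow> (nat \<Rightarrow> nat \<Rightarrow> 'a \<Rightarrow> real ^ 'd) \<Rightarrow>
   (nat \<Rightarrow> nat \<Rightarrow> 'a \<Rightarrow> real) \<Rightarrow> nat \<Rightarrow> 'a \<Rightarrow> real ^ 'd" where
  "beta_hat K w x y n \<omega> =
     matrix_inv (\<Sum>i=1..n. outer (v_hat K w x n i \<omega>) (v_hat K w x n i \<omega>)) *v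
     (\<Sum>i=1..n. y n i \<omega> *\<^sub>R v_hat K w x n i \<omega>)"

definition u_hat ::
  "(nat \<Rightarrow> nat) \<Rightarrow> (nat \<Rightarrow> nat \<Rightarrow> 'a \<Rightarrow> real Matrix.vec) \<Rightarrow> (nat \<Rightarrow> nat \<Rightarrow> 'a \<Rightarrow> real ^ 'd) \<Rightarrow>
   (nat \<Rightarrow> nat \<Rightarrow> 'a \<Rightarrow> real) \<Rightarrow> nat \<Rightarrow> nat \<Rightarrow> 'a \<Rightarrow> real" where
  "u_hat K w x y n i \<omega> =
     (\<Sum>j=1..n. annih K w n i j \<omega> * (y n j \<omega> - beta_hat K w x y n \<omega> \<bullet> x n j \<omega>))"

definition sigma2_hat ::
  "(nat \<Rightarrow> nat) \<Rightarrow> (nat \<Rightarrow> nat \<Rightarrow> 'a \<Rightarrow> real Matrix.vec) \<Rightarrow> (nat \<Rightarrow> nat \<Rightarrow> 'a \<Rightarrow> real ^ 'd) \<Rightarrow>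
   (nat \<Rightarrow> nat \<Rightarrow> 'a \<Rightarrow> real) \<Rightarrow> nat \<Rightarrow> 'a \<Rightarrow> real" where
  "sigma2_hat K w x y n \<omega> =
     1 / (real n - real CARD('d) - real (K n)) * (\<Sum>i=1..n. (u_hat K w x y n i \<omega>)\<^sup>2)"

definition Sigma_HO ::
  "(nat \<Rightarrow> nat) \<Rightarrow> (nat \<Rightarrow> nat \<Rightarrow> 'a \<Rightarrow> real Matrix.vec) \<Rightarrow> (nat \<Rightarrow> nat \<Rightarrow> 'a \<Rightarrow> real ^ 'd) \<Rightarrow>
   (nat \<Rightarrow> nat \<Rightarrow> 'a \<Rightarrow> real) \<Rightarrow> nat \<Rightarrow> 'a \<Rightarrow> real ^ 'd ^ 'd" where
  "Sigma_HO K w x y n \<omega> = sigma2_hat K w x y n \<omega> *\<^sub>R Gamma_hat K w x n \<omega>"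

definition Omega_hat ::
  "(nat \<Rightarrow> nat) \<Rightarrow> (nat \<Rightarrow> nat \<Rightarrow> 'a \<Rightarrow> real Matrix.vec) \<Rightarrow> (nat \<Rightarrow> nat \<Rightarrow> 'a \<Rightarrow> real ^ 'd) \<Rightarrow>
   (nat \<Rightarrow> 'a \<Rightarrow> real ^ 'd ^ 'd) \<Rightarrow> nat \<Rightarrow> 'a \<Rightarrow> real ^ 'd ^ 'd" where
  "Omega_hat K w x S n \<omega> =
     matrix_inv (Gamma_hat K w x n \<omega>) ** S n \<omega> ** matrix_inv (Gamma_hat K w x n \<omega>)"

section \<open>Population quantities\<close>

text \<open>The \<open>\<sigma>\<close>-algebra generated by \<open>\<X>\<^sub>n\<close> and \<open>\<W>\<^sub>n\<close>.\<close>

definition XW ::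
  "(nat \<Rightarrow> 'a measure) \<Rightarrow> (nat \<Rightarrow> 'a measure) \<Rightarrow> (nat \<Rightarrow> nat \<Rightarrow> 'a \<Rightarrow> real ^ 'd) \<Rightarrow> nat \<Rightarrow> 'a measure"
  where
  "XW M F x n = sigma (space (M n))
     (sets (F n) \<union> (\<Union>i\<in>{1..n}. {x n i -` A \<inter> space (M n) | A. A \<in> sets borel}))"

definition R_err ::
  "(nat \<Rightarrow> 'a measure) \<Rightarrow> (nat \<Rightarrow> 'a measure) \<Rightarrow> (nat \<Rightarrow> nat \<Rightarrow> 'a \<Rightarrow> real ^ 'd) \<Rightarrow>
   (nat \<Rightarrow> nat \<Rightarrow> 'a \<Rightarrow> real) \<Rightarrow> nat \<Rightarrow> nat \<Rightarrow> 'a \<Rightarrow> real" where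
  "R_err M F x u n i = real_cond_exp (M n) (XW M F x n) (u n i)"

definition varrho_n ::
  "(nat \<Rightarrow> 'a measure) \<Rightarrow> (nat \<Rightarrow> 'a measure) \<Rightarrow> (nat \<Rightarrow> nat \<Rightarrow> 'a \<Rightarrow> real ^ 'd) \<Rightarrow>
   (nat \<Rightarrow> nat \<Rightarrow> 'a \<Rightarrow> real) \<Rightarrow> nat \<Rightarrow> real" where
  "varrho_n M F x u n = (1 / real n) * (\<Sum>i=1..n. \<integral>\<omega>. (R_err M F x u n i \<omega>)\<^sup>2 \<partial>M n)"

definition r_err ::
  "(nat \<Rightarrow> 'a measure) \<Rightarrow> (nat \<Rightarrow> 'a measure) \<Rightarrow> (nat \<Rightarrow> nat \<Rightarrow> 'a \<Rightarrow> real) \<Rightarrow>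
   nat \<Rightarrow> nat \<Rightarrow> 'a \<Rightarrow> real" where
  "r_err M F u n i = real_cond_exp (M n) (F n) (u n i)"

definition rho_n ::
  "(nat \<Rightarrow> 'a measure) \<Rightarrow> (nat \<Rightarrow> 'a measure) \<Rightarrow> (nat \<Rightarrow> nat \<Rightarrow> 'a \<Rightarrow> real) \<Rightarrow> nat \<Rightarrow> real" where
  "rho_n M F u n = (1 / real n) * (\<Sum>i=1..n. \<integral>\<omega>. (r_err M F u n i \<omega>)\<^sup>2 \<partial>M n)"

definition pop_gram ::
  "(nat \<Rightarrow> 'a measure) \<Rightarrow> (nat \<Rightarrow> nat) \<Rightarrow> (nat \<Rightarrow> nat \<Rightarrow> 'a \<Rightarrow> real Matrix.vec) \<Rightarrow>
   nat \<Rightarrow> real Matrix.mat" where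
  "pop_gram M K w n = Matrix.mat (K n) (K n)
     (\<lambda>(a, b). \<Sum>i=1..n. \<integral>\<omega>. vec_index (w n i \<omega>) a * vec_index (w n i \<omega>) b \<partial>M n)"

text \<open>Row \<open>a\<close> of the matrix \<open>\<Sum>\<^sub>j E[x\<^sub>j w\<^sub>j']\<close>, whose two dimensions are indexed differently.\<close>

definition pop_cross_row ::
  "(nat \<Rightarrow> 'a measure) \<Rightarrow> (nat \<Rightarrow> nat) \<Rightarrow> (nat \<Rightarrow> nat \<Rightarrow> 'a \<Rightarrow> real Matrix.vec) \<Rightarrow>
   (nat \<Rightarrow> nat \<Rightarrow> 'a \<Rightarrow> real ^ 'd) \<Rightarrow> nat \<Rightarrow> 'd \<Rightarrow> real Matrix.vec" where
  "pop_cross_row M K w x n a = Matrix.vec (K n)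
     (\<lambda>b. \<Sum>j=1..n. \<integral>\<omega>. x n j \<omega> $ a * vec_index (w n j \<omega>) b \<partial>M n)"

definition v_pop ::
  "(nat \<Rightarrow> 'a measure) \<Rightarrow> (nat \<Rightarrow> nat) \<Rightarrow> (nat \<Rightarrow> nat \<Rightarrow> 'a \<Rightarrow> real Matrix.vec) \<Rightarrow>
   (nat \<Rightarrow> nat \<Rightarrow> 'a \<Rightarrow> real ^ 'd) \<Rightarrow> nat \<Rightarrow> nat \<Rightarrow> 'a \<Rightarrow> real ^ 'd" where
  "v_pop M K w x n i \<omega> = x n i \<omega> -
     (\<chi> a. scalar_prod (pop_cross_row M K w x n a) (mat_inv (pop_gram M K w n) *\<^sub>v w n i \<omega>))"

definition Q_err ::
  "(nat \<Rightarrow> 'a measure) \<Rightarrow> (nat \<Rightarrow> 'a measure) \<Rightarrow> (nat \<Rightarrow> nat) \<Rightarrow>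
   (nat \<Rightarrow> nat \<Rightarrow> 'a \<Rightarrow> real Matrix.vec) \<Rightarrow> (nat \<Rightarrow> nat \<Rightarrow> 'a \<Rightarrow> real ^ 'd) \<Rightarrow>
   nat \<Rightarrow> nat \<Rightarrow> 'a \<Rightarrow> real ^ 'd" where
  "Q_err M F K w x n i = vec_cond_exp (M n) (F n) (v_pop M K w x n i)"

definition chi_n ::
  "(nat \<Rightarrow> 'a measure) \<Rightarrow> (nat \<Rightarrow> 'a measure) \<Rightarrow> (nat \<Rightarrow> nat) \<Rightarrow>
   (nat \<Rightarrow> nat \<Rightarrow> 'a \<Rightarrow> real Matrix.vec) \<Rightarrow> (nat \<Rightarrow> nat \<Rightarrow> 'a \<Rightarrow> real ^ 'd) \<Rightarrow> nat \<Rightarrow> real" where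
  "chi_n M F K w x n =
     (1 / real n) * (\<Sum>i=1..n. \<integral>\<omega>. (norm (Q_err M F K w x n i \<omega>))\<^sup>2 \<partial>M n)"

definition U_err ::
  "(nat \<Rightarrow> 'a measure) \<Rightarrow> (nat \<Rightarrow> 'a measure) \<Rightarrow> (nat \<Rightarrow> nat \<Rightarrow> 'a \<Rightarrow> real ^ 'd) \<Rightarrow>
   (nat \<Rightarrow> nat \<Rightarrow> 'a \<Rightarrow> real) \<Rightarrow> nat \<Rightarrow> nat \<Rightarrow> 'a \<Rightarrow> real" where
  "U_err M F x y n i \<omega> = y n i \<omega> - real_cond_exp (M n) (XW M F x n) (y n i) \<omega>"

definition V_err ::
  "(nat \<Rightarrow> 'a measure) \<Rightarrow> (nat \<Rightarrow> 'a measure) \<Rightarrow> (nat \<Rightarrow> nat \<Rightarrow> 'a \<Rightarrow> real ^ 'd) \<Rightarrow>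
   nat \<Rightarrow> nat \<Rightarrow> 'a \<Rightarrow> real ^ 'd" where
  "V_err M F x n i \<omega> = x n i \<omega> - vec_cond_exp (M n) (F n) (x n i) \<omega>"

definition V_tilde ::
  "(nat \<Rightarrow> 'a measure) \<Rightarrow> (nat \<Rightarrow> 'a measure) \<Rightarrow> (nat \<Rightarrow> nat) \<Rightarrow>
   (nat \<Rightarrow> nat \<Rightarrow> 'a \<Rightarrow> real Matrix.vec) \<Rightarrow> (nat \<Rightarrow> nat \<Rightarrow> 'a \<Rightarrow> real ^ 'd) \<Rightarrow>
   nat \<Rightarrow> nat \<Rightarrow> 'a \<Rightarrow> real ^ 'd" where
  "V_tilde M F K w x n i \<omega> = (\<Sum>j=1..n. annih K w n i j \<omega> *\<^sub>R V_err M F x n j \<omega>)"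

definition Gamma_tilde ::
  "(nat \<Rightarrow> 'a measure) \<Rightarrow> (nat \<Rightarrow> 'a measure) \<Rightarrow> (nat \<Rightarrow> nat) \<Rightarrow>
   (nat \<Rightarrow> nat \<Rightarrow> 'a \<Rightarrow> real Matrix.vec) \<Rightarrow> (nat \<Rightarrow> nat \<Rightarrow> 'a \<Rightarrow> real ^ 'd) \<Rightarrow>
   nat \<Rightarrow> 'a \<Rightarrow> real ^ 'd ^ 'd" where
  "Gamma_tilde M F K w x n \<omega> =
     (1 / real n) *\<^sub>R (\<Sum>i=1..n. outer (V_tilde M F K w x n i \<omega>) (V_tilde M F K w x n i \<omega>))"

text \<open>Valued in \<^typ>\<open>ennreal\<close>, so that infinite conditional moments and vanishing denominators
  make the quantity infinite. In \<^typ>\<open>real\<close>, \<open>1 / 0 = 0\<close> would discard them.\<close>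

definition C_n ::
  "(nat \<Rightarrow> 'a measure) \<Rightarrow> (nat \<Rightarrow> 'a measure) \<Rightarrow> (nat \<Rightarrow> nat) \<Rightarrow>
   (nat \<Rightarrow> nat \<Rightarrow> 'a \<Rightarrow> real Matrix.vec) \<Rightarrow> (nat \<Rightarrow> nat \<Rightarrow> 'a \<Rightarrow> real ^ 'd) \<Rightarrow>
   (nat \<Rightarrow> nat \<Rightarrow> 'a \<Rightarrow> real) \<Rightarrow> nat \<Rightarrow> 'a \<Rightarrow> ennreal" where
  "C_n M F K w x y n \<omega> =
     (MAX i\<in>{1..n}.
        nn_cond_exp (M n) (XW M F x n) (\<lambda>\<omega>. ennreal ((U_err M F x y n i \<omega>) ^ 4)) \<omega> +
        nn_cond_exp (M n) (F n) (\<lambda>\<omega>. ennreal ((norm (V_err M F x n i \<omega>)) ^ 4)) \<omega> +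
        1 / nn_cond_exp (M n) (XW M F x n) (\<lambda>\<omega>. ennreal ((U_err M F x y n i \<omega>)\<^sup>2)) \<omega>) +
     1 / ennreal (min_eigenvalue (matrix_cond_exp (M n) (F n) (Gamma_tilde M F K w x n) \<omega>))"

end

theory Submission
  imports Defs
begin

text \<open>
  Why the theorem holds. Let \<open>P\<close> be the annihilator of the controls, \<open>v = P x\<close> the residualised
  regressors, \<open>G\<close> their second moment matrix, \<open>W\<close> its inverse square root, and split the error as
  \<open>u = U + R\<close> with \<open>R\<close> its mean given the regressors and the conditioning algebra \<open>F\<close>. Least squares
  algebra (\<open>ols_error\<close>) gives \<open>sqrt n (betahat - \<beta>) = inverse G s\<close> with
  \<open>s = (\<Sum> u v) / sqrt n\<close>, and a residual sum of squares \<open>u'P u - |W s|^2\<close>. Since the estimated variance is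
  \<open>sigmahat^2 inverse G\<close>, the studentised estimator is \<open>W s / sigmahat\<close> (\<open>sqrt_inv_sandwich\<close>),
  and three facts remain.

  First, \<open>Z\<close>, the vector \<open>W (\<Sum> U v) / (|\<sigma>| sqrt n)\<close>, is asymptotically standard normal. Given
  the regressors and \<open>F\<close> its weights are fixed, satisfy an exact isometry (\<open>zc_isometry\<close>), and are
  uniformly small because \<open>max |v| / sqrt n\<close> vanishes and \<open>G\<close> stays away from singularity. The errors
  are dependent inside blocks of bounded size only, and an error is centred given all regressors and all
  other blocks (\<open>centered_rest_extend\<close>), so blocks can be exchanged one at a time for Gaussian factors in
  the characteristic function (\<open>char_block_sum_bound\<close>, \<open>char_Z\<close>). Convolution with a small
  Gaussian turns this into weak convergence of vectors (\<open>weak_conv_vec_of_char\<close>).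

  Second, \<open>(\<Sum> R v) / sqrt n\<close> vanishes (\<open>whp_remainder\<close>). With \<open>x = V + Q\<close> up to a linear function of
  the controls, \<open>v = P V + P Q\<close>. The part \<open>P Q\<close> is covered by Cauchy-Schwarz and the rate of \<open>n chi varrho\<close>.
  Against \<open>P V\<close>, the difference of \<open>R\<close> and \<open>r\<close>, the mean of \<open>u\<close> given \<open>F\<close>, is covered by the rate of
  \<open>n (varrho - rho)\<close>, and \<open>r\<close> itself gives a linear form in the centred \<open>V\<close> with weights known to \<open>F\<close>,
  whose variance is of the order of \<open>rho\<close>.

  Third, \<open>sigmahat\<close> is consistent: \<open>U'P U\<close> concentrates at \<open>\<sigma>^2\<close> times the trace \<open>n - K\<close> of \<open>P\<close>
  (\<open>whp_U_quadratic\<close>), the contribution of \<open>R\<close> is small against \<open>n\<close>, and the degrees of freedom are of order \<open>n\<close>.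

  That \<open>G\<close> is bounded below (\<open>whp_Gamma_hat_pd\<close>) follows from the same bounds for quadratic and linear
  forms: \<open>G\<close> is \<open>Gammatilde\<close> plus a negligible cross term plus a positive semidefinite matrix, and
  \<open>Gammatilde\<close> concentrates at its conditional mean. Conditional moments are bounded only with high
  probability, so second moments are computed after multiplication by indicators of events that the conditioning
  algebra knows (\<open>EV\<close>, \<open>EU\<close>, \<open>small_design\<close>).

  Sample points are written \<open>om\<close>.
\<close>

section \<open>Measurability of matrix functions\<close>

text \<open>The preimage of a closed set is a countable union of projections, along balls, of closed sets,
  and projecting along a compact set preserves closedness. Matrix inversion and the square root,
  defined by choice and description operators, and the least eigenvalue are Borel for this reason.\<close>

lemma measurable_closed_graph:
  fixes f :: "'a::euclidean_space => 'b::euclidean_space"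
  assumes cl: "closed {(b, a). G a b}"
    and val: "\<And>a b. G a b ==> f a = b"
    and default: "\<And>a. \<not> (\<exists>b. G a b) ==> f a = c"
  shows "f \<in> borel_measurable borel"
proof -
  define D where "D r C = {a. \<exists>b. b \<in> cball 0 r \<inter> C \<and> (b, a) \<in> {(b, a). G a b}}" for r :: real and C
  have cD: "closed (D r C)" if "closed C" for r C
    unfolding D_def using that by (intro closed_compact_projection cl compact_Int_closed) auto
  define E where "E C = (\<Union>r\<in>(UNIV::nat set). D (real r) C)" for C
  have E_iff: "a \<in> E C \<longleftrightarrow> (\<exists>b. G a b \<and> b \<in> C)" for a C
  proof
    assume "\<exists>b. G a b \<and> b \<in> C"
    then obtain b where b: "G a b" "b \<in> C" by blast
    obtain r :: nat where "norm b \<le> real r" using real_arch_simple by blast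
    then show "a \<in> E C" unfolding E_def D_def using b by auto
  qed (auto simp: E_def D_def)
  have mE: "E C \<in> sets borel" if "closed C" for C
    unfolding E_def by (intro sets.countable_UN image_subsetI borel_closed cD that)
  have pre: "f -` C = E C \<union> (if c \<in> C then - E UNIV else {})" for C
  proof (rule Set.set_eqI)
    fix a show "a \<in> f -` C \<longleftrightarrow> a \<in> E C \<union> (if c \<in> C then - E UNIV else {})"
    proof (cases "\<exists>b. G a b")
      case True
      then obtain b where "G a b" by blast
      have k: "a \<in> E C' \<longleftrightarrow> f a \<in> C'" for C' using \<open>G a b\<close> by (metis E_iff val)
      show ?thesis by (simp add: k)
    next
      case False
      then show ?thesis using default[OF False] by (auto simp: E_iff)
    qed
  qed
  have "f \<in> measurable borel (sigma UNIV {S. closed S})"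
    by (rule measurable_measure_of) (auto simp: pre intro!: mE mE[OF closed_UNIV] sets.Un borel_comp)
  then show ?thesis by (simp add: borel_eq_closed)
qed

lemma continuous_on_matrix_mult:
  fixes f g :: "'b::topological_space => real ^ 'd ^ 'd"
  assumes "continuous_on S f" "continuous_on S g"
  shows "continuous_on S (\<lambda>p. f p ** g p)"
  unfolding matrix_matrix_mult_def using assms by (intro continuous_intros)

abbreviation id_matrix :: "real ^ 'd ^ 'd" where
  "id_matrix \<equiv> Finite_Cartesian_Product.mat 1"

lemma matrix_inv_eqI:
  fixes A B :: "real ^ 'd ^ 'd"
  assumes "A ** B = id_matrix"
  shows "matrix_inv A = B"
proof -
  have BA: "B ** A = id_matrix" using assms matrix_left_right_inverse by blast
  have "A ** matrix_inv A = id_matrix"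
    unfolding matrix_inv_def using someI[of "\<lambda>B. A ** B = id_matrix \<and> B ** A = id_matrix" B] assms BA by blast
  then show ?thesis using BA by (metis matrix_mul_assoc matrix_mul_lid matrix_mul_rid)
qed

lemma measurable_matrix_inv [measurable]: "(matrix_inv :: real^'d^'d => _) \<in> borel_measurable borel"
proof (rule measurable_closed_graph[where G="\<lambda>A B. A ** B = id_matrix \<and> B ** A = id_matrix" and c="SOME B. False"])
  show "closed {(B::real^'d^'d, A::real^'d^'d). A ** B = id_matrix \<and> B ** A = (id_matrix :: real^'d^'d)}"
    unfolding case_prod_beta
    apply (rule closed_Collect_conj; rule closed_Collect_eq; (rule continuous_on_const)?)
    apply (rule continuous_on_matrix_mult; intro continuous_intros)+
    done
next
  fix A B :: "real^'d^'d" assume "A ** B = id_matrix \<and> B ** A = id_matrix"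
  then show "matrix_inv A = B" by (simp add: matrix_inv_eqI)
next
  fix A :: "real^'d^'d" assume "\<not> (\<exists>B. A ** B = id_matrix \<and> B ** A = id_matrix)"
  then have "(\<lambda>B. A ** B = id_matrix \<and> B ** A = id_matrix) = (\<lambda>_. False)" by blast
  then show "matrix_inv A = (SOME B. False)" unfolding matrix_inv_def by simp
qed

abbreviation symmetric :: "real ^ 'd ^ 'd => bool" where
  "symmetric A \<equiv> Finite_Cartesian_Product.transpose A = A"

definition psd :: "real ^ 'd ^ 'd => bool" where
  "psd A \<longleftrightarrow> symmetric A \<and> (\<forall>v. 0 \<le> v \<bullet> (A *v v))"

lemma symmetric_inner:
  fixes A :: "real ^ 'd ^ 'd"
  assumes "symmetric A"
  shows "v \<bullet> (A *v w) = (A *v v) \<bullet> w"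
  using assms by (metis dot_lmul_matrix transpose_matrix_vector)

lemma symmetricI:
  fixes A :: "real ^ 'd ^ 'd"
  assumes "\<And>i j. A $ i $ j = A $ j $ i"
  shows "symmetric A"
  using assms by (simp add: Finite_Cartesian_Product.transpose_def vec_eq_iff)

text \<open>A minimiser of the quadratic form on the unit sphere is an eigenvector, since otherwise a small
  step against the component of \<open>A v\<close> orthogonal to \<open>v\<close> would lower the form. One such pair replaces
  the spectral theorem in what follows.\<close>

lemma symmetric_rayleigh_attained:
  fixes A :: "real ^ 'd ^ 'd"
  assumes A: "symmetric A"
  obtains l v where "norm v = 1" "A *v v = l *\<^sub>R v" "\<And>x. l * (x \<bullet> x) \<le> x \<bullet> (A *v x)"
proof -
  have ne: "sphere (0::real^'d) 1 \<noteq> {}"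
    using SOME_Basis[where 'a="real^'d"] norm_Basis by (auto simp: sphere_def dist_norm)
  have cont: "continuous_on (sphere 0 1) (\<lambda>x. x \<bullet> (A *v x))"
    by (intro continuous_intros matrix_vector_mult_linear_continuous_on)
  obtain v where v: "v \<in> sphere 0 1" "\<And>x. x \<in> sphere 0 1 ==> v \<bullet> (A *v v) \<le> x \<bullet> (A *v x)"
    using continuous_attains_inf[OF compact_sphere ne cont] by blast
  define l where "l = v \<bullet> (A *v v)"
  have nv: "norm v = 1" "v \<bullet> v = 1" using v(1) by (auto simp: dist_norm norm_eq_1)
  have ray: "l * (x \<bullet> x) \<le> x \<bullet> (A *v x)" for x
  proof (cases "x = 0")
    case False
    define y where "y = x /\<^sub>R norm x"
    have "y \<in> sphere 0 1" using False by (simp add: y_def)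
    from v(2)[OF this] have "l \<le> y \<bullet> (A *v y)" by (simp add: l_def)
    also have "\<dots> = (x \<bullet> (A *v x)) / (norm x)^2"
      by (simp add: y_def matrix_vector_mult_scaleR power2_eq_square divide_simps)
    finally show ?thesis using False
      by (simp add: divide_simps power2_norm_eq_inner split: if_splits)
  qed simp
  \<comment> \<open>the nonnegative form \<open>x \<bullet> (A x - l x)\<close> vanishes at \<open>v\<close>, hence so does its gradient there\<close>
  define g where "g = A *v v - l *\<^sub>R v"
  have "g \<bullet> g = 0"
  proof (rule ccontr)
    assume "g \<bullet> g \<noteq> 0"
    then have pos: "g \<bullet> g > 0" by (metis inner_ge_zero order_le_less)
    define q where "q = g \<bullet> (A *v g) - l * (g \<bullet> g)"
    have gv: "g \<bullet> v = 0"
    proof -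
      have "g \<bullet> v = (A *v v) \<bullet> v - l * (v \<bullet> v)" by (simp add: g_def inner_diff_left)
      also have "(A *v v) \<bullet> v = l" by (simp add: l_def inner_commute)
      finally show ?thesis using nv by simp
    qed
    have vg: "v \<bullet> g = 0" using gv by (simp add: inner_commute)
    have Av: "A *v v = g + l *\<^sub>R v" by (simp add: g_def)
    have *: "0 \<le> - 2 * t * (g \<bullet> g) + t^2 * q" for t
    proof -
      have "l * ((v - t *\<^sub>R g) \<bullet> (v - t *\<^sub>R g)) \<le> (v - t *\<^sub>R g) \<bullet> (A *v (v - t *\<^sub>R g))" by (rule ray)
      moreover have "A *v (v - t *\<^sub>R g) = g + l *\<^sub>R v - t *\<^sub>R (A *v g)"
        by (simp add: matrix_vector_mult_diff_distrib matrix_vector_mult_scaleR Av)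
      moreover have "v \<bullet> (A *v g) = g \<bullet> g"
        unfolding symmetric_inner[OF A, of v g] Av by (simp add: inner_add_left vg)
      moreover note gv vg nv
      ultimately have "l * (1 + t^2 * (g \<bullet> g)) \<le> l - 2 * t * (g \<bullet> g) + t^2 * (g \<bullet> (A *v g))"
        by (simp add: inner_diff_left inner_diff_right inner_add_right power2_eq_square algebra_simps)
      then show ?thesis by (simp add: q_def algebra_simps)
    qed
    have q: "q > 0"
    proof -
      have "2 * (g \<bullet> g) \<le> q" using *[of 1] by simp
      then show ?thesis using pos by linarith
    qed
    have "0 \<le> - 2 * ((g \<bullet> g) / q) * (g \<bullet> g) + ((g \<bullet> g) / q)^2 * q" by (rule *)
    also have "\<dots> = - ((g \<bullet> g)^2 / q)" using q by (simp add: field_simps power2_eq_square)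
    finally show False using pos q by (simp add: divide_simps)
  qed
  then have Av: "A *v v = l *\<^sub>R v" by (simp add: g_def)
  show ?thesis by (rule that[OF nv(1) Av ray])
qed

lemma finite_eigenvalues_symmetric:
  fixes A :: "real ^ 'd ^ 'd"
  assumes A: "symmetric A"
  shows "finite {l. \<exists>v. v \<noteq> 0 \<and> A *v v = l *\<^sub>R v}"
proof -
  define e where "e l = (SOME v. v \<noteq> 0 \<and> A *v v = l *\<^sub>R v)" for l :: real
  let ?L = "{l. \<exists>v. v \<noteq> 0 \<and> A *v v = l *\<^sub>R v}"
  have e: "e l \<noteq> 0 \<and> A *v e l = l *\<^sub>R e l" if "l \<in> ?L" for l
    unfolding e_def using that[unfolded mem_Collect_eq] by (rule someI_ex)
  have orth: "e l \<bullet> e m = 0" if "l \<in> ?L" "m \<in> ?L" "l \<noteq> m" for l m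
  proof -
    have "m * (e l \<bullet> e m) = l * (e l \<bullet> e m)"
      using symmetric_inner[OF A, of "e l" "e m"] e[OF that(1)] e[OF that(2)] by simp
    then show ?thesis using that by simp
  qed
  have "inj_on e ?L"
  proof (rule inj_onI, rule ccontr)
    fix l m assume lm: "l \<in> ?L" "m \<in> ?L" "e l = e m" "l \<noteq> m"
    from orth[OF lm(1,2,4)] lm(3) have "e m = 0" by simp
    with e[OF lm(2)] show False by simp
  qed
  moreover have "pairwise Linear_Algebra.orthogonal (e ` ?L)"
    unfolding pairwise_def Linear_Algebra.orthogonal_def using orth by blast
  then have "finite (e ` ?L)"
    using pairwise_orthogonal_imp_finite by blast
  ultimately show ?thesis by (rule finite_imageD[rotated])
qed

lemma min_eigenvalue_rayleigh:
  fixes A :: "real ^ 'd ^ 'd"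
  assumes A: "symmetric A"
  shows "min_eigenvalue A * (x \<bullet> x) \<le> x \<bullet> (A *v x)" (is ?g1)
    and "\<exists>v. norm v = 1 \<and> A *v v = min_eigenvalue A *\<^sub>R v"
proof -
  obtain l v where lv: "norm v = 1" "A *v v = l *\<^sub>R v" "\<And>x. l * (x \<bullet> x) \<le> x \<bullet> (A *v x)"
    using symmetric_rayleigh_attained[OF A] by blast
  have "min_eigenvalue A = l" unfolding min_eigenvalue_def
  proof (rule Min_eqI)
    show "finite {l. \<exists>v. v \<noteq> 0 \<and> A *v v = l *\<^sub>R v}" by (rule finite_eigenvalues_symmetric[OF A])
    show "l \<in> {l. \<exists>v. v \<noteq> 0 \<and> A *v v = l *\<^sub>R v}" proof -
      have "v \<noteq> 0" using lv(1) by auto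
      with lv(2) show ?thesis by blast
    qed
    fix m assume "m \<in> {l. \<exists>v. v \<noteq> 0 \<and> A *v v = l *\<^sub>R v}"
    then obtain y where y: "y \<noteq> 0" "A *v y = m *\<^sub>R y" by blast
    have "l * (y \<bullet> y) \<le> m * (y \<bullet> y)" using lv(3)[of y] y by simp
    then show "l \<le> m" using y by (simp add: mult_le_cancel_right)
  qed
  with lv show ?g1
    "\<exists>v. norm v = 1 \<and> A *v v = min_eigenvalue A *\<^sub>R v" by blast+
qed

lemma measurable_min_eigenvalue:
  fixes f :: "'a => real ^ 'd ^ 'd"
  assumes f: "f \<in> borel_measurable N" and sym: "\<And>om. om \<in> space N ==> symmetric (f om)"
  shows "(\<lambda>om. min_eigenvalue (f om)) \<in> borel_measurable N"
proof -
  \<comment> \<open>the least eigenvalue is a lower bound of the form attained on the compact sphere, a closed condition\<close>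
  define G where "G A l \<longleftrightarrow> symmetric A \<and> (\<exists>v. v \<in> sphere 0 1 \<and> A *v v = l *\<^sub>R v) \<and> (\<forall>x. l * (x \<bullet> x) \<le> x \<bullet> (A *v x))"
    for A :: "real^'d^'d" and l :: real
  define h where "h A = (if symmetric A then min_eigenvalue A else 0)" for A :: "real^'d^'d"
  have cont_mv: "continuous_on UNIV (\<lambda>p::(real^'d) \<times> real \<times> (real^'d^'d). snd (snd p) *v fst p)"
    unfolding matrix_vector_mult_def by (intro continuous_intros)
  have cont_mv': "continuous_on UNIV (\<lambda>p::real \<times> (real^'d^'d). snd p *v x)" for x
    unfolding matrix_vector_mult_def by (intro continuous_intros)
  have "h \<in> borel_measurable borel"
  proof (rule measurable_closed_graph[where G=G and c=0])
    have "closed {p::real \<times> (real^'d^'d). \<exists>v. v \<in> sphere 0 1 \<and> (v, p) \<in> {p. snd (snd p) *v fst p = fst (snd p) *\<^sub>R fst p}}"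
      by (rule closed_compact_projection[OF compact_sphere])
         (rule closed_Collect_eq[OF cont_mv], intro continuous_intros)
    then have 1: "closed {p::real \<times> (real^'d^'d). \<exists>v. v \<in> sphere 0 1 \<and> snd p *v v = fst p *\<^sub>R v}" by simp
    have 2: "closed {p::real \<times> (real^'d^'d). \<forall>x. fst p * (x \<bullet> x) \<le> x \<bullet> (snd p *v x)}"
      by (rule closed_Collect_all, rule closed_Collect_le)
         (intro continuous_on_inner cont_mv' continuous_intros)+
    have 3: "closed {p::real \<times> (real^'d^'d). symmetric (snd p)}"
      unfolding Finite_Cartesian_Product.transpose_def
      by (rule closed_Collect_eq) (intro continuous_intros)+
    show "closed {(l, A). G A l}"
      unfolding G_def case_prod_beta
      by (rule closed_Collect_conj[OF 3 closed_Collect_conj[OF 1 2]])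
  next
    fix A l assume G: "G A l"
    then obtain v where v: "norm v = 1" "A *v v = l *\<^sub>R v" by (auto simp: G_def dist_norm)
    from G have s: "symmetric A" by (simp add: G_def)
    obtain y where y: "norm y = 1" "A *v y = min_eigenvalue A *\<^sub>R y" using min_eigenvalue_rayleigh(2)[OF s] by blast
    have "min_eigenvalue A \<le> l" using min_eigenvalue_rayleigh(1)[OF s, of v] v by (simp add: norm_eq_1)
    moreover have "l * (y \<bullet> y) \<le> y \<bullet> (A *v y)" using G by (simp add: G_def)
    then have "l \<le> min_eigenvalue A" using y by (simp add: norm_eq_1)
    ultimately show "h A = l" using s by (simp add: h_def)
  next
    fix A assume n: "\<not> (\<exists>b. G A b)"
    show "h A = 0"
    proof (cases "symmetric A")
      case True
      then have "G A (min_eigenvalue A)"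
        using min_eigenvalue_rayleigh[OF True] by (auto simp: G_def dist_norm)
      with n show ?thesis by blast
    qed (simp add: h_def)
  qed
  then have "(\<lambda>om. h (f om)) \<in> borel_measurable N" using f by measurable
  then show ?thesis
    by (rule measurable_cong[THEN iffD1, rotated]) (simp add: h_def sym)
qed

lemma outer_mult_vec: "outer a b *v x = (b \<bullet> x) *\<^sub>R a"
  unfolding Finite_Cartesian_Product.vec_eq_iff
  by (simp add: outer_def matrix_vector_mult_def inner_vec_def sum_distrib_left sum_distrib_right mult.commute mult.left_commute)

lemma symmetricD: "symmetric A ==> A $ i $ j = A $ j $ i"
  by (drule arg_cong[where f="\<lambda>B. B $ j $ i"]) (simp add: Finite_Cartesian_Product.transpose_def)

text \<open>If all eigenvalues vanished, the minimising eigenpairs of \<open>D\<close> and of \<open>- D\<close> would force the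
  quadratic form to be zero, and polarisation would give \<open>D = 0\<close>.\<close>

lemma symmetric_nonzero_eigenvalue:
  fixes D :: "real ^ 'd ^ 'd"
  assumes D: "symmetric D" and nz: "D \<noteq> 0"
  obtains l v where "norm v = 1" "D *v v = l *\<^sub>R v" "l \<noteq> 0"
proof (rule ccontr)
  assume "\<not> thesis"
  with that have zero: "l = 0" if "norm v = 1" "D *v v = l *\<^sub>R v" for l v using that by metis
  have mD: "symmetric (- D)"
    by (rule symmetricI) (metis symmetricD[OF D] vector_uminus_component)
  have neg: "(- D) *v x = - (D *v x)" for x
    by (simp add: matrix_vector_mult_def Finite_Cartesian_Product.vec_eq_iff sum_negf)
  obtain l v where lv: "norm v = 1" "D *v v = l *\<^sub>R v" "\<And>x. l * (x \<bullet> x) \<le> x \<bullet> (D *v x)"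
    by (rule symmetric_rayleigh_attained[OF D]) (rule that)
  obtain m u where mu: "norm u = 1" "(- D) *v u = m *\<^sub>R u" "\<And>x. m * (x \<bullet> x) \<le> x \<bullet> ((- D) *v x)"
    by (rule symmetric_rayleigh_attained[OF mD]) (rule that)
  have "l = 0" by (rule zero[OF lv(1,2)])
  have "D *v u = (- m) *\<^sub>R u" using mu(2) by (metis neg minus_minus scaleR_minus_left)
  then have "m = 0" using zero[OF mu(1), of "- m"] by simp
  have form0: "x \<bullet> (D *v x) = 0" for x
    using lv(3)[of x] mu(3)[of x] \<open>l = 0\<close> \<open>m = 0\<close> by (simp add: neg)
  have "D *v y = 0" for y
  proof -
    let ?x = "D *v y"
    have "(?x + y) \<bullet> (D *v (?x + y)) = ?x \<bullet> (D *v y) + y \<bullet> (D *v ?x)"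
      by (simp add: matrix_vector_right_distrib inner_add_left inner_add_right form0)
    also have "y \<bullet> (D *v ?x) = (D *v y) \<bullet> ?x" by (rule symmetric_inner[OF D])
    finally have "?x \<bullet> ?x = 0" by (simp add: form0)
    then show ?thesis by simp
  qed
  then have "D = 0" by (simp add: matrix_eq)
  with nz show False by simp
qed

text \<open>For an eigenpair \<open>(l, v)\<close> of \<open>B - C\<close> with \<open>l \<noteq> 0\<close>, equality of the squares makes
  \<open>v'B v + v'C v\<close> vanish; both terms are nonnegative, so their difference \<open>l\<close> vanishes too.\<close>

lemma psd_sqrt_unique:
  fixes B C :: "real ^ 'd ^ 'd"
  assumes B: "psd B" and C: "psd C" and eq: "B ** B = C ** C"
  shows "B = C"
proof (rule ccontr)
  assume "B \<noteq> C"
  have sB: "symmetric B" and sC: "symmetric C" using B C by (auto simp: psd_def)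
  have D: "symmetric (B - C)"
    by (rule symmetricI) (metis symmetricD[OF sB] symmetricD[OF sC] vector_minus_component)
  have "B - C \<noteq> 0" using \<open>B \<noteq> C\<close> by simp
  then obtain l v where lv: "norm v = 1" "(B - C) *v v = l *\<^sub>R v" "l \<noteq> 0"
    using symmetric_nonzero_eigenvalue[OF D] by blast
  have d: "(B - C) *v x = B *v x - C *v x" for x by (rule matrix_vector_mult_diff_rdistrib)
  have sq: "B *v (B *v v) = C *v (C *v v)" using eq by (metis matrix_vector_mul_assoc)
  \<comment> \<open>from \<open>B (B - C) + (B - C) C = 0\<close>\<close>
  have "0 = v \<bullet> (B *v ((B - C) *v v)) + v \<bullet> ((B - C) *v (C *v v))"
    by (simp add: d matrix_vector_mult_diff_distrib sq flip: inner_add_right)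
  also have "v \<bullet> ((B - C) *v (C *v v)) = ((B - C) *v v) \<bullet> (C *v v)" by (rule symmetric_inner[OF D])
  finally have "0 = l * (v \<bullet> (B *v v) + v \<bullet> (C *v v))"
    unfolding lv(2) by (simp add: matrix_vector_mult_scaleR algebra_simps)
  then have s: "v \<bullet> (B *v v) + v \<bullet> (C *v v) = 0" using lv(3) by simp
  have nn: "0 \<le> v \<bullet> (B *v v)" "0 \<le> v \<bullet> (C *v v)" using B C by (auto simp: psd_def)
  have "v \<bullet> ((B - C) *v v) = v \<bullet> (B *v v) - v \<bullet> (C *v v)" by (simp only: d inner_diff_right)
  then have "l * (v \<bullet> v) = 0" using s nn lv(2) by simp
  moreover have "v \<bullet> v = 1" using lv(1) by (simp add: norm_eq_1)
  ultimately show False using lv(3) by simp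
qed

text \<open>Induction on the rank: an eigenpair is removed, the remainder has a root by induction, and that root
  annihilates the removed direction, so the two pieces do not interact.\<close>

lemma psd_sqrt_exists:
  fixes A :: "real ^ 'd ^ 'd"
  assumes "psd A"
  shows "\<exists>B. psd B \<and> B ** B = A"
  using assms
proof (induction "dim (range ((*v) A))" arbitrary: A rule: less_induct)
  case less
  show ?case
  proof (cases "A = 0")
    case True
    have z: "(0 :: real^'d^'d) *v x = 0" for x by (simp add: matrix_vector_mult_def Finite_Cartesian_Product.vec_eq_iff)
    have "psd (0 :: real^'d^'d)"
      unfolding psd_def by (simp add: Finite_Cartesian_Product.transpose_def Finite_Cartesian_Product.vec_eq_iff z)
    moreover have "(0 :: real^'d^'d) ** 0 = 0" by (simp add: matrix_matrix_mult_def Finite_Cartesian_Product.vec_eq_iff)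
    ultimately show ?thesis using True by blast
  next
    case False
    have sA: "symmetric A" and pA: "\<And>x. 0 \<le> x \<bullet> (A *v x)" using less.prems by (auto simp: psd_def)
    obtain l v where lv: "norm v = 1" "A *v v = l *\<^sub>R v" "l \<noteq> 0"
      using symmetric_nonzero_eigenvalue[OF sA False] by blast
    have vv: "v \<bullet> v = 1" using lv(1) by (simp add: norm_eq_1)
    have lpos: "l > 0" using pA[of v] lv vv by simp
    \<comment> \<open>deflation: remove the eigenpair, so that the range loses the direction \<open>v\<close>\<close>
    define A' where "A' = A - l *\<^sub>R outer v v"
    have A'x: "A' *v x = A *v x - (l * (v \<bullet> x)) *\<^sub>R v" for x
      by (simp add: A'_def matrix_vector_mult_diff_rdistrib outer_mult_vec scaleR_matrix_vector_assoc[symmetric])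
    have vAx: "v \<bullet> (A *v x) = l * (v \<bullet> x)" for x using symmetric_inner[OF sA, of v x] lv(2) by simp
    have sA': "symmetric A'" unfolding A'_def
      by (rule symmetricI) (simp add: outer_def mult.commute, metis symmetricD[OF sA])
    have pA': "0 \<le> x \<bullet> (A' *v x)" for x
    proof -
      let ?z = "x - (v \<bullet> x) *\<^sub>R v"
      have Az: "A *v ?z = A *v x - (l * (v \<bullet> x)) *\<^sub>R v"
        by (simp only: matrix_vector_mult_diff_distrib matrix_vector_mult_scaleR lv(2) scaleR_scaleR mult.commute)
      have "0 \<le> ?z \<bullet> (A *v ?z)" by (rule pA)
      also have "\<dots> = x \<bullet> (A' *v x)"
        unfolding Az A'x[symmetric]
        by (simp add: A'x inner_diff_left inner_diff_right vAx vv inner_commute[of x v])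
      finally show ?thesis .
    qed
    have psd': "psd A'" using sA' pA' by (simp add: psd_def)
    have orth: "v \<bullet> (A' *v x) = 0" for x by (simp add: A'x inner_diff_right vAx vv)
    have lin: "linear ((*v) X)" for X :: "real^'d^'d" by (rule matrix_vector_mul_linear)
    have v_in: "v \<in> range ((*v) A)"
    proof
      show "v = A *v ((1 / l) *\<^sub>R v)" using lv by (simp add: matrix_vector_mult_scaleR)
    qed simp
    have sub: "range ((*v) A') \<subseteq> range ((*v) A)"
    proof
      fix y assume "y \<in> range ((*v) A')"
      then obtain x where "y = A' *v x" by blast
      then have "y = A *v (x - (v \<bullet> x) *\<^sub>R v)"
        by (simp add: A'x matrix_vector_mult_diff_distrib matrix_vector_mult_scaleR lv(2) mult.commute)
      then show "y \<in> range ((*v) A)" by blast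
    qed
    have "v \<notin> range ((*v) A')" using orth vv by force
    then have "range ((*v) A') \<subset> range ((*v) A)" using sub v_in by blast
    moreover have "subspace (range ((*v) X))" for X :: "real^'d^'d"
      by (rule linear_subspace_image[OF lin subspace_UNIV])
    ultimately have "dim (range ((*v) A')) < dim (range ((*v) A))"
      by (intro dim_psubset) (simp add: span_eq_iff[THEN iffD2])
    from less.hyps[OF this psd'] obtain B' where B': "psd B'" "B' ** B' = A'" by blast
    have sB': "symmetric B'" using B'(1) by (simp add: psd_def)
    have BB': "B' *v (B' *v x) = A' *v x" for x by (simp add: matrix_vector_mul_assoc B'(2))
    have "(B' *v v) \<bullet> (B' *v v) = v \<bullet> (B' *v (B' *v v))" using symmetric_inner[OF sB', of v "B' *v v"] by simp
    then have "(B' *v v) \<bullet> (B' *v v) = 0" by (simp add: BB' orth)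
    then have B'v: "B' *v v = 0" by simp
    have vB': "v \<bullet> (B' *v x) = 0" for x using symmetric_inner[OF sB', of v x] B'v by simp
    define B where "B = B' + sqrt l *\<^sub>R outer v v"
    have Bx: "B *v x = B' *v x + (sqrt l * (v \<bullet> x)) *\<^sub>R v" for x
      by (simp add: B_def matrix_vector_mult_add_rdistrib outer_mult_vec scaleR_matrix_vector_assoc[symmetric])
    have "B ** B = A"
    proof (subst matrix_eq, intro allI)
      fix x
      have "(B ** B) *v x = B *v (B *v x)" by (simp add: matrix_vector_mul_assoc)
      also have "\<dots> = A' *v x + (l * (v \<bullet> x)) *\<^sub>R v"
        using lpos by (simp add: Bx matrix_vector_right_distrib matrix_vector_mult_scaleR BB' B'v inner_add_right vB' vv
            real_sqrt_mult_self flip: mult.assoc)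
      also have "\<dots> = A *v x" by (simp add: A'x)
      finally show "B ** B *v x = A *v x" .
    qed
    moreover have "psd B" unfolding psd_def
    proof
      show "symmetric B" unfolding B_def
        by (rule symmetricI) (simp add: outer_def mult.commute, metis symmetricD[OF sB'])
      show "\<forall>x. 0 \<le> x \<bullet> (B *v x)"
      proof
        fix x
        have "0 \<le> x \<bullet> (B' *v x)" using B'(1) by (simp add: psd_def)
        moreover have "0 \<le> sqrt l * (v \<bullet> x)^2" using lpos by simp
        ultimately show "0 \<le> x \<bullet> (B *v x)"
          by (simp add: Bx inner_add_right power2_eq_square inner_commute[of x v] mult.assoc)
      qed
    qed
    ultimately show ?thesis by blast
  qed
qed

lemma matrix_sqrt_eqI:
  assumes "psd B" "B ** B = A"
  shows "matrix_sqrt A = B"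
  unfolding matrix_sqrt_def
proof (rule the_equality)
  show "symmetric B \<and> (\<forall>v. 0 \<le> v \<bullet> (B *v v)) \<and> B ** B = A" using assms by (simp add: psd_def)
  fix C assume "symmetric C \<and> (\<forall>v. 0 \<le> v \<bullet> (C *v v)) \<and> C ** C = A"
  then have "psd C" "C ** C = B ** B" using assms by (auto simp: psd_def)
  then show "C = B" using assms(1) by (simp add: psd_sqrt_unique)
qed

lemma psd_matrix_sqrt:
  assumes "psd A"
  shows "psd (matrix_sqrt A)" "matrix_sqrt A ** matrix_sqrt A = A"
proof -
  obtain B where B: "psd B" "B ** B = A" using psd_sqrt_exists[OF assms] by (elim exE conjE)
  show "psd (matrix_sqrt A)" "matrix_sqrt A ** matrix_sqrt A = A"
    unfolding matrix_sqrt_eqI[OF B] using B by simp_all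
qed

lemma measurable_matrix_sqrt [measurable]: "(matrix_sqrt :: real^'d^'d => _) \<in> borel_measurable borel"
proof (rule measurable_closed_graph[where G="\<lambda>A B. psd B \<and> B ** B = A" and c="THE B. False"])
  have 1: "closed {p::(real^'d^'d) \<times> (real^'d^'d). symmetric (fst p)}"
    unfolding Finite_Cartesian_Product.transpose_def
    by (rule closed_Collect_eq) (intro continuous_intros)+
  have cont: "continuous_on UNIV (\<lambda>p::(real^'d^'d) \<times> (real^'d^'d). fst p *v x)" for x
    unfolding matrix_vector_mult_def by (intro continuous_intros)
  have 2: "closed {p::(real^'d^'d) \<times> (real^'d^'d). \<forall>v. 0 \<le> v \<bullet> (fst p *v v)}"
    by (rule closed_Collect_all, rule closed_Collect_le)
      (intro continuous_on_inner cont continuous_intros)+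
  have 3: "closed {p::(real^'d^'d) \<times> (real^'d^'d). fst p ** fst p = snd p}"
    by (rule closed_Collect_eq) (intro continuous_on_matrix_mult continuous_intros)+
  show "closed {(B::real^'d^'d, A::real^'d^'d). psd B \<and> B ** B = A}"
    unfolding psd_def case_prod_beta
    by (rule closed_Collect_conj[OF closed_Collect_conj[OF 1 2] 3])
next
  fix A B :: "real^'d^'d" assume "psd B \<and> B ** B = A"
  then show "matrix_sqrt A = B" by (simp add: matrix_sqrt_eqI)
next
  fix A :: "real^'d^'d" assume "\<not> (\<exists>B. psd B \<and> B ** B = A)"
  then have "(\<lambda>B. symmetric B \<and> (\<forall>v. 0 \<le> v \<bullet> (B *v v)) \<and> B ** B = A) = (\<lambda>_. False)"
    unfolding psd_def by blast
  then show "matrix_sqrt A = (THE B. False)" unfolding matrix_sqrt_def by simp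
qed

lemma Basis_vec_axis: "(Basis :: (real ^ 'd) set) = (\<lambda>a. axis a 1) ` UNIV"
  by (auto simp: Basis_vec_def)

lemma measurable_vec_component: "X \<in> borel_measurable L ==> (\<lambda>om. (X om :: real ^ 'e) $ a) \<in> borel_measurable L"
proof (erule measurable_compose)
  show "(\<lambda>v::real ^ 'e. v $ a) \<in> borel_measurable borel" by measurable
qed

lemma measurable_vecI:
  fixes f :: "'a => real ^ 'd"
  assumes "\<And>a. (\<lambda>om. f om $ a) \<in> borel_measurable N"
  shows "f \<in> borel_measurable N"
proof (subst borel_measurable_euclidean_space, intro ballI)
  fix b :: "real ^ 'd" assume "b \<in> Basis"
  then obtain a where b: "b = axis a 1" unfolding Basis_vec_axis by blast
  show "(\<lambda>om. f om \<bullet> b) \<in> borel_measurable N" unfolding b using assms by (simp add: inner_axis)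
qed

lemma measurable_matrixI:
  fixes f :: "'a => real ^ 'd ^ 'd"
  assumes "\<And>a b. (\<lambda>om. f om $ a $ b) \<in> borel_measurable N"
  shows "f \<in> borel_measurable N"
proof (subst borel_measurable_euclidean_space, intro ballI)
  fix b :: "real ^ 'd ^ 'd" assume "b \<in> Basis"
  then obtain a c where b: "b = axis a (axis c 1)" unfolding Basis_vec_def by auto
  show "(\<lambda>om. f om \<bullet> b) \<in> borel_measurable N" unfolding b using assms by (simp add: inner_axis)
qed

lemma measurable_matrix_vector_mult:
  fixes A :: "'a => real ^ 'd ^ 'd" and v :: "'a => real ^ 'd"
  assumes A: "A \<in> borel_measurable N" and v: "v \<in> borel_measurable N"
  shows "(\<lambda>om. A om *v v om) \<in> borel_measurable N"
proof (rule measurable_vecI)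
  fix a
  have "(\<lambda>om. A om $ a $ b) \<in> borel_measurable N" for b
  proof (rule measurable_compose[OF A])
    show "(\<lambda>A :: real ^ 'd ^ 'd. A $ a $ b) \<in> borel_measurable borel"
      by (intro borel_measurable_continuous_onI continuous_intros)
  qed
  then show "(\<lambda>om. (A om *v v om) $ a) \<in> borel_measurable N"
    unfolding matrix_vector_mult_def vec_lambda_beta
    by (intro borel_measurable_sum borel_measurable_times measurable_vec_component[OF v]) auto
qed

lemma measurable_matrix_mult:
  fixes A B :: "'a => real ^ 'd ^ 'd"
  assumes A [measurable]: "A \<in> borel_measurable N" and B [measurable]: "B \<in> borel_measurable N"
  shows "(\<lambda>om. A om ** B om) \<in> borel_measurable N"
proof (rule borel_measurable_continuous_Pair[OF A B])
  show "continuous_on UNIV (\<lambda>p :: (real ^ 'd ^ 'd) \<times> (real ^ 'd ^ 'd). fst p ** snd p)"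
    by (intro continuous_on_matrix_mult continuous_intros)
qed

lemma measurable_sum_outer:
  fixes v :: "nat => 'a => real ^ 'd"
  assumes "\<And>i. i \<in> I ==> v i \<in> borel_measurable N"
  shows "(\<lambda>om. \<Sum>i\<in>I. outer (v i om) (v i om)) \<in> borel_measurable N"
proof (rule measurable_matrixI)
  fix a b
  show "(\<lambda>om. (\<Sum>i\<in>I. outer (v i om) (v i om)) $ a $ b) \<in> borel_measurable N"
    unfolding sum_component outer_def vec_lambda_beta
    by (intro borel_measurable_sum borel_measurable_times measurable_vec_component assms)
qed

section \<open>The annihilator of the controls\<close>

lemma mat_inv_det_nonzero:
  assumes A: "A \<in> carrier_mat k k" and d: "Determinant.det A \<noteq> 0"
  shows "mat_inv A \<in> carrier_mat k k" (is ?g1) "A * mat_inv A = 1\<^sub>m k" "mat_inv A * A = 1\<^sub>m k"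
proof -
  have "A \<in> Units (ring_mat TYPE(real) k ())"
    using det_non_zero_imp_unit[OF A d] .
  then have "mat_inverse A \<noteq> None" using mat_inverse(1)[OF A, of "()"] by blast
  then obtain B where B: "mat_inverse A = Some B" by blast
  from mat_inverse(2)[OF A B] show ?g1 "A * mat_inv A = 1\<^sub>m k" "mat_inv A * A = 1\<^sub>m k"
    by (auto simp: mat_inv_def B)
qed

lemma mat_inv_det_zero:
  assumes A: "A \<in> carrier_mat k k" and d: "Determinant.det A = 0"
  shows "mat_inv A = 0\<^sub>m k k"
proof (cases "mat_inverse A")
  case (Some B)
  from mat_inverse(2)[OF A Some] have B: "A * B = 1\<^sub>m k" "B \<in> carrier_mat k k" by auto
  have "Determinant.det A * Determinant.det B = 1"
    using det_mult[OF A B(2)] B(1) by simp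
  with d show ?thesis by simp
qed (use A in \<open>auto simp: mat_inv_def\<close>)

text \<open>Cramer's rule shows the entries as rational functions, which makes them measurable.\<close>

lemma mat_inv_entry:
  assumes A: "A \<in> carrier_mat k k" and p: "p < k" and q: "q < k"
  shows "mat_inv A $$ (p, q) = (if Determinant.det A = 0 then 0 else adj_mat A $$ (p, q) / Determinant.det A)"
proof (cases "Determinant.det A = 0")
  case True
  then show ?thesis using mat_inv_det_zero[OF A] p q by simp
next
  case False
  note inv = mat_inv_det_nonzero[OF A False]
  note adj = adj_mat[OF A]
  have "Determinant.det A \<cdot>\<^sub>m mat_inv A = mat_inv A * (Determinant.det A \<cdot>\<^sub>m 1\<^sub>m k)"
    using inv by (simp add: mult_smult_distrib[OF inv(1) one_carrier_mat])
  also have "\<dots> = mat_inv A * (A * adj_mat A)" unfolding adj(2) ..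
  also have "\<dots> = (mat_inv A * A) * adj_mat A" by (rule assoc_mult_mat[OF inv(1) A adj(1), symmetric])
  also have "\<dots> = adj_mat A" unfolding inv(3) by (rule left_mult_one_mat[OF adj(1)])
  finally have "(Determinant.det A \<cdot>\<^sub>m mat_inv A) $$ (p, q) = adj_mat A $$ (p, q)" by simp
  then show ?thesis using False inv p q by (simp add: field_simps)
qed

lemma measurable_det:
  assumes "\<And>p q. p < k ==> q < k ==> (\<lambda>om. A om $$ (p, q)) \<in> borel_measurable N"
    and car: "\<And>om. A om \<in> carrier_mat k k"
  shows "(\<lambda>om. Determinant.det (A om) :: real) \<in> borel_measurable N"
proof -
  have "(\<lambda>om. \<Sum>s | s permutes {0..<k}. signof s * (\<Prod>i=0..<k. A om $$ (i, s i))) \<in> borel_measurable N"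
    by (intro borel_measurable_sum borel_measurable_times borel_measurable_const borel_measurable_prod assms)
       (auto simp: permutes_in_image)
  moreover have "Determinant.det (A om) = (\<Sum>s | s permutes {0..<k}. signof s * (\<Prod>i=0..<k. A om $$ (i, s i)))" for om
    using car[of om] by (simp add: Determinant.det_def)
  ultimately show ?thesis by simp
qed

lemma measurable_mat_inv_entry:
  assumes A: "\<And>p q. p < k ==> q < k ==> (\<lambda>om. A om $$ (p, q)) \<in> borel_measurable N"
    and car: "\<And>om. A om \<in> carrier_mat k k" and p: "p < k" and q: "q < k"
  shows "(\<lambda>om. mat_inv (A om) $$ (p, q)) \<in> borel_measurable N"
proof -
  have D: "(\<lambda>om. Determinant.det (A om)) \<in> borel_measurable N" by (rule measurable_det[OF A car])
  have md: "(\<lambda>om. Determinant.det (mat_delete (A om) q p)) \<in> borel_measurable N"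
  proof (rule measurable_det[where k="k - 1"])
    show "mat_delete (A om) q p \<in> carrier_mat (k - 1) (k - 1)" for om using car[of om] by (rule mat_delete_carrier)
    fix a b assume ab: "a < k - 1" "b < k - 1"
    have "mat_delete (A om) q p $$ (a, b) = A om $$ (if a < q then a else Suc a, if b < p then b else Suc b)" for om
      using car[of om] ab by (simp add: mat_delete_def)
    then show "(\<lambda>om. mat_delete (A om) q p $$ (a, b)) \<in> borel_measurable N"
      using ab by (simp add: A)
  qed
  have "adj_mat (A om) $$ (p, q) = (-1) ^ (q + p) * Determinant.det (mat_delete (A om) q p)" for om
    using car[of om] p q by (auto simp: adj_mat_def cofactor_def)
  then have "mat_inv (A om) $$ (p, q) = (if Determinant.det (A om) = 0 then 0 else (-1) ^ (q + p) * Determinant.det (mat_delete (A om) q p) / Determinant.det (A om))" for om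
    using mat_inv_entry[OF car p q] by simp
  then show ?thesis using D md by simp
qed

lemma gram_carrier: "gram K w n om \<in> carrier_mat (K n) (K n)" by (simp add: gram_def)

lemma gram_entry: "p < K n ==> q < K n ==>
  gram K w n om $$ (p, q) = (\<Sum>i=1..n. vec_index (w n i om) p * vec_index (w n i om) q)"
  by (simp add: gram_def)

text \<open>The entries of the hat matrix as double sums, which turns its algebra into exchanges of sums. A singular Gram
  matrix has inverse zero by convention; the hat matrix is then zero and the annihilator the identity, so
  that symmetry and idempotence hold at every sample point.\<close>

definition hat where
  "hat K w n i j om = (\<Sum>p<K n. \<Sum>q<K n. vec_index (w n i om) p * mat_inv (gram K w n om) $$ (p, q) * vec_index (w n j om) q)"

lemma mat_inv_carrier: "A \<in> carrier_mat k k ==> mat_inv A \<in> carrier_mat k k"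
  using mat_inv_det_nonzero(1)[of A k] mat_inv_det_zero[of A k] by (cases "Determinant.det A = 0") auto

lemma annih_hat:
  assumes "w n i om \<in> carrier_vec (K n)" "w n j om \<in> carrier_vec (K n)"
  shows "annih K w n i j om = of_bool (i = j) - hat K w n i j om"
proof -
  have G: "mat_inv (gram K w n om) \<in> carrier_mat (K n) (K n)" by (rule mat_inv_carrier[OF gram_carrier])
  show ?thesis
    using assms G unfolding annih_def hat_def
    by (simp add: scalar_prod_def mult_mat_vec_def row_def sum_distrib_left atLeast0LessThan mult.assoc)
qed

lemma mat_inv_gram_sym:
  assumes "p < K n" "q < K n"
  shows "mat_inv (gram K w n om) $$ (p, q) = mat_inv (gram K w n om) $$ (q, p)"
proof (cases "Determinant.det (gram K w n om) = 0")
  case True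
  then show ?thesis using mat_inv_det_zero[OF gram_carrier True] assms by simp
next
  case False
  let ?S = "gram K w n om" let ?G = "mat_inv ?S"
  note inv = mat_inv_det_nonzero[OF gram_carrier False]
  have symS: "?S\<^sup>T = ?S" by (auto simp: gram_def mult.commute)
  have "?G\<^sup>T = ?G\<^sup>T * (?S * ?G)" using inv by simp
  also have "\<dots> = (?G\<^sup>T * ?S\<^sup>T) * ?G" using inv gram_carrier[of K w n om] by (simp add: symS)
  also have "?G\<^sup>T * ?S\<^sup>T = (?S * ?G)\<^sup>T" using Matrix.transpose_mult[OF gram_carrier[of K w n om] inv(1)] by simp
  also have "\<dots> = 1\<^sub>m (K n)" by (simp add: inv)
  finally have "?G\<^sup>T = ?G" using inv by simp
  then show ?thesis using assms inv(1) by (metis carrier_matD index_transpose_mat(1))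
qed

lemma mat_inv_gram_mult:
  assumes d: "Determinant.det (gram K w n om) \<noteq> 0" and pr: "p < K n" "r < K n"
  shows "(\<Sum>q<K n. mat_inv (gram K w n om) $$ (p, q) * (\<Sum>i=1..n. vec_index (w n i om) q * vec_index (w n i om) r)) = of_bool (p = r)"
proof -
  note inv = mat_inv_det_nonzero[OF gram_carrier d]
  have "(mat_inv (gram K w n om) * gram K w n om) $$ (p, r) = of_bool (p = r)" using inv(3) pr by simp
  moreover have "(mat_inv (gram K w n om) * gram K w n om) $$ (p, r)
      = (\<Sum>q<K n. mat_inv (gram K w n om) $$ (p, q) * gram K w n om $$ (q, r))"
    using inv(1) gram_carrier[of K w n om] pr by (simp add: scalar_prod_def atLeast0LessThan)
  ultimately show ?thesis using pr by (simp add: gram_entry)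
qed

lemma hat_mult_w:
  assumes d: "Determinant.det (gram K w n om) \<noteq> 0" and r: "r < K n"
  shows "(\<Sum>j=1..n. hat K w n i j om * vec_index (w n j om) r) = vec_index (w n i om) r"
proof -
  let ?W = "\<lambda>i p. vec_index (w n i om) p" and ?G = "\<lambda>p q. mat_inv (gram K w n om) $$ (p, q)"
  have "(\<Sum>j=1..n. hat K w n i j om * ?W j r) = (\<Sum>j=1..n. \<Sum>p<K n. \<Sum>q<K n. ?W i p * (?G p q * (?W j q * ?W j r)))"
    by (simp add: hat_def sum_distrib_right mult.assoc)
  also have "\<dots> = (\<Sum>p<K n. \<Sum>q<K n. \<Sum>j=1..n. ?W i p * (?G p q * (?W j q * ?W j r)))"
    by (subst sum.swap, rule sum.cong[OF refl], subst sum.swap, rule refl)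
  also have "\<dots> = (\<Sum>p<K n. ?W i p * (\<Sum>q<K n. ?G p q * (\<Sum>j=1..n. ?W j q * ?W j r)))"
    by (simp add: sum_distrib_left)
  also have "\<dots> = (\<Sum>p<K n. ?W i p * of_bool (p = r))"
    by (intro sum.cong refl arg_cong2[where f="(*)"] mat_inv_gram_mult[OF d _ r]) auto
  also have "\<dots> = ?W i r" using r by (simp add: of_bool_def if_distrib[where f="\<lambda>x. _ * x"] cong: if_cong)
  finally show ?thesis .
qed

lemma hat_sym: "hat K w n i j om = hat K w n j i om"
proof -
  have "hat K w n i j om = (\<Sum>q<K n. \<Sum>p<K n. vec_index (w n i om) p * mat_inv (gram K w n om) $$ (p, q) * vec_index (w n j om) q)"
    unfolding hat_def by (rule sum.swap)
  also have "\<dots> = hat K w n j i om"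
    unfolding hat_def by (intro sum.cong refl) (simp add: mat_inv_gram_sym[where K=K and n=n and w=w] mult.commute mult.left_commute)
  finally show ?thesis .
qed

lemma hat_singular: "Determinant.det (gram K w n om) = 0 ==> hat K w n i j om = 0"
  unfolding hat_def using mat_inv_det_zero[OF gram_carrier, of K w n om] by simp

lemma hat_idem: "(\<Sum>k=1..n. hat K w n i k om * hat K w n k j om) = hat K w n i j om"
proof (cases "Determinant.det (gram K w n om) = 0")
  case False
  let ?W = "\<lambda>i p. vec_index (w n i om) p" and ?G = "\<lambda>p q. mat_inv (gram K w n om) $$ (p, q)"
  have "(\<Sum>k=1..n. hat K w n i k om * hat K w n k j om) =
    (\<Sum>k=1..n. \<Sum>p<K n. \<Sum>q<K n. (hat K w n i k om * ?W k p) * (?G p q * ?W j q))"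
    unfolding hat_def[of K w n _ j] by (simp add: sum_distrib_left mult.assoc)
  also have "\<dots> = (\<Sum>p<K n. \<Sum>q<K n. \<Sum>k=1..n. (hat K w n i k om * ?W k p) * (?G p q * ?W j q))"
    by (subst sum.swap, rule sum.cong[OF refl], subst sum.swap, rule refl)
  also have "\<dots> = (\<Sum>p<K n. \<Sum>q<K n. ?W i p * (?G p q * ?W j q))"
    by (intro sum.cong refl) (simp add: hat_mult_w[OF False] del: One_nat_def flip: sum_distrib_right)
  also have "\<dots> = hat K w n i j om" by (simp add: hat_def mult.assoc)
  finally show ?thesis .
qed (simp add: hat_singular)

lemma hat_trace:
  assumes d: "Determinant.det (gram K w n om) \<noteq> 0"
  shows "(\<Sum>i=1..n. hat K w n i i om) = real (K n)"
proof -
  let ?W = "\<lambda>i p. vec_index (w n i om) p" and ?G = "\<lambda>p q. mat_inv (gram K w n om) $$ (p, q)"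
  have "(\<Sum>i=1..n. hat K w n i i om) = (\<Sum>i=1..n. \<Sum>p<K n. \<Sum>q<K n. ?G p q * (?W i q * ?W i p))"
    unfolding hat_def by (simp add: mult.commute mult.left_commute)
  also have "\<dots> = (\<Sum>p<K n. \<Sum>q<K n. \<Sum>i=1..n. ?G p q * (?W i q * ?W i p))"
    by (subst sum.swap, rule sum.cong[OF refl], subst sum.swap, rule refl)
  also have "\<dots> = (\<Sum>p<K n. 1)"
    by (rule sum.cong[OF refl]) (use mat_inv_gram_mult[OF d] in \<open>simp add: sum_distrib_left\<close>)
  finally show ?thesis by simp
qed

context
  fixes K :: "nat => nat" and w :: "nat => nat => 'a => real Matrix.vec" and n :: nat and om :: 'a
  assumes car: "\<And>i. i \<in> {1..n} ==> w n i om \<in> carrier_vec (K n)"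
begin

lemma annih_eq:
  assumes "i \<in> {1..n}" "j \<in> {1..n}"
  shows "annih K w n i j om = of_bool (i = j) - hat K w n i j om"
  by (intro annih_hat car assms)

lemma annih_sym:
  assumes "i \<in> {1..n}" "j \<in> {1..n}"
  shows "annih K w n i j om = annih K w n j i om"
  using annih_eq[of i j] annih_eq[of j i] hat_sym[of K w n i j] assms by auto

lemma annih_idem:
  assumes i: "i \<in> {1..n}" and j: "j \<in> {1..n}"
  shows "(\<Sum>k=1..n. annih K w n i k om * annih K w n k j om) = annih K w n i j om"
proof -
  have "(\<Sum>k=1..n. annih K w n i k om * annih K w n k j om)
      = (\<Sum>k=1..n. (of_bool (i = k) - hat K w n i k om) * (of_bool (k = j) - hat K w n k j om))"
    by (intro sum.cong refl) (simp only: annih_eq i j)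
  also have "\<dots> = (\<Sum>k=1..n. of_bool (i = k) * (of_bool (k = j) - hat K w n k j om))
      - (\<Sum>k=1..n. hat K w n i k om * of_bool (k = j)) + (\<Sum>k=1..n. hat K w n i k om * hat K w n k j om)"
    by (simp add: algebra_simps sum.distrib sum_subtractf)
  also have "(\<Sum>k=1..n. of_bool (i = k) * (of_bool (k = j) - hat K w n k j om)) = of_bool (i = j) - hat K w n i j om"
    using i by (subst sum.remove[of _ i]) (auto intro!: sum.neutral)
  also have "(\<Sum>k=1..n. hat K w n i k om * of_bool (k = j)) = hat K w n i j om"
    using j by (subst sum.remove[of _ j]) (auto intro!: sum.neutral)
  finally show ?thesis by (simp only: hat_idem annih_eq i j)
qed

lemma annih_mult_w:
  assumes d: "Determinant.det (gram K w n om) \<noteq> 0" and r: "r < K n" and i: "i \<in> {1..n}"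
  shows "(\<Sum>j=1..n. annih K w n i j om * vec_index (w n j om) r) = 0"
proof -
  have "(\<Sum>j=1..n. annih K w n i j om * vec_index (w n j om) r)
      = (\<Sum>j=1..n. of_bool (i = j) * vec_index (w n j om) r) - (\<Sum>j=1..n. hat K w n i j om * vec_index (w n j om) r)"
    unfolding sum_subtractf[symmetric]
    by (intro sum.cong refl) (simp only: annih_eq i left_diff_distrib)
  also have "(\<Sum>j=1..n. of_bool (i = j) * vec_index (w n j om) r) = vec_index (w n i om) r"
    using i by (subst sum.remove[of _ i]) (auto intro!: sum.neutral)
  finally show ?thesis by (simp add: hat_mult_w[OF d r] del: One_nat_def)
qed

lemma annih_trace:
  assumes d: "Determinant.det (gram K w n om) \<noteq> 0"
  shows "(\<Sum>i=1..n. annih K w n i i om) = real n - real (K n)"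
proof -
  have "(\<Sum>i=1..n. annih K w n i i om) = (\<Sum>i=1..n. 1 - hat K w n i i om)"
    by (intro sum.cong refl) (simp add: annih_eq)
  then show ?thesis by (simp add: sum_subtractf hat_trace[OF d] del: One_nat_def)
qed

end

lemma measurable_annih:
  assumes w: "\<And>i k. i \<in> {1..n} ==> k < K n ==> (\<lambda>om. vec_index (w n i om) k) \<in> borel_measurable N"
    and car: "\<And>i om. i \<in> {1..n} ==> om \<in> space N ==> w n i om \<in> carrier_vec (K n)"
    and i: "i \<in> {1..n}" and j: "j \<in> {1..n}"
  shows "annih K w n i j \<in> borel_measurable N"
proof -
  have G: "(\<lambda>om. mat_inv (gram K w n om) $$ (p, q)) \<in> borel_measurable N" if "p < K n" "q < K n" for p q
    using that by (intro measurable_mat_inv_entry[where k="K n"] gram_carrier)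
      (auto simp: gram_entry intro!: borel_measurable_sum borel_measurable_times w)
  have "hat K w n i j \<in> borel_measurable N"
    unfolding hat_def[abs_def] using i j
    by (intro borel_measurable_sum borel_measurable_times w G) auto
  then have "(\<lambda>om. of_bool (i = j) - hat K w n i j om) \<in> borel_measurable N" by simp
  moreover have "annih K w n i j om = of_bool (i = j) - hat K w n i j om" if "om \<in> space N" for om
    by (intro annih_hat car i j that)
  ultimately show ?thesis
    using measurable_cong[of N "annih K w n i j" "\<lambda>om. of_bool (i = j) - hat K w n i j om" borel] by blast
qed

lemma min_eigenvalue_mat_pos_imp_det:
  assumes A: "A \<in> carrier_mat k k" and pos: "min_eigenvalue_mat A > 0"
  shows "Determinant.det A \<noteq> 0"
proof
  assume "Determinant.det A = 0"
  then obtain v where "v \<in> carrier_vec k" "v \<noteq> 0\<^sub>v k" "A *\<^sub>v v = 0\<^sub>v k"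
    using det_0_iff_vec_prod_zero[OF A] by blast
  then have "eigenvalue A 0" using A unfolding eigenvalue_def eigenvector_def
    by (intro exI[of _ v]) auto
  moreover have "finite {l. eigenvalue A l}"
  proof -
    have "char_poly A \<noteq> 0" using degree_monic_char_poly[OF A] by auto
    then have "finite {l. poly (char_poly A) l = 0}" by (rule poly_roots_finite)
    then show ?thesis by (simp add: eigenvalue_root_char_poly[OF A])
  qed
  ultimately have "Min {l. eigenvalue A l} \<le> 0" by (intro Min_le) auto
  with pos show False by (simp add: min_eigenvalue_mat_def)
qed

section \<open>Centred variables and conditionally independent blocks\<close>

text \<open>The conditional mean given \<open>H\<close> is zero. The integrated form avoids versions of conditional
  expectations when \<open>H\<close> is enlarged or generated by smaller families.\<close>

definition centered :: "'a measure => 'a measure => ('a => real) => bool" where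
  "centered M H X \<longleftrightarrow> integrable M X \<and> (\<forall>S\<in>sets H. (\<integral>om. indicator S om * X om \<partial>M) = 0)"

context prob_space
begin

lemma sigma_finite_subalgebraI: "subalgebra M F ==> sigma_finite_subalgebra M F"
  by (intro finite_measure_subalgebra_is_sigma_finite finite_measure_subalgebra.intro
      finite_measure_subalgebra_axioms.intro finite_measure_axioms)

lemma centered_mono: "centered M H X ==> sets F \<subseteq> sets H ==> centered M F X"
  by (auto simp: centered_def)

lemma centered_cond_exp:
  assumes F: "subalgebra M F" and X: "centered M F X"
  shows "AE om in M. real_cond_exp M F X om = 0"
proof -
  interpret sigma_finite_subalgebra M F by (rule sigma_finite_subalgebraI[OF F])
  show ?thesis
    by (rule real_cond_exp_charact) (use X in \<open>auto simp: centered_def set_lebesgue_integral_def\<close>)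
qed

lemma centeredI_cond_exp:
  assumes F: "subalgebra M F" and X: "integrable M X" and 0: "AE om in M. real_cond_exp M F X om = 0"
  shows "centered M F X"
  unfolding centered_def
proof (intro conjI ballI X)
  interpret sigma_finite_subalgebra M F by (rule sigma_finite_subalgebraI[OF F])
  fix S assume S: "S \<in> sets F"
  have "(\<integral>om. indicator S om * X om \<partial>M) = (\<integral>om. indicator S om * real_cond_exp M F X om \<partial>M)"
    using real_cond_exp_intA[OF X S] by (simp add: set_lebesgue_integral_def)
  also have "\<dots> = (\<integral>om. 0 \<partial>M)"
  proof (rule integral_cong_AE)
    show "(\<lambda>om. indicator S om * real_cond_exp M F X om) \<in> borel_measurable M"
      using S F by (auto simp: subalgebra_def)
  qed (use 0 in auto)
  finally show "(\<integral>om. indicator S om * X om \<partial>M) = 0" by simp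
qed

lemma centered_diff_cond_exp:
  assumes F: "subalgebra M F" and X: "integrable M X"
  shows "centered M F (\<lambda>om. X om - real_cond_exp M F X om)"
  unfolding centered_def
proof (intro conjI ballI)
  interpret sigma_finite_subalgebra M F by (rule sigma_finite_subalgebraI[OF F])
  show "integrable M (\<lambda>om. X om - real_cond_exp M F X om)"
    using X real_cond_exp_int(1)[OF X] by simp
  fix S assume S: "S \<in> sets F"
  then have SM: "S \<in> sets M" using F by (auto simp: subalgebra_def)
  have "integrable M (\<lambda>om. indicator S om * X om)" "integrable M (\<lambda>om. indicator S om * real_cond_exp M F X om)"
    using integrable_mult_indicator[OF SM X] integrable_mult_indicator[OF SM real_cond_exp_int(1)[OF X]] by simp_all
  then show "(\<integral>om. indicator S om * (X om - real_cond_exp M F X om) \<partial>M) = 0"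
    using real_cond_exp_intA[OF X S] by (simp add: set_lebesgue_integral_def right_diff_distrib)
qed

lemma centered_mult:
  assumes H: "subalgebra M H" and X: "centered M H X"
    and f: "f \<in> borel_measurable H" and int: "integrable M (\<lambda>om. f om * X om)"
  shows "(\<integral>om. f om * X om \<partial>M) = 0"
proof -
  interpret sigma_finite_subalgebra M H by (rule sigma_finite_subalgebraI[OF H])
  have Xm: "X \<in> borel_measurable M" using X by (auto simp: centered_def)
  have "(\<integral>om. f om * X om \<partial>M) = (\<integral>om. f om * real_cond_exp M H X om \<partial>M)"
    using real_cond_exp_intg[OF int f Xm] by simp
  also have "\<dots> = (\<integral>om. 0 \<partial>M)"
    using centered_cond_exp[OF H X] f by (intro integral_cong_AE) (auto intro: measurable_from_subalg[OF H])
  finally show ?thesis by simp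
qed

lemma centered_cmult:
  assumes H: "subalgebra M H" and X: "centered M H X"
    and f: "f \<in> borel_measurable H" and int: "integrable M (\<lambda>om. f om * X om)"
  shows "centered M H (\<lambda>om. f om * X om)"
  unfolding centered_def
proof (intro conjI ballI int)
  fix S assume S: "S \<in> sets H"
  then have SM: "S \<in> sets M" using H by (auto simp: subalgebra_def)
  have "integrable M (\<lambda>om. (indicator S om * f om) * X om)"
    using integrable_mult_indicator[OF SM int] by (simp add: mult.assoc)
  then have "(\<integral>om. (indicator S om * f om) * X om \<partial>M) = 0"
    using S f by (intro centered_mult[OF H X]) auto
  then show "(\<integral>om. indicator S om * (f om * X om) \<partial>M) = 0" by (simp add: mult.assoc)
qed

lemma centered_AE_cong:
  assumes "centered M H X" "AE om in M. X om = Y om" "Y \<in> borel_measurable M" "subalgebra M H"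
  shows "centered M H Y"
  unfolding centered_def
proof (intro conjI ballI)
  have Xm: "X \<in> borel_measurable M" using assms(1) by (auto simp: centered_def)
  show "integrable M Y"
    using assms(1) Xm unfolding centered_def by (subst integrable_cong_AE[of Y M X]) (use assms in auto)
  fix S assume "S \<in> sets H"
  then have "S \<in> sets M" using assms(4) by (auto simp: subalgebra_def)
  then have "(\<integral>om. indicator S om * Y om \<partial>M) = (\<integral>om. indicator S om * X om \<partial>M)"
    using assms Xm by (intro integral_cong_AE) auto
  then show "(\<integral>om. indicator S om * Y om \<partial>M) = 0" using assms(1) \<open>S \<in> sets H\<close> by (simp add: centered_def)
qed

text \<open>The sets on which the integral vanishes form a Dynkin system.\<close>

lemma centered_generated:
  assumes stable: "Int_stable P" and sub: "P \<subseteq> sets M" and top: "space M \<in> P"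
    and X: "integrable M X" and zero: "\<And>S. S \<in> P ==> (\<integral>om. indicator S om * X om \<partial>M) = 0"
  shows "centered M (sigma (space M) P) X"
  unfolding centered_def
proof (intro conjI ballI X)
  have P: "P \<subseteq> Pow (space M)" using sub sets.sets_into_space by blast
  fix S assume "S \<in> sets (sigma (space M) P)"
  then have S: "S \<in> sigma_sets (space M) P" using P by (simp add: sets_measure_of)
  have sM: "S \<in> sets M" if "S \<in> sigma_sets (space M) P" for S
    using sets.sigma_sets_subset[OF sub] that by blast
  have intS: "integrable M (\<lambda>om. indicator S om * X om)" if "S \<in> sets M" for S
    using integrable_mult_indicator[OF that X] by simp
  from stable P S show "(\<integral>om. indicator S om * X om \<partial>M) = 0"
  proof (induction rule: sigma_sets_induct_disjoint)
    case (basic A)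
    then show ?case by (rule zero)
  next
    case empty
    show ?case by simp
  next
    case (compl A)
    have "(\<integral>om. indicator (space M - A) om * X om \<partial>M)
        = (\<integral>om. indicator (space M) om * X om - indicator A om * X om \<partial>M)"
      by (intro Bochner_Integration.integral_cong refl) (auto simp: indicator_def)
    also have "\<dots> = 0"
      using zero[OF top] compl.IH intS[OF sets.top] intS[OF sM[OF compl.hyps]] by simp
    finally show ?case .
  next
    case (union A)
    have A: "A i \<in> sets M" for i using sM union.hyps(2) by blast
    then have UA: "(\<Union>i. A i) \<in> sets M" by blast
    have "(LINT om:(\<Union>i. A i)|M. X om) = (\<Sum>i. (LINT om:A i|M. X om))"
    proof (rule lebesgue_integral_countable_add)
      show "A i \<inter> A j = {}" if "i \<noteq> j" for i j using union.hyps(1) that by (auto simp: disjoint_family_on_def)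
      show "set_integrable M (\<Union>(range A)) X" using intS[OF UA] by (simp add: set_integrable_def)
    qed (rule A)
    then show ?case using union.IH by (simp add: set_lebesgue_integral_def)
  qed
qed

end

text \<open>The information in \<open>F\<close> and in all blocks except \<open>k\<close>.\<close>

definition rest_algebra :: "'a measure => 'a measure => ('i => 'a set set) => 'i set => 'i => 'a measure" where
  "rest_algebra M F G I k = sigma (space M) (sets F \<union> (\<Union>g\<in>I - {k}. G g))"

locale cond_indep_blocks = prob_space M for M :: "'a measure" +
  fixes F :: "'a measure" and G :: "'i => 'a set set" and I :: "'i set"
  assumes subalg: "subalgebra M F"
    and fin: "finite I"
    and sigma_alg: "\<And>g. g \<in> I ==> sigma_algebra (space M) (G g)"
    and indep: "cond_indep_sets M F G I"
begin

lemma G_sets: "g \<in> I ==> G g \<subseteq> sets M"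
  using indep by (auto simp: cond_indep_sets_def)

lemma F_sets: "sets F \<subseteq> sets M" "space F = space M"
  using subalg by (auto simp: subalgebra_def)

lemma rest_gen_Pow: "sets F \<union> (\<Union>g\<in>I - {k}. G g) \<subseteq> Pow (space M)"
  using G_sets F_sets sets.sets_into_space[of _ M] by blast

lemma sets_rest: "sets (rest_algebra M F G I k) = sigma_sets (space M) (sets F \<union> (\<Union>g\<in>I - {k}. G g))"
  unfolding rest_algebra_def by (rule sets_measure_of[OF rest_gen_Pow])

lemma space_rest [simp]: "space (rest_algebra M F G I k) = space M"
  unfolding rest_algebra_def by (rule space_measure_of[OF rest_gen_Pow])

lemma F_le_rest: "sets F \<subseteq> sets (rest_algebra M F G I k)"
  unfolding sets_rest by auto

lemma G_le_rest: "g \<in> I ==> g \<noteq> k ==> G g \<subseteq> sets (rest_algebra M F G I k)"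
  unfolding sets_rest by auto

lemma subalgebra_rest: "subalgebra M (rest_algebra M F G I k)"
  unfolding subalgebra_def sets_rest
  using sets.sigma_sets_subset[of "sets F \<union> (\<Union>g\<in>I - {k}. G g)" M] G_sets F_sets by auto

lemma block_alg:
  assumes "k \<in> I"
  shows "sets (sigma (space M) (G k)) = G k" (is ?g1) "subalgebra M (sigma (space M) (G k))" (is ?g2)
proof -
  have "G k \<subseteq> Pow (space M)" using G_sets[OF assms] sets.sets_into_space by blast
  then show 1: ?g1
    by (simp add: sets_measure_of sigma_algebra.sigma_sets_eq[OF sigma_alg[OF assms]])
  show ?g2
    unfolding subalgebra_def 1 using G_sets[OF assms] \<open>G k \<subseteq> Pow (space M)\<close> by (simp add: space_measure_of)
qed

lemma space_in_G: "g \<in> I ==> space M \<in> G g"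
  using sigma_algebra.axioms(1)[OF sigma_alg] algebra.top by blast

text \<open>Given \<open>F\<close> the other blocks say nothing about block \<open>k\<close>. It suffices to integrate over sets \<open>A \<inter> C\<close>
  with \<open>A\<close> in \<open>F\<close> and \<open>C\<close> an intersection of events of the other blocks. There \<open>1_C\<close> may be replaced by its
  conditional probability \<open>p\<close>: conditional independence says that \<open>1_A (1_C - p)\<close> is centred given block \<open>k\<close>.\<close>

lemma centered_rest:
  assumes k: "k \<in> I" and Xm: "X \<in> borel_measurable (sigma (space M) (G k))" and X: "integrable M X"
  shows "centered M (rest_algebra M F G I k) (\<lambda>om. X om - real_cond_exp M F X om)"
proof -
  interpret Fs: sigma_finite_subalgebra M F by (rule sigma_finite_subalgebraI[OF subalg])
  let ?Y = "\<lambda>om. X om - real_cond_exp M F X om"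
  define P where "P = {A \<inter> (\<Inter>g\<in>I - {k}. B g) | A B. A \<in> sets F \<and> (\<forall>g\<in>I - {k}. B g \<in> G g)}"
  have intX: "integrable M (real_cond_exp M F X)" using Fs.real_cond_exp_int(1)[OF X] .
  have Y: "integrable M ?Y" using X intX by simp
  have stable: "Int_stable P"
  proof (rule Int_stableI)
    fix S S' assume "S \<in> P" "S' \<in> P"
    then obtain A B A' B' where *: "S = A \<inter> (\<Inter>g\<in>I - {k}. B g)" "S' = A' \<inter> (\<Inter>g\<in>I - {k}. B' g)"
      "A \<in> sets F" "A' \<in> sets F" "\<forall>g\<in>I - {k}. B g \<in> G g" "\<forall>g\<in>I - {k}. B' g \<in> G g"
      unfolding P_def by blast
    have "S \<inter> S' = (A \<inter> A') \<inter> (\<Inter>g\<in>I - {k}. B g \<inter> B' g)" unfolding * by blast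
    moreover have "B g \<inter> B' g \<in> G g" if "g \<in> I - {k}" for g
    proof -
      have "g \<in> I" "B g \<in> G g" "B' g \<in> G g" using * that by auto
      then show ?thesis
        using sets.Int[of "B g" "sigma (space M) (G g)" "B' g", unfolded block_alg(1)[OF \<open>g \<in> I\<close>]] by blast
    qed
    moreover have "A \<inter> A' \<in> sets F" using * by auto
    ultimately show "S \<inter> S' \<in> P"
      unfolding P_def by (intro CollectI exI[of _ "A \<inter> A'"] exI[of _ "\<lambda>g. B g \<inter> B' g"]) simp
  qed
  have PM: "P \<subseteq> sets M"
  proof
    fix S assume "S \<in> P"
    then obtain A B where *: "S = A \<inter> (\<Inter>g\<in>I - {k}. B g)" "A \<in> sets F" "\<forall>g\<in>I - {k}. B g \<in> G g"
      unfolding P_def by blast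
    show "S \<in> sets M"
    proof (cases "I - {k} = {}")
      case True then show ?thesis using * F_sets by (simp only:) auto
    next
      case False
      then have "(\<Inter>g\<in>I - {k}. B g) \<in> sets M" using * G_sets fin by (intro sets.finite_INT) auto
      then show ?thesis using * F_sets by auto
    qed
  qed
  have gen1: "A \<in> P" if "A \<in> sets F" for A
  proof -
    have "A = A \<inter> (\<Inter>g\<in>I - {k}. space M)" using that F_sets sets.sets_into_space[of A M] by blast
    then show ?thesis unfolding P_def using that space_in_G by blast
  qed
  have gen2: "A \<in> P" if "A \<in> G h" "h \<in> I - {k}" for A h
  proof -
    let ?B = "\<lambda>g. if g = h then A else space M"
    have "A \<subseteq> space M" using that G_sets sets.sets_into_space by blast
    then have "A = space M \<inter> (\<Inter>g\<in>I - {k}. ?B g)" using that by auto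
    moreover have "\<forall>g\<in>I - {k}. ?B g \<in> G g" using that space_in_G by auto
    moreover have "space M \<in> sets F" using sets.top[of F] F_sets by simp
    ultimately show ?thesis unfolding P_def by blast
  qed
  have zero: "(\<integral>om. indicator S om * ?Y om \<partial>M) = 0" if SP: "S \<in> P" for S
  proof -
    obtain A B where *: "S = A \<inter> (\<Inter>g\<in>I - {k}. B g)" "A \<in> sets F" "\<forall>g\<in>I - {k}. B g \<in> G g"
      using SP unfolding P_def by blast
    have AM: "A \<in> sets M" and Asp: "A \<subseteq> space M" using * F_sets sets.sets_into_space[of A M] by auto
    let ?B = "\<lambda>D g. if g = k then D else B g"
    define E where "E D = (\<Inter>g\<in>I. ?B D g)" for D
    have BG: "?B D \<in> Pi I G" if "D \<in> G k" for D using * that by auto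
    have EM: "E D \<in> sets M" if "D \<in> G k" for D
      unfolding E_def
    proof (rule sets.finite_INT)
      show "?B D i \<in> sets M" if "i \<in> I" for i using Pi_mem[OF BG[OF \<open>D \<in> G k\<close>] that] G_sets[OF that] by blast
    qed (use fin k in auto)
    define C where "C = E (space M)"
    have CM: "C \<in> sets M" unfolding C_def by (rule EM[OF space_in_G[OF k]])
    have ED: "E D = D \<inter> C" if "D \<in> G k" for D
    proof -
      have "D \<subseteq> space M" using that G_sets[OF k] sets.sets_into_space by blast
      then show ?thesis unfolding E_def C_def using k by (auto split: if_splits)
    qed
    have SC: "S = A \<inter> C" unfolding * C_def E_def using Asp k by (auto split: if_splits)
    define p where "p = real_cond_exp M F (indicator C)"
    have pF [measurable]: "p \<in> borel_measurable F" unfolding p_def by simp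
    have pM [measurable]: "p \<in> borel_measurable M" unfolding p_def by simp
    have intind: "integrable M (indicator D :: _ => real)" if "D \<in> sets M" for D
      using that by (simp add: emeasure_eq_measure)
    have p01: "AE om in M. 0 \<le> p om \<and> p om \<le> 1"
      using Fs.real_cond_exp_ge_c[OF intind[OF CM], of 0] Fs.real_cond_exp_le_c[OF intind[OF CM], of 1]
      unfolding p_def by (auto simp: indicator_def)
    have prodk: "(\<Prod>g\<in>I. real_cond_exp M F (indicator (?B D g)) om)
        = real_cond_exp M F (indicator D) om * (\<Prod>g\<in>I - {k}. real_cond_exp M F (indicator (B g)) om)" for D om
      using k fin by (subst prod.remove[of I k]) (auto intro!: prod.cong arg_cong2[where f="(*)"])
    have ind: "AE om in M. real_cond_exp M F (indicator (E D)) om =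
        real_cond_exp M F (indicator D) om * (\<Prod>g\<in>I - {k}. real_cond_exp M F (indicator (B g)) om)" if "D \<in> G k" for D
      using indep BG[OF that] fin k unfolding cond_indep_sets_def E_def prodk[symmetric] by blast
    have one: "AE om in M. real_cond_exp M F (indicator (space M)) om = 1"
    proof -
      have "AE om in M. real_cond_exp M F (indicator (space M)) om = (indicator (space M) om :: real)"
        using F_sets sets.top[of F] by (intro Fs.real_cond_exp_F_meas intind) auto
      then show ?thesis by (auto simp: indicator_def elim!: AE_mp)
    qed
    have split: "AE om in M. real_cond_exp M F (indicator (D \<inter> C)) om = real_cond_exp M F (indicator D) om * p om"
      if "D \<in> G k" for D
      using ind[OF that] ind[OF space_in_G[OF k]] one
      unfolding ED[OF that] p_def C_def by eventually_elim simp
    \<comment> \<open>the conditional independence of \<open>C\<close> and the block \<open>k\<close>, localised to \<open>A\<close>\<close>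
    define h where "h om = indicator A om * (indicator C om - p om)" for om
    have hM [measurable]: "h \<in> borel_measurable M" unfolding h_def using AM CM by measurable
    have hb: "AE om in M. \<bar>h om\<bar> \<le> 1"
      using p01 by eventually_elim (auto simp: h_def indicator_def)
    have h_int: "integrable M h"
      by (rule integrable_const_bound[where B=1]) (use hb in auto)
    have "centered M (sigma (space M) (G k)) h"
      unfolding centered_def block_alg(1)[OF k]
    proof (intro conjI ballI h_int)
      fix D assume D: "D \<in> G k"
      then have DM: "D \<in> sets M" using G_sets[OF k] by blast
      have i1: "integrable M (\<lambda>om. indicator A om * indicator (D \<inter> C) om :: real)"
        using AM DM CM by (intro integrable_const_bound[where B=1]) (auto simp: indicator_def)
      have "AE om in M. \<bar>indicator A om * p om * indicator D om\<bar> \<le> 1"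
        using p01 by eventually_elim (auto simp: indicator_def)
      then have i2: "integrable M (\<lambda>om. (indicator A om * p om) * indicator D om :: real)"
        using AM DM by (intro integrable_const_bound[where B=1]) auto
      have AF: "(indicator A :: _ => real) \<in> borel_measurable F" using *(2) by simp
      have "(\<integral>om. indicator A om * indicator (D \<inter> C) om \<partial>M)
          = (\<integral>om. indicator A om * real_cond_exp M F (indicator (D \<inter> C)) om \<partial>M)"
        using Fs.real_cond_exp_intg(2)[OF i1 AF] DM CM by simp
      also have "\<dots> = (\<integral>om. (indicator A om * p om) * real_cond_exp M F (indicator D) om \<partial>M)"
        by (rule integral_cong_AE) (use split[OF D] AM in \<open>auto elim!: AE_mp\<close>)
      also have "\<dots> = (\<integral>om. (indicator A om * p om) * indicator D om \<partial>M)"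
        using Fs.real_cond_exp_intg(2)[OF i2] AF DM by simp
      finally have eq: "(\<integral>om. indicator A om * indicator (D \<inter> C) om \<partial>M) = (\<integral>om. (indicator A om * p om) * indicator D om \<partial>M)" .
      have "(\<integral>om. indicator D om * h om \<partial>M) = (\<integral>om. indicator A om * indicator (D \<inter> C) om - (indicator A om * p om) * indicator D om \<partial>M)"
        by (intro Bochner_Integration.integral_cong refl) (auto simp: h_def indicator_def)
      then show "(\<integral>om. indicator D om * h om \<partial>M) = 0" using i1 i2 eq by simp
    qed
    moreover have Xh: "integrable M (\<lambda>om. X om * h om)"
      by (rule Bochner_Integration.integrable_bound[OF X])
        (use X hb in \<open>auto elim!: AE_mp intro!: mult_left_le simp: abs_mult\<close>)
    ultimately have hX: "(\<integral>om. X om * h om \<partial>M) = 0"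
      by (rule centered_mult[OF block_alg(2)[OF k] _ Xm])
    have mX: "X \<in> borel_measurable M" using X by auto
    have bd: "AE om in M. \<bar>indicator A om * p om\<bar> \<le> 1" using p01 by eventually_elim (auto simp: indicator_def)
    have j1: "integrable M (\<lambda>om. (indicator A om * p om) * X om)"
      by (rule Bochner_Integration.integrable_bound[OF X])
        (use mX AM bd in \<open>auto elim!: AE_mp intro!: mult_left_le_one_le simp: abs_mult\<close>)
    have SM: "S \<in> sets M" using PM SP by blast
    have j2: "integrable M (\<lambda>om. indicator S om * X om)" "integrable M (\<lambda>om. indicator S om * real_cond_exp M F X om)"
      using integrable_mult_indicator[OF SM X] integrable_mult_indicator[OF SM intX] by simp_all
    have "(\<integral>om. indicator S om * X om \<partial>M) = (\<integral>om. X om * h om + (indicator A om * p om) * X om \<partial>M)"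
      by (intro Bochner_Integration.integral_cong refl) (auto simp: h_def SC indicator_def algebra_simps)
    also have "\<dots> = (\<integral>om. (indicator A om * p om) * X om \<partial>M)" using Xh j1 hX by simp
    also have "\<dots> = (\<integral>om. (indicator A om * p om) * real_cond_exp M F X om \<partial>M)"
      using Fs.real_cond_exp_intg(2)[OF j1] mX *(2) by simp
    also have "\<dots> = (\<integral>om. (indicator A om * real_cond_exp M F X om) * p om \<partial>M)" by (simp add: mult_ac)
    also have "\<dots> = (\<integral>om. (indicator A om * real_cond_exp M F X om) * indicator C om \<partial>M)"
    proof -
      have "integrable M (\<lambda>om. (indicator A om * real_cond_exp M F X om) * indicator C om)"
        using j2(2) by (rule Bochner_Integration.integrable_cong[THEN iffD1, rotated -1]) (auto simp: SC indicator_def)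
      from Fs.real_cond_exp_intg(2)[OF this] show ?thesis using *(2) CM by (simp add: p_def)
    qed
    also have "\<dots> = (\<integral>om. indicator S om * real_cond_exp M F X om \<partial>M)"
      by (intro Bochner_Integration.integral_cong refl) (auto simp: SC indicator_def)
    finally show ?thesis using j2 by (simp add: right_diff_distrib)
  qed
  have "centered M (sigma (space M) P) ?Y"
    using gen1[of "space M"] sets.top[of F] F_sets
    by (intro centered_generated stable PM Y zero) auto
  moreover have "sets (rest_algebra M F G I k) \<subseteq> sets (sigma (space M) P)"
  proof -
    have "P \<subseteq> Pow (space M)" using PM sets.sets_into_space by blast
    then have sP: "sets (sigma (space M) P) = sigma_sets (space M) P" by (rule sets_measure_of)
    show ?thesis unfolding sP sets_rest
      by (rule sigma_sets_mono) (use gen1 gen2 in auto)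
  qed
  ultimately show ?thesis by (rule centered_mono)
qed

text \<open>The regressors contain information about block \<open>k\<close> itself. This version adds a part \<open>C\<close> of the block to the
  conditioning algebra: localising \<open>X\<close> to a set of \<open>C\<close> keeps it in the block and centred given \<open>F\<close>,
  so the previous lemma applies to the localised variable.\<close>

lemma centered_rest_extend:
  assumes k: "k \<in> I" and Xm: "X \<in> borel_measurable (sigma (space M) (G k))"
    and X: "centered M XA X"
    and C: "Int_stable C" "C \<subseteq> G k" "space M \<in> C"
    and XA: "sets F \<subseteq> sets XA" "C \<subseteq> sets XA"
  shows "centered M (sigma (space M) (sets (rest_algebra M F G I k) \<union> C)) X"
proof -
  have intX: "integrable M X" using X by (simp add: centered_def)
  let ?R = "rest_algebra M F G I k"
  have RM: "sets ?R \<subseteq> sets M" using subalgebra_rest by (auto simp: subalgebra_def)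
  have CM: "C \<subseteq> sets M" using C G_sets[OF k] by blast
  define P where "P = {S \<inter> D | S D. S \<in> sets ?R \<and> D \<in> C}"
  have PM: "P \<subseteq> sets M" unfolding P_def using RM CM by auto
  have spR: "space M \<in> sets ?R" using sets.top[of ?R] by simp
  have stable: "Int_stable P"
  proof (rule Int_stableI)
    fix S S' assume "S \<in> P" "S' \<in> P"
    then obtain A D A' D' where *: "S = A \<inter> D" "S' = A' \<inter> D'" "A \<in> sets ?R" "A' \<in> sets ?R" "D \<in> C" "D' \<in> C"
      unfolding P_def by blast
    have "S \<inter> S' = (A \<inter> A') \<inter> (D \<inter> D')" unfolding * by blast
    moreover have "A \<inter> A' \<in> sets ?R" using * by auto
    moreover have "D \<inter> D' \<in> C" using C(1) * by (auto simp: Int_stable_def)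
    ultimately show "S \<inter> S' \<in> P" unfolding P_def by blast
  qed
  have zero: "(\<integral>om. indicator S om * X om \<partial>M) = 0" if SP: "S \<in> P" for S
  proof -
    obtain A D where *: "S = A \<inter> D" "A \<in> sets ?R" "D \<in> C" using SP unfolding P_def by blast
    have DM: "D \<in> sets M" using * CM by blast
    let ?Z = "\<lambda>om. indicator D om * X om"
    have intZ: "integrable M ?Z" using integrable_mult_indicator[OF DM intX] by simp
    have Zm: "?Z \<in> borel_measurable (sigma (space M) (G k))"
      using Xm * C(2) block_alg(1)[OF k] by (intro borel_measurable_times borel_measurable_indicator) auto
    have "centered M F ?Z"
      unfolding centered_def
    proof (intro conjI ballI intZ)
      fix B assume "B \<in> sets F"
      then have "B \<inter> D \<in> sets XA" using XA * by auto
      then have "(\<integral>om. indicator (B \<inter> D) om * X om \<partial>M) = 0" using X by (simp add: centered_def)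
      then show "(\<integral>om. indicator B om * ?Z om \<partial>M) = 0" by (simp add: indicator_inter_arith mult.assoc)
    qed
    then have "AE om in M. real_cond_exp M F ?Z om = 0" by (rule centered_cond_exp[OF subalg])
    then have "AE om in M. ?Z om - real_cond_exp M F ?Z om = ?Z om" by eventually_elim simp
    with centered_rest[OF k Zm intZ] intZ have "centered M ?R ?Z"
      by (intro centered_AE_cong[where Y="?Z" and X="\<lambda>om. ?Z om - real_cond_exp M F ?Z om"] subalgebra_rest) auto
    then have "(\<integral>om. indicator A om * ?Z om \<partial>M) = 0" using * by (simp add: centered_def)
    then show ?thesis by (simp add: * indicator_inter_arith mult.assoc)
  qed
  have "space M \<in> P" unfolding P_def using spR C(3) by blast
  then have "centered M (sigma (space M) P) X"
    by (intro centered_generated stable PM intX zero)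
  moreover have "sets (sigma (space M) (sets ?R \<union> C)) \<subseteq> sets (sigma (space M) P)"
  proof -
    have 1: "P \<subseteq> Pow (space M)" using PM sets.sets_into_space by blast
    have 2: "sets ?R \<union> C \<subseteq> Pow (space M)" using RM CM sets.sets_into_space[of _ M] by blast
    have "sets ?R \<union> C \<subseteq> P"
    proof
      fix S assume "S \<in> sets ?R \<union> C"
      then have "S = S \<inter> space M" "S = space M \<inter> S" using 2 by auto
      then show "S \<in> P" unfolding P_def using \<open>S \<in> sets ?R \<union> C\<close> spR C(3) by blast
    qed
    then show ?thesis unfolding sets_measure_of[OF 1] sets_measure_of[OF 2] by (intro sigma_sets_mono) auto
  qed
  ultimately show ?thesis by (rule centered_mono)
qed

end

lemma (in prob_space) cond_exp_eqI:
  assumes F: "subalgebra M F" and Y: "centered M F Y" and f: "f \<in> borel_measurable F" "integrable M f"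
    and X: "X \<in> borel_measurable M" "AE om in M. X om = Y om + f om"
  shows "AE om in M. real_cond_exp M F X om = f om"
proof -
  interpret S: sigma_finite_subalgebra M F by (rule sigma_finite_subalgebraI[OF F])
  have iY: "integrable M Y" using Y by (simp add: centered_def)
  have "AE om in M. real_cond_exp M F X om = real_cond_exp M F (\<lambda>om. Y om + f om) om"
    by (rule S.real_cond_exp_cong[OF X(2,1)]) (use iY f in auto)
  moreover have "AE om in M. real_cond_exp M F (\<lambda>om. Y om + f om) om = real_cond_exp M F Y om + real_cond_exp M F f om"
    by (rule S.real_cond_exp_add[OF iY f(2)])
  moreover have "AE om in M. real_cond_exp M F f om = f om" by (rule S.real_cond_exp_F_meas[OF f(2,1)])
  moreover have "AE om in M. real_cond_exp M F Y om = 0" by (rule centered_cond_exp[OF F Y])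
  ultimately show ?thesis by eventually_elim simp
qed

lemma (in prob_space) centered_sum:
  assumes "finite I" "\<And>i. i \<in> I ==> centered M F (X i)" and F: "subalgebra M F"
  shows "centered M F (\<lambda>om. \<Sum>i\<in>I. X i om)"
  unfolding centered_def
proof (intro conjI ballI)
  have int: "integrable M (X i)" if "i \<in> I" for i using assms(2)[OF that] by (simp add: centered_def)
  then show "integrable M (\<lambda>om. \<Sum>i\<in>I. X i om)" by (rule Bochner_Integration.integrable_sum)
  fix S assume S: "S \<in> sets F"
  then have SM: "S \<in> sets M" using F by (auto simp: subalgebra_def)
  have iS: "integrable M (\<lambda>om. indicator S om * X i om)" if "i \<in> I" for i
    using integrable_mult_indicator[OF SM int[OF that]] by simp
  show "(\<integral>om. indicator S om * (\<Sum>i\<in>I. X i om) \<partial>M) = 0"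
    unfolding sum_distrib_left using iS assms(2) S
    by (subst Bochner_Integration.integral_sum) (auto simp: centered_def)
qed

section \<open>Events of high probability\<close>

text \<open>Exceptional points need only be covered by a small measurable set, so events need not be measurable.\<close>

definition with_prob :: "'a measure => real => ('a => bool) => bool" where
  "with_prob M e P \<longleftrightarrow> (\<exists>S\<in>sets M. measure M S \<le> e \<and> {om \<in> space M. \<not> P om} \<subseteq> S)"

definition whp :: "(nat => 'a measure) => (nat => 'a => bool) => bool" where
  "whp M P \<longleftrightarrow> (\<forall>e>0. \<forall>\<^sub>F n in sequentially. with_prob (M n) e (P n))"

lemma with_prob_mono:
  "with_prob M e P ==> (\<And>om. om \<in> space M ==> P om ==> Q om) ==> e \<le> e' ==> with_prob M e' Q"
  unfolding with_prob_def by (force intro: order_trans)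

lemma (in prob_space) with_prob_conj:
  assumes "with_prob M e P" "with_prob M e' Q"
  shows "with_prob M (e + e') (\<lambda>om. P om \<and> Q om)"
proof -
  obtain S S' where S: "S \<in> sets M" "measure M S \<le> e" "{om \<in> space M. \<not> P om} \<subseteq> S"
    and S': "S' \<in> sets M" "measure M S' \<le> e'" "{om \<in> space M. \<not> Q om} \<subseteq> S'"
    using assms unfolding with_prob_def by blast
  have "measure M (S \<union> S') \<le> e + e'" using measure_Un_le[OF S(1) S'(1)] S S' by linarith
  then show ?thesis unfolding with_prob_def using S S' by (intro bexI[of _ "S \<union> S'"]) auto
qed

lemma (in prob_space) with_prob_AE: "AE om in M. P om ==> 0 \<le> e ==> with_prob M e P"
  unfolding with_prob_def by (elim AE_E) (rule bexI, auto simp: measure_def)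

lemma (in prob_space) with_prob_markov:
  assumes X: "integrable M X" "\<And>om. 0 \<le> X om" and m: "(\<integral>om. X om \<partial>M) \<le> m" and e: "0 < e"
  shows "with_prob M e (\<lambda>om. X om \<le> m / e)"
proof -
  have E0: "0 \<le> (\<integral>om. X om \<partial>M)" using X(2) by simp
  then have m0: "0 \<le> m" using m by linarith
  have Xm: "X \<in> borel_measurable M" using X by auto
  show ?thesis
  proof (cases "m = 0")
    case True
    have "(\<integral>om. X om \<partial>M) = 0" using m True E0 by simp
    then have "AE om in M. X om = 0" using integral_nonneg_eq_0_iff_AE[OF X(1)] X(2) by auto
    then have "AE om in M. X om \<le> m / e" by eventually_elim (simp add: True)
    then show ?thesis by (rule with_prob_AE) (use e in simp)
  next
    case False
    let ?S = "{om \<in> space M. m / e \<le> X om}"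
    have "measure M ?S \<le> (\<integral>om. X om \<partial>M) / (m / e)"
      using integral_Markov_inequality_measure[OF X(1), of "{}" "m / e"] X(2) e m0 False by simp
    also have "\<dots> \<le> m / (m / e)" using m e m0 by (intro divide_right_mono) auto
    also have "\<dots> = e" using False e by simp
    finally have "measure M ?S \<le> e" .
    moreover have "?S \<in> sets M" using Xm by simp
    ultimately show ?thesis unfolding with_prob_def by (intro bexI[of _ ?S]) auto
  qed
qed

lemma (in prob_space) with_prob_measure:
  assumes "{om \<in> space M. \<not> P om} \<in> sets M" "measure M {om \<in> space M. \<not> P om} \<le> e"
  shows "with_prob M e P"
  unfolding with_prob_def using assms by blast

lemma (in prob_space) expectation_diff_with_prob:
  fixes f g :: "'a => real"
  assumes [measurable]: "f \<in> borel_measurable M" "g \<in> borel_measurable M"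
    and f: "\<And>om. \<bar>f om\<bar> \<le> B" and g: "\<And>om. \<bar>g om\<bar> \<le> B"
    and wp: "with_prob M e (\<lambda>om. \<bar>f om - g om\<bar> \<le> d)" and d: "0 \<le> d"
  shows "\<bar>(\<integral>om. f om \<partial>M) - (\<integral>om. g om \<partial>M)\<bar> \<le> d + 2 * B * e"
proof -
  obtain S where S: "S \<in> sets M" "measure M S \<le> e" "{om \<in> space M. \<not> \<bar>f om - g om\<bar> \<le> d} \<subseteq> S"
    using wp unfolding with_prob_def by blast
  have B0: "0 \<le> B" using f[of undefined] by linarith
  have i: "integrable M f" "integrable M g"
    by (rule integrable_const_bound[where B=B], use f g in auto)+
  have iS: "integrable M (\<lambda>om. 2 * B * indicator S om)" using S by (simp add: emeasure_eq_measure)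
  have "\<bar>(\<integral>om. f om \<partial>M) - (\<integral>om. g om \<partial>M)\<bar> = \<bar>\<integral>om. f om - g om \<partial>M\<bar>" using i by simp
  also have "\<dots> \<le> (\<integral>om. \<bar>f om - g om\<bar> \<partial>M)" by (rule integral_abs_bound)
  also have "\<dots> \<le> (\<integral>om. d + 2 * B * indicator S om \<partial>M)"
  proof (rule integral_mono)
    fix om assume "om \<in> space M"
    then show "\<bar>f om - g om\<bar> \<le> d + 2 * B * indicator S om"
      using S(3) f[of om] g[of om] d by (cases "om \<in> S") auto
  qed (use i iS in auto)
  also have "\<dots> = d + 2 * B * measure M S" using iS S by (simp add: prob_space)
  also have "\<dots> \<le> d + 2 * B * e" using S B0 by (intro add_left_mono mult_left_mono) auto
  finally show ?thesis .
qed

lemma whp_mono: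
  assumes "whp M P" "\<forall>\<^sub>F n in sequentially. \<forall>om\<in>space (M n). P n om \<longrightarrow> Q n om"
  shows "whp M Q"
  unfolding whp_def
proof (intro allI impI)
  fix e :: real assume "0 < e"
  then have "\<forall>\<^sub>F n in sequentially. with_prob (M n) e (P n)" using assms(1) by (auto simp: whp_def)
  then show "\<forall>\<^sub>F n in sequentially. with_prob (M n) e (Q n)"
    using assms(2) by eventually_elim (auto intro: with_prob_mono)
qed

lemma whp_conj:
  assumes "\<And>n. prob_space (M n)" "whp M P" "whp M Q"
  shows "whp M (\<lambda>n om. P n om \<and> Q n om)"
  unfolding whp_def
proof (intro allI impI)
  fix e :: real assume "0 < e"
  then have "\<forall>\<^sub>F n in sequentially. with_prob (M n) (e / 2) (P n)" "\<forall>\<^sub>F n in sequentially. with_prob (M n) (e / 2) (Q n)"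
    using assms by (auto simp: whp_def)
  then show "\<forall>\<^sub>F n in sequentially. with_prob (M n) e (\<lambda>om. P n om \<and> Q n om)"
  proof eventually_elim
    case (elim n)
    then show ?case using prob_space.with_prob_conj[OF assms(1) elim] by simp
  qed
qed

lemma whp_second_moment:
  assumes prob: "\<And>n. prob_space (M n)"
    and X: "\<forall>\<^sub>F n in sequentially. integrable (M n) (\<lambda>om. (X n om)^2) \<and> (\<integral>om. (X n om)^2 \<partial>M n) \<le> m n"
    and m: "m \<longlonglongrightarrow> 0" and d: "0 < (d::real)"
  shows "whp M (\<lambda>n om. \<bar>X n om\<bar> \<le> d)"
  unfolding whp_def
proof (intro allI impI)
  fix e :: real assume e: "0 < e"
  have "\<forall>\<^sub>F n in sequentially. m n < d^2 * e" using order_tendstoD(2)[OF m, of "d^2 * e"] d e by simp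
  with X show "\<forall>\<^sub>F n in sequentially. with_prob (M n) e (\<lambda>om. \<bar>X n om\<bar> \<le> d)"
  proof eventually_elim
    case (elim n)
    interpret prob_space "M n" by (rule prob)
    have "with_prob (M n) e (\<lambda>om. (X n om)^2 \<le> (d^2 * e) / e)"
      by (rule with_prob_markov) (use elim e in auto)
    then show ?case
      by (rule with_prob_mono) (use e d in \<open>auto simp: abs_le_square_iff[symmetric]\<close>)
  qed
qed

lemma whp_product:
  assumes prob: "\<And>n. prob_space (M n)"
    and A: "\<forall>\<^sub>F n in sequentially. integrable (M n) (A n) \<and> (\<integral>om. A n om \<partial>M n) \<le> a n" "\<And>n om. 0 \<le> A n om"
    and B: "\<forall>\<^sub>F n in sequentially. integrable (M n) (B n) \<and> (\<integral>om. B n om \<partial>M n) \<le> b n" "\<And>n om. 0 \<le> B n om"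
    and ab: "(\<lambda>n. a n * b n) \<longlonglongrightarrow> 0" and d: "0 < (d::real)"
  shows "whp M (\<lambda>n om. A n om * B n om \<le> d)"
  unfolding whp_def
proof (intro allI impI)
  fix e :: real assume e: "0 < e"
  have "\<forall>\<^sub>F n in sequentially. a n * b n < d * (e / 2)^2" using order_tendstoD(2)[OF ab, of "d * (e / 2)^2"] d e by simp
  with A(1) B(1) show "\<forall>\<^sub>F n in sequentially. with_prob (M n) e (\<lambda>om. A n om * B n om \<le> d)"
  proof eventually_elim
    case (elim n)
    interpret prob_space "M n" by (rule prob)
    have 1: "with_prob (M n) (e / 2) (\<lambda>om. A n om \<le> a n / (e / 2))"
      by (rule with_prob_markov) (use elim e A(2) in auto)
    have 2: "with_prob (M n) (e / 2) (\<lambda>om. B n om \<le> b n / (e / 2))"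
      by (rule with_prob_markov) (use elim e B(2) in auto)
    show ?case
    proof (rule with_prob_mono[OF with_prob_conj[OF 1 2]])
      fix om assume *: "A n om \<le> a n / (e / 2) \<and> B n om \<le> b n / (e / 2)"
      have "A n om * B n om \<le> (a n / (e / 2)) * (b n / (e / 2))"
        using * A(2)[of n om] B(2)[of n om] by (intro mult_mono) (auto intro: order_trans)
      also have "\<dots> = (a n * b n) / (e / 2)^2" by (simp add: power2_eq_square)
      also have "\<dots> \<le> d" using elim(3) e by (subst pos_divide_le_eq) auto
      finally show "A n om * B n om \<le> d" .
    qed simp
  qed
qed

text \<open>Turns a statement of positive probability about nonrandom quantities into a certainty.\<close>

lemma (in prob_space) with_prob_witness:
  assumes "with_prob M e P" "e < 1" "AE om in M. Q om"
  obtains om where "om \<in> space M" "P om" "Q om"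
proof (rule ccontr)
  assume no: "\<not> thesis"
  have "with_prob M (e + 0) (\<lambda>om. P om \<and> Q om)" by (intro with_prob_conj with_prob_AE assms) simp
  then obtain S where S: "S \<in> sets M" "measure M S \<le> e" "{om \<in> space M. \<not> (P om \<and> Q om)} \<subseteq> S"
    unfolding with_prob_def by auto
  have "space M \<subseteq> S" using S(3) no that by blast
  then have "S = space M" using sets.sets_into_space[OF S(1)] by blast
  then show False using S(2) assms(2) prob_space by simp
qed

lemma whp_ball:
  assumes prob: "\<And>n. prob_space (M n)" and I: "finite I" and P: "\<And>i. i \<in> I ==> whp M (P i)"
  shows "whp M (\<lambda>n om. \<forall>i\<in>I. P i n om)"
  using I P
proof (induction I rule: finite_induct)
  case empty
  show ?case unfolding whp_def
  proof (intro allI impI always_eventually)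
    fix e :: real and n assume "0 < e"
    then show "with_prob (M n) e (\<lambda>om. \<forall>i\<in>{}. P i n om)" by (intro prob_space.with_prob_AE[OF prob]) auto
  qed
next
  case (insert i I)
  have "whp M (P i)" "whp M (\<lambda>n om. \<forall>i\<in>I. P i n om)" using insert by simp_all
  from whp_conj[OF prob this] show ?case by simp
qed

section \<open>Linear and quadratic forms in block-dependent errors\<close>

lemma integrable_dominated:
  fixes f g :: "'a => real"
  assumes "integrable M g" "f \<in> borel_measurable M" "AE om in M. \<bar>f om\<bar> \<le> g om"
  shows "integrable M f"
  by (rule Bochner_Integration.integrable_bound[OF assms(1,2)]) (use assms(3) in \<open>eventually_elim, simp\<close>)


lemma integrable_product_squares:
  fixes X Y :: "'a => real"
  assumes [measurable]: "X \<in> borel_measurable M" "Y \<in> borel_measurable M"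
    and "integrable M (\<lambda>om. (X om)^2)" "integrable M (\<lambda>om. (Y om)^2)"
  shows "integrable M (\<lambda>om. X om * Y om)"
proof (rule Bochner_Integration.integrable_bound)
  show "integrable M (\<lambda>om. (X om)^2 + (Y om)^2)" using assms by simp
  show "AE om in M. norm (X om * Y om) \<le> norm ((X om)^2 + (Y om)^2)"
  proof (rule AE_I2)
    fix om
    have "2 * \<bar>X om\<bar> * \<bar>Y om\<bar> \<le> \<bar>X om\<bar>^2 + \<bar>Y om\<bar>^2" by (rule sum_squares_bound)
    moreover have "0 \<le> \<bar>X om\<bar> * \<bar>Y om\<bar>" by simp
    ultimately have "\<bar>X om\<bar> * \<bar>Y om\<bar> \<le> (X om)^2 + (Y om)^2" unfolding power2_abs by linarith
    then show "norm (X om * Y om) \<le> norm ((X om)^2 + (Y om)^2)" by (simp add: abs_mult)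
  qed
qed simp

text \<open>Only pairs related by \<open>rel\<close> contribute to the second moment of the sum, and each such product
  is at most the average of two squares.\<close>

lemma orthogonal_sum_bound:
  fixes Y :: "'p => 'a => real"
  assumes P: "finite P" and Ym [measurable]: "\<And>p. p \<in> P ==> Y p \<in> borel_measurable M"
    and Y2: "\<And>p. p \<in> P ==> integrable M (\<lambda>om. (Y p om)^2)"
    and sym: "\<And>p q. rel p q ==> rel q p"
    and card: "\<And>p. p \<in> P ==> card {q \<in> P. rel p q} \<le> c"
    and orth: "\<And>p q. p \<in> P ==> q \<in> P ==> \<not> rel p q ==> (\<integral>om. Y p om * Y q om \<partial>M) = 0"
  shows "integrable M (\<lambda>om. (\<Sum>p\<in>P. Y p om)^2)" (is ?g1)
    and "(\<integral>om. (\<Sum>p\<in>P. Y p om)^2 \<partial>M) \<le> real c * (\<Sum>p\<in>P. \<integral>om. (Y p om)^2 \<partial>M)" (is ?g2)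
proof -
  have sq: "(\<Sum>p\<in>P. Y p om)^2 = (\<Sum>p\<in>P. \<Sum>q\<in>P. Y p om * Y q om)" for om
    by (simp add: power2_eq_square sum_product)
  have int: "integrable M (\<lambda>om. Y p om * Y q om)" if "p \<in> P" "q \<in> P" for p q
    by (rule integrable_product_squares[OF Ym Ym Y2 Y2]) (use that in auto)
  show ?g1 unfolding sq using int by auto
  define e where "e p = (\<integral>om. (Y p om)^2 \<partial>M)" for p
  have e0: "0 \<le> e p" for p by (simp add: e_def)
  have pq: "(\<integral>om. Y p om * Y q om \<partial>M) \<le> (if rel p q then (e p + e q) / 2 else 0)" if "p \<in> P" "q \<in> P" for p q
  proof (cases "rel p q")
    case True
    have "(\<integral>om. Y p om * Y q om \<partial>M) \<le> (\<integral>om. ((Y p om)^2 + (Y q om)^2) / 2 \<partial>M)"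
    proof (rule integral_mono)
      show "integrable M (\<lambda>om. ((Y p om)^2 + (Y q om)^2) / 2)" using Y2 that by simp
      fix om show "Y p om * Y q om \<le> ((Y p om)^2 + (Y q om)^2) / 2"
        using sum_squares_bound[of "Y p om" "Y q om"] by simp
    qed (rule int[OF that])
    then show ?thesis using True Y2 that by (simp add: e_def)
  qed (use orth that in simp)
  have "(\<integral>om. (\<Sum>p\<in>P. Y p om)^2 \<partial>M) = (\<Sum>p\<in>P. \<Sum>q\<in>P. \<integral>om. Y p om * Y q om \<partial>M)"
    unfolding sq using int by (simp add: Bochner_Integration.integral_sum)
  also have "\<dots> \<le> (\<Sum>p\<in>P. \<Sum>q\<in>P. if rel p q then (e p + e q) / 2 else 0)"
    by (intro sum_mono pq)
  also have "\<dots> = (\<Sum>p\<in>P. \<Sum>q\<in>P. if rel p q then e p / 2 else 0) + (\<Sum>p\<in>P. \<Sum>q\<in>P. if rel p q then e q / 2 else 0)"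
    unfolding sum.distrib[symmetric] by (intro sum.cong refl) (simp add: add_divide_distrib)
  also have "(\<Sum>p\<in>P. \<Sum>q\<in>P. if rel p q then e q / 2 else 0) = (\<Sum>p\<in>P. \<Sum>q\<in>P. if rel p q then e p / 2 else 0)"
    by (subst sum.swap) (intro sum.cong refl if_cong, use sym in blast)
  also have "(\<Sum>p\<in>P. \<Sum>q\<in>P. if rel p q then e p / 2 else 0) = (\<Sum>p\<in>P. real (card {q \<in> P. rel p q}) * (e p / 2))"
    using P by (intro sum.cong refl) (simp add: sum.If_cases Int_def)
  also have "\<dots> + \<dots> \<le> (\<Sum>p\<in>P. real c * (e p / 2)) + (\<Sum>p\<in>P. real c * (e p / 2))"
    using card e0 by (intro add_mono sum_mono mult_right_mono) auto
  also have "\<dots> = real c * (\<Sum>p\<in>P. e p)" by (simp add: sum_distrib_left flip: sum.distrib)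
  finally show ?g2 by (simp add: e_def)
qed

text \<open>The weight \<open>a\<close> is known to the conditioning algebra and vanishes where the conditional mean of \<open>X\<close> exceeds \<open>B\<close>.
  This is how moment bounds that hold only with high probability enter expectations.\<close>

lemma (in prob_space) integral_cond_moment_bound:
  fixes a X :: "'a => real"
  assumes sub: "subalgebra M F" and a: "a \<in> borel_measurable F" "\<And>om. 0 \<le> a om" "integrable M a"
    and X [measurable]: "X \<in> borel_measurable M" and X0: "\<And>om. 0 \<le> X om"
    and bd: "AE om in M. a om \<noteq> 0 \<longrightarrow> nn_cond_exp M F (\<lambda>om. ennreal (X om)) om \<le> ennreal B" and B: "0 \<le> B"
  shows "integrable M (\<lambda>om. a om * X om)" (is ?g1) "(\<integral>om. a om * X om \<partial>M) \<le> B * (\<integral>om. a om \<partial>M)" (is ?g2)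
proof -
  interpret sigma_finite_subalgebra M F by (rule sigma_finite_subalgebraI[OF sub])
  have aM [measurable]: "a \<in> borel_measurable M" using a by auto
  have "(\<integral>\<^sup>+ om. ennreal (a om * X om) \<partial>M) = (\<integral>\<^sup>+ om. ennreal (a om) * ennreal (X om) \<partial>M)"
    using a X0 by (simp add: ennreal_mult)
  also have "\<dots> = (\<integral>\<^sup>+ om. ennreal (a om) * nn_cond_exp M F (\<lambda>om. ennreal (X om)) om \<partial>M)"
    by (rule nn_cond_exp_intg[symmetric]) (use a in auto)
  also have "\<dots> \<le> (\<integral>\<^sup>+ om. ennreal (a om) * ennreal B \<partial>M)"
  proof (rule nn_integral_mono_AE)
    show "AE om in M. ennreal (a om) * nn_cond_exp M F (\<lambda>om. ennreal (X om)) om \<le> ennreal (a om) * ennreal B"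
      using bd
    proof eventually_elim
      case (elim om)
      then show ?case by (cases "a om = 0") (auto intro: mult_left_mono)
    qed
  qed
  also have "\<dots> = ennreal (B * (\<integral>om. a om \<partial>M))"
    using a B by (subst nn_integral_multc) (auto simp: nn_integral_eq_integral ennreal_mult mult.commute)
  finally have *: "(\<integral>\<^sup>+ om. ennreal (a om * X om) \<partial>M) \<le> ennreal (B * (\<integral>om. a om \<partial>M))" .
  have nn: "0 \<le> a om * X om" for om using a X0 by simp
  show int: ?g1
    by (rule integrableI_nonneg) (use nn * in \<open>auto intro: le_less_trans\<close>)
  have "0 \<le> B * (\<integral>om. a om \<partial>M)" using a B by simp
  then show ?g2
    using * nn_integral_eq_integral[OF int] nn by (simp add: ennreal_le_iff)
qed

lemma square_le_fourth: "(c :: real)^2 \<le> 1 + c ^ 4"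
proof -
  have "2 * c^2 \<le> 1 + (c^2)^2" using sum_squares_bound[of 1 "c^2"] by simp
  moreover have "(c^2)^2 = c ^ 4" by (simp flip: power_mult)
  moreover have "0 \<le> c^2" by simp
  ultimately show ?thesis by linarith
qed

lemma abs_mult_le_fourth: "\<bar>a * b\<bar> \<le> 1 + a ^ 4 + (b :: real) ^ 4"
proof -
  have "2 * (\<bar>a\<bar> * \<bar>b\<bar>) \<le> a^2 + b^2" using sum_squares_bound[of "\<bar>a\<bar>" "\<bar>b\<bar>"] by simp
  then have "2 * (\<bar>a\<bar> * \<bar>b\<bar>) \<le> 2 + a ^ 4 + b ^ 4" using square_le_fourth[of a] square_le_fourth[of b] by simp
  moreover have "0 \<le> a ^ 4" "0 \<le> b ^ 4" by simp_all
  ultimately show ?thesis unfolding abs_mult by linarith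
qed

lemma abs_cube_le_fourth: "\<bar>c :: real\<bar> ^ 3 \<le> 1 + c ^ 4"
proof (cases "\<bar>c\<bar> \<le> 1")
  case True
  then have "\<bar>c\<bar> ^ 3 \<le> 1" by (simp add: power_le_one)
  moreover have "0 \<le> c ^ 4" by simp
  ultimately show ?thesis by linarith
next
  case False
  then have "\<bar>c\<bar> ^ 3 \<le> \<bar>c\<bar> ^ 4" by (intro power_increasing) auto
  then show ?thesis by (simp add: power_even_abs)
qed

context prob_space
begin

lemma cond_exp_square:
  assumes F: "subalgebra M F" and Xm: "X \<in> borel_measurable M" and X2: "integrable M (\<lambda>om. (X om)^2)"
  shows "integrable M X" "integrable M (\<lambda>om. (real_cond_exp M F X om)^2)" (is ?g1)
    "(\<integral>om. (real_cond_exp M F X om)^2 \<partial>M) \<le> (\<integral>om. (X om)^2 \<partial>M)" (is ?g2)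
    "(\<integral>om. (X om - real_cond_exp M F X om)^2 \<partial>M) = (\<integral>om. (X om)^2 \<partial>M) - (\<integral>om. (real_cond_exp M F X om)^2 \<partial>M)" (is ?g3)
    "integrable M (\<lambda>om. (X om - real_cond_exp M F X om)^2)" (is ?g4)
proof -
  interpret sigma_finite_subalgebra M F by (rule sigma_finite_subalgebraI[OF F])
  show X: "integrable M X" by (rule square_integrable_imp_integrable[OF Xm X2])
  have cv: "convex_on UNIV (\<lambda>x::real. x^2)" by (rule convex_power_even) simp
  show E2: ?g1
    by (rule integrable_convex_cond_exp[OF X, where I=UNIV]) (use X2 cv in auto)
  have XE: "integrable M (\<lambda>om. real_cond_exp M F X om * X om)"
    by (rule integrable_product_squares[OF _ Xm E2 X2]) simp
  have eq: "(\<integral>om. real_cond_exp M F X om * X om \<partial>M) = (\<integral>om. (real_cond_exp M F X om)^2 \<partial>M)"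
    using real_cond_exp_intg(2)[OF XE _ Xm] by (simp add: power2_eq_square)
  have expand: "(X om - real_cond_exp M F X om)^2 = (X om)^2 - 2 * (real_cond_exp M F X om * X om) + (real_cond_exp M F X om)^2" for om
    by (simp add: power2_eq_square algebra_simps)
  show ?g4 unfolding expand using X2 XE E2 by simp
  show d: ?g3
    unfolding expand using X2 XE E2 eq by simp
  have "0 \<le> (\<integral>om. (X om - real_cond_exp M F X om)^2 \<partial>M)" by simp
  then show ?g2 using d by simp
qed

text \<open>The pointwise bound \<open>|X Y| \<le> 1 + X^4 + Y^4\<close> passes to conditional expectations.\<close>

lemma cond_exp_product_bound:
  assumes F: "subalgebra M F" and Xm [measurable]: "X \<in> borel_measurable M" and Ym [measurable]: "Y \<in> borel_measurable M"
    and B: "0 \<le> B"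
  shows "AE om in M. nn_cond_exp M F (\<lambda>om. ennreal (X om ^ 4)) om \<le> ennreal B \<longrightarrow>
    nn_cond_exp M F (\<lambda>om. ennreal (Y om ^ 4)) om \<le> ennreal B \<longrightarrow>
    \<bar>real_cond_exp M F (\<lambda>om. X om * Y om) om\<bar> \<le> 1 + 2 * B"
proof -
  interpret sigma_finite_subalgebra M F by (rule sigma_finite_subalgebraI[OF F])
  have a: "AE om in M. ennreal \<bar>real_cond_exp M F (\<lambda>om. X om * Y om) om\<bar> \<le> nn_cond_exp M F (\<lambda>om. ennreal \<bar>X om * Y om\<bar>) om"
    by (rule real_cond_exp_abs) simp
  have b: "AE om in M. nn_cond_exp M F (\<lambda>om. ennreal \<bar>X om * Y om\<bar>) om \<le> nn_cond_exp M F (\<lambda>om. (1 + ennreal (X om ^ 4)) + ennreal (Y om ^ 4)) om"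
  proof (rule nn_cond_exp_mono)
    have "ennreal \<bar>X om * Y om\<bar> \<le> (1 + ennreal (X om ^ 4)) + ennreal (Y om ^ 4)" for om
    proof -
      have "ennreal \<bar>X om * Y om\<bar> \<le> ennreal (1 + X om ^ 4 + Y om ^ 4)" by (intro ennreal_leI abs_mult_le_fourth)
      also have "ennreal (1 + X om ^ 4 + Y om ^ 4) = ennreal (1 + X om ^ 4) + ennreal (Y om ^ 4)"
        by (intro ennreal_plus) auto
      also have "ennreal (1 + X om ^ 4) = ennreal 1 + ennreal (X om ^ 4)" by (intro ennreal_plus) auto
      also have "ennreal 1 = 1" by simp
      finally show ?thesis .
    qed
    then show "AE om in M. ennreal \<bar>X om * Y om\<bar> \<le> (1 + ennreal (X om ^ 4)) + ennreal (Y om ^ 4)" by simp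
  qed simp_all
  have c: "AE om in M. nn_cond_exp M F (\<lambda>om. 1 + ennreal (X om ^ 4)) om + nn_cond_exp M F (\<lambda>om. ennreal (Y om ^ 4)) om
      = nn_cond_exp M F (\<lambda>om. (1 + ennreal (X om ^ 4)) + ennreal (Y om ^ 4)) om"
    by (rule nn_cond_exp_sum) simp_all
  have d: "AE om in M. nn_cond_exp M F (\<lambda>om. 1) om + nn_cond_exp M F (\<lambda>om. ennreal (X om ^ 4)) om = nn_cond_exp M F (\<lambda>om. 1 + ennreal (X om ^ 4)) om"
    by (rule nn_cond_exp_sum) simp_all
  have e: "AE om in M. 1 = nn_cond_exp M F (\<lambda>om. 1) om"
    by (rule nn_cond_exp_F_meas) simp
  from a b c d e show ?thesis
  proof eventually_elim
    case (elim om)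
    show ?case
    proof (intro impI)
      assume 1: "nn_cond_exp M F (\<lambda>om. ennreal (X om ^ 4)) om \<le> ennreal B" and 2: "nn_cond_exp M F (\<lambda>om. ennreal (Y om ^ 4)) om \<le> ennreal B"
      have "ennreal \<bar>real_cond_exp M F (\<lambda>om. X om * Y om) om\<bar> \<le> nn_cond_exp M F (\<lambda>om. (1 + ennreal (X om ^ 4)) + ennreal (Y om ^ 4)) om"
        by (rule order_trans[OF elim(1,2)])
      also have "\<dots> = (1 + nn_cond_exp M F (\<lambda>om. ennreal (X om ^ 4)) om) + nn_cond_exp M F (\<lambda>om. ennreal (Y om ^ 4)) om"
        unfolding elim(3)[symmetric] elim(4)[symmetric] elim(5)[symmetric] ..
      also have "\<dots> \<le> (1 + ennreal B) + ennreal B" using 1 2 by (intro add_mono) auto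
      also have "\<dots> = ennreal (1 + B + B)"
      proof -
        have "ennreal (1 + B + B) = ennreal (1 + B) + ennreal B" "ennreal (1 + B) = ennreal 1 + ennreal B"
          using B by (intro ennreal_plus; simp)+
        then show ?thesis by simp
      qed
      finally have "\<bar>real_cond_exp M F (\<lambda>om. X om * Y om) om\<bar> \<le> 1 + B + B"
        using ennreal_le_iff[of "1 + B + B"] B by simp
      then show "\<bar>real_cond_exp M F (\<lambda>om. X om * Y om) om\<bar> \<le> 1 + 2 * B" by simp
    qed
  qed
qed

end

text \<open>\<open>g t\<close> is the block of the observation \<open>t\<close>, and \<open>H k\<close> holds the information available outside block \<open>k\<close>.\<close>

locale block_filtration = prob_space M for M :: "'a measure" +
  fixes F :: "'a measure" and H :: "'i => 'a measure" and J :: "nat set" and g :: "nat => 'i" and c :: nat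
  assumes subF: "subalgebra M F" and subH: "\<And>t. t \<in> J ==> subalgebra M (H (g t))"
    and FH: "\<And>t. t \<in> J ==> subalgebra (H (g t)) F"
    and finO: "finite J" and block_size: "\<And>t. t \<in> J ==> card {s \<in> J. g s = g t} \<le> c"
begin

lemma F_imp_H: "t \<in> J ==> a \<in> borel_measurable F ==> a \<in> borel_measurable (H (g t))"
  by (rule measurable_from_subalg[OF FH])

lemma F_imp_M: "a \<in> borel_measurable F ==> a \<in> borel_measurable M"
  by (rule measurable_from_subalg[OF subF])

text \<open>Terms from different blocks are orthogonal, because one of them is known to the algebra given which
  the other is centred; a term therefore correlates with at most \<open>c\<close> others.\<close>

lemma linear_form_moment_bound:
  fixes a \<xi> :: "nat => 'a => real"
  assumes cen: "\<And>t. t \<in> J ==> centered M (H (g t)) (\<xi> t)"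
    and meas: "\<And>s t. s \<in> J ==> t \<in> J ==> g s \<noteq> g t ==> \<xi> s \<in> borel_measurable (H (g t))"
    and a: "\<And>t. t \<in> J ==> a t \<in> borel_measurable F" and a2: "\<And>t. t \<in> J ==> integrable M (\<lambda>om. (a t om)^2)"
    and mom: "\<And>t. t \<in> J ==> AE om in M. a t om \<noteq> 0 \<longrightarrow> nn_cond_exp M F (\<lambda>om. ennreal (\<xi> t om ^ 4)) om \<le> ennreal B"
    and B: "0 \<le> B"
  shows "integrable M (\<lambda>om. (\<Sum>t\<in>J. a t om * \<xi> t om)^2)" (is ?g1)
    and "(\<integral>om. (\<Sum>t\<in>J. a t om * \<xi> t om)^2 \<partial>M) \<le> real c * (1 + B) * (\<Sum>t\<in>J. \<integral>om. (a t om)^2 \<partial>M)" (is ?g2)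
proof -
  have \<xi>M: "\<xi> t \<in> borel_measurable M" if "t \<in> J" for t using cen[OF that] by (auto simp: centered_def)
  have *: "integrable M (\<lambda>om. (a t om * \<xi> t om)^2) \<and> (\<integral>om. (a t om * \<xi> t om)^2 \<partial>M) \<le> (1 + B) * (\<integral>om. (a t om)^2 \<partial>M)" if t: "t \<in> J" for t
  proof -
    have m4: "(\<lambda>om. \<xi> t om ^ 4) \<in> borel_measurable M" using \<xi>M[OF t] by simp
    have aF: "(\<lambda>om. (a t om)^2) \<in> borel_measurable F" using a[OF t] by simp
    have md: "AE om in M. (a t om)^2 \<noteq> 0 \<longrightarrow> nn_cond_exp M F (\<lambda>om. ennreal (\<xi> t om ^ 4)) om \<le> ennreal B" using mom[OF t] by simp
    note mb = integral_cond_moment_bound[OF subF aF _ a2[OF t] m4 _ md B]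
    have mb1: "integrable M (\<lambda>om. (a t om)^2 * \<xi> t om ^ 4)" by (rule mb(1)) auto
    have mb2: "(\<integral>om. (a t om)^2 * \<xi> t om ^ 4 \<partial>M) \<le> B * (\<integral>om. (a t om)^2 \<partial>M)" by (rule mb(2)) auto
    have le: "(a t om * \<xi> t om)^2 \<le> (a t om)^2 + (a t om)^2 * \<xi> t om ^ 4" for om
    proof -
      have "(a t om * \<xi> t om)^2 = (a t om)^2 * (\<xi> t om)^2" by (simp add: power_mult_distrib)
      also have "\<dots> \<le> (a t om)^2 * (1 + \<xi> t om ^ 4)" by (intro mult_left_mono square_le_fourth) simp
      finally show ?thesis by (simp add: distrib_left)
    qed
    have dom: "integrable M (\<lambda>om. (a t om)^2 + (a t om)^2 * \<xi> t om ^ 4)" using a2[OF t] mb1 by simp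
    have int: "integrable M (\<lambda>om. (a t om * \<xi> t om)^2)"
      by (rule integrable_dominated[OF dom]) (use F_imp_M[OF a[OF t]] \<xi>M[OF t] le in auto)
    have "(\<integral>om. (a t om * \<xi> t om)^2 \<partial>M) \<le> (\<integral>om. (a t om)^2 + (a t om)^2 * \<xi> t om ^ 4 \<partial>M)"
      by (rule integral_mono[OF int dom le])
    also have "\<dots> \<le> (1 + B) * (\<integral>om. (a t om)^2 \<partial>M)" using a2[OF t] mb1 mb2 by (simp add: algebra_simps)
    finally show ?thesis using int by blast
  qed
  have int: "integrable M (\<lambda>om. (a t om * \<xi> t om)^2)" if "t \<in> J" for t using * that by blast
  have Ym: "(\<lambda>om. a t om * \<xi> t om) \<in> borel_measurable M" if "t \<in> J" for t
    using \<xi>M[OF that] F_imp_M[OF a[OF that]] by simp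
  have orth: "(\<integral>om. (a t om * \<xi> t om) * (a s om * \<xi> s om) \<partial>M) = 0" if t: "t \<in> J" and s: "s \<in> J" and ts: "\<not> g t = g s" for t s
  proof -
    have i: "integrable M (\<lambda>om. (a t om * \<xi> t om) * (a s om * \<xi> s om))"
      by (rule integrable_product_squares[OF Ym[OF t] Ym[OF s] int[OF t] int[OF s]])
    have eq: "(\<lambda>om. (a t om * \<xi> t om) * (a s om * \<xi> s om)) = (\<lambda>om. (a t om * (a s om * \<xi> s om)) * \<xi> t om)"
      by (simp add: mult_ac)
    have m: "(\<lambda>om. a t om * (a s om * \<xi> s om)) \<in> borel_measurable (H (g t))"
      using F_imp_H[OF t a[OF t]] F_imp_H[OF t a[OF s]] meas[OF s t] ts by auto
    show ?thesis using centered_mult[OF subH[OF t] cen[OF t] m] i unfolding eq by blast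
  qed
  note B = orthogonal_sum_bound[where P=J and Y="\<lambda>t om. a t om * \<xi> t om" and rel="\<lambda>t s. g t = g s" and c=c and M=M]
  have card: "card {s \<in> J. g t = g s} \<le> c" if "t \<in> J" for t using block_size[OF that] by (simp add: eq_commute)
  show ?g1
    by (rule B(1)[OF finO Ym int _ card orth]) auto
  have "(\<integral>om. (\<Sum>t\<in>J. a t om * \<xi> t om)^2 \<partial>M) \<le> real c * (\<Sum>t\<in>J. \<integral>om. (a t om * \<xi> t om)^2 \<partial>M)"
    by (rule B(2)[OF finO Ym int _ card orth]) auto
  also have "\<dots> \<le> real c * (\<Sum>t\<in>J. (1 + B) * (\<integral>om. (a t om)^2 \<partial>M))"
    by (intro mult_left_mono sum_mono) (use * in auto)
  finally show ?g2
    by (simp add: sum_distrib_left mult.assoc)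
qed

text \<open>Two products of errors are orthogonal unless they involve the same pair of blocks: otherwise one
  error lies in a block absent from the other product and is centred given everything else. Products within a
  block are centred by subtraction of their conditional mean \<open>b\<close>. At most \<open>2 c^2\<close> products share a pair of blocks.\<close>

lemma quadratic_form_moment_bound:
  fixes m z :: "nat \<times> nat => 'a => real" and \<xi> \<eta> :: "nat => 'a => real"
  assumes cen\<xi>: "\<And>t. t \<in> J ==> centered M (H (g t)) (\<xi> t)" and cen\<eta>: "\<And>t. t \<in> J ==> centered M (H (g t)) (\<eta> t)"
    and meas\<xi>: "\<And>s t. s \<in> J ==> t \<in> J ==> g s \<noteq> g t ==> \<xi> s \<in> borel_measurable (H (g t))"
    and meas\<eta>: "\<And>s t. s \<in> J ==> t \<in> J ==> g s \<noteq> g t ==> \<eta> s \<in> borel_measurable (H (g t))"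
    and m: "\<And>p. p \<in> J \<times> J ==> m p \<in> borel_measurable F"
    and b: "\<And>p. p \<in> J \<times> J ==> b p \<in> borel_measurable F"
    and z: "\<And>s t om. s \<in> J ==> t \<in> J ==> z (s, t) om = \<xi> s om * \<eta> t om - (if g s = g t then b (s, t) om else 0)"
    and cenz: "\<And>s t. s \<in> J ==> t \<in> J ==> g s = g t ==> centered M (H (g t)) (z (s, t))"
    and m2: "\<And>p. p \<in> J \<times> J ==> integrable M (\<lambda>om. (m p om)^2)"
    and mom\<xi>: "\<And>s t. s \<in> J ==> t \<in> J ==> AE om in M. m (s, t) om \<noteq> 0 \<longrightarrow> nn_cond_exp M F (\<lambda>om. ennreal (\<xi> s om ^ 4)) om \<le> ennreal B"
    and mom\<eta>: "\<And>s t. s \<in> J ==> t \<in> J ==> AE om in M. m (s, t) om \<noteq> 0 \<longrightarrow> nn_cond_exp M F (\<lambda>om. ennreal (\<eta> t om ^ 4)) om \<le> ennreal B"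
    and bd: "\<And>p. p \<in> J \<times> J ==> AE om in M. m p om \<noteq> 0 \<longrightarrow> \<bar>b p om\<bar> \<le> D"
    and B: "0 \<le> B"
  shows "integrable M (\<lambda>om. (\<Sum>p\<in>J \<times> J. m p om * z p om)^2)" (is ?g1)
    and "(\<integral>om. (\<Sum>p\<in>J \<times> J. m p om * z p om)^2 \<partial>M) \<le> real (2 * c^2) * (2 * B + 2 * D^2) * (\<Sum>p\<in>J \<times> J. \<integral>om. (m p om)^2 \<partial>M)" (is ?g2)
proof -
  have *: "integrable M (\<lambda>om. (m p om * z p om)^2) \<and> (\<integral>om. (m p om * z p om)^2 \<partial>M) \<le> (2 * B + 2 * D^2) * (\<integral>om. (m p om)^2 \<partial>M)" if p: "p \<in> J \<times> J" for p
  proof -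
    obtain s t where st: "p = (s, t)" "s \<in> J" "t \<in> J" using p by blast
    have \<xi>M: "\<xi> s \<in> borel_measurable M" "\<eta> t \<in> borel_measurable M"
      using cen\<xi>[OF st(2)] cen\<eta>[OF st(3)] by (auto simp: centered_def)
    have zf: "z p = (\<lambda>om. \<xi> s om * \<eta> t om - (if g s = g t then b p om else 0))"
      using z[OF st(2,3)] st(1) by blast
    have mM: "m p \<in> borel_measurable M" and bM: "b p \<in> borel_measurable M" using F_imp_M m[OF p] b[OF p] by auto
    have zM: "z p \<in> borel_measurable M" unfolding zf using \<xi>M bM by simp
    have mF: "(\<lambda>om. (m p om)^2) \<in> borel_measurable F" using m[OF p] by simp
    have md: "AE om in M. (m p om)^2 \<noteq> 0 \<longrightarrow> nn_cond_exp M F (\<lambda>om. ennreal (\<xi> s om ^ 4)) om \<le> ennreal B"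
      "AE om in M. (m p om)^2 \<noteq> 0 \<longrightarrow> nn_cond_exp M F (\<lambda>om. ennreal (\<eta> t om ^ 4)) om \<le> ennreal B"
      using mom\<xi>[OF st(2,3)] mom\<eta>[OF st(2,3)] st(1) by simp_all
    have m4: "(\<lambda>om. \<xi> s om ^ 4) \<in> borel_measurable M" "(\<lambda>om. \<eta> t om ^ 4) \<in> borel_measurable M" using \<xi>M by simp_all
    note mb = integral_cond_moment_bound[OF subF mF _ m2[OF p] m4(1) _ md(1) B]
    note nb = integral_cond_moment_bound[OF subF mF _ m2[OF p] m4(2) _ md(2) B]
    have mb1: "integrable M (\<lambda>om. (m p om)^2 * \<xi> s om ^ 4)" by (rule mb(1)) auto
    have mb2: "(\<integral>om. (m p om)^2 * \<xi> s om ^ 4 \<partial>M) \<le> B * (\<integral>om. (m p om)^2 \<partial>M)" by (rule mb(2)) auto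
    have nb1: "integrable M (\<lambda>om. (m p om)^2 * \<eta> t om ^ 4)" by (rule nb(1)) auto
    have nb2: "(\<integral>om. (m p om)^2 * \<eta> t om ^ 4 \<partial>M) \<le> B * (\<integral>om. (m p om)^2 \<partial>M)" by (rule nb(2)) auto
    let ?d = "\<lambda>om. (m p om)^2 * \<xi> s om ^ 4 + (m p om)^2 * \<eta> t om ^ 4 + 2 * D^2 * (m p om)^2"
    have le: "AE om in M. (m p om * z p om)^2 \<le> ?d om"
      using bd[OF p]
    proof eventually_elim
      case (elim om)
      show ?case
      proof (cases "m p om = 0")
        case False
        let ?b = "if g s = g t then b p om else 0"
        have bD: "\<bar>b p om\<bar> \<le> D" using elim False by simp
        then have "0 \<le> D" by linarith
        then have "\<bar>?b\<bar> \<le> \<bar>D\<bar>" using bD by simp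
        then have "?b^2 \<le> D^2" by (simp only: abs_le_square_iff)
        have "(z p om)^2 \<le> 2 * (\<xi> s om * \<eta> t om)^2 + 2 * ?b^2"
        proof -
          have "0 \<le> (\<xi> s om * \<eta> t om + ?b)^2" by simp
          then show ?thesis unfolding zf by (simp only: power2_sum power2_diff)
        qed
        also have "2 * (\<xi> s om * \<eta> t om)^2 \<le> \<xi> s om ^ 4 + \<eta> t om ^ 4"
          using sum_squares_bound[of "(\<xi> s om)^2" "(\<eta> t om)^2"] by (simp add: power_mult_distrib flip: power_mult)
        finally have "(z p om)^2 \<le> \<xi> s om ^ 4 + \<eta> t om ^ 4 + 2 * D^2" using \<open>?b^2 \<le> D^2\<close> by linarith
        then have "(m p om)^2 * (z p om)^2 \<le> (m p om)^2 * (\<xi> s om ^ 4 + \<eta> t om ^ 4 + 2 * D^2)" by (intro mult_left_mono) auto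
        then show ?thesis by (simp add: power_mult_distrib algebra_simps)
      qed simp
    qed
    have dom: "integrable M ?d" using mb1 nb1 m2[OF p] by simp
    have int: "integrable M (\<lambda>om. (m p om * z p om)^2)"
      by (rule integrable_dominated[OF dom]) (use mM zM le in auto)
    have "(\<integral>om. (m p om * z p om)^2 \<partial>M) \<le> (\<integral>om. ?d om \<partial>M)"
      by (rule integral_mono_AE[OF int dom le])
    also have "\<dots> \<le> (2 * B + 2 * D^2) * (\<integral>om. (m p om)^2 \<partial>M)" using m2[OF p] mb1 mb2 nb1 nb2 by (simp add: algebra_simps)
    finally show ?thesis using int by blast
  qed
  have int: "integrable M (\<lambda>om. (m p om * z p om)^2)" if "p \<in> J \<times> J" for p using * that by blast
  define gg where "gg p = {g (fst p), g (snd p)}" for p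
  have \<xi>M: "\<xi> t \<in> borel_measurable M" "\<eta> t \<in> borel_measurable M" if "t \<in> J" for t
    using cen\<xi>[OF that] cen\<eta>[OF that] by (auto simp: centered_def)
  have zf: "z (s, t) = (\<lambda>om. \<xi> s om * \<eta> t om - (if g s = g t then b (s, t) om else 0))" if "s \<in> J" "t \<in> J" for s t
    using z[OF that] by blast
  have zM: "z p \<in> borel_measurable M" if "p \<in> J \<times> J" for p
  proof -
    obtain s t where st: "p = (s, t)" "s \<in> J" "t \<in> J" using \<open>p \<in> J \<times> J\<close> by blast
    show ?thesis unfolding st(1) zf[OF st(2,3)]
      using \<xi>M[OF st(2)] \<xi>M[OF st(3)] F_imp_M[OF b[OF \<open>p \<in> J \<times> J\<close>]] st by auto
  qed
  have Ym: "(\<lambda>om. m p om * z p om) \<in> borel_measurable M" if "p \<in> J \<times> J" for p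
    using zM[OF that] F_imp_M[OF m[OF that]] by simp
  have zH: "z p \<in> borel_measurable (H (g r))" if p: "p \<in> J \<times> J" and r: "r \<in> J" and nr: "g r \<notin> gg p" for p r
  proof -
    obtain s t where st: "p = (s, t)" "s \<in> J" "t \<in> J" using p by blast
    have "g s \<noteq> g r" "g t \<noteq> g r" using nr by (auto simp: gg_def st)
    then show ?thesis unfolding st(1) zf[OF st(2,3)]
      using meas\<xi>[OF st(2) r] meas\<eta>[OF st(3) r] F_imp_H[OF r b[OF p]] st by auto
  qed
  have half: "(\<integral>om. (m p om * z p om) * (m q om * z q om) \<partial>M) = 0"
    if p: "p \<in> J \<times> J" and q: "q \<in> J \<times> J" and r: "r \<in> {fst p, snd p}" and nr: "g r \<notin> gg q" for p q r
  proof -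
    obtain s t where st: "p = (s, t)" "s \<in> J" "t \<in> J" using p by blast
    have rO: "r \<in> J" using r st by auto
    have i: "integrable M (\<lambda>om. (m p om * z p om) * (m q om * z q om))"
      by (rule integrable_product_squares[OF Ym[OF p] Ym[OF q] int[OF p] int[OF q]])
    have mH: "m p \<in> borel_measurable (H (g r))" "m q \<in> borel_measurable (H (g r))"
      using F_imp_H[OF rO] m p q by auto
    note zq = zH[OF q rO nr]
    show ?thesis
    proof (cases "g s = g t")
      case True
      then have gr: "g r = g t" using r st by auto
      have eq: "(\<lambda>om. (m p om * z p om) * (m q om * z q om)) = (\<lambda>om. (m p om * (m q om * z q om)) * z p om)"
        by (simp add: mult_ac)
      have "(\<lambda>om. m p om * (m q om * z q om)) \<in> borel_measurable (H (g r))" using mH zq by auto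
      then show ?thesis
        using centered_mult[OF subH[OF rO], of "z p"] cenz[OF st(2,3) True] i unfolding eq st(1)[symmetric] gr by blast
    next
      case False
      then have zp: "z p = (\<lambda>om. \<xi> s om * \<eta> t om)" using zf[OF st(2,3)] st(1) by simp
      consider "r = s" | "r = t" using r st by auto
      then show ?thesis
      proof cases
        case 1
        have eq: "(\<lambda>om. (m p om * z p om) * (m q om * z q om)) = (\<lambda>om. (m p om * (m q om * z q om) * \<eta> t om) * \<xi> s om)"
          by (simp add: mult_ac zp)
        have "\<eta> t \<in> borel_measurable (H (g s))" using meas\<eta>[OF st(3,2)] False by auto
        then have "(\<lambda>om. m p om * (m q om * z q om) * \<eta> t om) \<in> borel_measurable (H (g s))" using mH zq 1 by auto
        then show ?thesis using centered_mult[OF subH[OF st(2)] cen\<xi>[OF st(2)]] i unfolding eq by blast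
      next
        case 2
        have eq: "(\<lambda>om. (m p om * z p om) * (m q om * z q om)) = (\<lambda>om. (m p om * (m q om * z q om) * \<xi> s om) * \<eta> t om)"
          by (simp add: mult_ac zp)
        have "\<xi> s \<in> borel_measurable (H (g t))" using meas\<xi>[OF st(2,3)] False by auto
        then have "(\<lambda>om. m p om * (m q om * z q om) * \<xi> s om) \<in> borel_measurable (H (g t))" using mH zq 2 by auto
        then show ?thesis using centered_mult[OF subH[OF st(3)] cen\<eta>[OF st(3)]] i unfolding eq by blast
      qed
    qed
  qed
  have orth: "(\<integral>om. (m p om * z p om) * (m q om * z q om) \<partial>M) = 0"
    if p: "p \<in> J \<times> J" and q: "q \<in> J \<times> J" and pq: "\<not> gg p = gg q" for p q
  proof -
    consider (1) r where "r \<in> {fst p, snd p}" "g r \<notin> gg q" | (2) r where "r \<in> {fst q, snd q}" "g r \<notin> gg p"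
      using pq unfolding gg_def by blast
    then show ?thesis
    proof cases
      case 1 then show ?thesis by (rule half[OF p q])
    next
      case 2
      have "(\<integral>om. (m q om * z q om) * (m p om * z p om) \<partial>M) = 0" by (rule half[OF q p 2])
      then show ?thesis by (simp add: mult.commute)
    qed
  qed
  have card: "card {q \<in> J \<times> J. gg p = gg q} \<le> 2 * c^2" if p: "p \<in> J \<times> J" for p
  proof -
    obtain s t where st: "p = (s, t)" "s \<in> J" "t \<in> J" using p by blast
    let ?S = "{r \<in> J. g r = g s}" and ?T = "{r \<in> J. g r = g t}"
    have fin: "finite ?S" "finite ?T" using finO by auto
    have "{q \<in> J \<times> J. gg p = gg q} \<subseteq> ?S \<times> ?T \<union> ?T \<times> ?S"
      by (auto simp: gg_def st doubleton_eq_iff)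
    then have "card {q \<in> J \<times> J. gg p = gg q} \<le> card (?S \<times> ?T \<union> ?T \<times> ?S)"
      by (intro card_mono) (use fin in auto)
    also have "\<dots> \<le> card (?S \<times> ?T) + card (?T \<times> ?S)" by (rule card_Un_le)
    also have "\<dots> \<le> c * c + c * c"
      unfolding card_cartesian_product by (intro add_mono mult_mono block_size st) auto
    finally show ?thesis by (simp add: power2_eq_square)
  qed
  note B = orthogonal_sum_bound[where P="J \<times> J" and Y="\<lambda>p om. m p om * z p om" and rel="\<lambda>p q. gg p = gg q" and c="2 * c^2" and M=M]
  have fin: "finite (J \<times> J)" using finO by simp
  show ?g1
    by (rule B(1)[OF fin Ym int _ card orth]) auto
  have "(\<integral>om. (\<Sum>p\<in>J \<times> J. m p om * z p om)^2 \<partial>M) \<le> real (2 * c^2) * (\<Sum>p\<in>J \<times> J. \<integral>om. (m p om * z p om)^2 \<partial>M)"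
    by (rule B(2)[OF fin Ym int _ card orth]) auto
  also have "\<dots> \<le> real (2 * c^2) * (\<Sum>p\<in>J \<times> J. (2 * B + 2 * D^2) * (\<integral>om. (m p om)^2 \<partial>M))"
    by (intro mult_left_mono sum_mono) (use * in auto)
  finally show ?g2
    by (simp only: sum_distrib_left[symmetric] mult.assoc)
qed

end

section \<open>Replacing blocks by Gaussian factors\<close>

lemma exp_minus_taylor_bound:
  fixes v :: real assumes "0 \<le> v"
  shows "\<bar>exp (- v) - 1 + v\<bar> \<le> v^2"
proof -
  have "1 - v \<le> exp (- v)" using exp_ge_add_one_self[of "- v"] by simp
  moreover have "exp (- v) \<le> 1 - v + v^2"
  proof -
    have "exp (- v) \<le> 1 / (1 + v)"
      using exp_ge_add_one_self[of v] assms by (simp add: exp_minus field_simps)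
    also have "\<dots> \<le> 1 - v + v^2"
      using assms by (simp add: divide_simps) (simp add: algebra_simps power2_eq_square)
    finally show ?thesis .
  qed
  ultimately show ?thesis by auto
qed

lemma (in prob_space) centered_mult_complex:
  fixes W :: "'a => complex"
  assumes H: "subalgebra M H" and X: "centered M H X" and W: "W \<in> borel_measurable H" and W1: "\<And>om. cmod (W om) \<le> 1"
    and f: "f \<in> borel_measurable H" and int: "integrable M (\<lambda>om. f om * X om)"
  shows "integrable M (\<lambda>om. W om * complex_of_real (f om * X om))" (is ?g1)
    and "(\<integral>om. W om * complex_of_real (f om * X om) \<partial>M) = 0" (is ?g2)
proof -
  have WM: "W \<in> borel_measurable M" by (rule measurable_from_subalg[OF H W])
  have fX: "(\<lambda>om. f om * X om) \<in> borel_measurable M" using int by auto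
  show i: ?g1
  proof (rule Bochner_Integration.integrable_bound[OF int])
    show "(\<lambda>om. W om * complex_of_real (f om * X om)) \<in> borel_measurable M"
    proof (rule borel_measurable_times[OF WM])
      show "(\<lambda>om. complex_of_real (f om * X om)) \<in> borel_measurable M" using fX by measurable
    qed
    show "AE om in M. norm (W om * complex_of_real (f om * X om)) \<le> norm (f om * X om)"
      unfolding norm_mult[of "W _"] norm_of_real real_norm_def by (intro AE_I2 mult_left_le_one_le W1) auto
  qed
  have part: "(\<integral>om. r om * (f om * X om) \<partial>M) = 0" if r: "r \<in> borel_measurable H" and r1: "\<And>om. \<bar>r om\<bar> \<le> 1" for r :: "'a => real"
  proof -
    have rM: "r \<in> borel_measurable M" by (rule measurable_from_subalg[OF H r])
    have "integrable M (\<lambda>om. r om * (f om * X om))"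
      by (rule Bochner_Integration.integrable_bound[OF int])
        (use int rM r1 in \<open>auto simp: abs_mult intro!: mult_left_le_one_le\<close>)
    then have "integrable M (\<lambda>om. (r om * f om) * X om)" by (simp add: mult.assoc)
    then have "(\<integral>om. (r om * f om) * X om \<partial>M) = 0"
      using r f by (intro centered_mult[OF H X]) auto
    then show ?thesis by (simp add: mult.assoc)
  qed
  have "Re (\<integral>om. W om * complex_of_real (f om * X om) \<partial>M) = (\<integral>om. Re (W om) * (f om * X om) \<partial>M)"
    unfolding integral_Re[OF i, symmetric] by simp
  moreover have "Im (\<integral>om. W om * complex_of_real (f om * X om) \<partial>M) = (\<integral>om. Im (W om) * (f om * X om) \<partial>M)"
    unfolding integral_Im[OF i, symmetric] by simp
  moreover have "(\<integral>om. Re (W om) * (f om * X om) \<partial>M) = 0"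
  proof (rule part)
    show "(\<lambda>om. Re (W om)) \<in> borel_measurable H" using W by measurable
    show "\<bar>Re (W om)\<bar> \<le> 1" for om by (rule order_trans[OF abs_Re_le_cmod W1])
  qed
  moreover have "(\<integral>om. Im (W om) * (f om * X om) \<partial>M) = 0"
  proof (rule part)
    show "(\<lambda>om. Im (W om)) \<in> borel_measurable H" using W by measurable
    show "\<bar>Im (W om)\<bar> \<le> 1" for om by (rule order_trans[OF abs_Im_le_cmod W1])
  qed
  ultimately show ?g2 by (simp add: complex_eq_iff)
qed

text \<open>Both exponentials are compared with their Taylor polynomials. The difference of the polynomials is what has
  mean zero if \<open>v\<close> is the conditional variance of \<open>G\<close>.\<close>

lemma iexp_gaussian_remainder:
  assumes v: "0 \<le> v"
  shows "cmod (iexp G - complex_of_real (exp (- v / 2)) - (\<i> * complex_of_real G - complex_of_real ((G^2 - v) / 2))) \<le> \<bar>G\<bar> ^ 3 / 6 + v^2 / 4"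
proof -
  have 1: "cmod (iexp G - (1 + \<i> * G - G\<^sup>2 / 2)) \<le> \<bar>G\<bar> ^ 3 / 6"
    using iexp_approx1[of G 2]
    by (simp add: numeral_eq_Suc fact_numeral power_mult_distrib algebra_simps)
  have 2: "\<bar>exp (- (v / 2)) - 1 + v / 2\<bar> \<le> (v / 2)^2" using v by (intro exp_minus_taylor_bound) simp
  have "iexp G - complex_of_real (exp (- v / 2)) - (\<i> * complex_of_real G - complex_of_real ((G^2 - v) / 2))
      = (iexp G - (1 + \<i> * G - G\<^sup>2 / 2)) - complex_of_real (exp (- (v / 2)) - 1 + v / 2)"
    by (simp add: diff_divide_distrib)
  also have "cmod \<dots> \<le> cmod (iexp G - (1 + \<i> * G - G\<^sup>2 / 2)) + cmod (complex_of_real (exp (- (v / 2)) - 1 + v / 2))"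
    by (rule norm_triangle_ineq4)
  also have "\<dots> \<le> \<bar>G\<bar> ^ 3 / 6 + (v / 2)^2"
    using 1 2 by (intro add_mono) (simp_all only: norm_of_real)
  finally show ?thesis by (simp add: power2_eq_square)
qed

text \<open>Lindeberg's replacement argument. \<open>D k\<close> carries the first \<open>k\<close> blocks in the exponential and Gaussian factors
  for the remaining ones. Consecutive terms share a factor \<open>W\<close> that is known outside block \<open>k\<close>, against
  which the Taylor terms of first and second order integrate to zero; for the second this uses that
  the errors are uncorrelated with common variance \<open>s2\<close>.\<close>

lemma (in prob_space) char_block_sum_bound:
  fixes a U :: "nat => 'a => real" and T :: "nat => nat set" and s2 :: real
  assumes finT: "\<And>k. k \<in> {1..m} ==> finite (T k)"
    and subF: "subalgebra M F"
    and subH: "\<And>k. k \<in> {1..m} ==> subalgebra M (H k)"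
    and FH: "\<And>k. k \<in> {1..m} ==> subalgebra (H k) F"
    and a: "\<And>k t. k \<in> {1..m} ==> t \<in> T k ==> a t \<in> borel_measurable F"
    and ab: "\<And>k t om. k \<in> {1..m} ==> t \<in> T k ==> \<bar>a t om\<bar> \<le> b"
    and UH: "\<And>j k t. j \<in> {1..m} ==> k \<in> {1..m} ==> j \<noteq> k ==> t \<in> T j ==> U t \<in> borel_measurable (H k)"
    and cen1: "\<And>k t. k \<in> {1..m} ==> t \<in> T k ==> centered M (H k) (U t)"
    and cen2: "\<And>k t s. k \<in> {1..m} ==> t \<in> T k ==> s \<in> T k ==> centered M (H k) (\<lambda>om. U t om * U s om - s2 * of_bool (t = s))"
    and s2: "0 \<le> s2"
    and int3: "\<And>k. k \<in> {1..m} ==> integrable M (\<lambda>om. \<bar>\<Sum>t\<in>T k. a t om * U t om\<bar> ^ 3)"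
  shows "cmod ((\<integral>om. iexp (\<Sum>k=1..m. \<Sum>t\<in>T k. a t om * U t om) \<partial>M) - (\<integral>om. complex_of_real (exp (- (\<Sum>k=1..m. s2 * (\<Sum>t\<in>T k. (a t om)^2)) / 2)) \<partial>M))
    \<le> (\<Sum>k=1..m. (\<integral>om. \<bar>\<Sum>t\<in>T k. a t om * U t om\<bar> ^ 3 \<partial>M) / 6 + (\<integral>om. (s2 * (\<Sum>t\<in>T k. (a t om)^2))^2 \<partial>M) / 4)"
proof -
  define G where "G k om = (\<Sum>t\<in>T k. a t om * U t om)" for k om
  define v where "v k om = s2 * (\<Sum>t\<in>T k. (a t om)^2)" for k om
  define D where "D k om = iexp (\<Sum>j=1..k. G j om) * complex_of_real (exp (- (\<Sum>j=Suc k..m. v j om) / 2))" for k om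
  define err where "err k = (\<integral>om. \<bar>G k om\<bar> ^ 3 \<partial>M) / 6 + (\<integral>om. (v k om)^2 \<partial>M) / 4" for k
  have v0: "0 \<le> v k om" for k om unfolding v_def using s2 by (simp add: sum_nonneg)
  have aM: "a t \<in> borel_measurable M" if "k \<in> {1..m}" "t \<in> T k" for k t
    by (rule measurable_from_subalg[OF subF a[OF that]])
  have UM: "U t \<in> borel_measurable M" if "k \<in> {1..m}" "t \<in> T k" for k t
    using cen1[OF that] by (auto simp: centered_def)
  have GM: "G k \<in> borel_measurable M" if "k \<in> {1..m}" for k
    unfolding G_def[abs_def] using aM[OF that] UM[OF that] by auto
  have vF: "v k \<in> borel_measurable F" if "k \<in> {1..m}" for k
    unfolding v_def[abs_def] using a[OF that] by auto
  have vM: "v k \<in> borel_measurable M" if "k \<in> {1..m}" for k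
    by (rule measurable_from_subalg[OF subF vF[OF that]])
  have DM: "D k \<in> borel_measurable M" if "k \<le> m" for k
  proof -
    have "(\<lambda>om. \<Sum>j=1..k. G j om) \<in> borel_measurable M" "(\<lambda>om. \<Sum>j=Suc k..m. v j om) \<in> borel_measurable M"
      using GM vM that by (auto intro!: borel_measurable_sum)
    then show ?thesis unfolding D_def[abs_def] by measurable
  qed
  have exp1: "exp (- (\<Sum>j\<in>A. v j om) / 2) \<le> 1" for A om using v0 by (simp add: sum_nonneg)
  have Dint: "integrable M (D k)" if "k \<le> m" for k
    by (rule integrable_const_bound[where B=1]) (use DM[OF that] exp1 in \<open>auto simp: D_def norm_mult\<close>)
  have step: "cmod ((\<integral>om. D k om \<partial>M) - (\<integral>om. D (k - 1) om \<partial>M)) \<le> err k" if k: "k \<in> {1..m}" for k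
  proof -
    define W where "W om = iexp (\<Sum>j=1..k - 1. G j om) * complex_of_real (exp (- (\<Sum>j=Suc k..m. v j om) / 2))" for om
    define rem where "rem om = iexp (G k om) - complex_of_real (exp (- v k om / 2)) - (\<i> * complex_of_real (G k om) - complex_of_real (((G k om)^2 - v k om) / 2))" for om
    have FHk: "f \<in> borel_measurable (H k)" if "f \<in> borel_measurable F" for f :: "'a => real"
      by (rule measurable_from_subalg[OF FH[OF k] that])
    have WH: "W \<in> borel_measurable (H k)"
    proof -
      have "G j \<in> borel_measurable (H k)" if "j \<in> {1..k - 1}" for j
      proof -
        have j: "j \<in> {1..m}" "j \<noteq> k" using that k by auto
        show ?thesis unfolding G_def[abs_def] using UH[OF j(1) k j(2)] FHk[OF a[OF j(1)]] by auto
      qed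
      then have 1: "(\<lambda>om. \<Sum>j=1..k - 1. G j om) \<in> borel_measurable (H k)" by (intro borel_measurable_sum)
      have 2: "(\<lambda>om. \<Sum>j=Suc k..m. v j om) \<in> borel_measurable (H k)"
        using FHk[OF vF] by (intro borel_measurable_sum) auto
      show ?thesis unfolding W_def[abs_def] using 1 2 by measurable
    qed
    have WM: "W \<in> borel_measurable M" by (rule measurable_from_subalg[OF subH[OF k] WH])
    have W1: "cmod (W om) \<le> 1" for om using exp1 by (simp add: W_def norm_mult)
    have b0: "0 \<le> b" if "t \<in> T k" for t using ab[OF k that, of undefined] by linarith
    \<comment> \<open>the linear Taylor term is centred against \<open>W\<close>\<close>
    have lin_int: "integrable M (\<lambda>om. a t om * U t om)" if t: "t \<in> T k" for t
    proof (rule Bochner_Integration.integrable_bound)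
      show "integrable M (\<lambda>om. b * U t om)" using cen1[OF k t] by (simp add: centered_def)
      show "(\<lambda>om. a t om * U t om) \<in> borel_measurable M" using aM[OF k t] UM[OF k t] by simp
      show "AE om in M. norm (a t om * U t om) \<le> norm (b * U t om)"
        using ab[OF k t] b0[OF t] by (intro AE_I2) (auto simp: abs_mult intro: mult_right_mono)
    qed
    have W_lin: "integrable M (\<lambda>om. W om * complex_of_real (G k om))" "(\<integral>om. W om * complex_of_real (G k om) \<partial>M) = 0"
    proof -
      have eq: "W om * complex_of_real (G k om) = (\<Sum>t\<in>T k. W om * complex_of_real (a t om * U t om))" for om
        by (simp add: G_def sum_distrib_left)
      note c = centered_mult_complex[OF subH[OF k] cen1[OF k] WH W1 FHk[OF a[OF k]] lin_int]
      show "integrable M (\<lambda>om. W om * complex_of_real (G k om))" unfolding eq using c(1) by (intro Bochner_Integration.integrable_sum)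
      show "(\<integral>om. W om * complex_of_real (G k om) \<partial>M) = 0"
        unfolding eq using c by (subst Bochner_Integration.integral_sum) auto
    qed
    \<comment> \<open>so is the quadratic term, once the conditional variance is subtracted\<close>
    have quad_int: "integrable M (\<lambda>om. (a t om * a s om) * (U t om * U s om - s2 * of_bool (t = s)))" if t: "t \<in> T k" and s: "s \<in> T k" for t s
    proof (rule Bochner_Integration.integrable_bound)
      show "integrable M (\<lambda>om. (b * b) * (U t om * U s om - s2 * of_bool (t = s)))"
        using cen2[OF k t s] unfolding centered_def by (intro integrable_mult_right) blast
      show "(\<lambda>om. (a t om * a s om) * (U t om * U s om - s2 * of_bool (t = s))) \<in> borel_measurable M"
        using aM[OF k t] UM[OF k t] aM[OF k s] UM[OF k s] by simp
      show "AE om in M. norm ((a t om * a s om) * (U t om * U s om - s2 * of_bool (t = s))) \<le> norm ((b * b) * (U t om * U s om - s2 * of_bool (t = s)))"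
      proof (rule AE_I2)
        fix om
        have "\<bar>a t om\<bar> * \<bar>a s om\<bar> \<le> b * b" using ab[OF k t] ab[OF k s] b0[OF t] by (intro mult_mono) auto
        then show "norm ((a t om * a s om) * (U t om * U s om - s2 * of_bool (t = s))) \<le> norm ((b * b) * (U t om * U s om - s2 * of_bool (t = s)))"
          unfolding real_norm_def abs_mult[of "a t om * a s om"] abs_mult[of "b * b"]
          by (intro mult_right_mono) (simp_all add: abs_mult)
      qed
    qed
    have W_quad: "integrable M (\<lambda>om. W om * complex_of_real ((G k om)^2 - v k om))" "(\<integral>om. W om * complex_of_real ((G k om)^2 - v k om) \<partial>M) = 0"
    proof -
      have eq0: "(G k om)^2 - v k om = (\<Sum>t\<in>T k. \<Sum>s\<in>T k. (a t om * a s om) * (U t om * U s om - s2 * of_bool (t = s)))" for om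
      proof -
        have "(\<Sum>t\<in>T k. \<Sum>s\<in>T k. (a t om * a s om) * (s2 * of_bool (t = s))) = (\<Sum>t\<in>T k. (a t om * a t om) * s2)"
        proof (rule sum.cong[OF refl])
          fix t assume "t \<in> T k"
          then have "(\<Sum>s\<in>T k. (a t om * a s om) * (s2 * of_bool (t = s))) = (\<Sum>s\<in>T k. if t = s then (a t om * a t om) * s2 else 0)"
            by (intro sum.cong refl) auto
          also have "\<dots> = (a t om * a t om) * s2" using finT[OF k] \<open>t \<in> T k\<close> by simp
          finally show "(\<Sum>s\<in>T k. (a t om * a s om) * (s2 * of_bool (t = s))) = (a t om * a t om) * s2" .
        qed
        then show ?thesis
          by (simp add: G_def v_def power2_eq_square sum_product right_diff_distrib sum_subtractf sum_distrib_left mult_ac)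
      qed
      have eq: "W om * complex_of_real ((G k om)^2 - v k om) = (\<Sum>t\<in>T k. \<Sum>s\<in>T k. W om * complex_of_real ((a t om * a s om) * (U t om * U s om - s2 * of_bool (t = s))))" for om
        unfolding eq0 of_real_sum by (simp only: sum_distrib_left)
      have aa: "(\<lambda>om. a t om * a s om) \<in> borel_measurable (H k)" if "t \<in> T k" "s \<in> T k" for t s
        using FHk[OF a[OF k that(1)]] FHk[OF a[OF k that(2)]] by simp
      note c = centered_mult_complex[OF subH[OF k] cen2[OF k] WH W1 aa quad_int]
      show "integrable M (\<lambda>om. W om * complex_of_real ((G k om)^2 - v k om))"
        unfolding eq by (intro Bochner_Integration.integrable_sum c(1))
      show "(\<integral>om. W om * complex_of_real ((G k om)^2 - v k om) \<partial>M) = 0"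
        unfolding eq
        apply (subst Bochner_Integration.integral_sum)
         apply (intro Bochner_Integration.integrable_sum c(1); assumption)
        apply (intro sum.neutral ballI)
        apply (subst Bochner_Integration.integral_sum)
         apply (intro c(1); assumption)
        apply (intro sum.neutral ballI c(2); assumption)
        done
    qed
    have Ddiff: "D k om - D (k - 1) om = W om * (iexp (G k om) - complex_of_real (exp (- v k om / 2)))" for om
    proof -
      have "{1..k} = insert k {1..k - 1}" using k by auto
      then have s1: "(\<Sum>j=1..k. G j om) = G k om + (\<Sum>j=1..k - 1. G j om)"
        using k by (simp only:) (subst sum.insert, auto)
      have "{Suc (k - 1)..m} = insert k {Suc k..m}" using k by auto
      then have s2: "(\<Sum>j=Suc (k - 1)..m. v j om) = v k om + (\<Sum>j=Suc k..m. v j om)" by simp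
      have e: "exp (- (v k om + (\<Sum>j=Suc k..m. v j om)) / 2) = exp (- v k om / 2) * exp (- (\<Sum>j=Suc k..m. v j om) / 2)"
        unfolding exp_add[symmetric] by (simp add: field_simps)
      show ?thesis unfolding D_def W_def s1 s2 e
        by (simp add: exp_add distrib_left algebra_simps)
    qed
    have decomp: "D k om - D (k - 1) om = \<i> * (W om * complex_of_real (G k om)) - (1 / 2) * (W om * complex_of_real ((G k om)^2 - v k om)) + W om * rem om" for om
      unfolding Ddiff rem_def by (simp add: algebra_simps diff_divide_distrib)
    have remb: "cmod (rem om) \<le> \<bar>G k om\<bar> ^ 3 / 6 + (v k om)^2 / 4" for om
      unfolding rem_def by (rule iexp_gaussian_remainder[OF v0])
    have v2int: "integrable M (\<lambda>om. (v k om)^2)"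
    proof (rule integrable_const_bound[where B="(s2 * (\<Sum>t\<in>T k. b^2))^2"])
      show "AE om in M. norm ((v k om)^2) \<le> (s2 * (\<Sum>t\<in>T k. b^2))^2"
      proof (rule AE_I2)
        fix om
        have "v k om \<le> s2 * (\<Sum>t\<in>T k. b^2)"
          unfolding v_def using s2 ab[OF k] by (intro mult_left_mono sum_mono) (auto simp: abs_le_square_iff[symmetric] intro: order_trans[OF _ abs_ge_self])
        then show "norm ((v k om)^2) \<le> (s2 * (\<Sum>t\<in>T k. b^2))^2" using v0[of k om] by (simp add: power_mono)
      qed
    qed (use vM[OF k] in simp)
    have bint: "integrable M (\<lambda>om. \<bar>G k om\<bar> ^ 3 / 6 + (v k om)^2 / 4)"
      using int3[OF k] v2int by (simp add: G_def)
    have remM: "rem \<in> borel_measurable M" unfolding rem_def[abs_def] using GM[OF k] vM[OF k] by measurable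
    have Wremb: "cmod (W om * rem om) \<le> \<bar>G k om\<bar> ^ 3 / 6 + (v k om)^2 / 4" for om
    proof -
      have "cmod (W om * rem om) \<le> 1 * cmod (rem om)" unfolding norm_mult by (intro mult_right_mono W1) simp
      then show ?thesis using remb[of om] by simp
    qed
    have Wrem: "integrable M (\<lambda>om. W om * rem om)"
      by (rule Bochner_Integration.integrable_bound[OF bint])
        (use WM remM Wremb in \<open>auto intro!: AE_I2 order_trans[OF _ abs_ge_self]\<close>)
    have "(\<integral>om. D k om \<partial>M) - (\<integral>om. D (k - 1) om \<partial>M) = (\<integral>om. D k om - D (k - 1) om \<partial>M)"
      using Dint[of k] Dint[of "k - 1"] k by (subst Bochner_Integration.integral_diff) auto
    also have "\<dots> = (\<integral>om. W om * rem om \<partial>M)"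
      unfolding decomp using W_lin W_quad Wrem by simp
    also have "cmod \<dots> \<le> (\<integral>om. cmod (W om * rem om) \<partial>M)" by (rule integral_norm_bound)
    also have "\<dots> \<le> (\<integral>om. \<bar>G k om\<bar> ^ 3 / 6 + (v k om)^2 / 4 \<partial>M)"
      using Wrem bint Wremb by (intro integral_mono) auto
    also have "\<dots> = err k"
      using int3[OF k] v2int by (simp add: err_def G_def)
    finally show ?thesis .
  qed
  have "cmod ((\<integral>om. D k om \<partial>M) - (\<integral>om. D 0 om \<partial>M)) \<le> (\<Sum>j=1..k. err j)" if "k \<le> m" for k
    using that
  proof (induction k)
    case (Suc k)
    have "cmod ((\<integral>om. D (Suc k) om \<partial>M) - (\<integral>om. D 0 om \<partial>M))
        = cmod (((\<integral>om. D (Suc k) om \<partial>M) - (\<integral>om. D k om \<partial>M)) + ((\<integral>om. D k om \<partial>M) - (\<integral>om. D 0 om \<partial>M)))" by simp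
    also have "\<dots> \<le> cmod ((\<integral>om. D (Suc k) om \<partial>M) - (\<integral>om. D k om \<partial>M)) + cmod ((\<integral>om. D k om \<partial>M) - (\<integral>om. D 0 om \<partial>M))"
      by (rule norm_triangle_ineq)
    also have "\<dots> \<le> err (Suc k) + (\<Sum>j=1..k. err j)"
      using step[of "Suc k"] Suc by (intro add_mono) auto
    finally show ?case by simp
  qed simp
  from this[of m] show ?thesis
    unfolding D_def err_def G_def v_def by simp
qed

section \<open>Least squares algebra\<close>

text \<open>A symmetric idempotent matrix indexed by \<open>J\<close>. Its action \<open>ap\<close> is defined for entries in any real vector
  space, so that errors and regressors are residualised by the same map.\<close>

locale projection =
  fixes J :: "nat set" and P :: "nat => nat => real"
  assumes sym: "\<And>i j. i \<in> J ==> j \<in> J ==> P i j = P j i"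
    and idem: "\<And>i j. i \<in> J ==> j \<in> J ==> (\<Sum>k\<in>J. P i k * P k j) = P i j"
begin

definition ap :: "(nat => 'v::real_vector) => nat => 'v" where
  "ap z i = (\<Sum>j\<in>J. P i j *\<^sub>R z j)"

lemma ap_real: "ap (z :: nat => real) i = (\<Sum>j\<in>J. P i j * z j)" by (simp add: ap_def)

lemma ap_add: "ap (\<lambda>i. z i + t i) i = ap z i + ap t i"
  by (simp add: ap_def scaleR_add_right sum.distrib)

lemma ap_diff: "ap (\<lambda>i. z i - t i) i = ap z i - ap t i"
  by (simp add: ap_def scaleR_diff_right sum_subtractf)

lemma ap_cong: "(\<And>j. j \<in> J ==> z j = t j) ==> ap z i = ap t i"
  by (simp add: ap_def)

lemma ap_inner: "ap (\<lambda>i. a \<bullet> z i) i = a \<bullet> ap z i"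
  by (simp add: ap_def inner_sum_right)

lemma ap_component: "ap z i $ a = ap (\<lambda>j. z j $ a) i"
  by (simp add: ap_def sum_component)

lemma ap_ap: "i \<in> J ==> ap (ap z) i = ap z i"
proof -
  assume i: "i \<in> J"
  have "ap (ap z) i = (\<Sum>k\<in>J. \<Sum>j\<in>J. (P i k * P k j) *\<^sub>R z j)" by (simp add: ap_def scaleR_sum_right)
  also have "\<dots> = (\<Sum>j\<in>J. (\<Sum>k\<in>J. P i k * P k j) *\<^sub>R z j)" by (subst sum.swap) (simp add: scaleR_sum_left)
  also have "\<dots> = ap z i" unfolding ap_def by (intro sum.cong refl) (simp add: idem i)
  finally show ?thesis .
qed

lemma ap_adjoint: "(\<Sum>i\<in>J. ap z i * t i) = (\<Sum>i\<in>J. z i * ap (t :: nat => real) i)"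
proof -
  have "(\<Sum>i\<in>J. ap z i * t i) = (\<Sum>i\<in>J. \<Sum>j\<in>J. P i j * z j * t i)" by (simp add: ap_real sum_distrib_right)
  also have "\<dots> = (\<Sum>j\<in>J. \<Sum>i\<in>J. P i j * z j * t i)" by (rule sum.swap)
  also have "\<dots> = (\<Sum>j\<in>J. z j * ap t j)" unfolding ap_real sum_distrib_left
    by (intro sum.cong refl) (simp add: sym mult_ac)
  finally show ?thesis .
qed

lemma ap_adjoint_scaleR: "(\<Sum>i\<in>J. ap z i *\<^sub>R t i) = (\<Sum>i\<in>J. z i *\<^sub>R ap (t :: nat => 'v::real_vector) i)"
proof -
  have "(\<Sum>i\<in>J. ap z i *\<^sub>R t i) = (\<Sum>i\<in>J. \<Sum>j\<in>J. (P i j * z j) *\<^sub>R t i)" by (simp add: ap_real scaleR_sum_left)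
  also have "\<dots> = (\<Sum>j\<in>J. \<Sum>i\<in>J. (P i j * z j) *\<^sub>R t i)" by (rule sum.swap)
  also have "\<dots> = (\<Sum>j\<in>J. z j *\<^sub>R ap t j)" unfolding ap_def scaleR_sum_right
    by (intro sum.cong refl) (simp add: sym mult_ac)
  finally show ?thesis .
qed

lemma ap_prod: "(\<Sum>i\<in>J. ap z i * ap t i) = (\<Sum>i\<in>J. z i * ap (t :: nat => real) i)"
  by (subst ap_adjoint) (simp add: ap_ap)

lemma quad_form: "(\<Sum>i\<in>J. z i * ap t i) = (\<Sum>p\<in>J \<times> J. P (fst p) (snd p) * (z (fst p) * t (snd p)))"
  by (simp add: ap_real sum_distrib_left sum.cartesian_product split_beta mult_ac)

lemma ap_contraction: "(\<Sum>i\<in>J. (ap z i)^2) \<le> (\<Sum>i\<in>J. (z i :: real)^2)"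
proof -
  have "0 \<le> (\<Sum>i\<in>J. (z i - ap z i)^2)" by (simp add: sum_nonneg)
  also have "\<dots> = (\<Sum>i\<in>J. (z i)^2) - 2 * (\<Sum>i\<in>J. z i * ap z i) + (\<Sum>i\<in>J. (ap z i)^2)"
    by (simp add: power2_diff sum.distrib sum_subtractf sum_distrib_left algebra_simps)
  also have "(\<Sum>i\<in>J. z i * ap z i) = (\<Sum>i\<in>J. (ap z i)^2)" using ap_prod[of z z] by (simp add: power2_eq_square)
  finally show ?thesis by simp
qed

context assumes fin: "finite J" begin

lemma diag_eq: "i \<in> J ==> P i i = (\<Sum>j\<in>J. (P i j)^2)"
  using idem[of i i] by (simp add: power2_eq_square sym cong: sum.cong)

lemma entry_le_1: "i \<in> J ==> j \<in> J ==> \<bar>P i j\<bar> \<le> 1"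
proof -
  assume i: "i \<in> J" and j: "j \<in> J"
  have le: "(P i k)^2 \<le> P i i" if "k \<in> J" for k
    unfolding diag_eq[OF i] using fin that by (intro member_le_sum) auto
  have "P i i \<le> 1"
  proof (rule ccontr)
    assume "\<not> P i i \<le> 1"
    then have "P i i * 1 < P i i * P i i" by (intro mult_strict_left_mono) auto
    then show False using le[OF i] by (simp add: power2_eq_square)
  qed
  then have "(P i j)^2 \<le> 1" using le[OF j] by linarith
  then show ?thesis by (simp add: abs_square_le_1)
qed

lemma sum_squares_le: "(\<Sum>p\<in>J \<times> J. (P (fst p) (snd p))^2) \<le> real (card J)"
proof -
  have "(\<Sum>p\<in>J \<times> J. (P (fst p) (snd p))^2) = (\<Sum>i\<in>J. \<Sum>j\<in>J. (P i j)^2)"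
    by (simp add: sum.cartesian_product split_beta)
  also have "\<dots> = (\<Sum>i\<in>J. P i i)" by (simp add: diag_eq)
  also have "\<dots> \<le> (\<Sum>i\<in>J. 1)" using entry_le_1 by (intro sum_mono) (meson abs_ge_self order_trans)
  finally show ?thesis by simp
qed

end

end

lemma sum_outer_mult_vec: "(\<Sum>i\<in>J. outer (v i) (v i)) *v (x :: real ^ 'd) = (\<Sum>i\<in>J. (v i \<bullet> x) *\<^sub>R v i)"
proof (induction J rule: infinite_finite_induct)
  case (insert i J)
  then show ?case by (simp add: matrix_vector_mult_add_rdistrib outer_mult_vec)
qed (simp_all add: matrix_vector_mult_def Finite_Cartesian_Product.vec_eq_iff)

lemma symmetric_sum_outer: "symmetric (\<Sum>i\<in>J. outer (v i) (v i :: real ^ 'd))"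
  by (rule symmetricI) (simp add: sum_component outer_def mult.commute)

lemma symmetric_scaleR: "symmetric A ==> symmetric (c *\<^sub>R A)"
  by (rule symmetricI) (simp, metis symmetricD)

definition matrix_pd :: "real => real ^ 'd ^ 'd => bool" where
  "matrix_pd c A \<longleftrightarrow> symmetric A \<and> (\<forall>x. c * (x \<bullet> x) \<le> x \<bullet> (A *v x))"

locale pd_matrix =
  fixes c :: real and A :: "real ^ 'd ^ 'd"
  assumes c: "0 < c" and pd: "matrix_pd c A"
begin

lemma symA: "symmetric A" and lower: "c * (x \<bullet> x) \<le> x \<bullet> (A *v x)"
  using pd by (auto simp: matrix_pd_def)

lemma inv1: "A ** matrix_inv A = id_matrix" (is ?g1) and inv2: "matrix_inv A ** A = id_matrix"
proof -
  have "x = 0" if "A *v x = 0" for x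
    using lower[of x] that c by (simp add: mult_le_0_iff) (metis antisym inner_eq_zero_iff inner_ge_zero)
  then obtain B where B: "B ** A = id_matrix"
    using matrix_left_invertible_ker[of A] by blast
  then have B': "A ** B = id_matrix" using matrix_left_right_inverse by blast
  then show ?g1 "matrix_inv A ** A = id_matrix"
    using matrix_inv_eqI[OF B'] B by simp_all
qed

lemma inv_vec: "A *v (matrix_inv A *v x) = x" "matrix_inv A *v (A *v x) = x"
  by (simp_all add: matrix_vector_mul_assoc inv1 inv2)

definition S where "S = matrix_sqrt A"
definition W where "W = matrix_inv S"

lemma psdA: "psd A"
  unfolding psd_def using symA lower c by (metis inner_ge_zero order_trans zero_le_mult_iff less_imp_le)

lemma S: "psd S" "S ** S = A"
  unfolding S_def using psd_matrix_sqrt[OF psdA] by auto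

lemma symS: "symmetric S" using S by (simp add: psd_def)

lemma SW: "S ** W = id_matrix" "W ** S = id_matrix"
proof -
  have "S ** (S ** matrix_inv A) = id_matrix" using inv1 S(2) by (simp add: matrix_mul_assoc)
  then have "matrix_inv S = S ** matrix_inv A" by (rule matrix_inv_eqI)
  then show 1: "S ** W = id_matrix" using \<open>S ** (S ** matrix_inv A) = id_matrix\<close> by (simp add: W_def)
  then show "W ** S = id_matrix" using matrix_left_right_inverse by blast
qed

lemma SW_vec: "S *v (W *v x) = x" "W *v (S *v x) = x"
  by (simp_all add: matrix_vector_mul_assoc SW)

lemma SS_vec: "S *v (S *v x) = A *v x" by (simp add: matrix_vector_mul_assoc S)

lemma WW_vec: "W *v (W *v x) = matrix_inv A *v x"
proof -
  have "W *v (W *v x) = W *v (W *v (S *v (S *v (matrix_inv A *v x))))" by (simp add: SS_vec inv_vec)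
  then show ?thesis by (simp add: SW_vec)
qed

lemma W_inner: "x \<bullet> (W *v y) = (W *v x) \<bullet> y"
proof -
  have "x \<bullet> (W *v y) = (S *v (W *v x)) \<bullet> (W *v y)" by (simp add: SW_vec)
  also have "\<dots> = (W *v x) \<bullet> (S *v (W *v y))" using symmetric_inner[OF symS] by metis
  finally show ?thesis by (simp add: SW_vec)
qed

lemma psdW: "psd W"
  unfolding psd_def
proof (intro conjI allI)
  show "symmetric W"
  proof (rule symmetricI)
    fix i j
    have e: "axis i 1 \<bullet> (W *v axis j 1) = W $ i $ j" for i j
      by (simp add: inner_axis' matrix_vector_mul_component inner_axis)
    show "W $ i $ j = W $ j $ i"
      using W_inner[of "axis i 1" "axis j 1"] e[of i j] e[of j i] by (simp add: inner_commute)
  qed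
  fix x
  have "x \<bullet> (W *v x) = (S *v (W *v x)) \<bullet> (W *v x)" by (simp add: SW_vec)
  also have "\<dots> \<ge> 0" using S(1) by (simp add: psd_def inner_commute)
  finally show "0 \<le> x \<bullet> (W *v x)" .
qed

lemma W_norm: "(norm (W *v x))^2 \<le> (norm x)^2 / c"
proof -
  let ?z = "matrix_inv A *v x"
  have "c * (norm ?z)^2 \<le> ?z \<bullet> x" using lower[of ?z] by (simp add: power2_norm_eq_inner inv_vec)
  also have "\<dots> \<le> norm ?z * norm x" by (rule norm_cauchy_schwarz)
  finally have "c * norm ?z * norm ?z \<le> norm x * norm ?z" by (simp add: power2_eq_square mult_ac)
  then have z: "c * norm ?z \<le> norm x" by (cases "norm ?z = 0") (auto simp: mult_le_cancel_right)
  have "(norm (W *v x))^2 = (W *v x) \<bullet> (W *v x)" by (simp add: power2_norm_eq_inner)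
  also have "\<dots> = x \<bullet> ?z" using W_inner[of x "W *v x"] by (simp add: WW_vec)
  also have "\<dots> \<le> norm x * norm ?z" by (rule norm_cauchy_schwarz)
  also have "\<dots> \<le> norm x * (norm x / c)" using z c by (intro mult_left_mono) (auto simp: field_simps)
  finally show ?thesis by (simp add: power2_eq_square)
qed

lemma W_isometry: "(W *v x) \<bullet> (A *v (W *v x)) = x \<bullet> x"
proof -
  have "(W *v x) \<bullet> (A *v (W *v x)) = (W *v x) \<bullet> (S *v x)" by (simp add: SS_vec[symmetric] SW_vec)
  also have "\<dots> = (S *v (W *v x)) \<bullet> x" by (rule symmetric_inner[OF symS])
  finally show ?thesis by (simp add: SW_vec)
qed

text \<open>The sandwich collapses to \<open>t^2\<close> times the inverse of \<open>A\<close>, with root \<open>t W\<close>.\<close>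

lemma sqrt_inv_sandwich:
  assumes t: "0 < t"
  shows "matrix_inv (matrix_sqrt (matrix_inv A ** (t^2 *\<^sub>R A) ** matrix_inv A)) *v x = (1 / t) *\<^sub>R (S *v x)"
proof -
  have e: "matrix_inv A ** (t^2 *\<^sub>R A) ** matrix_inv A = (t *\<^sub>R W) ** (t *\<^sub>R W)"
    unfolding matrix_eq matrix_vector_mul_assoc[symmetric]
    by (simp add: scaleR_matrix_vector_assoc[symmetric] matrix_vector_mult_scaleR inv_vec WW_vec power2_eq_square)
  have "psd (t *\<^sub>R W)" using psdW t unfolding psd_def
    by (simp add: symmetric_scaleR scaleR_matrix_vector_assoc[symmetric])
  then have "matrix_sqrt (matrix_inv A ** (t^2 *\<^sub>R A) ** matrix_inv A) = t *\<^sub>R W"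
    unfolding e by (rule matrix_sqrt_eqI) simp
  moreover have "matrix_inv (t *\<^sub>R W) = (1 / t) *\<^sub>R S"
  proof (rule matrix_inv_eqI)
    show "(t *\<^sub>R W) ** ((1 / t) *\<^sub>R S) = id_matrix"
      unfolding matrix_eq matrix_vector_mul_assoc[symmetric] using t
      by (simp add: scaleR_matrix_vector_assoc[symmetric] matrix_vector_mult_scaleR SW_vec)
  qed
  ultimately show ?thesis by (simp add: scaleR_matrix_vector_assoc[symmetric])
qed

end

definition L2 :: "'a measure => ('a => real) => bool" where
  "L2 M X \<longleftrightarrow> X \<in> borel_measurable M \<and> integrable M (\<lambda>om. (X om)^2)"

lemma L2_I: "X \<in> borel_measurable M ==> integrable M (\<lambda>om. (X om)^2) ==> L2 M X"
  by (simp add: L2_def)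

lemma L2_meas: "L2 M X ==> X \<in> borel_measurable M" and L2_int: "L2 M X ==> integrable M (\<lambda>om. (X om)^2)"
  by (auto simp: L2_def)

lemma L2_prod: "L2 M X ==> L2 M Y ==> integrable M (\<lambda>om. X om * Y om)"
  by (rule integrable_product_squares) (auto simp: L2_def)

lemma L2_bound:
  assumes "L2 M Y" "X \<in> borel_measurable M" "AE om in M. \<bar>X om\<bar> \<le> \<bar>Y om\<bar>"
  shows "L2 M X"
proof (rule L2_I[OF assms(2)])
  show "integrable M (\<lambda>om. (X om)^2)"
  proof (rule Bochner_Integration.integrable_bound[OF L2_int[OF assms(1)]])
    show "AE om in M. norm ((X om)^2) \<le> norm ((Y om)^2)"
      using assms(3) by eventually_elim (simp add: abs_le_square_iff)
  qed (use assms(2) in simp)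
qed

lemma L2_cmult: "L2 M X ==> L2 M (\<lambda>om. c * X om)"
  by (auto simp: L2_def power_mult_distrib)

lemma L2_add: "L2 M X ==> L2 M Y ==> L2 M (\<lambda>om. X om + Y om)"
proof -
  assume X: "L2 M X" and Y: "L2 M Y"
  have "(\<lambda>om. (X om + Y om)^2) = (\<lambda>om. (X om)^2 + (Y om)^2 + 2 * (X om * Y om))"
    by (simp add: power2_sum mult.assoc)
  then show ?thesis using X Y L2_prod[OF X Y] by (auto simp: L2_def)
qed

lemma L2_zero: "L2 M (\<lambda>_. 0)" by (simp add: L2_def)

lemma L2_sum: "(\<And>i. i \<in> I ==> L2 M (X i)) ==> L2 M (\<lambda>om. \<Sum>i\<in>I. X i om)"
proof (induction I rule: infinite_finite_induct)
  case (insert i I)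
  then show ?case using L2_add[of M "X i" "\<lambda>om. \<Sum>i\<in>I. X i om"] by simp
qed (simp_all add: L2_zero)

lemma L2_diff: "L2 M X ==> L2 M Y ==> L2 M (\<lambda>om. X om - Y om)"
  using L2_add[of M X "\<lambda>om. - 1 * Y om"] L2_cmult[of M Y "- 1"] by simp

lemma L2_cong: "L2 M X ==> (\<And>om. om \<in> space M ==> X om = Y om) ==> L2 M Y"
  unfolding L2_def using measurable_cong[of M X Y borel] Bochner_Integration.integrable_cong[of M M "\<lambda>om. (X om)^2" "\<lambda>om. (Y om)^2"] by auto

lemma (in prob_space) L2_integrable: "L2 M X ==> integrable M X"
  by (rule square_integrable_imp_integrable) (auto simp: L2_def)

lemma (in prob_space) L2_cond_exp: "subalgebra M F ==> L2 M X ==> L2 M (real_cond_exp M F X)"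
  using cond_exp_square(2)[of F X] by (auto simp: L2_def)

context projection
begin

text \<open>The projection removes \<open>e\<close>, the part explained by the controls. The first equation is the normal
  equation, the second Pythagoras for the fitted values.\<close>

lemma ols_error:
  fixes x :: "nat => real ^ 'd" and y e u :: "nat => real" and N :: real
  assumes y: "\<And>i. i \<in> J ==> y i = \<beta> \<bullet> x i + e i + u i" and e: "\<And>i. i \<in> J ==> ap e i = 0"
    and N: "0 < N" and A: "A = (1 / N) *\<^sub>R (\<Sum>i\<in>J. outer (ap x i) (ap x i))" and pd: "pd_matrix c A"
    and bh: "bh = matrix_inv (\<Sum>i\<in>J. outer (ap x i) (ap x i)) *v (\<Sum>i\<in>J. y i *\<^sub>R ap x i)"
    and s: "s = (1 / sqrt N) *\<^sub>R (\<Sum>i\<in>J. u i *\<^sub>R ap x i)"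
  shows "sqrt N *\<^sub>R (bh - \<beta>) = matrix_inv A *v s" (is ?g1)
    and "(\<Sum>i\<in>J. (ap (\<lambda>j. y j - bh \<bullet> x j) i)^2) = (\<Sum>i\<in>J. u i * ap u i) - s \<bullet> (matrix_inv A *v s)" (is ?g2)
proof -
  interpret pd_matrix c A by (rule pd)
  let ?v = "ap x"
  have NA: "(\<Sum>i\<in>J. outer (?v i) (?v i)) = N *\<^sub>R A" using N by (simp add: A)
  have NAx: "(\<Sum>i\<in>J. (?v i \<bullet> b) *\<^sub>R ?v i) = N *\<^sub>R (A *v b)" for b
    unfolding sum_outer_mult_vec[symmetric] NA by (simp add: scaleR_matrix_vector_assoc)
  have inv: "matrix_inv (N *\<^sub>R A) = (1 / N) *\<^sub>R matrix_inv A"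
  proof (rule matrix_inv_eqI)
    show "N *\<^sub>R A ** (1 / N) *\<^sub>R matrix_inv A = id_matrix"
      unfolding matrix_eq matrix_vector_mul_assoc[symmetric] using N
      by (simp add: scaleR_matrix_vector_assoc[symmetric] matrix_vector_mult_scaleR inv_vec)
  qed
  have proj: "(\<Sum>i\<in>J. z i *\<^sub>R ?v i) = (\<Sum>i\<in>J. ap z i *\<^sub>R ?v i)" for z :: "nat => real"
    unfolding ap_adjoint_scaleR by (intro sum.cong refl) (simp add: ap_ap)
  have "(\<Sum>i\<in>J. y i *\<^sub>R ?v i) = (\<Sum>i\<in>J. (\<beta> \<bullet> x i) *\<^sub>R ?v i) + (\<Sum>i\<in>J. e i *\<^sub>R ?v i) + (\<Sum>i\<in>J. u i *\<^sub>R ?v i)"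
    unfolding sum.distrib[symmetric] by (intro sum.cong refl) (simp add: y scaleR_add_left)
  also have "(\<Sum>i\<in>J. (\<beta> \<bullet> x i) *\<^sub>R ?v i) = N *\<^sub>R (A *v \<beta>)"
    unfolding proj[of "\<lambda>i. \<beta> \<bullet> x i"] ap_inner NAx[symmetric] by (simp add: inner_commute)
  also have "(\<Sum>i\<in>J. e i *\<^sub>R ?v i) = 0" unfolding proj[of e] by (simp add: e)
  also have "(\<Sum>i\<in>J. u i *\<^sub>R ?v i) = sqrt N *\<^sub>R s" using N by (simp add: s)
  finally have "bh = (1 / N) *\<^sub>R (matrix_inv A *v (N *\<^sub>R (A *v \<beta>) + sqrt N *\<^sub>R s))"
    unfolding bh NA inv by (simp add: scaleR_matrix_vector_assoc)
  also have "\<dots> = \<beta> + (sqrt N / N) *\<^sub>R (matrix_inv A *v s)"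
    using N by (simp add: matrix_vector_right_distrib matrix_vector_mult_scaleR inv_vec scaleR_add_right)
  finally have "bh = \<beta> + (sqrt N / N) *\<^sub>R (matrix_inv A *v s)" .
  moreover have sN: "sqrt N / N = 1 / sqrt N" using N real_sqrt_mult_self[of N] by (simp add: field_simps)
  ultimately have bd: "bh = \<beta> + (1 / sqrt N) *\<^sub>R (matrix_inv A *v s)"
    using sN by simp
  show b: ?g1 unfolding bd using N by simp
  define d where "d = (1 / sqrt N) *\<^sub>R (matrix_inv A *v s)"
  have res: "ap (\<lambda>j. y j - bh \<bullet> x j) i = ap u i - d \<bullet> ?v i" if i: "i \<in> J" for i
  proof -
    have "ap (\<lambda>j. y j - bh \<bullet> x j) i = ap (\<lambda>j. (e j + u j) - d \<bullet> x j) i"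
      by (rule ap_cong) (simp add: y bd d_def[symmetric] inner_add_left)
    also have "\<dots> = ap (\<lambda>j. e j + u j) i - ap (\<lambda>j. d \<bullet> x j) i" by (rule ap_diff)
    also have "\<dots> = ap u i - d \<bullet> ?v i" by (simp add: ap_add ap_inner e[OF i])
    finally show ?thesis .
  qed
  have cross: "(\<Sum>i\<in>J. ap u i * (d \<bullet> ?v i)) = s \<bullet> (matrix_inv A *v s)"
  proof -
    have "(\<Sum>i\<in>J. ap u i * (d \<bullet> ?v i)) = d \<bullet> (\<Sum>i\<in>J. ap u i *\<^sub>R ?v i)" by (simp add: inner_sum_right)
    also have "\<dots> = d \<bullet> (\<Sum>i\<in>J. u i *\<^sub>R ?v i)" unfolding proj[of u] ..
    also have "(\<Sum>i\<in>J. u i *\<^sub>R ?v i) = sqrt N *\<^sub>R s" using N by (simp add: s)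
    finally show ?thesis using N by (simp add: d_def inner_commute)
  qed
  have sq: "(\<Sum>i\<in>J. (d \<bullet> ?v i)^2) = s \<bullet> (matrix_inv A *v s)"
  proof -
    have "(\<Sum>i\<in>J. (d \<bullet> ?v i)^2) = d \<bullet> (\<Sum>i\<in>J. (?v i \<bullet> d) *\<^sub>R ?v i)"
      by (simp add: inner_sum_right power2_eq_square inner_commute)
    also have "\<dots> = N * (d \<bullet> (A *v d))" unfolding NAx by simp
    also have "\<dots> = s \<bullet> (matrix_inv A *v s)"
      using N by (simp add: d_def matrix_vector_mult_scaleR inv_vec inner_commute)
    finally show ?thesis .
  qed
  have "(\<Sum>i\<in>J. (ap (\<lambda>j. y j - bh \<bullet> x j) i)^2) = (\<Sum>i\<in>J. (ap u i)^2 - 2 * (ap u i * (d \<bullet> ?v i)) + (d \<bullet> ?v i)^2)"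
    by (intro sum.cong refl) (simp add: res power2_diff)
  also have "\<dots> = (\<Sum>i\<in>J. (ap u i)^2) - 2 * (\<Sum>i\<in>J. ap u i * (d \<bullet> ?v i)) + (\<Sum>i\<in>J. (d \<bullet> ?v i)^2)"
    by (simp add: sum.distrib sum_subtractf sum_distrib_left)
  also have "\<dots> = (\<Sum>i\<in>J. (ap u i)^2) - s \<bullet> (matrix_inv A *v s)" unfolding cross sq by simp
  also have "(\<Sum>i\<in>J. (ap u i)^2) = (\<Sum>i\<in>J. u i * ap u i)" using ap_prod[of u u] by (simp add: power2_eq_square)
  finally show ?g2 .
qed

end

section \<open>Weak convergence from characteristic functions\<close>

definition gauss_dens :: "real ^ 'd => real" where
  "gauss_dens z = (\<Prod>a\<in>UNIV. std_normal_density (z $ a))"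

lemma std_normal_vec_eq: "std_normal_vec = density lborel (\<lambda>z. ennreal (gauss_dens z))"
  by (simp add: std_normal_vec_def gauss_dens_def)

lemma gauss_dens_nonneg: "0 \<le> gauss_dens z"
  unfolding gauss_dens_def by (intro prod_nonneg) (simp add: normal_density_nonneg)

lemma measurable_gauss_dens [measurable]: "gauss_dens \<in> borel_measurable borel"
  unfolding gauss_dens_def[abs_def] by measurable

lemma prod_Basis_axis:
  fixes f :: "real ^ 'd => 'b::comm_monoid_mult"
  shows "(\<Prod>b\<in>Basis. f b) = (\<Prod>a\<in>UNIV. f (axis a 1))"
  unfolding Basis_vec_axis by (subst prod.reindex) (auto simp: inj_on_def axis_eq_axis)

text \<open>Lebesgue measure on \<open>real ^ 'd\<close> is the image of the product of lines indexed by the standard basis.\<close>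

lemma lborel_vec_product:
  fixes f :: "'d::finite => real => complex"
  assumes f: "\<And>a. integrable lborel (f a)"
  shows "integrable lborel (\<lambda>z::real ^ 'd. \<Prod>a\<in>UNIV. f a (z $ a))" (is ?g1)
    and "(\<integral>z. (\<Prod>a\<in>UNIV. f a ((z :: real ^ 'd) $ a)) \<partial>lborel) = (\<Prod>a\<in>UNIV. \<integral>x. f a x \<partial>lborel)" (is ?g2)
proof -
  interpret product_sigma_finite "\<lambda>_::real ^ 'd. lborel :: real measure" ..
  define ix where "ix b = (THE a. b = axis a 1)" for b :: "real ^ 'd"
  have ix: "ix (axis a 1) = a" for a unfolding ix_def by (auto simp: axis_eq_axis)
  define h where "h = (\<lambda>x::real ^ 'd => real. \<Sum>b\<in>Basis. x b *\<^sub>R b)"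
  have hm: "h \<in> measurable (Pi\<^sub>M Basis (\<lambda>_. lborel)) borel"
    unfolding h_def by measurable
  have L: "(lborel :: (real ^ 'd) measure) = distr (Pi\<^sub>M Basis (\<lambda>_. lborel)) borel h"
    unfolding lborel_def[where 'a="real ^ 'd"] lborel_eq_real h_def ..
  have fm [measurable]: "f a \<in> borel_measurable borel" for a using f[of a] by auto
  have gm: "(\<lambda>z::real ^ 'd. \<Prod>a\<in>UNIV. f a (z $ a)) \<in> borel_measurable borel" by measurable
  have comp: "(\<Prod>a\<in>UNIV. f a (h x $ a)) = (\<Prod>b\<in>Basis. f (ix b) (x b))" for x
  proof -
    have "h x $ a = x (axis a 1)" for a
    proof -
      have "h x $ a = h x \<bullet> axis a 1" by (simp add: inner_axis)
      also have "\<dots> = x (axis a 1)"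
        unfolding h_def by (rule inner_sum_left_Basis) (simp add: Basis_vec_axis)
      finally show ?thesis .
    qed
    then show ?thesis by (simp add: prod_Basis_axis ix)
  qed
  have ii: "integrable lborel (f (ix b))" for b by (rule f)
  have 1: "integrable (Pi\<^sub>M Basis (\<lambda>_. lborel)) (\<lambda>x. \<Prod>b\<in>(Basis :: (real ^ 'd) set). f (ix b) (x b))"
    by (rule product_integrable_prod[OF finite_Basis ii])
  have 2: "(\<integral>x. (\<Prod>b\<in>(Basis :: (real ^ 'd) set). f (ix b) (x b)) \<partial>Pi\<^sub>M Basis (\<lambda>_. lborel)) = (\<Prod>b\<in>(Basis :: (real ^ 'd) set). \<integral>x. f (ix b) x \<partial>lborel)"
    by (rule product_integral_prod[OF finite_Basis ii])
  show ?g1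
    unfolding L by (subst integrable_distr_eq[OF hm gm]) (simp only: comp 1)
  show ?g2
    unfolding L by (subst integral_distr[OF hm gm]) (simp only: comp 2, simp only: prod_Basis_axis ix)
qed

lemma integrable_gauss_char_1:
  "integrable lborel (\<lambda>x. iexp (t * x) * complex_of_real (std_normal_density x))" (is ?g1)
  "(\<integral>x. iexp (t * x) * complex_of_real (std_normal_density x) \<partial>lborel) = complex_of_real (exp (- t\<^sup>2 / 2))" (is ?g2)
proof -
  have i: "integrable lborel std_normal_density" by simp
  show ?g1
    by (rule Bochner_Integration.integrable_bound[OF i]) (auto simp: norm_mult)
  have "char std_normal_distribution t = complex_of_real (exp (- t\<^sup>2 / 2))"
    by (simp add: char_std_normal_distribution)
  moreover have "char std_normal_distribution t = (\<integral>x. std_normal_density x *\<^sub>R iexp (t * x) \<partial>lborel)"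
    unfolding char_def by (subst integral_density) (auto simp: normal_density_nonneg)
  ultimately show ?g2
    by (simp add: scaleR_conv_of_real mult.commute)
qed

lemma gauss_dens_char_prod:
  fixes t z :: "real ^ 'd"
  shows "iexp (t \<bullet> z) * complex_of_real (gauss_dens z) = (\<Prod>a\<in>UNIV. iexp (t $ a * z $ a) * complex_of_real (std_normal_density (z $ a)))"
  by (simp add: gauss_dens_def prod.distrib inner_vec_def exp_sum sum_distrib_left)

lemma gauss_dens_integral: "integrable lborel (gauss_dens :: real ^ 'd => real)" (is ?g1) "(\<integral>z. gauss_dens (z :: real ^ 'd) \<partial>lborel) = 1" (is ?g2)
  and gauss_dens_char: "(\<integral>z. iexp (t \<bullet> z) * complex_of_real (gauss_dens z) \<partial>lborel) = complex_of_real (exp (- (t \<bullet> t) / 2))" (is ?g3)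
  for t :: "real ^ 'd"
proof -
  have I: "integrable lborel (\<lambda>z. iexp (t \<bullet> z) * complex_of_real (gauss_dens z))" for t :: "real ^ 'd"
    unfolding gauss_dens_char_prod by (rule lborel_vec_product) (rule integrable_gauss_char_1)
  have E: "(\<integral>z. iexp (t \<bullet> z) * complex_of_real (gauss_dens z) \<partial>lborel) = complex_of_real (exp (- (t \<bullet> t) / 2))" for t :: "real ^ 'd"
  proof -
    have "(\<integral>z. iexp (t \<bullet> z) * complex_of_real (gauss_dens z) \<partial>lborel) = (\<Prod>a\<in>UNIV. complex_of_real (exp (- (t $ a)\<^sup>2 / 2)))"
      unfolding gauss_dens_char_prod
      by (subst lborel_vec_product(2)) (simp_all only: integrable_gauss_char_1)
    also have "\<dots> = complex_of_real (exp (\<Sum>a\<in>UNIV. - (t $ a)\<^sup>2 / 2))" by (simp add: exp_sum)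
    also have "(\<Sum>a\<in>UNIV. - (t $ a)\<^sup>2 / 2) = - (t \<bullet> t) / 2"
      by (simp add: inner_vec_def sum_negf sum_divide_distrib power2_eq_square)
    finally show ?thesis .
  qed
  show ?g3 by (rule E)
  have "integrable lborel (\<lambda>z::real ^ 'd. complex_of_real (gauss_dens z))" using I[of 0] by simp
  then show i: ?g1 by (simp only: complex_of_real_integrable_eq)
  have "(\<integral>z. complex_of_real (gauss_dens (z :: real ^ 'd)) \<partial>lborel) = 1" using E[of 0] by simp
  then show ?g2 by (simp add: integral_complex_of_real)
qed

lemma prob_space_std_normal_vec: "prob_space (std_normal_vec :: (real ^ 'd) measure)"
proof
  have "emeasure (std_normal_vec :: (real ^ 'd) measure) (space std_normal_vec) = (\<integral>\<^sup>+ z. ennreal (gauss_dens (z::real ^ 'd)) \<partial>lborel)"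
    unfolding std_normal_vec_eq by (subst emeasure_density) (auto simp: indicator_def intro!: nn_integral_cong)
  also have "\<dots> = ennreal 1"
    using nn_integral_eq_integral[OF gauss_dens_integral(1)] gauss_dens_nonneg gauss_dens_integral(2) by (metis AE_I2)
  finally show "emeasure (std_normal_vec :: (real ^ 'd) measure) (space std_normal_vec) = 1" by simp
qed

lemma sets_std_normal_vec [measurable_cong, simp]: "sets (std_normal_vec :: (real ^ 'd) measure) = sets borel"
  and space_std_normal_vec [simp]: "space (std_normal_vec :: (real ^ 'd) measure) = UNIV"
  unfolding std_normal_vec_eq by simp_all

lemma integral_std_normal_vec:
  fixes f :: "real ^ 'd => 'b::{banach, second_countable_topology}"
  assumes "f \<in> borel_measurable borel"
  shows "(\<integral>z. f z \<partial>std_normal_vec) = (\<integral>z. gauss_dens z *\<^sub>R f z \<partial>lborel)"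
  unfolding std_normal_vec_eq using assms by (subst integral_density) (auto simp: gauss_dens_nonneg)

lemma char_std_normal_vec:
  fixes t :: "real ^ 'd"
  shows "(\<integral>z. iexp (t \<bullet> z) \<partial>std_normal_vec) = complex_of_real (exp (- (t \<bullet> t) / 2))"
  using gauss_dens_char[of t]
  by (subst integral_std_normal_vec) (simp_all add: scaleR_conv_of_real mult.commute)

definition gauss_norm :: "'d itself => real" where "gauss_norm (_::'d itself) = (1 / sqrt (2 * pi)) ^ CARD('d)"

text \<open>The Gaussian density is, up to normalisation, its own characteristic function. This converts means of Gaussian
  bumps into averages of characteristic functions.\<close>

lemma gauss_dens_self_dual:
  fixes t :: "real ^ 'd"
  shows "complex_of_real (gauss_dens t) = complex_of_real (gauss_norm TYPE('d)) * (\<integral>z. iexp (t \<bullet> z) \<partial>std_normal_vec)"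
proof -
  have "gauss_dens t = (\<Prod>a\<in>(UNIV::'d set). (1 / sqrt (2 * pi)) * exp (- (t $ a)\<^sup>2 / 2))"
    unfolding gauss_dens_def by (simp add: std_normal_density_def)
  also have "\<dots> = gauss_norm TYPE('d) * exp (\<Sum>a\<in>UNIV. - (t $ a)\<^sup>2 / 2)"
    unfolding prod.distrib by (simp add: gauss_norm_def exp_sum)
  also have "(\<Sum>a\<in>UNIV. - (t $ a)\<^sup>2 / 2) = - (t \<bullet> t) / 2"
    by (simp add: inner_vec_def sum_negf sum_divide_distrib power2_eq_square)
  finally show ?thesis unfolding char_std_normal_vec by simp
qed

lemma gauss_dens_le: "gauss_dens (t :: real ^ 'd) \<le> gauss_norm TYPE('d)"
proof -
  have "gauss_dens t = gauss_norm TYPE('d) * exp (- (t \<bullet> t) / 2)"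
    using gauss_dens_self_dual[of t] unfolding char_std_normal_vec by (simp flip: of_real_mult)
  also have "\<dots> \<le> gauss_norm TYPE('d) * 1" by (intro mult_left_mono) (auto simp: gauss_norm_def)
  finally show ?thesis by simp
qed

text \<open>By self-duality and Fubini, the mean of a Gaussian bump centred at \<open>Z\<close> depends on \<open>Z\<close> only through
  its characteristic function.\<close>

lemma (in prob_space) expectation_gauss_dens_char:
  fixes Z :: "'a => real ^ 'd" and y :: "real ^ 'd" and h :: real
  assumes Z [measurable]: "Z \<in> borel_measurable M"
  shows "complex_of_real (\<integral>om. gauss_dens (h *\<^sub>R (y - Z om)) \<partial>M) =
    complex_of_real (gauss_norm TYPE('d)) * (\<integral>t. iexp (h * (t \<bullet> y)) * (\<integral>om. iexp ((- h *\<^sub>R t) \<bullet> Z om) \<partial>M) \<partial>std_normal_vec)"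
proof -
  interpret N: prob_space "std_normal_vec :: (real ^ 'd) measure" by (rule prob_space_std_normal_vec)
  interpret P: pair_prob_space M "std_normal_vec :: (real ^ 'd) measure" ..
  have int: "integrable (M \<Otimes>\<^sub>M std_normal_vec) (\<lambda>(om, t). iexp ((h *\<^sub>R (y - Z om)) \<bullet> t))"
    by (rule P.integrable_const_bound[where B=1]) (auto simp: split_beta)
  have "complex_of_real (\<integral>om. gauss_dens (h *\<^sub>R (y - Z om)) \<partial>M) = (\<integral>om. complex_of_real (gauss_dens (h *\<^sub>R (y - Z om))) \<partial>M)"
    by simp
  also have "\<dots> = complex_of_real (gauss_norm TYPE('d)) * (\<integral>om. (\<integral>t. iexp ((h *\<^sub>R (y - Z om)) \<bullet> t) \<partial>std_normal_vec) \<partial>M)"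
    unfolding gauss_dens_self_dual by simp
  also have "(\<integral>om. (\<integral>t. iexp ((h *\<^sub>R (y - Z om)) \<bullet> t) \<partial>std_normal_vec) \<partial>M) = (\<integral>t. (\<integral>om. iexp ((h *\<^sub>R (y - Z om)) \<bullet> t) \<partial>M) \<partial>std_normal_vec)"
    using P.Fubini_integral[OF int] by simp
  also have "\<dots> = (\<integral>t. iexp (h * (t \<bullet> y)) * (\<integral>om. iexp ((- h *\<^sub>R t) \<bullet> Z om) \<partial>M) \<partial>std_normal_vec)"
  proof (intro Bochner_Integration.integral_cong refl)
    fix t :: "real ^ 'd"
    have "iexp ((h *\<^sub>R (y - Z om)) \<bullet> t) = iexp (h * (t \<bullet> y)) * iexp ((- h *\<^sub>R t) \<bullet> Z om)" for om
      by (simp add: exp_add[symmetric] inner_diff_left inner_commute algebra_simps)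
    then show "(\<integral>om. iexp ((h *\<^sub>R (y - Z om)) \<bullet> t) \<partial>M) = iexp (h * (t \<bullet> y)) * (\<integral>om. iexp ((- h *\<^sub>R t) \<bullet> Z om) \<partial>M)"
      by simp
  qed
  finally show ?thesis .
qed

text \<open>Convolution of \<open>f\<close> with a Gaussian of scale \<open>h\<close>.\<close>

definition gauss_smooth :: "real => (real ^ 'd => real) => real ^ 'd => real" where
  "gauss_smooth h f z = (\<integral>x. f (z + h *\<^sub>R x) \<partial>std_normal_vec)"

lemma gauss_smooth_conv:
  fixes f :: "real ^ 'd => real"
  assumes h: "0 < h" and f: "f \<in> borel_measurable borel"
  shows "gauss_smooth h f z = (1 / h ^ CARD('d)) * (\<integral>y. f y * gauss_dens ((1 / h) *\<^sub>R (y - z)) \<partial>lborel)"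
proof -
  have gm: "(\<lambda>y. f y * gauss_dens ((1 / h) *\<^sub>R (y - z))) \<in> borel_measurable borel" using f by measurable
  have "(\<integral>y. f y * gauss_dens ((1 / h) *\<^sub>R (y - z)) \<partial>lborel)
      = (\<integral>y. f y * gauss_dens ((1 / h) *\<^sub>R (y - z)) \<partial>density (distr lborel borel (\<lambda>x. z + h *\<^sub>R x)) (\<lambda>_. ennreal (\<bar>h\<bar> ^ DIM(real ^ 'd))))"
    using lborel_affine[of h z] h by simp
  also have "\<dots> = (\<integral>y. (h ^ CARD('d)) *\<^sub>R (f y * gauss_dens ((1 / h) *\<^sub>R (y - z))) \<partial>distr lborel borel (\<lambda>x. z + h *\<^sub>R x))"
    using h gm by (subst integral_density) (auto simp: abs_of_pos)
  also have "\<dots> = h ^ CARD('d) * (\<integral>x. f (z + h *\<^sub>R x) * gauss_dens x \<partial>lborel)"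
    using h gm by (subst integral_distr) auto
  also have "(\<integral>x. f (z + h *\<^sub>R x) * gauss_dens x \<partial>lborel) = gauss_smooth h f z"
    unfolding gauss_smooth_def using f by (subst integral_std_normal_vec) (auto simp: mult.commute)
  finally show ?thesis using h by simp
qed

lemma gauss_smooth_uniform:
  fixes f :: "real ^ 'd => real"
  assumes uc: "uniformly_continuous_on UNIV f" and fb: "\<And>x. \<bar>f x\<bar> \<le> B" and e: "0 < e"
  shows "\<exists>h>0. \<forall>z. \<bar>gauss_smooth h f z - f z\<bar> \<le> e"
proof -
  interpret N: prob_space "std_normal_vec :: (real ^ 'd) measure" by (rule prob_space_std_normal_vec)
  have fm [measurable]: "f \<in> borel_measurable borel"
    using uc by (intro borel_measurable_continuous_onI uniformly_continuous_imp_continuous)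
  have B0: "0 \<le> B" using fb[of 0] by linarith
  have "(\<lambda>k. measure std_normal_vec {x::real ^ 'd. real k \<le> norm x}) \<longlonglongrightarrow> measure (std_normal_vec :: (real ^ 'd) measure) (\<Inter>k. {x::real ^ 'd. real k \<le> norm x})"
    by (rule N.finite_Lim_measure_decseq) (auto simp: decseq_def intro: order_trans)
  moreover have "(\<Inter>k. {x::real ^ 'd. real k \<le> norm x}) = {}"
    using reals_Archimedean2 not_le by blast
  ultimately have "(\<lambda>k. measure std_normal_vec {x::real ^ 'd. real k \<le> norm x}) \<longlonglongrightarrow> 0" by simp
  from LIMSEQ_D[OF this, of "e / (4 * (B + 1))"] obtain k0 where k0:
    "measure std_normal_vec {x::real ^ 'd. real k \<le> norm x} < e / (4 * (B + 1))" if "k \<ge> k0" for k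
    using e B0 by auto
  define k where "k = Suc k0"
  have k: "k > 0" "measure std_normal_vec {x::real ^ 'd. real k \<le> norm x} < e / (4 * (B + 1))"
    using k0[of k] by (simp_all add: k_def)
  obtain d where d: "d > 0" "\<And>x y. dist x y < d ==> dist (f x) (f y) < e / 2"
    using uc e unfolding uniformly_continuous_on_def by (metis UNIV_I half_gt_zero)
  define h where "h = d / k"
  have h: "h > 0" using d k by (simp add: h_def)
  have "\<bar>gauss_smooth h f z - f z\<bar> \<le> e" for z
  proof -
    have i1: "integrable std_normal_vec (\<lambda>x. f (z + h *\<^sub>R x))"
      by (rule N.integrable_const_bound[where B=B]) (use fb in auto)
    have "gauss_smooth h f z - f z = (\<integral>x. f (z + h *\<^sub>R x) - f z \<partial>std_normal_vec)"
      unfolding gauss_smooth_def using i1 N.prob_space by (simp del: space_std_normal_vec)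
    also have "\<bar>\<dots>\<bar> \<le> (\<integral>x. \<bar>f (z + h *\<^sub>R x) - f z\<bar> \<partial>std_normal_vec)" by (rule integral_abs_bound)
    also have "\<dots> \<le> (\<integral>x. e / 2 + 2 * B * indicator {x::real ^ 'd. real k \<le> norm x} x \<partial>std_normal_vec)"
    proof (rule integral_mono)
      show "integrable std_normal_vec (\<lambda>x. \<bar>f (z + h *\<^sub>R x) - f z\<bar>)" using i1 by simp
      show "integrable std_normal_vec (\<lambda>x::real ^ 'd. e / 2 + 2 * B * indicator {x. real k \<le> norm x} x)"
        by (rule N.integrable_const_bound[where B="e / 2 + 2 * B"]) (use e B0 in \<open>auto simp: indicator_def\<close>)
      fix x :: "real ^ 'd"
      show "\<bar>f (z + h *\<^sub>R x) - f z\<bar> \<le> e / 2 + 2 * B * indicator {x. real k \<le> norm x} x"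
      proof (cases "real k \<le> norm x")
        case True
        then show ?thesis using fb[of "z + h *\<^sub>R x"] fb[of z] e by auto
      next
        case False
        then have "norm (h *\<^sub>R x) < d" using k h d unfolding h_def by (simp add: field_simps)
        then have "dist (z + h *\<^sub>R x) z < d" by (simp add: dist_norm)
        from d(2)[OF this] show ?thesis using False by (simp add: dist_real_def)
      qed
    qed
    also have "\<dots> = e / 2 + 2 * B * measure std_normal_vec {x::real ^ 'd. real k \<le> norm x}"
      by (subst Bochner_Integration.integral_add) (auto simp: N.emeasure_eq_measure N.prob_space[simplified])
    also have "\<dots> \<le> e / 2 + 2 * B * (e / (4 * (B + 1)))"
      using k B0 by (intro add_left_mono mult_left_mono) auto
    also have "\<dots> \<le> e" using B0 e by (simp add: field_simps)
    finally show ?thesis .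
  qed
  then show ?thesis using h by blast
qed

lemma gauss_dens_expectation_tendsto:
  fixes Z :: "nat => 'a => real ^ 'd"
  assumes prob: "\<And>n. prob_space (M n)" and Z: "\<And>n. Z n \<in> borel_measurable (M n)"
    and char: "\<And>s. (\<lambda>n. \<integral>om. iexp (s \<bullet> Z n om) \<partial>M n) \<longlonglongrightarrow> complex_of_real (exp (- (s \<bullet> s) / 2))"
  shows "(\<lambda>n. \<integral>om. gauss_dens (h *\<^sub>R (y - Z n om)) \<partial>M n) \<longlonglongrightarrow> (\<integral>z. gauss_dens (h *\<^sub>R (y - z)) \<partial>std_normal_vec)"
proof -
  interpret N: prob_space "std_normal_vec :: (real ^ 'd) measure" by (rule prob_space_std_normal_vec)
  define c where "c n t = (\<integral>om. iexp ((- h *\<^sub>R t) \<bullet> Z n om) \<partial>M n)" for n and t :: "real ^ 'd"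
  have cm: "c n \<in> borel_measurable std_normal_vec" for n
  proof -
    interpret prob_space "M n" by (rule prob)
    note Z[of n, measurable]
    show ?thesis unfolding c_def[abs_def] by measurable
  qed
  have c1: "cmod (c n t) \<le> 1" for n t
  proof -
    interpret prob_space "M n" by (rule prob)
    have "cmod (c n t) \<le> (\<integral>om. cmod (iexp ((- h *\<^sub>R t) \<bullet> Z n om)) \<partial>M n)" unfolding c_def by (rule integral_norm_bound)
    also have "\<dots> = 1" by (simp add: prob_space)
    finally show ?thesis .
  qed
  have N: "complex_of_real (\<integral>z. gauss_dens (h *\<^sub>R (y - z)) \<partial>std_normal_vec) =
      complex_of_real (gauss_norm TYPE('d)) * (\<integral>t. iexp (h * (t \<bullet> y)) * complex_of_real (exp (- ((- h *\<^sub>R t) \<bullet> (- h *\<^sub>R t)) / 2)) \<partial>std_normal_vec)"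
    using N.expectation_gauss_dens_char[of "\<lambda>z. z" h y] unfolding char_std_normal_vec by simp
  have "(\<lambda>n. \<integral>t. iexp (h * (t \<bullet> y)) * c n t \<partial>std_normal_vec) \<longlonglongrightarrow>
      (\<integral>t. iexp (h * (t \<bullet> y)) * complex_of_real (exp (- ((- h *\<^sub>R t) \<bullet> (- h *\<^sub>R t)) / 2)) \<partial>std_normal_vec)"
  proof (rule integral_dominated_convergence[where w="\<lambda>_. 1"])
    show "AE t in std_normal_vec. (\<lambda>n. iexp (h * (t \<bullet> y)) * c n t) \<longlonglongrightarrow> iexp (h * (t \<bullet> y)) * complex_of_real (exp (- ((- h *\<^sub>R t) \<bullet> (- h *\<^sub>R t)) / 2))"
      unfolding c_def by (intro AE_I2 tendsto_mult tendsto_const char)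
    show "AE t in std_normal_vec. norm (iexp (h * (t \<bullet> y)) * c n t) \<le> 1" for n
      using c1 by (auto simp: norm_mult)
    show "(\<lambda>t. iexp (h * (t \<bullet> y)) * c n t) \<in> borel_measurable std_normal_vec" for n using cm[of n] by measurable
  qed measurable
  then have "(\<lambda>n. complex_of_real (gauss_norm TYPE('d)) * (\<integral>t. iexp (h * (t \<bullet> y)) * c n t \<partial>std_normal_vec)) \<longlonglongrightarrow>
      complex_of_real (\<integral>z. gauss_dens (h *\<^sub>R (y - z)) \<partial>std_normal_vec)"
    unfolding N by (intro tendsto_mult tendsto_const)
  moreover have "complex_of_real (gauss_norm TYPE('d)) * (\<integral>t. iexp (h * (t \<bullet> y)) * c n t \<partial>std_normal_vec) = complex_of_real (\<integral>om. gauss_dens (h *\<^sub>R (y - Z n om)) \<partial>M n)" for n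
    unfolding c_def by (rule prob_space.expectation_gauss_dens_char[OF prob Z, symmetric])
  ultimately have "(\<lambda>n. complex_of_real (\<integral>om. gauss_dens (h *\<^sub>R (y - Z n om)) \<partial>M n)) \<longlonglongrightarrow> complex_of_real (\<integral>z. gauss_dens (h *\<^sub>R (y - z)) \<partial>std_normal_vec)"
    by (simp only:)
  then show ?thesis by (rule tendsto_of_real_iff[THEN iffD1])
qed

lemma abs_gauss_dens_le: "\<bar>gauss_dens (t :: real ^ 'd)\<bar> \<le> gauss_norm TYPE('d)"
  using gauss_dens_le[of t] gauss_dens_nonneg[of t] by simp

lemma abs_mult_gauss_dens_le: "\<bar>r * gauss_dens (t :: real ^ 'd)\<bar> \<le> gauss_norm TYPE('d) * \<bar>r\<bar>"
  unfolding abs_mult mult.commute[of "\<bar>r\<bar>"] by (intro mult_right_mono abs_gauss_dens_le) simp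

text \<open>Writes the mean of the smoothed function as a mixture of Gaussian bumps, to which the limit of
  characteristic functions applies.\<close>

lemma (in prob_space) expectation_gauss_smooth:
  fixes Z :: "'a => real ^ 'd" and f :: "real ^ 'd => real"
  assumes h: "0 < h" and Z [measurable]: "Z \<in> borel_measurable M" and f: "integrable lborel f"
  shows "(\<integral>om. gauss_smooth h f (Z om) \<partial>M) = (1 / h ^ CARD('d)) * (\<integral>y. f y * (\<integral>om. gauss_dens ((1 / h) *\<^sub>R (y - Z om)) \<partial>M) \<partial>lborel)"
proof -
  interpret P: pair_sigma_finite M "lborel :: (real ^ 'd) measure" ..
  have fm [measurable]: "f \<in> borel_measurable borel" using f by auto
  let ?g = "\<lambda>om y. f y * gauss_dens ((1 / h) *\<^sub>R (y - Z om))"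
  have i1: "integrable lborel (?g om)" for om
  proof (rule Bochner_Integration.integrable_bound[where f="\<lambda>y. gauss_norm TYPE('d) * \<bar>f y\<bar>"])
    show "AE y in lborel. norm (?g om y) \<le> norm (gauss_norm TYPE('d) * \<bar>f y\<bar>)"
      using abs_mult_gauss_dens_le by (intro AE_I2) (auto intro: order_trans[OF _ abs_ge_self])
  qed (use f in auto)
  have bd: "(\<integral>y. norm (?g om y) \<partial>lborel) \<le> (\<integral>y. gauss_norm TYPE('d) * \<bar>f y\<bar> \<partial>lborel)" for om
  proof (rule integral_mono)
    show "integrable lborel (\<lambda>y. norm (?g om y))" using i1 by (rule integrable_norm)
    show "norm (?g om y) \<le> gauss_norm TYPE('d) * \<bar>f y\<bar>" for y
      unfolding real_norm_def by (rule abs_mult_gauss_dens_le)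
  qed (use f in auto)
  have int: "integrable (M \<Otimes>\<^sub>M lborel) (\<lambda>(om, y). ?g om y)"
  proof (rule P.Fubini_integrable)
    show "integrable M (\<lambda>om. \<integral>y. norm (case (om, y) of (om, y) => ?g om y) \<partial>lborel)"
      by (rule integrable_const_bound[where B="\<integral>y. gauss_norm TYPE('d) * \<bar>f y\<bar> \<partial>lborel"]) (use bd in auto)
  qed (use i1 in auto)
  have "(\<integral>om. gauss_smooth h f (Z om) \<partial>M) = (1 / h ^ CARD('d)) * (\<integral>om. (\<integral>y. ?g om y \<partial>lborel) \<partial>M)"
    by (subst gauss_smooth_conv[OF h fm]) simp
  also have "(\<integral>om. (\<integral>y. ?g om y \<partial>lborel) \<partial>M) = (\<integral>y. (\<integral>om. ?g om y \<partial>M) \<partial>lborel)"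
    using P.Fubini_integral[OF int] by simp
  also have "\<dots> = (\<integral>y. f y * (\<integral>om. gauss_dens ((1 / h) *\<^sub>R (y - Z om)) \<partial>M) \<partial>lborel)" by simp
  finally show ?thesis .
qed

lemma gauss_smooth_expectation_tendsto:
  fixes Z :: "nat => 'a => real ^ 'd"
  assumes prob: "\<And>n. prob_space (M n)" and Z: "\<And>n. Z n \<in> borel_measurable (M n)"
    and char: "\<And>s. (\<lambda>n. \<integral>om. iexp (s \<bullet> Z n om) \<partial>M n) \<longlonglongrightarrow> complex_of_real (exp (- (s \<bullet> s) / 2))"
    and h: "0 < h" and f: "integrable lborel f"
  shows "(\<lambda>n. \<integral>om. gauss_smooth h f (Z n om) \<partial>M n) \<longlonglongrightarrow> (\<integral>z. gauss_smooth h f z \<partial>std_normal_vec)"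
proof -
  interpret N: prob_space "std_normal_vec :: (real ^ 'd) measure" by (rule prob_space_std_normal_vec)
  have fm [measurable]: "f \<in> borel_measurable borel" using f by auto
  have em: "(\<lambda>y. \<integral>om. gauss_dens ((1 / h) *\<^sub>R (y - Z n om)) \<partial>M n) \<in> borel_measurable borel" for n
  proof -
    interpret prob_space "M n" by (rule prob)
    note Z[of n, measurable]
    show ?thesis by measurable
  qed
  have bnd: "0 \<le> (\<integral>om. gauss_dens ((1 / h) *\<^sub>R (y - Z n om)) \<partial>M n)" "(\<integral>om. gauss_dens ((1 / h) *\<^sub>R (y - Z n om)) \<partial>M n) \<le> gauss_norm TYPE('d)" for n y
  proof -
    interpret prob_space "M n" by (rule prob)
    note Z[of n, measurable]
    show "0 \<le> (\<integral>om. gauss_dens ((1 / h) *\<^sub>R (y - Z n om)) \<partial>M n)" by (intro integral_nonneg_AE AE_I2 gauss_dens_nonneg)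
    have "integrable (M n) (\<lambda>om. gauss_dens ((1 / h) *\<^sub>R (y - Z n om)))"
      by (rule integrable_const_bound[where B="gauss_norm TYPE('d)"]) (use abs_gauss_dens_le in auto)
    then have "(\<integral>om. gauss_dens ((1 / h) *\<^sub>R (y - Z n om)) \<partial>M n) \<le> (\<integral>om. gauss_norm TYPE('d) \<partial>M n)"
      by (rule integral_mono) (auto intro: gauss_dens_le)
    then show "(\<integral>om. gauss_dens ((1 / h) *\<^sub>R (y - Z n om)) \<partial>M n) \<le> gauss_norm TYPE('d)" by (simp add: prob_space)
  qed
  have "(\<lambda>n. \<integral>y. f y * (\<integral>om. gauss_dens ((1 / h) *\<^sub>R (y - Z n om)) \<partial>M n) \<partial>lborel) \<longlonglongrightarrow>
      (\<integral>y. f y * (\<integral>z. gauss_dens ((1 / h) *\<^sub>R (y - z)) \<partial>std_normal_vec) \<partial>lborel)"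
  proof (rule integral_dominated_convergence[where w="\<lambda>y. gauss_norm TYPE('d) * \<bar>f y\<bar>"])
    show "AE y in lborel. (\<lambda>n. f y * (\<integral>om. gauss_dens ((1 / h) *\<^sub>R (y - Z n om)) \<partial>M n)) \<longlonglongrightarrow> f y * (\<integral>z. gauss_dens ((1 / h) *\<^sub>R (y - z)) \<partial>std_normal_vec)"
      by (intro AE_I2 tendsto_mult tendsto_const gauss_dens_expectation_tendsto prob Z char)
    show "AE y in lborel. norm (f y * (\<integral>om. gauss_dens ((1 / h) *\<^sub>R (y - Z n om)) \<partial>M n)) \<le> gauss_norm TYPE('d) * \<bar>f y\<bar>" for n
      using bnd by (auto simp: abs_mult mult.commute[of "\<bar>f _\<bar>"] intro!: mult_right_mono)
    show "(\<lambda>y. f y * (\<integral>om. gauss_dens ((1 / h) *\<^sub>R (y - Z n om)) \<partial>M n)) \<in> borel_measurable lborel" for n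
      using em[of n] by measurable
    show "(\<lambda>y. f y * (\<integral>z. gauss_dens ((1 / h) *\<^sub>R (y - z)) \<partial>std_normal_vec)) \<in> borel_measurable lborel" by measurable
    show "integrable lborel (\<lambda>y. gauss_norm TYPE('d) * \<bar>f y\<bar>)" using f by simp
  qed
  then have "(\<lambda>n. (1 / h ^ CARD('d)) * (\<integral>y. f y * (\<integral>om. gauss_dens ((1 / h) *\<^sub>R (y - Z n om)) \<partial>M n) \<partial>lborel)) \<longlonglongrightarrow>
      (1 / h ^ CARD('d)) * (\<integral>y. f y * (\<integral>z. gauss_dens ((1 / h) *\<^sub>R (y - z)) \<partial>std_normal_vec) \<partial>lborel)"
    by (intro tendsto_mult tendsto_const)
  moreover have "(1 / h ^ CARD('d)) * (\<integral>y. f y * (\<integral>z. gauss_dens ((1 / h) *\<^sub>R (y - z)) \<partial>std_normal_vec) \<partial>lborel) = (\<integral>z. gauss_smooth h f z \<partial>std_normal_vec)"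
    using N.expectation_gauss_smooth[OF h _ f, of "\<lambda>z. z"] by simp
  ultimately show ?thesis
    by (simp only: prob_space.expectation_gauss_smooth[OF prob h Z f])
qed

text \<open>Compact support makes \<open>f\<close> integrable and uniformly continuous, so it can be smoothed at a uniformly small
  cost before the limit is taken; uniform continuity also absorbs the step from \<open>Z\<close> to \<open>T\<close>.\<close>

lemma compact_support_expectation_tendsto:
  fixes Z T :: "nat => 'a => real ^ 'd" and f :: "real ^ 'd => real"
  assumes prob: "\<And>n. prob_space (M n)" and Z: "\<And>n. Z n \<in> borel_measurable (M n)" and T: "\<And>n. T n \<in> borel_measurable (M n)"
    and char: "\<And>s. (\<lambda>n. \<integral>om. iexp (s \<bullet> Z n om) \<partial>M n) \<longlonglongrightarrow> complex_of_real (exp (- (s \<bullet> s) / 2))"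
    and close: "\<And>d. 0 < d ==> whp M (\<lambda>n om. norm (T n om - Z n om) \<le> d)"
    and f: "continuous_on UNIV f" and supp: "\<And>x. norm x > r ==> f x = 0"
  shows "(\<lambda>n. \<integral>om. f (T n om) \<partial>M n) \<longlonglongrightarrow> (\<integral>z. f z \<partial>std_normal_vec)"
proof (rule LIMSEQ_I)
  interpret N: prob_space "std_normal_vec :: (real ^ 'd) measure" by (rule prob_space_std_normal_vec)
  fix e :: real assume e: "0 < e"
  have fm [measurable]: "f \<in> borel_measurable borel" using f by (rule borel_measurable_continuous_onI)
  have "bounded (f ` cball 0 r)"
    by (intro compact_imp_bounded compact_continuous_image continuous_on_subset[OF f]) auto
  then obtain B where B: "B > 0" "\<And>x. x \<in> cball 0 r ==> \<bar>f x\<bar> \<le> B"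
    unfolding bounded_pos by (auto simp: image_iff)
  have fb: "\<bar>f x\<bar> \<le> B" for x
    using B supp[of x] by (cases "norm x > r") (auto simp: dist_norm)
  have uc: "uniformly_continuous_on UNIV f"
    unfolding uniformly_continuous_on_def
  proof (intro allI impI)
    fix e :: real assume e: "0 < e"
    have "uniformly_continuous_on (cball 0 (r + 1)) f"
      by (intro compact_uniformly_continuous continuous_on_subset[OF f]) auto
    then obtain d where d: "d > 0" "\<And>x y. x \<in> cball 0 (r + 1) ==> y \<in> cball 0 (r + 1) ==> dist y x < d ==> dist (f y) (f x) < e"
      unfolding uniformly_continuous_on_def using e by metis
    show "\<exists>d>0. \<forall>x\<in>UNIV. \<forall>x'\<in>UNIV. dist x' x < d \<longrightarrow> dist (f x') (f x) < e"
    proof (intro exI[of _ "min d 1"] conjI ballI impI)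
      fix x y :: "real ^ 'd" assume xy: "dist y x < min d 1"
      have n: "norm y \<le> norm x + dist y x" "norm x \<le> norm y + dist y x"
        using norm_triangle_sub[of y x] norm_triangle_sub[of x y] by (auto simp: dist_norm norm_minus_commute)
      show "dist (f y) (f x) < e"
      proof (cases "norm x \<le> r + 1 \<and> norm y \<le> r + 1")
        case True
        then show ?thesis using d(2)[of x y] xy by simp
      next
        case False
        then have "norm x > r" "norm y > r" using n xy by auto
        then show ?thesis using supp e by simp
      qed
    qed (use d in auto)
  qed
  have fint: "integrable lborel f"
  proof -
    have "integrable lborel (\<lambda>x. indicator (cball 0 r) x *\<^sub>R f x)"
      by (rule borel_integrable_compact) (auto intro: continuous_on_subset[OF f])
    moreover have "(\<lambda>x. indicator (cball 0 r) x *\<^sub>R f x) = f"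
      using supp by (intro ext) (auto simp: indicator_def not_le)
    ultimately show ?thesis by (simp only:)
  qed
  obtain h where h: "h > 0" "\<And>z. \<bar>gauss_smooth h f z - f z\<bar> \<le> e / 8"
    using gauss_smooth_uniform[OF uc fb, of "e / 8"] e by auto
  obtain d where d: "d > 0" "\<And>x y. dist x y < d ==> dist (f x) (f y) < e / 8"
    using uc e unfolding uniformly_continuous_on_def by (metis UNIV_I divide_pos_pos zero_less_numeral)
  have gm [measurable]: "gauss_smooth h f \<in> borel_measurable borel"
    unfolding gauss_smooth_def[abs_def] by measurable
  have gb: "\<bar>gauss_smooth h f z\<bar> \<le> B + e" for z using h(2)[of z] fb[of z] e by linarith
  have lim: "\<forall>\<^sub>F n in sequentially. \<bar>(\<integral>om. gauss_smooth h f (Z n om) \<partial>M n) - (\<integral>z. gauss_smooth h f z \<partial>std_normal_vec)\<bar> < e / 8"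
    using tendstoD[OF gauss_smooth_expectation_tendsto[OF prob Z char h(1) fint], of "e / 8"] e by (simp add: dist_real_def)
  have sN: "\<bar>(\<integral>z. gauss_smooth h f z \<partial>std_normal_vec) - (\<integral>z. f z \<partial>std_normal_vec)\<bar> \<le> e / 8 + 2 * (B + e) * 0"
    using fb gb h(2) e by (intro N.expectation_diff_with_prob N.with_prob_AE) (auto intro: order_trans[OF fb])
  have "\<forall>\<^sub>F n in sequentially. with_prob (M n) (e / (16 * B)) (\<lambda>om. norm (T n om - Z n om) \<le> d / 2)"
    using close[of "d / 2"] d e B by (simp add: whp_def)
  with lim have "\<forall>\<^sub>F n in sequentially. norm ((\<integral>om. f (T n om) \<partial>M n) - (\<integral>z. f z \<partial>std_normal_vec)) < e"
  proof eventually_elim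
    case (elim n)
    interpret prob_space "M n" by (rule prob)
    note Z[of n, measurable] T[of n, measurable]
    have "\<bar>(\<integral>om. f (T n om) \<partial>M n) - (\<integral>om. f (Z n om) \<partial>M n)\<bar> \<le> e / 8 + 2 * B * (e / (16 * B))"
    proof (rule expectation_diff_with_prob)
      show "with_prob (M n) (e / (16 * B)) (\<lambda>om. \<bar>f (T n om) - f (Z n om)\<bar> \<le> e / 8)"
      proof (rule with_prob_mono[OF elim(2)])
        fix om assume "norm (T n om - Z n om) \<le> d / 2"
        then have "dist (T n om) (Z n om) < d" using d by (simp add: dist_norm)
        from d(2)[OF this] show "\<bar>f (T n om) - f (Z n om)\<bar> \<le> e / 8" by (simp add: dist_real_def)
      qed simp
    qed (use fb e in auto)
    also have "\<dots> = e / 4" using B by (simp add: field_simps)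
    finally have 1: "\<bar>(\<integral>om. f (T n om) \<partial>M n) - (\<integral>om. f (Z n om) \<partial>M n)\<bar> \<le> e / 4" .
    have 2: "\<bar>(\<integral>om. gauss_smooth h f (Z n om) \<partial>M n) - (\<integral>om. f (Z n om) \<partial>M n)\<bar> \<le> e / 8 + 2 * (B + e) * 0"
      using fb gb h(2) e by (intro expectation_diff_with_prob with_prob_AE) (auto intro: order_trans[OF fb])
    show ?case using 1 2 sN elim(1) e unfolding real_norm_def mult_zero_right by linarith
  qed
  then show "\<exists>no. \<forall>n\<ge>no. norm ((\<integral>om. f (T n om) \<partial>M n) - (\<integral>z. f z \<partial>std_normal_vec)) < e"
    by (simp add: eventually_sequentially)
qed

text \<open>The mass beyond the cut-off \<open>k\<close> is measured by the mean of \<open>k\<close> itself. As this mean converges,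
  tightness comes with it.\<close>

lemma (in prob_space) truncation_error_bound:
  fixes f k :: "'b::topological_space => real"
  assumes X [measurable]: "X \<in> borel_measurable M" and [measurable]: "f \<in> borel_measurable borel" "k \<in> borel_measurable borel"
    and B: "\<And>x. \<bar>f x\<bar> \<le> B" and k01: "\<And>x. 0 \<le> k x" "\<And>x. k x \<le> 1"
  shows "\<bar>(\<integral>x. f (X x) \<partial>M) - (\<integral>x. f (X x) * k (X x) \<partial>M)\<bar> \<le> B * (1 - (\<integral>x. k (X x) \<partial>M))"
proof -
  have cut: "\<bar>f x - f x * k x\<bar> \<le> B * (1 - k x)" for x
  proof -
    have "f x - f x * k x = f x * (1 - k x)" by (simp add: right_diff_distrib)
    then have "\<bar>f x - f x * k x\<bar> = \<bar>f x\<bar> * (1 - k x)" using k01[of x] by (simp only: abs_mult)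
    also have "\<dots> \<le> B * (1 - k x)" using B k01 by (intro mult_right_mono) auto
    finally show ?thesis .
  qed
  have fk: "\<bar>f x * k x\<bar> \<le> B" for x
  proof -
    have "\<bar>f x * k x\<bar> \<le> \<bar>f x\<bar> * 1" unfolding abs_mult using k01[of x] by (intro mult_left_mono) auto
    then show ?thesis using B[of x] by simp
  qed
  have i: "integrable M (\<lambda>x. f (X x))" "integrable M (\<lambda>x. f (X x) * k (X x))"
    by (rule integrable_const_bound[where B=B], use B fk in auto)+
  have i3: "integrable M (\<lambda>x. k (X x))" by (rule integrable_const_bound[where B=1]) (use k01 in auto)
  have "\<bar>(\<integral>x. f (X x) \<partial>M) - (\<integral>x. f (X x) * k (X x) \<partial>M)\<bar> = \<bar>\<integral>x. f (X x) - f (X x) * k (X x) \<partial>M\<bar>" using i by simp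
  also have "\<dots> \<le> (\<integral>x. \<bar>f (X x) - f (X x) * k (X x)\<bar> \<partial>M)" by (rule integral_abs_bound)
  also have "\<dots> \<le> (\<integral>x. B * (1 - k (X x)) \<partial>M)" by (rule integral_mono) (use i i3 cut in auto)
  also have "\<dots> = B * (1 - (\<integral>x. k (X x) \<partial>M))" using i3 by (simp add: prob_space)
  finally show ?thesis .
qed

text \<open>Levy's continuity theorem for the standard normal limit, combined with Slutsky's: the statistic \<open>T\<close> may differ from
  \<open>Z\<close> by a term that vanishes in probability.\<close>

theorem weak_conv_vec_of_char:
  fixes Z T :: "nat => 'a => real ^ 'd"
  assumes prob: "\<And>n. prob_space (M n)" and Z: "\<And>n. Z n \<in> borel_measurable (M n)" and T: "\<And>n. T n \<in> borel_measurable (M n)"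
    and char: "\<And>s. (\<lambda>n. \<integral>om. iexp (s \<bullet> Z n om) \<partial>M n) \<longlonglongrightarrow> complex_of_real (exp (- (s \<bullet> s) / 2))"
    and close: "\<And>d. 0 < d ==> whp M (\<lambda>n om. norm (T n om - Z n om) \<le> d)"
  shows "weak_conv_vec (\<lambda>n. distr (M n) borel (T n)) std_normal_vec"
  unfolding weak_conv_vec_def
proof (intro allI impI)
  interpret N: prob_space "std_normal_vec :: (real ^ 'd) measure" by (rule prob_space_std_normal_vec)
  fix f :: "real ^ 'd => real" assume f: "continuous_on UNIV f" and bf: "bounded (range f)"
  obtain B where B: "B > 0" "\<And>x. \<bar>f x\<bar> \<le> B" using bf unfolding bounded_pos by auto
  have fm [measurable]: "f \<in> borel_measurable borel" using f by (rule borel_measurable_continuous_onI)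
  define k where "k r x = max 0 (min 1 (r + 1 - norm x))" for r :: real and x :: "real ^ 'd"
  have kc: "continuous_on UNIV (k r)" for r unfolding k_def[abs_def] by (intro continuous_intros)
  have km [measurable]: "k r \<in> borel_measurable borel" for r using kc by (rule borel_measurable_continuous_onI)
  have k01: "0 \<le> k r x" "k r x \<le> 1" for r x by (auto simp: k_def)
  have ksupp: "k r x = 0" if "norm x > r + 1" for r x using that by (simp add: k_def)
  note cut_int = prob_space.truncation_error_bound[OF _ _ fm km B(2) k01]
  show "(\<lambda>n. \<integral>z. f z \<partial>distr (M n) borel (T n)) \<longlonglongrightarrow> (\<integral>z. f z \<partial>std_normal_vec)"
  proof (rule LIMSEQ_I)
    fix e :: real assume e: "0 < e"
    have "(\<lambda>j. \<integral>z. k (real j) z \<partial>std_normal_vec) \<longlonglongrightarrow> (\<integral>z. 1 \<partial>(std_normal_vec :: (real ^ 'd) measure))"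
    proof (rule integral_dominated_convergence[where w="\<lambda>_. 1"])
      have "\<forall>\<^sub>F j in sequentially. k (real j) z = 1" for z
        using eventually_ge_at_top[of "nat \<lceil>norm z\<rceil>"] by eventually_elim (simp add: k_def)
      then show "AE z in std_normal_vec. (\<lambda>j. k (real j) z) \<longlonglongrightarrow> 1" by (intro AE_I2 tendsto_eventually)
    qed (use k01 in auto)
    then have "(\<lambda>j. \<integral>z. k (real j) z \<partial>std_normal_vec) \<longlonglongrightarrow> 1" by (simp add: N.prob_space[simplified])
    from LIMSEQ_D[OF this, of "e / (8 * B)"] obtain j where "\<bar>(\<integral>z. k (real j) z \<partial>std_normal_vec) - 1\<bar> < e / (8 * B)"
      using e B by auto
    then have j: "B * (1 - (\<integral>z. k (real j) z \<partial>std_normal_vec)) \<le> e / 8"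
      using B by (simp add: abs_less_iff field_simps)
    let ?k = "k (real j)"
    have l1: "(\<lambda>n. \<integral>om. ?k (T n om) \<partial>M n) \<longlonglongrightarrow> (\<integral>z. ?k z \<partial>std_normal_vec)"
      by (rule compact_support_expectation_tendsto[OF prob Z T char close kc ksupp])
    have l2: "(\<lambda>n. \<integral>om. f (T n om) * ?k (T n om) \<partial>M n) \<longlonglongrightarrow> (\<integral>z. f z * ?k z \<partial>std_normal_vec)"
      by (rule compact_support_expectation_tendsto[OF prob Z T char close, where f="\<lambda>z. f z * ?k z" and r="real j + 1"])
        (use ksupp in \<open>auto intro!: continuous_intros f kc\<close>)
    have e1: "\<forall>\<^sub>F n in sequentially. \<bar>(\<integral>om. ?k (T n om) \<partial>M n) - (\<integral>z. ?k z \<partial>std_normal_vec)\<bar> < e / (8 * B)"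
      using tendstoD[OF l1, of "e / (8 * B)"] e B by (simp add: dist_real_def)
    have e2: "\<forall>\<^sub>F n in sequentially. \<bar>(\<integral>om. f (T n om) * ?k (T n om) \<partial>M n) - (\<integral>z. f z * ?k z \<partial>std_normal_vec)\<bar> < e / 8"
      using tendstoD[OF l2, of "e / 8"] e by (simp add: dist_real_def)
    from e1 e2 have "\<forall>\<^sub>F n in sequentially. norm ((\<integral>z. f z \<partial>distr (M n) borel (T n)) - (\<integral>z. f z \<partial>std_normal_vec)) < e"
    proof eventually_elim
      case (elim n)
      have eq: "(\<integral>z. f z \<partial>distr (M n) borel (T n)) = (\<integral>om. f (T n om) \<partial>M n)"
        by (rule integral_distr[OF T fm])
      have a: "\<bar>(\<integral>om. f (T n om) \<partial>M n) - (\<integral>om. f (T n om) * ?k (T n om) \<partial>M n)\<bar> \<le> B * (1 - (\<integral>om. ?k (T n om) \<partial>M n))"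
        by (rule cut_int[OF prob T])
      have b: "\<bar>(\<integral>z. f z \<partial>std_normal_vec) - (\<integral>z. f z * ?k z \<partial>std_normal_vec)\<bar> \<le> B * (1 - (\<integral>z. ?k z \<partial>std_normal_vec))"
        using cut_int[OF prob_space_std_normal_vec, of "\<lambda>z. z"] by simp
      have "B * \<bar>(\<integral>om. ?k (T n om) \<partial>M n) - (\<integral>z. ?k z \<partial>std_normal_vec)\<bar> \<le> B * (e / (8 * B))"
        using elim(1) B by (intro mult_left_mono) auto
      then have "B * \<bar>(\<integral>om. ?k (T n om) \<partial>M n) - (\<integral>z. ?k z \<partial>std_normal_vec)\<bar> \<le> e / 8" using B by simp
      moreover have "B * (1 - (\<integral>om. ?k (T n om) \<partial>M n)) \<le> B * (1 - (\<integral>z. ?k z \<partial>std_normal_vec)) + B * \<bar>(\<integral>om. ?k (T n om) \<partial>M n) - (\<integral>z. ?k z \<partial>std_normal_vec)\<bar>"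
        using B unfolding distrib_left[symmetric] by (intro mult_left_mono) auto
      ultimately show ?case using a b j elim(2) e unfolding eq real_norm_def by linarith
    qed
    then show "\<exists>no. \<forall>n\<ge>no. norm ((\<integral>z. f z \<partial>distr (M n) borel (T n)) - (\<integral>z. f z \<partial>std_normal_vec)) < e"
      by (simp add: eventually_sequentially)
  qed
qed

section \<open>The regression model\<close>

locale many_covariates =
  fixes M F :: "nat => 'a measure"
    and K N :: "nat => nat"
    and x :: "nat => nat => 'a => real ^ 'd"
    and w :: "nat => nat => 'a => real Matrix.vec"
    and y u :: "nat => nat => 'a => real"
    and \<beta> :: "real ^ 'd"
    and \<gamma> :: "nat => real Matrix.vec"
    and T :: "nat => nat => nat set"
    and \<sigma> :: "nat => real"
  assumes prob: "\<And>n. prob_space (M n)"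
    and subalg: "\<And>n. subalgebra (M n) (F n)"
    and x_meas: "\<And>n i. i \<in> {1..n} ==> x n i \<in> borel_measurable (M n)"
    and u_meas: "\<And>n i. i \<in> {1..n} ==> u n i \<in> borel_measurable (M n)"
    and w_dim: "\<And>n i om. i \<in> {1..n} ==> om \<in> space (M n) ==> w n i om \<in> carrier_vec (K n)"
    and w_meas: "\<And>n i k. i \<in> {1..n} ==> k < K n ==>
      (\<lambda>om. vec_index (w n i om) k) \<in> borel_measurable (M n)"
    and \<gamma>_dim: "\<And>n. \<gamma> n \<in> carrier_vec (K n)"
    and model: "\<And>n i om. i \<in> {1..n} ==> om \<in> space (M n) ==>
      y n i om = \<beta> \<bullet> x n i om + scalar_prod (\<gamma> n) (w n i om) + u n i om"
    and x_moment: "\<And>n i. i \<in> {1..n} ==> integrable (M n) (\<lambda>om. (norm (x n i om))^2)"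
    and u_moment: "\<And>n i. i \<in> {1..n} ==> integrable (M n) (\<lambda>om. (u n i om)^2)"
    and w_moment: "\<And>n i k. i \<in> {1..n} ==> k < K n ==>
      integrable (M n) (\<lambda>om. (vec_index (w n i om) k)^2)"
    and w_cond: "\<And>n i k. i \<in> {1..n} ==> k < K n ==> AE om in M n.
      real_cond_exp (M n) (F n) (\<lambda>om. vec_index (w n i om) k) om = vec_index (w n i om) k"
    and sampling_cov: "\<And>n i j. i \<in> {1..n} ==> j \<in> {1..n} ==> i \<noteq> j ==> AE om in M n.
      cond_cov (M n) (XW M F x n) (U_err M F x y n i) (U_err M F x y n j) om = 0"
    and sampling_partition: "\<And>n. partition_on {1..n} (T n ` {1..N n})" "\<And>n. inj_on (T n) {1..N n}"
    and sampling_card: "(\<lambda>n. real (MAX i\<in>{1..N n}. card (T n i))) \<in> O(\<lambda>_. 1)"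
    and sampling_indep: "\<And>n. cond_indep_vars (M n) (F n)
      (\<lambda>i. Pi\<^sub>M (T n i) (\<lambda>_. borel \<Otimes>\<^sub>M borel))
      (\<lambda>i om. \<lambda>t\<in>T n i. (U_err M F x y n t om, V_err M F x n t om)) {1..N n}"
    and design_rank: "(\<lambda>n. measure (M n)
      {om \<in> space (M n). min_eigenvalue_mat (gram K w n om) > 0}) \<longlonglongrightarrow> 1"
    and design_dim: "limsup (\<lambda>n. ereal (real (K n) / real n)) < 1"
    and design_C: "bounded_in_prob M (C_n M F K w x y)"
    and approx_chi: "chi_n M F K w x \<in> O(\<lambda>_. 1)"
    and approx_rho: "(\<lambda>n. varrho_n M F x u n
        + real n * (varrho_n M F x u n - rho_n M F u n)
        + real n * chi_n M F K w x n * varrho_n M F x u n) \<in> o(\<lambda>_. 1)"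
    and approx_v: "vanishes_in_prob M
      (\<lambda>n om. (MAX i\<in>{1..n}. norm (v_hat K w x n i om)) / sqrt (real n))"
    and homoskedastic: "\<And>n i. i \<in> {1..n} ==> AE om in M n.
      real_cond_exp (M n) (XW M F x n) (\<lambda>om. (U_err M F x y n i om)^2) om = (\<sigma> n)^2"
begin

abbreviation "XF n \<equiv> XW M F x n"
abbreviation "U \<equiv> U_err M F x y"
abbreviation "V \<equiv> V_err M F x"
abbreviation "R \<equiv> R_err M F x u"
abbreviation "r \<equiv> r_err M F u"
abbreviation "Q \<equiv> Q_err M F K w x"
abbreviation "EF n \<equiv> real_cond_exp (M n) (F n)"
abbreviation "EXF n \<equiv> real_cond_exp (M n) (XF n)"
abbreviation "NF n \<equiv> nn_cond_exp (M n) (F n)"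
abbreviation "NXF n \<equiv> nn_cond_exp (M n) (XF n)"
abbreviation "vhat \<equiv> v_hat K w x"
abbreviation "Gammahat \<equiv> Gamma_hat K w x"
abbreviation "betahat \<equiv> beta_hat K w x y"
abbreviation "uhat \<equiv> u_hat K w x y"
abbreviation "sigmahat2 \<equiv> sigma2_hat K w x y"
abbreviation "Omegahat \<equiv> Omega_hat K w x (Sigma_HO K w x y)"
abbreviation "Vtilde \<equiv> V_tilde M F K w x"
abbreviation "Gammatilde \<equiv> Gamma_tilde M F K w x"
abbreviation "chi \<equiv> chi_n M F K w x"
abbreviation "varrho \<equiv> varrho_n M F x u"
abbreviation "rho \<equiv> rho_n M F u"
abbreviation "Cn \<equiv> C_n M F K w x y"
abbreviation "pairs n \<equiv> {1..n::nat} \<times> {1..n}"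

lemma space_F: "space (F n) = space (M n)" and sets_F: "sets (F n) \<subseteq> sets (M n)"
  using subalg[of n] by (auto simp: subalgebra_def)

lemma XF_gen: "sets (F n) \<union> (\<Union>i\<in>{1..n}. {x n i -` A \<inter> space (M n) | A. A \<in> sets borel}) \<subseteq> sets (M n)"
proof -
  have "x n i -` A \<inter> space (M n) \<in> sets (M n)" if "i \<in> {1..n}" "A \<in> sets borel" for i A
    using measurable_sets[OF x_meas[OF that(1)] that(2)] .
  then show ?thesis using sets_F[of n] by blast
qed

lemma XF_Pow: "sets (F n) \<union> (\<Union>i\<in>{1..n}. {x n i -` A \<inter> space (M n) | A. A \<in> sets borel}) \<subseteq> Pow (space (M n))"
  using XF_gen[of n] sets.space_closed[of "M n"] by (rule order_trans)

lemma sets_XF: "sets (XF n) = sigma_sets (space (M n)) (sets (F n) \<union> (\<Union>i\<in>{1..n}. {x n i -` A \<inter> space (M n) | A. A \<in> sets borel}))"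
  unfolding XW_def by (rule sets_measure_of[OF XF_Pow])

lemma space_XF: "space (XF n) = space (M n)"
  unfolding XW_def by (rule space_measure_of[OF XF_Pow])

lemma subalg_XF: "subalgebra (M n) (XF n)"
  unfolding subalgebra_def space_XF sets_XF using sets.sigma_sets_subset[OF XF_gen] by blast

lemma sets_F_le_XF: "sets (F n) \<subseteq> sets (XF n)"
  unfolding sets_XF by auto

lemma F_le_XF: "subalgebra (XF n) (F n)"
  unfolding subalgebra_def using sets_F_le_XF space_XF space_F by auto

lemma x_XF: "i \<in> {1..n} ==> x n i \<in> borel_measurable (XF n)"
  by (rule measurableI) (auto simp: space_XF sets_XF intro!: sigma_sets.Basic)

lemma XF_M: "f \<in> borel_measurable (XF n) ==> f \<in> borel_measurable (M n)"
  by (rule measurable_from_subalg[OF subalg_XF])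

lemma F_XF: "f \<in> borel_measurable (F n) ==> f \<in> borel_measurable (XF n)"
  by (rule measurable_from_subalg[OF F_le_XF])

lemma F_M: "f \<in> borel_measurable (F n) ==> f \<in> borel_measurable (M n)"
  by (rule measurable_from_subalg[OF subalg])

text \<open>The controls agree with \<open>F\<close>-measurable vectors only almost surely. Weights built from these
  versions are \<open>F\<close>-measurable everywhere.\<close>

definition wF :: "nat => nat => 'a => real Matrix.vec" where
  "wF n i om = Matrix.vec (K n) (\<lambda>k. EF n (\<lambda>om. vec_index (w n i om) k) om)"

lemma wF_carrier: "wF n i om \<in> carrier_vec (K n)" by (simp add: wF_def)

lemma wF_meas: "k < K n ==> (\<lambda>om. vec_index (wF n i om) k) \<in> borel_measurable (F n)"
  by (simp add: wF_def)

lemma AE_wF: "AE om in M n. \<forall>i\<in>{1..n}. w n i om = wF n i om"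
proof -
  have "AE om in M n. \<forall>i\<in>{1..n}. \<forall>k\<in>{..<K n}. EF n (\<lambda>om. vec_index (w n i om) k) om = vec_index (w n i om) k"
    by (intro AE_finite_allI) (use w_cond in auto)
  then show ?thesis
    using AE_space
  proof eventually_elim
    case (elim om)
    show ?case
    proof
      fix i assume i: "i \<in> {1..n}"
      show "w n i om = wF n i om"
        by (rule eq_vecI) (use elim(1) i w_dim[OF i elim(2)] in \<open>auto simp: wF_def\<close>)
    qed
  qed
qed

definition P :: "nat => nat => nat => 'a => real" where "P n i j om = annih K wF n i j om"

abbreviation "Pp n p \<equiv> P n (fst p) (snd p)"

lemma P_F: "i \<in> {1..n} ==> j \<in> {1..n} ==> P n i j \<in> borel_measurable (F n)"
  unfolding P_def[abs_def] using measurable_annih[of n K wF "F n" i j] wF_meas wF_carrier by simp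

lemma P_projection: "projection {1..n} (\<lambda>i j. P n i j om)"
proof
  fix i j assume ij: "i \<in> {1..n}" "j \<in> {1..n}"
  show "P n i j om = P n j i om" unfolding P_def by (rule annih_sym[where K=K and w=wF and n=n and om=om, OF wF_carrier ij])
  show "(\<Sum>k\<in>{1..n}. P n i k om * P n k j om) = P n i j om" unfolding P_def by (rule annih_idem[where K=K and w=wF and n=n and om=om, OF wF_carrier ij])
qed

lemma AE_P: "AE om in M n. \<forall>i\<in>{1..n}. \<forall>j\<in>{1..n}. annih K w n i j om = P n i j om"
  using AE_wF
proof eventually_elim
  case (elim om)
  have "gram K w n om = gram K wF n om" unfolding gram_def using elim by (intro cong_mat refl) (auto intro!: sum.cong)
  then show ?case using elim by (simp add: annih_def P_def)
qed

lemma vec_component_L2: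
  assumes X: "X \<in> borel_measurable L" and X2: "integrable L (\<lambda>om. (norm (X om :: real ^ 'd))^2)"
  shows "L2 L (\<lambda>om. X om $ a)"
proof (rule L2_bound)
  show "L2 L (\<lambda>om. norm (X om))" using X X2 by (intro L2_I) auto
qed (use X in \<open>auto simp: component_le_norm_cart intro: measurable_vec_component\<close>)

lemma x_L2: "i \<in> {1..n} ==> L2 (M n) (\<lambda>om. x n i om $ a)"
  by (rule vec_component_L2[OF x_meas x_moment])

lemma u_L2: "i \<in> {1..n} ==> L2 (M n) (u n i)"
  by (rule L2_I[OF u_meas u_moment])

lemma w_L2: "i \<in> {1..n} ==> k < K n ==> L2 (M n) (\<lambda>om. vec_index (w n i om) k)"
  by (rule L2_I[OF w_meas w_moment])

lemma wF_L2: "i \<in> {1..n} ==> k < K n ==> L2 (M n) (\<lambda>om. vec_index (wF n i om) k)"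
  using prob_space.L2_cond_exp[OF prob subalg w_L2] by (simp add: wF_def)

definition g_dot where "g_dot n v = (\<Sum>k<K n. vec_index (\<gamma> n) k * vec_index v k)"

lemma g_dot: "v \<in> carrier_vec (K n) ==> scalar_prod (\<gamma> n) v = g_dot n v"
  by (simp add: scalar_prod_def g_dot_def atLeast0LessThan)

lemma g_dot_F: "(\<lambda>om. g_dot n (wF n i om)) \<in> borel_measurable (F n)"
  unfolding g_dot_def by (intro borel_measurable_sum borel_measurable_times wF_meas) auto

lemma g_dot_L2: "i \<in> {1..n} ==> L2 (M n) (\<lambda>om. g_dot n (wF n i om))" "i \<in> {1..n} ==> L2 (M n) (\<lambda>om. g_dot n (w n i om))"
  unfolding g_dot_def by (auto intro!: L2_sum L2_cmult wF_L2 w_L2)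

lemma bx_L2: "i \<in> {1..n} ==> L2 (M n) (\<lambda>om. \<beta> \<bullet> x n i om)"
  unfolding inner_vec_def inner_real_def by (intro L2_sum L2_cmult x_L2)

lemma y_L2: "i \<in> {1..n} ==> L2 (M n) (y n i)"
  by (rule L2_cong[OF L2_add[OF L2_add[OF bx_L2 g_dot_L2(2)] u_L2]]) (simp_all add: model g_dot w_dim)

lemma U_L2: "i \<in> {1..n} ==> L2 (M n) (U n i)"
  unfolding U_err_def[abs_def] by (intro L2_diff y_L2 prob_space.L2_cond_exp[OF prob subalg_XF])

lemma U_centered: "i \<in> {1..n} ==> centered (M n) (XF n) (U n i)"
  unfolding U_err_def[abs_def]
  by (rule prob_space.centered_diff_cond_exp[OF prob subalg_XF prob_space.L2_integrable[OF prob y_L2]])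

text \<open>Combines the uncorrelatedness of the errors with their common conditional variance.\<close>

lemma U_products_centered:
  assumes i: "i \<in> {1..n}" and j: "j \<in> {1..n}"
  shows "centered (M n) (XF n) (\<lambda>om. U n i om * U n j om - (\<sigma> n)\<^sup>2 * of_bool (i = j))"
proof -
  interpret prob_space "M n" by (rule prob)
  interpret S: sigma_finite_subalgebra "M n" "XF n" by (rule sigma_finite_subalgebraI[OF subalg_XF])
  have int: "integrable (M n) (\<lambda>om. U n i om * U n j om)" by (rule L2_prod[OF U_L2[OF i] U_L2[OF j]])
  have Um: "U n i \<in> borel_measurable (M n)" "U n j \<in> borel_measurable (M n)" using L2_meas U_L2 i j by auto
  show ?thesis
  proof (cases "i = j")
    case True
    have "AE om in M n. EXF n (\<lambda>om. U n i om * U n i om - (\<sigma> n)\<^sup>2) om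
        = EXF n (\<lambda>om. U n i om * U n i om) om - EXF n (\<lambda>_. (\<sigma> n)^2) om"
      by (rule S.real_cond_exp_diff) (use int True in auto)
    moreover have "AE om in M n. EXF n (\<lambda>_. (\<sigma> n)^2) om = (\<sigma> n)^2"
      by (rule S.real_cond_exp_F_meas) auto
    ultimately have "AE om in M n. EXF n (\<lambda>om. U n i om * U n i om - (\<sigma> n)\<^sup>2) om = 0"
      using homoskedastic[OF i] by eventually_elim (simp add: power2_eq_square)
    then show ?thesis using int True by (intro centeredI_cond_exp[OF subalg_XF]) auto
  next
    case False
    have z: "AE om in M n. EXF n (U n k) om = 0" if "k \<in> {1..n}" for k
      by (rule centered_cond_exp[OF subalg_XF U_centered[OF that]])
    have "AE om in M n. (U n i om - EXF n (U n i) om) * (U n j om - EXF n (U n j) om) = U n i om * U n j om"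
      using z[OF i] z[OF j] by eventually_elim simp
    then have "AE om in M n. cond_cov (M n) (XF n) (U n i) (U n j) om = EXF n (\<lambda>om. U n i om * U n j om) om"
      unfolding cond_cov_def by (rule S.real_cond_exp_cong) (use Um in auto)
    then have "AE om in M n. EXF n (\<lambda>om. U n i om * U n j om) om = 0"
      using sampling_cov[OF i j False] by eventually_elim simp
    then show ?thesis using int False by (intro centeredI_cond_exp[OF subalg_XF]) auto
  qed
qed

lemma V_component: "V n i om $ a = x n i om $ a - EF n (\<lambda>om. x n i om $ a) om"
  by (simp add: V_err_def vec_cond_exp_def)

lemma V_L2: "i \<in> {1..n} ==> L2 (M n) (\<lambda>om. V n i om $ a)"
  unfolding V_component by (intro L2_diff x_L2 prob_space.L2_cond_exp[OF prob subalg])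

lemma V_centered: "i \<in> {1..n} ==> centered (M n) (F n) (\<lambda>om. V n i om $ a)"
  unfolding V_component
  by (rule prob_space.centered_diff_cond_exp[OF prob subalg prob_space.L2_integrable[OF prob x_L2]])

lemma measurable_vec_cond_exp:
  fixes X :: "'a => real ^ 'd"
  shows "vec_cond_exp (M n) (F n) X \<in> borel_measurable (F n)"
  by (rule measurable_vecI) (simp add: vec_cond_exp_def)

lemma V_XF: "i \<in> {1..n} ==> V n i \<in> borel_measurable (XF n)"
  unfolding V_err_def[abs_def] using x_XF F_XF[OF measurable_vec_cond_exp] by simp

lemma V_M: "i \<in> {1..n} ==> V n i \<in> borel_measurable (M n)"
  by (rule measurable_from_subalg[OF subalg_XF V_XF])

lemma R_L2: "i \<in> {1..n} ==> L2 (M n) (R n i)"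
  unfolding R_err_def by (intro u_L2 prob_space.L2_cond_exp[OF prob subalg_XF])

lemma r_L2: "i \<in> {1..n} ==> L2 (M n) (r n i)"
  unfolding r_err_def by (intro u_L2 prob_space.L2_cond_exp[OF prob subalg])

lemma r_F: "r n i \<in> borel_measurable (F n)"
  unfolding r_err_def by simp

text \<open>The part \<open>y - u\<close> is a function of regressors and controls, so that \<open>y\<close> and \<open>u\<close> deviate equally from their
  conditional means.\<close>

lemma AE_u: "AE om in M n. \<forall>i\<in>{1..n}. u n i om = U n i om + R n i om"
proof (rule AE_finite_allI)
  fix i assume i: "i \<in> {1..n}"
  interpret prob_space "M n" by (rule prob)
  interpret S: sigma_finite_subalgebra "M n" "XF n" by (rule sigma_finite_subalgebraI[OF subalg_XF])
  let ?f = "\<lambda>om. \<beta> \<bullet> x n i om + g_dot n (wF n i om)"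
  have fXF: "?f \<in> borel_measurable (XF n)" using x_XF[OF i] F_XF[OF g_dot_F] by simp
  have fint: "integrable (M n) ?f" by (intro L2_integrable L2_add bx_L2 g_dot_L2 i)
  have uint: "integrable (M n) (u n i)" by (intro L2_integrable u_L2 i)
  have yeq: "AE om in M n. y n i om = ?f om + u n i om"
    using AE_wF AE_space by eventually_elim (use model i g_dot w_dim in \<open>auto simp: wF_carrier\<close>)
  have 1: "AE om in M n. EXF n (y n i) om = EXF n (\<lambda>om. ?f om + u n i om) om"
    by (rule S.real_cond_exp_cong[OF yeq]) (use L2_meas[OF y_L2[OF i]] fint uint in auto)
  have 2: "AE om in M n. EXF n (\<lambda>om. ?f om + u n i om) om = EXF n ?f om + EXF n (u n i) om"
    by (rule S.real_cond_exp_add[OF fint uint])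
  have 3: "AE om in M n. EXF n ?f om = ?f om"
    by (rule S.real_cond_exp_F_meas[OF fint fXF])
  from yeq 1 2 3 show "AE om in M n. u n i om = U n i om + R n i om"
    by eventually_elim (simp add: U_err_def R_err_def)
qed simp

text \<open>The population projection of the regressors on the controls is linear in the controls, hence
  invisible after residualisation.\<close>

definition l_coef where
  "l_coef n a q = (\<Sum>p<K n. vec_index (pop_cross_row M K w x n a) p * mat_inv (pop_gram M K w n) $$ (p, q))"

definition l_part :: "nat => real Matrix.vec => real ^ 'd" where
  "l_part n v = (\<chi> a. \<Sum>q<K n. l_coef n a q * vec_index v q)"

lemma v_pop_eq:
  assumes "i \<in> {1..n}" "om \<in> space (M n)"
  shows "v_pop M K w x n i om = x n i om - l_part n (w n i om)"
proof -
  have c: "pop_gram M K w n \<in> carrier_mat (K n) (K n)" by (simp add: pop_gram_def)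
  have G: "mat_inv (pop_gram M K w n) \<in> carrier_mat (K n) (K n)" by (rule mat_inv_carrier[OF c])
  have row: "pop_cross_row M K w x n a \<in> carrier_vec (K n)" for a by (simp add: pop_cross_row_def)
  have "scalar_prod (pop_cross_row M K w x n a) (mat_inv (pop_gram M K w n) *\<^sub>v w n i om) = (\<Sum>q<K n. l_coef n a q * vec_index (w n i om) q)" for a
  proof -
    have "scalar_prod (pop_cross_row M K w x n a) (mat_inv (pop_gram M K w n) *\<^sub>v w n i om)
        = (\<Sum>p<K n. \<Sum>q<K n. vec_index (pop_cross_row M K w x n a) p * (mat_inv (pop_gram M K w n) $$ (p, q) * vec_index (w n i om) q))"
      using G row[of a] w_dim[OF assms] unfolding scalar_prod_def
      by (simp add: scalar_prod_def mult_mat_vec_def row_def sum_distrib_left atLeast0LessThan)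
    also have "\<dots> = (\<Sum>q<K n. l_coef n a q * vec_index (w n i om) q)"
      unfolding l_coef_def sum_distrib_right by (subst sum.swap) (simp add: mult.assoc)
    finally show ?thesis .
  qed
  then show ?thesis by (simp add: v_pop_def l_part_def)
qed

lemma Q_F: "Q n i \<in> borel_measurable (F n)"
  unfolding Q_err_def by (rule measurable_vec_cond_exp)

lemma l_part_L2: "i \<in> {1..n} ==> L2 (M n) (\<lambda>om. l_part n (w n i om) $ a)" "i \<in> {1..n} ==> L2 (M n) (\<lambda>om. l_part n (wF n i om) $ a)"
  unfolding l_part_def by (auto intro!: L2_sum L2_cmult w_L2 wF_L2)

lemma v_pop_L2: "i \<in> {1..n} ==> L2 (M n) (\<lambda>om. v_pop M K w x n i om $ a)"
  by (rule L2_cong[OF L2_diff[OF x_L2 l_part_L2(1)]]) (simp_all add: v_pop_eq)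

lemma Q_L2: "i \<in> {1..n} ==> L2 (M n) (\<lambda>om. Q n i om $ a)"
  unfolding Q_err_def vec_cond_exp_def by (simp add: prob_space.L2_cond_exp[OF prob subalg v_pop_L2])

lemma AE_x: "AE om in M n. \<forall>i\<in>{1..n}. x n i om = V n i om + Q n i om + l_part n (wF n i om)"
proof -
  have "AE om in M n. \<forall>i\<in>{1..n}. \<forall>a\<in>UNIV. x n i om $ a = V n i om $ a + Q n i om $ a + l_part n (wF n i om) $ a"
  proof (intro AE_finite_allI)
    fix i and a :: 'd assume i: "i \<in> {1..n}"
    interpret prob_space "M n" by (rule prob)
    interpret S: sigma_finite_subalgebra "M n" "F n" by (rule sigma_finite_subalgebraI[OF subalg])
    let ?l = "\<lambda>om. l_part n (wF n i om) $ a"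
    have lF: "?l \<in> borel_measurable (F n)" unfolding l_part_def using wF_meas by auto
    have lint: "integrable (M n) ?l" and xint: "integrable (M n) (\<lambda>om. x n i om $ a)"
      by (intro L2_integrable l_part_L2 x_L2 i)+
    have veq: "AE om in M n. v_pop M K w x n i om $ a = x n i om $ a - ?l om"
      using AE_wF AE_space by eventually_elim (use v_pop_eq i in auto)
    have 1: "AE om in M n. EF n (\<lambda>om. v_pop M K w x n i om $ a) om = EF n (\<lambda>om. x n i om $ a - ?l om) om"
      by (rule S.real_cond_exp_cong[OF veq]) (use L2_meas[OF v_pop_L2[OF i]] lint xint in auto)
    have 2: "AE om in M n. EF n (\<lambda>om. x n i om $ a - ?l om) om = EF n (\<lambda>om. x n i om $ a) om - EF n ?l om"
      by (rule S.real_cond_exp_diff[OF xint lint])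
    have 3: "AE om in M n. EF n ?l om = ?l om"
      by (rule S.real_cond_exp_F_meas[OF lint lF])
    from 1 2 3 show "AE om in M n. x n i om $ a = V n i om $ a + Q n i om $ a + ?l om"
      by eventually_elim (simp add: V_component Q_err_def vec_cond_exp_def)
  qed auto
  then show ?thesis by eventually_elim (simp add: Finite_Cartesian_Product.vec_eq_iff)
qed

section \<open>Blocks of observations\<close>

definition blk :: "nat => nat => nat" where "blk n t = (THE k. k \<in> {1..N n} \<and> t \<in> T n k)"

lemma blk_unique:
  assumes "k \<in> {1..N n}" "t \<in> T n k" "j \<in> {1..N n}" "t \<in> T n j"
  shows "k = j"
proof -
  have "T n k = T n j"
    using sampling_partition(1)[of n] assms unfolding partition_on_def disjoint_def by blast
  then show ?thesis using sampling_partition(2)[of n] assms unfolding inj_on_def by blast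
qed

lemma blk_eq: "k \<in> {1..N n} ==> t \<in> T n k ==> blk n t = k"
  unfolding blk_def by (rule the_equality) (blast intro: blk_unique)+

lemma T_sub: "k \<in> {1..N n} ==> T n k \<subseteq> {1..n}"
  using sampling_partition(1)[of n] unfolding partition_on_def by blast

lemma blk: "t \<in> {1..n} ==> blk n t \<in> {1..N n}" "t \<in> {1..n} ==> t \<in> T n (blk n t)"
proof -
  assume t: "t \<in> {1..n}"
  have "t \<in> \<Union>(T n ` {1..N n})" by (rule subsetD[OF equalityD1[OF partition_onD1[OF sampling_partition(1)]] t])
  then obtain k where k: "k \<in> {1..N n}" "t \<in> T n k" by blast
  then show "blk n t \<in> {1..N n}" "t \<in> T n (blk n t)" using blk_eq[OF k] by auto
qed

lemma finite_T: "k \<in> {1..N n} ==> finite (T n k)"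
  by (rule finite_subset[OF T_sub]) simp_all

lemma sum_blocks: "(\<Sum>k=1..N n. \<Sum>t\<in>T n k. f t) = (\<Sum>t=1..n. f t)" for f :: "nat => real"
proof -
  have "(\<Union>k\<in>{1..N n}. T n k) = {1..n}" using blk T_sub by blast
  then have "(\<Sum>t=1..n. f t) = (\<Sum>t\<in>(\<Union>k\<in>{1..N n}. T n k). f t)" by simp
  also have "\<dots> = (\<Sum>k=1..N n. \<Sum>t\<in>T n k. f t)"
    by (rule sum.UNION_disjoint) (use finite_T blk_unique in auto)
  finally show ?thesis by simp
qed

lemma block_bound: "\<exists>c::nat. \<forall>\<^sub>F n in sequentially. \<forall>k\<in>{1..N n}. card (T n k) \<le> c"
proof -
  obtain C where "\<forall>\<^sub>F n in sequentially. norm (real (MAX i\<in>{1..N n}. card (T n i))) \<le> C * norm (1 :: real)"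
    using sampling_card by (elim landau_o.bigE) blast
  then have "\<forall>\<^sub>F n in sequentially. \<forall>k\<in>{1..N n}. card (T n k) \<le> nat \<lceil>C\<rceil>"
  proof eventually_elim
    case (elim n)
    show ?case
    proof
      fix k assume k: "k \<in> {1..N n}"
      have "card (T n k) \<le> (MAX i\<in>{1..N n}. card (T n i))" using k by (intro Max_ge) auto
      then have "real (card (T n k)) \<le> C" using elim by simp
      then show "card (T n k) \<le> nat \<lceil>C\<rceil>" by linarith
    qed
  qed
  then show ?thesis by blast
qed

text \<open>\<open>Gb n k\<close> is the algebra of the \<open>k\<close>th block of pairs \<open>(U, V)\<close>.\<close>

definition Zb :: "nat => nat => 'a => nat => real \<times> (real ^ 'd)" where
  "Zb n k om = (\<lambda>t\<in>T n k. (U n t om, V n t om))"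

definition Gb :: "nat => nat => 'a set set" where
  "Gb n k = {Zb n k -` A \<inter> space (M n) | A. A \<in> sets (Pi\<^sub>M (T n k) (\<lambda>_. borel \<Otimes>\<^sub>M borel))}"

lemma Zb_meas: "k \<in> {1..N n} ==> Zb n k \<in> measurable (M n) (Pi\<^sub>M (T n k) (\<lambda>_. borel \<Otimes>\<^sub>M borel))"
  using sampling_indep[of n] unfolding cond_indep_vars_def Zb_def[abs_def] by blast

lemma Gb_vimage: "k \<in> {1..N n} ==> Gb n k = sets (vimage_algebra (space (M n)) (Zb n k) (Pi\<^sub>M (T n k) (\<lambda>_. borel \<Otimes>\<^sub>M borel)))"
  unfolding Gb_def by (subst sets_vimage_algebra2) (use measurable_space[OF Zb_meas] in auto)

lemma blocks: "cond_indep_blocks (M n) (F n) (Gb n) {1..N n}"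
proof -
  interpret prob_space "M n" by (rule prob)
  show ?thesis
  proof (intro cond_indep_blocks.intro cond_indep_blocks_axioms.intro prob)
    show "sigma_algebra (space (M n)) (Gb n k)" if "k \<in> {1..N n}" for k
      unfolding Gb_vimage[OF that] using sets.sigma_algebra_axioms[of "vimage_algebra (space (M n)) (Zb n k) (Pi\<^sub>M (T n k) (\<lambda>_. borel \<Otimes>\<^sub>M borel))"]
      by (simp only: space_vimage_algebra)
    show "cond_indep_sets (M n) (F n) (Gb n) {1..N n}"
      using sampling_indep[of n] unfolding cond_indep_vars_def Gb_def[abs_def] Zb_def[abs_def] by blast
  qed (use subalg in auto)
qed

abbreviation "blk_alg n k \<equiv> sigma (space (M n)) (Gb n k)"
abbreviation "rest n \<equiv> rest_algebra (M n) (F n) (Gb n) {1..N n}"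

lemma sets_blk_alg: "k \<in> {1..N n} ==> sets (blk_alg n k) = Gb n k"
  by (rule cond_indep_blocks.block_alg(1)[OF blocks])

lemma space_blk_alg: "k \<in> {1..N n} ==> space (blk_alg n k) = space (M n)"
  using cond_indep_blocks.block_alg(2)[OF blocks] by (auto simp: subalgebra_def)

lemma UV_block:
  assumes k: "k \<in> {1..N n}" and t: "t \<in> T n k"
  shows "U n t \<in> borel_measurable (blk_alg n k)" (is ?g1) "V n t \<in> borel_measurable (blk_alg n k)"
proof -
  let ?A = "vimage_algebra (space (M n)) (Zb n k) (Pi\<^sub>M (T n k) (\<lambda>_. borel \<Otimes>\<^sub>M borel))"
  have S: "sets ?A = sets (blk_alg n k)" by (simp only: Gb_vimage[OF k, symmetric] sets_blk_alg[OF k])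
  have eq: "measurable ?A (borel :: real measure) = measurable (blk_alg n k) borel"
      "measurable ?A (borel :: (real ^ 'd) measure) = measurable (blk_alg n k) borel"
    by (rule measurable_cong_sets[OF S refl])+
  have Z: "Zb n k \<in> measurable ?A (Pi\<^sub>M (T n k) (\<lambda>_. borel \<Otimes>\<^sub>M borel))"
    by (rule measurable_vimage_algebra1) (use measurable_space[OF Zb_meas[OF k]] in auto)
  have Zt: "(\<lambda>om. Zb n k om t) \<in> measurable ?A (borel \<Otimes>\<^sub>M borel)"
    by (rule measurable_compose[OF Z measurable_component_singleton[OF t]])
  have "(\<lambda>om. fst (Zb n k om t)) \<in> borel_measurable ?A" "(\<lambda>om. snd (Zb n k om t)) \<in> borel_measurable ?A"
    using Zt by measurable
  then show ?g1 "V n t \<in> borel_measurable (blk_alg n k)"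
    unfolding eq by (simp_all add: Zb_def t)
qed

text \<open>\<open>HU n k\<close> holds \<open>F\<close>, the other blocks, and the regressor errors of block \<open>k\<close>. It contains all regressors
  (\<open>XF_le_HU\<close>), and the errors \<open>U\<close> of block \<open>k\<close> remain centred given it.\<close>

definition CV :: "nat => nat => 'a set set" where
  "CV n k = sets (vimage_algebra (space (M n)) (\<lambda>om. \<lambda>t\<in>T n k. V n t om) (Pi\<^sub>M (T n k) (\<lambda>_. borel)))"

definition HU :: "nat => nat => 'a measure" where
  "HU n k = sigma (space (M n)) (sets (rest n k) \<union> CV n k)"

lemma CV_sub:
  assumes A: "space A = space (M n)" and V: "\<And>t. t \<in> T n k ==> V n t \<in> borel_measurable A"
  shows "CV n k \<subseteq> sets A"
proof
  fix S assume "S \<in> CV n k"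
  moreover have "(\<lambda>om. \<lambda>t\<in>T n k. V n t om) \<in> space (M n) \<rightarrow> space (Pi\<^sub>M (T n k) (\<lambda>_. borel))" by (auto simp: space_PiM)
  ultimately obtain E where E: "E \<in> sets (Pi\<^sub>M (T n k) (\<lambda>_. borel :: (real ^ 'd) measure))"
      "S = (\<lambda>om. \<lambda>t\<in>T n k. V n t om) -` E \<inter> space (M n)"
    unfolding CV_def by (auto simp: sets_vimage_algebra2)
  have "(\<lambda>om. \<lambda>t\<in>T n k. V n t om) \<in> measurable A (Pi\<^sub>M (T n k) (\<lambda>_. borel))"
    by (rule measurable_restrict) (rule V)
  from measurable_sets[OF this E(1)] show "S \<in> sets A" by (simp add: E(2) A)
qed

lemma CV_Gb: "k \<in> {1..N n} ==> CV n k \<subseteq> Gb n k"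
  using CV_sub[OF space_blk_alg UV_block(2)] sets_blk_alg by blast

lemma CV_XF: "k \<in> {1..N n} ==> CV n k \<subseteq> sets (XF n)"
  using T_sub[of k n] by (intro CV_sub space_XF V_XF) auto

lemma rest_M: "sets (rest n k) \<subseteq> sets (M n)" and space_rest': "space (rest n k) = space (M n)"
  using cond_indep_blocks.subalgebra_rest[OF blocks, of n k] by (auto simp: subalgebra_def)

lemma HU_Pow: "k \<in> {1..N n} ==> sets (rest n k) \<union> CV n k \<subseteq> Pow (space (M n))"
  using order_trans[OF rest_M sets.space_closed] order_trans[OF CV_XF sets.space_closed] space_XF
  by (metis Un_least)

lemma sets_HU: "k \<in> {1..N n} ==> sets (HU n k) = sigma_sets (space (M n)) (sets (rest n k) \<union> CV n k)"
  unfolding HU_def by (rule sets_measure_of[OF HU_Pow])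

lemma space_HU: "k \<in> {1..N n} ==> space (HU n k) = space (M n)"
  unfolding HU_def by (rule space_measure_of[OF HU_Pow])

lemma subalg_HU: "k \<in> {1..N n} ==> subalgebra (M n) (HU n k)"
proof -
  assume k: "k \<in> {1..N n}"
  have "sets (XF n) \<subseteq> sets (M n)" using subalg_XF unfolding subalgebra_def by blast
  then have "sets (rest n k) \<union> CV n k \<subseteq> sets (M n)" using rest_M CV_XF[OF k] by (meson Un_least order_trans)
  then show ?thesis unfolding subalgebra_def space_HU[OF k] sets_HU[OF k] using sets.sigma_sets_subset by blast
qed

lemma rest_le_HU: "k \<in> {1..N n} ==> subalgebra (HU n k) (rest n k)"
proof -
  assume k: "k \<in> {1..N n}"
  show ?thesis unfolding subalgebra_def space_HU[OF k] sets_HU[OF k] space_rest' by blast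
qed

lemma F_le_rest: "subalgebra (rest n k) (F n)"
  unfolding subalgebra_def space_rest' space_F using cond_indep_blocks.F_le_rest[OF blocks] by blast

lemma UV_rest:
  assumes j: "j \<in> {1..N n}" "j \<noteq> k" and t: "t \<in> T n j"
  shows "U n t \<in> borel_measurable (rest n k)" (is ?g1) "V n t \<in> borel_measurable (rest n k)"
proof -
  have "subalgebra (rest n k) (blk_alg n j)"
    unfolding subalgebra_def space_rest' space_blk_alg[OF j(1)] sets_blk_alg[OF j(1)]
    using cond_indep_blocks.G_le_rest[OF blocks j] by blast
  from measurable_from_subalg[OF this] show ?g1 "V n t \<in> borel_measurable (rest n k)"
    using UV_block[OF j(1) t] by auto
qed

lemma V_HU:
  assumes k: "k \<in> {1..N n}" and t: "t \<in> {1..n}"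
  shows "V n t \<in> borel_measurable (HU n k)"
proof (cases "t \<in> T n k")
  case True
  let ?A = "vimage_algebra (space (M n)) (\<lambda>om. \<lambda>t\<in>T n k. V n t om) (Pi\<^sub>M (T n k) (\<lambda>_. borel :: (real ^ 'd) measure))"
  have Z: "(\<lambda>om. \<lambda>t\<in>T n k. V n t om) \<in> measurable ?A (Pi\<^sub>M (T n k) (\<lambda>_. borel))"
    by (rule measurable_vimage_algebra1) (auto simp: space_PiM)
  have "(\<lambda>om. (\<lambda>t\<in>T n k. V n t om) t) \<in> borel_measurable ?A"
    by (rule measurable_compose[OF Z measurable_component_singleton[OF True]])
  then have "V n t \<in> borel_measurable ?A" using True by simp
  moreover have "subalgebra (HU n k) ?A"
    unfolding subalgebra_def by (auto simp: space_HU[OF k] sets_HU[OF k] CV_def)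
  ultimately show ?thesis by (rule measurable_from_subalg[rotated])
next
  case False
  then have "V n t \<in> borel_measurable (rest n k)"
    using UV_rest(2)[of "blk n t" n k t] blk[OF t] by auto
  then show ?thesis by (rule measurable_from_subalg[OF rest_le_HU[OF k]])
qed

lemma XF_le_HU:
  assumes k: "k \<in> {1..N n}"
  shows "subalgebra (HU n k) (XF n)"
proof -
  have FH: "subalgebra (HU n k) (F n)"
    using F_le_rest[of n k] rest_le_HU[OF k] unfolding subalgebra_def by auto
  have x: "x n i \<in> borel_measurable (HU n k)" if i: "i \<in> {1..n}" for i
  proof -
    have "(\<lambda>om. V n i om + vec_cond_exp (M n) (F n) (x n i) om) \<in> borel_measurable (HU n k)"
      using V_HU[OF k i] measurable_from_subalg[OF FH measurable_vec_cond_exp] by simp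
    then show ?thesis by (simp add: V_err_def)
  qed
  have "sets (F n) \<union> (\<Union>i\<in>{1..n}. {x n i -` A \<inter> space (M n) | A. A \<in> sets borel}) \<subseteq> sets (HU n k)"
    using FH measurable_sets[OF x] by (auto simp: subalgebra_def space_HU[OF k])
  then have "sets (XF n) \<subseteq> sets (HU n k)"
    unfolding sets_XF space_HU[OF k, symmetric] by (rule sets.sigma_sets_subset)
  then show ?thesis by (simp add: subalgebra_def space_HU[OF k] space_XF)
qed

text \<open>Adding the errors \<open>U\<close> of other blocks to the regressors does not destroy centredness.\<close>

lemma extend_HU:
  assumes k: "k \<in> {1..N n}" and X: "X \<in> borel_measurable (blk_alg n k)" "centered (M n) (XF n) X"
  shows "centered (M n) (HU n k) X"
  unfolding HU_def
proof (rule cond_indep_blocks.centered_rest_extend[OF blocks k X])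
  show "Int_stable (CV n k)" unfolding CV_def by (rule sets.Int_stable)
  show "space (M n) \<in> CV n k"
    unfolding CV_def using sets.top[of "vimage_algebra (space (M n)) (\<lambda>om. \<lambda>t\<in>T n k. V n t om) (Pi\<^sub>M (T n k) (\<lambda>_. borel))"] by simp
qed (use CV_Gb[OF k] CV_XF[OF k] sets_F_le_XF in auto)

lemma T_imp: "k \<in> {1..N n} ==> t \<in> T n k ==> t \<in> {1..n}"
  using T_sub by blast

lemma U_HU: "k \<in> {1..N n} ==> t \<in> T n k ==> centered (M n) (HU n k) (U n t)"
  by (rule extend_HU[OF _ UV_block(1) U_centered[OF T_imp]])

lemma UU_HU:
  assumes "k \<in> {1..N n}" "t \<in> T n k" "s \<in> T n k"
  shows "centered (M n) (HU n k) (\<lambda>om. U n t om * U n s om - (\<sigma> n)\<^sup>2 * of_bool (t = s))"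
proof (rule extend_HU[OF assms(1) _ U_products_centered])
  show "(\<lambda>om. U n t om * U n s om - (\<sigma> n)\<^sup>2 * of_bool (t = s)) \<in> borel_measurable (blk_alg n k)"
    using UV_block(1)[OF assms(1,2)] UV_block(1)[OF assms(1,3)] by simp
qed (rule T_imp[OF assms(1,2)], rule T_imp[OF assms(1,3)])

lemma V_rest:
  assumes k: "k \<in> {1..N n}" and t: "t \<in> T n k"
  shows "centered (M n) (rest n k) (\<lambda>om. V n t om $ a)"
proof -
  interpret prob_space "M n" by (rule prob)
  have t': "t \<in> {1..n}" by (rule T_imp[OF k t])
  have Vm: "(\<lambda>om. V n t om $ a) \<in> borel_measurable (blk_alg n k)"
    by (rule measurable_vec_component[OF UV_block(2)[OF k t]])
  have int: "integrable (M n) (\<lambda>om. V n t om $ a)" by (rule L2_integrable[OF V_L2[OF t']])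
  have c: "centered (M n) (rest n k) (\<lambda>om. V n t om $ a - EF n (\<lambda>om. V n t om $ a) om)"
    by (rule cond_indep_blocks.centered_rest[OF blocks k Vm int])
  have "AE om in M n. EF n (\<lambda>om. V n t om $ a) om = 0"
    by (rule centered_cond_exp[OF subalg V_centered[OF t']])
  then have "AE om in M n. V n t om $ a - EF n (\<lambda>om. V n t om $ a) om = V n t om $ a"
    by eventually_elim simp
  then show ?thesis
    by (rule centered_AE_cong[OF c]) (use int cond_indep_blocks.subalgebra_rest[OF blocks] in auto)
qed

lemma VV_rest:
  assumes k: "k \<in> {1..N n}" and t: "t \<in> T n k" and s: "s \<in> T n k"
  shows "centered (M n) (rest n k) (\<lambda>om. V n s om $ a * V n t om $ b - EF n (\<lambda>om. V n s om $ a * V n t om $ b) om)"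
proof (rule cond_indep_blocks.centered_rest[OF blocks k])
  show "(\<lambda>om. V n s om $ a * V n t om $ b) \<in> borel_measurable (blk_alg n k)"
    by (intro borel_measurable_times measurable_vec_component UV_block(2) k s t)
  show "integrable (M n) (\<lambda>om. V n s om $ a * V n t om $ b)"
    by (intro L2_prod V_L2 T_imp[OF k] s t)
qed

lemma V_rest_other: "s \<in> {1..n} ==> t \<in> {1..n} ==> blk n s \<noteq> blk n t ==> V n s \<in> borel_measurable (rest n (blk n t))"
  using UV_rest(2)[OF blk(1)[of s n] _ blk(2)[of s n]] by blast

lemma U_HU_other: "s \<in> {1..n} ==> t \<in> {1..n} ==> blk n s \<noteq> blk n t ==> U n s \<in> borel_measurable (HU n (blk n t))"
  using UV_rest(1)[OF blk(1)[of s n] _ blk(2)[of s n]] measurable_from_subalg[OF rest_le_HU[OF blk(1)]] by blast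

definition small_blocks :: "nat => nat => bool" where
  "small_blocks c n \<longleftrightarrow> (\<forall>k\<in>{1..N n}. card (T n k) \<le> c)"

lemma block_card:
  assumes "small_blocks c n" "t \<in> {1..n}"
  shows "card {s \<in> {1..n}. blk n s = blk n t} \<le> c"
proof -
  have "{s \<in> {1..n}. blk n s = blk n t} \<subseteq> T n (blk n t)" using blk by force
  then have "card {s \<in> {1..n}. blk n s = blk n t} \<le> card (T n (blk n t))"
    by (intro card_mono finite_T blk assms)
  also have "\<dots> \<le> c" using assms blk unfolding small_blocks_def by blast
  finally show ?thesis .
qed

lemma filtration_V: "small_blocks c n ==> block_filtration (M n) (F n) (rest n) {1..n} (blk n) c"
  by (intro block_filtration.intro block_filtration_axioms.intro prob subalg F_le_rest block_card
      cond_indep_blocks.subalgebra_rest[OF blocks] finite_atLeastAtMost)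

lemma filtration_U: "small_blocks c n ==> block_filtration (M n) (XF n) (HU n) {1..n} (blk n) c"
  by (intro block_filtration.intro block_filtration_axioms.intro prob subalg_XF XF_le_HU block_card
      subalg_HU blk finite_atLeastAtMost)

section \<open>Truncated moment bounds\<close>

text \<open>Events on which conditional fourth moments are at most \<open>B\<close>. The conditioning algebra knows them, so
  that their indicators may multiply weights.\<close>

definition EV :: "real => nat => 'a => bool" where
  "EV B n om \<longleftrightarrow> (\<forall>i\<in>{1..n}. NF n (\<lambda>om. ennreal (norm (V n i om) ^ 4)) om \<le> ennreal B)"

definition EU :: "real => nat => 'a => bool" where
  "EU B n om \<longleftrightarrow> (\<forall>i\<in>{1..n}. NXF n (\<lambda>om. ennreal (U n i om ^ 4)) om \<le> ennreal B)"

lemma EV_F: "{om \<in> space (F n). EV B n om} \<in> sets (F n)"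
  unfolding EV_def by measurable

lemma EU_XF: "{om \<in> space (XF n). EU B n om} \<in> sets (XF n)"
  unfolding EU_def by measurable

lemma EV_component:
  assumes i: "i \<in> {1..n}"
  shows "AE om in M n. EV B n om \<longrightarrow> NF n (\<lambda>om. ennreal ((V n i om $ a) ^ 4)) om \<le> ennreal B"
proof -
  interpret prob_space "M n" by (rule prob)
  interpret S: sigma_finite_subalgebra "M n" "F n" by (rule sigma_finite_subalgebraI[OF subalg])
  note V_M[OF i, measurable]
  have "AE om in M n. NF n (\<lambda>om. ennreal ((V n i om $ a) ^ 4)) om \<le> NF n (\<lambda>om. ennreal (norm (V n i om) ^ 4)) om"
  proof (rule S.nn_cond_exp_mono)
    have "(V n i om $ a) ^ 4 \<le> norm (V n i om) ^ 4" for om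
    proof -
      have "\<bar>V n i om $ a\<bar> ^ 4 \<le> norm (V n i om) ^ 4" by (intro power_mono component_le_norm_cart) simp
      then show ?thesis by (simp add: power_even_abs)
    qed
    then show "AE om in M n. ennreal ((V n i om $ a) ^ 4) \<le> ennreal (norm (V n i om) ^ 4)" by (intro AE_I2 ennreal_leI)
    show "(\<lambda>om. ennreal ((V n i om $ a) ^ 4)) \<in> borel_measurable (M n)"
      using measurable_vec_component[OF V_M[OF i], of a] by measurable
  qed measurable
  then show ?thesis by eventually_elim (use i in \<open>auto simp: EV_def intro: order_trans\<close>)
qed

definition iV where "iV B n om = (indicator {om \<in> space (F n). EV B n om} om :: real)"
definition iU where "iU B n om = (indicator {om \<in> space (XF n). EU B n om} om :: real)"

lemma iV_F: "iV B n \<in> borel_measurable (F n)" unfolding iV_def[abs_def] using EV_F by simp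
lemma iU_XF: "iU B n \<in> borel_measurable (XF n)" unfolding iU_def[abs_def] using EU_XF by simp

lemma iV_nonzero: "iV B n om \<noteq> 0 ==> EV B n om" and iU_nonzero: "iU B n om \<noteq> 0 ==> EU B n om"
  by (auto simp: iV_def iU_def indicator_def split: if_splits)

lemma iV_bound: "\<bar>iV B n om\<bar> \<le> 1" and iU_bound: "\<bar>iU B n om\<bar> \<le> 1"
  by (auto simp: iV_def iU_def indicator_def)

lemma iV_1: "om \<in> space (M n) ==> EV B n om ==> iV B n om = 1" and iU_1: "om \<in> space (M n) ==> EU B n om ==> iU B n om = 1"
  by (auto simp: iV_def iU_def space_F space_XF)

lemma P_bound: "i \<in> {1..n} ==> j \<in> {1..n} ==> \<bar>P n i j om\<bar> \<le> 1"
  using projection.entry_le_1[OF P_projection] by simp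

lemma P_square_sum_bound:
  assumes e: "e \<in> borel_measurable (M n)" "\<And>om. \<bar>e om\<bar> \<le> 1"
  shows "\<And>p. p \<in> pairs n ==> integrable (M n) (\<lambda>om. (e om * Pp n p om)^2)"
    and "(\<Sum>p\<in>pairs n. \<integral>om. (e om * Pp n p om)^2 \<partial>M n) \<le> real n" (is ?g1)
proof -
  interpret prob_space "M n" by (rule prob)
  show int: "integrable (M n) (\<lambda>om. (e om * Pp n p om)^2)" if "p \<in> pairs n" for p
  proof (rule integrable_const_bound[where B=1])
    have "\<bar>e om * Pp n p om\<bar> \<le> 1" for om
      unfolding abs_mult using e(2)[of om] P_bound[of "fst p" n "snd p" om] that by (intro mult_le_one) auto
    then show "AE om in M n. norm ((e om * Pp n p om)^2) \<le> 1" by (simp add: abs_square_le_1)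
    show "(\<lambda>om. (e om * Pp n p om)^2) \<in> borel_measurable (M n)"
      using e(1) F_M[OF P_F[of "fst p" n "snd p"]] that by auto
  qed
  have "(\<Sum>p\<in>pairs n. \<integral>om. (e om * Pp n p om)^2 \<partial>M n) = (\<integral>om. (\<Sum>p\<in>pairs n. (e om * Pp n p om)^2) \<partial>M n)"
    using int by (subst Bochner_Integration.integral_sum) auto
  also have "\<dots> \<le> (\<integral>om. real n \<partial>M n)"
  proof (rule integral_mono)
    fix om
    have "(\<Sum>p\<in>pairs n. (e om * Pp n p om)^2) \<le> (\<Sum>p\<in>pairs n. (Pp n p om)^2)"
    proof (rule sum_mono)
      fix p
      have "(e om)^2 * (Pp n p om)^2 \<le> 1 * (Pp n p om)^2"
        using e(2)[of om] by (intro mult_right_mono) (auto simp: abs_square_le_1)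
      then show "(e om * Pp n p om)^2 \<le> (Pp n p om)^2" by (simp add: power_mult_distrib)
    qed
    also have "\<dots> \<le> real n" using projection.sum_squares_le[OF P_projection, of n om] by simp
    finally show "(\<Sum>p\<in>pairs n. (e om * Pp n p om)^2) \<le> real n" .
  qed (use int in auto)
  finally show ?g1 by (simp add: prob_space)
qed

text \<open>Products within a block may have a nonzero conditional mean \<open>kap\<close>; \<open>zV\<close> is the product centred accordingly.\<close>

definition kap where
  "kap n a b p om = EF n (\<lambda>om. V n (fst p) om $ a * V n (snd p) om $ b) om"

definition zV where
  "zV n a b p om = V n (fst p) om $ a * V n (snd p) om $ b - (if blk n (fst p) = blk n (snd p) then kap n a b p om else 0)"

text \<open>The squared entries of a projection sum to at most \<open>n\<close>, so the variance of the form is of order \<open>n\<close>.\<close>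

lemma quadratic_V_bound:
  assumes c: "small_blocks c n" and B: "0 \<le> B"
  shows "integrable (M n) (\<lambda>om. (\<Sum>p\<in>pairs n. iV B n om * Pp n p om * zV n a b p om)^2)"
    and "(\<integral>om. (\<Sum>p\<in>pairs n. iV B n om * Pp n p om * zV n a b p om)^2 \<partial>M n) \<le> real (2 * c^2) * (2 * B + 2 * (1 + 2 * B)^2) * real n"
proof -
  interpret block_filtration "M n" "F n" "rest n" "{1..n}" "blk n" c by (rule filtration_V[OF c])
  let ?m = "\<lambda>p om. iV B n om * Pp n p om"
  have m: "?m p \<in> borel_measurable (F n)" if "p \<in> pairs n" for p
    using iV_F P_F that by auto
  have b: "kap n a b p \<in> borel_measurable (F n)" for p unfolding kap_def[abs_def] by simp
  have kb: "AE om in M n. ?m p om \<noteq> 0 \<longrightarrow> \<bar>kap n a b p om\<bar> \<le> 1 + 2 * B" if p: "p \<in> pairs n" for p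
  proof -
    have ij: "fst p \<in> {1..n}" "snd p \<in> {1..n}" using p by auto
    show ?thesis
      using cond_exp_product_bound[OF subalg L2_meas[OF V_L2[OF ij(1)]] L2_meas[OF V_L2[OF ij(2)]] B, of a b]
        EV_component[OF ij(1), of B a] EV_component[OF ij(2), of B b]
      by eventually_elim (use iV_nonzero in \<open>auto simp: kap_def\<close>)
  qed
  have cz: "centered (M n) (rest n (blk n t)) (zV n a b (s, t))" if st: "s \<in> {1..n}" "t \<in> {1..n}" "blk n s = blk n t" for s t
  proof -
    have "s \<in> T n (blk n t)" using blk(2)[OF st(1)] st(3) by simp
    from VV_rest[OF blk(1)[OF st(2)] blk(2)[OF st(2)] this, of a b] show ?thesis
      unfolding zV_def[abs_def] kap_def by (simp add: st(3))
  qed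
  have z: "zV n a b (s, t) om = V n s om $ a * V n t om $ b - (if blk n s = blk n t then kap n a b (s, t) om else 0)" for s t om
    by (simp add: zV_def)
  have mom: "AE om in M n. ?m (s, t) om \<noteq> 0 \<longrightarrow> NF n (\<lambda>om. ennreal ((V n q om $ e) ^ 4)) om \<le> ennreal B" if "q \<in> {1..n}" for q e s t
    using EV_component[OF that, of B e] by eventually_elim (use iV_nonzero in auto)
  note Q = quadratic_form_moment_bound[where m="?m" and z="zV n a b" and \<xi>="\<lambda>t om. V n t om $ a" and \<eta>="\<lambda>t om. V n t om $ b" and b="kap n a b" and B=B and D="1 + 2 * B",
      OF V_rest[OF blk] V_rest[OF blk] measurable_vec_component[OF V_rest_other] measurable_vec_component[OF V_rest_other] m b z cz
        P_square_sum_bound(1)[OF F_M[OF iV_F] iV_bound] mom mom kb B]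
  show "integrable (M n) (\<lambda>om. (\<Sum>p\<in>pairs n. ?m p om * zV n a b p om)^2)"
    by (rule Q(1)) assumption+
  have "(\<integral>om. (\<Sum>p\<in>pairs n. ?m p om * zV n a b p om)^2 \<partial>M n) \<le> real (2 * c^2) * (2 * B + 2 * (1 + 2 * B)^2) * (\<Sum>p\<in>pairs n. \<integral>om. (?m p om)^2 \<partial>M n)"
    by (rule Q(2)) assumption+
  also have "\<dots> \<le> real (2 * c^2) * (2 * B + 2 * (1 + 2 * B)^2) * real n"
    by (intro mult_left_mono P_square_sum_bound(2)[OF F_M[OF iV_F] iV_bound]) (use B in auto)
  finally show "(\<integral>om. (\<Sum>p\<in>pairs n. ?m p om * zV n a b p om)^2 \<partial>M n) \<le> real (2 * c^2) * (2 * B + 2 * (1 + 2 * B)^2) * real n" .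
qed

lemma linear_V_bound:
  assumes c: "small_blocks c n" and B: "0 \<le> B"
    and a: "\<And>t. t \<in> {1..n} ==> h t \<in> borel_measurable (F n)" "\<And>t. t \<in> {1..n} ==> L2 (M n) (h t)"
  shows "integrable (M n) (\<lambda>om. (\<Sum>t=1..n. (iV B n om * h t om) * V n t om $ b)^2)" (is ?g1)
    and "(\<integral>om. (\<Sum>t=1..n. (iV B n om * h t om) * V n t om $ b)^2 \<partial>M n) \<le> real c * (1 + B) * (\<Sum>t=1..n. \<integral>om. (h t om)^2 \<partial>M n)" (is ?g2)
proof -
  interpret block_filtration "M n" "F n" "rest n" "{1..n}" "blk n" c by (rule filtration_V[OF c])
  have m: "(\<lambda>om. iV B n om * h t om) \<in> borel_measurable (F n)" if "t \<in> {1..n}" for t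
    using iV_F a(1)[OF that] by simp
  have le: "(iV B n om * h t om)^2 \<le> (h t om)^2" for om t
  proof -
    have "(iV B n om)^2 * (h t om)^2 \<le> 1 * (h t om)^2" using iV_bound[of B n om] by (intro mult_right_mono) (auto simp: abs_square_le_1)
    then show ?thesis by (simp add: power_mult_distrib)
  qed
  have m2: "integrable (M n) (\<lambda>om. (iV B n om * h t om)^2)" if t: "t \<in> {1..n}" for t
    by (rule Bochner_Integration.integrable_bound[OF L2_int[OF a(2)[OF t]]]) (use le F_M[OF m[OF t]] in auto)
  have mom: "AE om in M n. iV B n om * h t om \<noteq> 0 \<longrightarrow> NF n (\<lambda>om. ennreal ((V n t om $ b) ^ 4)) om \<le> ennreal B" if "t \<in> {1..n}" for t
    using EV_component[OF that, of B b] by eventually_elim (use iV_nonzero in auto)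
  note L = linear_form_moment_bound[where a="\<lambda>t om. iV B n om * h t om" and \<xi>="\<lambda>t om. V n t om $ b" and B=B,
      OF V_rest[OF blk] measurable_vec_component[OF V_rest_other] m m2 mom B]
  show ?g1 by (rule L(1)) assumption+
  have "(\<integral>om. (\<Sum>t=1..n. (iV B n om * h t om) * V n t om $ b)^2 \<partial>M n) \<le> real c * (1 + B) * (\<Sum>t=1..n. \<integral>om. (iV B n om * h t om)^2 \<partial>M n)"
    by (rule L(2)) assumption+
  also have "\<dots> \<le> real c * (1 + B) * (\<Sum>t=1..n. \<integral>om. (h t om)^2 \<partial>M n)"
    using B by (intro mult_left_mono sum_mono integral_mono m2 L2_int[OF a(2)] le) auto
  finally show ?g2 .
qed

lemma linear_U_bound:
  assumes c: "small_blocks c n" and B: "0 \<le> B"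
    and a: "\<And>t. t \<in> {1..n} ==> h t \<in> borel_measurable (XF n)" "\<And>t. t \<in> {1..n} ==> integrable (M n) (\<lambda>om. (h t om)^2)"
    and nz: "\<And>t om. t \<in> {1..n} ==> h t om \<noteq> 0 ==> EU B n om"
  shows "integrable (M n) (\<lambda>om. (\<Sum>t=1..n. h t om * U n t om)^2)" (is ?g1)
    and "(\<integral>om. (\<Sum>t=1..n. h t om * U n t om)^2 \<partial>M n) \<le> real c * (1 + B) * (\<Sum>t=1..n. \<integral>om. (h t om)^2 \<partial>M n)" (is ?g2)
proof -
  interpret block_filtration "M n" "XF n" "HU n" "{1..n}" "blk n" c by (rule filtration_U[OF c])
  have mom: "AE om in M n. h t om \<noteq> 0 \<longrightarrow> NXF n (\<lambda>om. ennreal (U n t om ^ 4)) om \<le> ennreal B" if "t \<in> {1..n}" for t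
    using nz[OF that] that by (auto simp: EU_def)
  note L = linear_form_moment_bound[where a=h and \<xi>="U n" and B=B, OF U_HU[OF blk] U_HU_other a mom B]
  show ?g1 by (rule L(1)) assumption+
  show ?g2 by (rule L(2)) assumption+
qed

lemma quadratic_U_bound:
  assumes c: "small_blocks c n" and B: "0 \<le> B"
  shows "integrable (M n) (\<lambda>om. (\<Sum>p\<in>pairs n. iU B n om * Pp n p om * (U n (fst p) om * U n (snd p) om - (\<sigma> n)\<^sup>2 * of_bool (fst p = snd p)))^2)"
    and "(\<integral>om. (\<Sum>p\<in>pairs n. iU B n om * Pp n p om * (U n (fst p) om * U n (snd p) om - (\<sigma> n)\<^sup>2 * of_bool (fst p = snd p)))^2 \<partial>M n)
      \<le> real (2 * c^2) * (2 * B + 2 * ((\<sigma> n)^2)^2) * real n"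
proof -
  interpret block_filtration "M n" "XF n" "HU n" "{1..n}" "blk n" c by (rule filtration_U[OF c])
  let ?m = "\<lambda>p om. iU B n om * Pp n p om"
  let ?b = "\<lambda>p om. (\<sigma> n)^2 * of_bool (fst p = snd p)"
  let ?z = "\<lambda>p om. U n (fst p) om * U n (snd p) om - ?b p om"
  have m: "?m p \<in> borel_measurable (XF n)" if "p \<in> pairs n" for p
    using iU_XF F_XF[OF P_F] that by auto
  have b: "?b p \<in> borel_measurable (XF n)" for p :: "nat \<times> nat" by simp
  have bb: "AE om in M n. ?m p om \<noteq> 0 \<longrightarrow> \<bar>?b p om\<bar> \<le> (\<sigma> n)^2" for p by (intro AE_I2) auto
  have cz: "centered (M n) (HU n (blk n t)) (?z (s, t))" if st: "s \<in> {1..n}" "t \<in> {1..n}" "blk n s = blk n t" for s t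
  proof -
    have "s \<in> T n (blk n t)" using blk(2)[OF st(1)] st(3) by simp
    from UU_HU[OF blk(1)[OF st(2)] this blk(2)[OF st(2)]] show ?thesis by simp
  qed
  have z: "?z (s, t) om = U n s om * U n t om - (if blk n s = blk n t then ?b (s, t) om else 0)" for s t om
    by auto
  have mom: "AE om in M n. ?m (s, t) om \<noteq> 0 \<longrightarrow> NXF n (\<lambda>om. ennreal (U n q om ^ 4)) om \<le> ennreal B" if "q \<in> {1..n}" for q s t
    using iU_nonzero[of B n] that by (auto simp: EU_def)
  note Q = quadratic_form_moment_bound[where m="?m" and z="?z" and \<xi>="U n" and \<eta>="U n" and b="?b" and B=B and D="(\<sigma> n)^2",
      OF U_HU[OF blk] U_HU[OF blk] U_HU_other U_HU_other m b z cz
        P_square_sum_bound(1)[OF XF_M[OF iU_XF] iU_bound] mom mom bb B]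
  show "integrable (M n) (\<lambda>om. (\<Sum>p\<in>pairs n. ?m p om * ?z p om)^2)"
    by (rule Q(1)) assumption+
  have "(\<integral>om. (\<Sum>p\<in>pairs n. ?m p om * ?z p om)^2 \<partial>M n) \<le> real (2 * c^2) * (2 * B + 2 * ((\<sigma> n)^2)^2) * (\<Sum>p\<in>pairs n. \<integral>om. (?m p om)^2 \<partial>M n)"
    by (rule Q(2)) assumption+
  also have "\<dots> \<le> real (2 * c^2) * (2 * B + 2 * ((\<sigma> n)^2)^2) * real n"
    by (intro mult_left_mono P_square_sum_bound(2)[OF XF_M[OF iU_XF] iU_bound]) (use B in auto)
  finally show "(\<integral>om. (\<Sum>p\<in>pairs n. ?m p om * ?z p om)^2 \<partial>M n) \<le> real (2 * c^2) * (2 * B + 2 * ((\<sigma> n)^2)^2) * real n" .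
qed

section \<open>Regular samples and rates\<close>

abbreviation Pr :: "nat => 'a => (nat => 'v::real_vector) => nat => 'v" where
  "Pr n om \<equiv> projection.ap {1..n} (\<lambda>i j. P n i j om)"

lemma Pr_def: "Pr n om z i = (\<Sum>j=1..n. P n i j om *\<^sub>R z j)"
  by (rule projection.ap_def[OF P_projection])

lemma Pr_L2:
  assumes z: "\<And>j. j \<in> {1..n} ==> L2 (M n) (z j)" and i: "i \<in> {1..n}"
  shows "L2 (M n) (\<lambda>om. Pr n om (\<lambda>j. z j om) i)"
  unfolding Pr_def real_scaleR_def
proof (rule L2_sum)
  fix j assume j: "j \<in> {1..n}"
  show "L2 (M n) (\<lambda>om. P n i j om * z j om)"
  proof (rule L2_bound[OF z[OF j]])
    show "(\<lambda>om. P n i j om * z j om) \<in> borel_measurable (M n)"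
      using F_M[OF P_F[OF i j]] L2_meas[OF z[OF j]] by simp
    show "AE om in M n. \<bar>P n i j om * z j om\<bar> \<le> \<bar>z j om\<bar>"
      using P_bound[OF i j] by (intro AE_I2) (simp add: abs_mult mult_left_le_one_le)
  qed
qed

lemma Pr_F:
  assumes z: "\<And>j. j \<in> {1..n} ==> z j \<in> borel_measurable (F n)" and i: "i \<in> {1..n}"
  shows "(\<lambda>om. Pr n om (\<lambda>j. z j om) i :: real) \<in> borel_measurable (F n)"
  unfolding Pr_def real_scaleR_def by (intro borel_measurable_sum borel_measurable_times P_F z i)

lemma Pr_contraction_int:
  assumes z: "\<And>j. j \<in> {1..n} ==> L2 (M n) (z j)"
  shows "(\<Sum>i=1..n. \<integral>om. (Pr n om (\<lambda>j. z j om) i)^2 \<partial>M n) \<le> (\<Sum>i=1..n. \<integral>om. (z i om)^2 \<partial>M n)"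
proof -
  have a: "integrable (M n) (\<lambda>om. (Pr n om (\<lambda>j. z j om) i)^2)" if "i \<in> {1..n}" for i
    by (rule L2_int[OF Pr_L2[OF z that]])
  have b: "integrable (M n) (\<lambda>om. (z i om)^2)" if "i \<in> {1..n}" for i by (rule L2_int[OF z[OF that]])
  have "(\<Sum>i=1..n. \<integral>om. (Pr n om (\<lambda>j. z j om) i)^2 \<partial>M n) = (\<integral>om. (\<Sum>i=1..n. (Pr n om (\<lambda>j. z j om) i)^2) \<partial>M n)"
    by (rule Bochner_Integration.integral_sum[symmetric]) (rule a)
  also have "\<dots> \<le> (\<integral>om. (\<Sum>i=1..n. (z i om)^2) \<partial>M n)"
    by (intro integral_mono Bochner_Integration.integrable_sum a b projection.ap_contraction[OF P_projection])
  also have "\<dots> = (\<Sum>i=1..n. \<integral>om. (z i om)^2 \<partial>M n)"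
    by (rule Bochner_Integration.integral_sum) (rule b)
  finally show ?thesis .
qed

text \<open>The event on which the almost sure identities hold and the controls have full rank.\<close>

definition regular :: "nat => 'a => bool" where
  "regular n om \<longleftrightarrow> Determinant.det (gram K wF n om) \<noteq> 0 \<and> (\<forall>i\<in>{1..n}. w n i om = wF n i om) \<and>
    (\<forall>i\<in>{1..n}. \<forall>j\<in>{1..n}. annih K w n i j om = P n i j om) \<and> (\<forall>i\<in>{1..n}. u n i om = U n i om + R n i om) \<and>
    (\<forall>i\<in>{1..n}. x n i om = V n i om + Q n i om + l_part n (wF n i om))"

lemma whp_regular: "whp M regular"
  unfolding whp_def
proof (intro allI impI)
  fix e :: real assume e: "0 < e"
  let ?A = "\<lambda>n. {om \<in> space (M n). min_eigenvalue_mat (gram K w n om) > 0}"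
  have "\<forall>\<^sub>F n in sequentially. max 0 (1 - e) < measure (M n) (?A n)"
    using order_tendstoD(1)[OF design_rank, of "max 0 (1 - e)"] e by simp
  then show "\<forall>\<^sub>F n in sequentially. with_prob (M n) e (regular n)"
  proof eventually_elim
    case (elim n)
    interpret prob_space "M n" by (rule prob)
    have AM: "?A n \<in> sets (M n)" using elim measure_notin_sets[of "?A n" "M n"] by (cases "?A n \<in> sets (M n)") auto
    have c: "{om \<in> space (M n). \<not> min_eigenvalue_mat (gram K w n om) > 0} = space (M n) - ?A n" by blast
    have 1: "with_prob (M n) e (\<lambda>om. min_eigenvalue_mat (gram K w n om) > 0)"
    proof (rule with_prob_measure)
      show "{om \<in> space (M n). \<not> min_eigenvalue_mat (gram K w n om) > 0} \<in> sets (M n)" unfolding c using AM by blast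
      show "measure (M n) {om \<in> space (M n). \<not> min_eigenvalue_mat (gram K w n om) > 0} \<le> e"
        unfolding c using prob_compl[OF AM] elim by simp
    qed
    let ?I = "\<lambda>om. (\<forall>i\<in>{1..n}. w n i om = wF n i om) \<and>
      (\<forall>i\<in>{1..n}. \<forall>j\<in>{1..n}. annih K w n i j om = P n i j om) \<and> (\<forall>i\<in>{1..n}. u n i om = U n i om + R n i om) \<and>
      (\<forall>i\<in>{1..n}. x n i om = V n i om + Q n i om + l_part n (wF n i om))"
    have "AE om in M n. ?I om"
      using AE_wF AE_P AE_u AE_x by eventually_elim blast
    then have 2: "with_prob (M n) 0 ?I"
      by (rule with_prob_AE) simp
    show ?case
    proof (rule with_prob_mono[OF with_prob_conj[OF 1 2]])
      fix om assume *: "0 < min_eigenvalue_mat (gram K w n om) \<and> ?I om"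
      have g: "gram K w n om = gram K wF n om" unfolding gram_def using * by (intro cong_mat refl) (auto intro!: sum.cong)
      have "Determinant.det (gram K w n om) \<noteq> 0"
        by (rule min_eigenvalue_mat_pos_imp_det[OF gram_carrier]) (use * in blast)
      then show "regular n om" unfolding regular_def g using * by blast
    qed simp
  qed
qed

lemma regular_kills:
  assumes "regular n om" "i \<in> {1..n}"
  shows "Pr n om (\<lambda>j. g_dot n (wF n j om)) i = 0" (is ?g1) "Pr n om (\<lambda>j. l_part n (wF n j om)) i = 0" (is ?g2)
proof -
  have d: "Determinant.det (gram K wF n om) \<noteq> 0" using assms by (simp add: regular_def)
  have k: "(\<Sum>j=1..n. P n i j om * vec_index (wF n j om) q) = 0" if "q < K n" for q
    unfolding P_def by (rule annih_mult_w[where K=K and w=wF and n=n and om=om, OF wF_carrier d that assms(2)])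
  have lin: "(\<Sum>j=1..n. P n i j om * (\<Sum>q<K n. c q * vec_index (wF n j om) q)) = 0" for c
  proof -
    have "(\<Sum>j=1..n. P n i j om * (\<Sum>q<K n. c q * vec_index (wF n j om) q)) = (\<Sum>q<K n. c q * (\<Sum>j=1..n. P n i j om * vec_index (wF n j om) q))"
      unfolding sum_distrib_left by (subst sum.swap) (simp add: mult_ac)
    also have "\<dots> = 0" by (rule sum.neutral) (use k in simp)
    finally show ?thesis .
  qed
  show ?g1 unfolding Pr_def g_dot_def real_scaleR_def by (rule lin)
  show ?g2
  proof (subst Finite_Cartesian_Product.vec_eq_iff, intro allI)
    fix a
    have "Pr n om (\<lambda>j. l_part n (wF n j om)) i $ a = (\<Sum>j=1..n. P n i j om * (\<Sum>q<K n. l_coef n a q * vec_index (wF n j om) q))"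
      unfolding Pr_def sum_component vector_scaleR_component l_part_def vec_lambda_beta real_scaleR_def ..
    then show "Pr n om (\<lambda>j. l_part n (wF n j om)) i $ a = 0 $ a" using lin by simp
  qed
qed

lemma regular_v_hat:
  assumes r: "regular n om" and i: "i \<in> {1..n}"
  shows "vhat n i om = Pr n om (\<lambda>j. x n j om) i" (is ?g1)
    and "vhat n i om = Pr n om (\<lambda>j. V n j om) i + Pr n om (\<lambda>j. Q n j om) i" (is ?g2)
proof -
  show 1: ?g1
    unfolding v_hat_def Pr_def using r i by (intro sum.cong refl) (simp add: regular_def)
  have "Pr n om (\<lambda>j. x n j om) i = Pr n om (\<lambda>j. (V n j om + Q n j om) + l_part n (wF n j om)) i"
    by (rule projection.ap_cong[OF P_projection]) (use r in \<open>simp add: regular_def\<close>)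
  also have "\<dots> = Pr n om (\<lambda>j. V n j om) i + Pr n om (\<lambda>j. Q n j om) i"
    unfolding projection.ap_add[OF P_projection] regular_kills(2)[OF r i] by simp
  finally show ?g2 unfolding 1 .
qed

lemma regular_trace:
  assumes "regular n om"
  shows "(\<Sum>i=1..n. P n i i om) = real n - real (K n)"
  unfolding P_def by (rule annih_trace[where K=K and w=wF and n=n and om=om, OF wF_carrier]) (use assms in \<open>simp add: regular_def\<close>)

lemma chi_nonneg: "0 \<le> chi n"
  unfolding chi_n_def by (intro mult_nonneg_nonneg sum_nonneg) auto

lemma varrho_nonneg: "0 \<le> varrho n"
  unfolding varrho_n_def by (intro mult_nonneg_nonneg sum_nonneg) auto

lemma rho_nonneg: "0 \<le> rho n"
  unfolding rho_n_def by (intro mult_nonneg_nonneg sum_nonneg) auto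

text \<open>\<open>r\<close> is the conditional mean of \<open>R\<close> given \<open>F\<close>, and the residual is orthogonal to it.\<close>

lemma R_minus_r:
  assumes i: "i \<in> {1..n}"
  shows "L2 (M n) (\<lambda>om. R n i om - r n i om)" (is ?g1)
    and "(\<integral>om. (R n i om - r n i om)^2 \<partial>M n) = (\<integral>om. (R n i om)^2 \<partial>M n) - (\<integral>om. (r n i om)^2 \<partial>M n)" (is ?g2)
proof -
  interpret prob_space "M n" by (rule prob)
  interpret S: sigma_finite_subalgebra "M n" "F n" by (rule sigma_finite_subalgebraI[OF subalg])
  show ?g1 by (intro L2_diff R_L2 r_L2 i)
  have tower: "AE om in M n. EF n (R n i) om = r n i om"
    unfolding R_err_def r_err_def
    by (rule S.real_cond_exp_nested_subalg[OF subalg_XF F_le_XF L2_integrable[OF u_L2[OF i]]])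
  note sq = cond_exp_square[OF subalg L2_meas[OF R_L2[OF i]] L2_int[OF R_L2[OF i]]]
  have Rm: "R n i \<in> borel_measurable (M n)" and rm: "r n i \<in> borel_measurable (M n)"
    by (rule L2_meas[OF R_L2[OF i]]) (rule L2_meas[OF r_L2[OF i]])
  have "(\<integral>om. (R n i om - r n i om)^2 \<partial>M n) = (\<integral>om. (R n i om - EF n (R n i) om)^2 \<partial>M n)"
    by (rule integral_cong_AE) (use Rm rm tower in auto)
  also have "\<dots> = (\<integral>om. (R n i om)^2 \<partial>M n) - (\<integral>om. (EF n (R n i) om)^2 \<partial>M n)" by (rule sq(4))
  also have "(\<integral>om. (EF n (R n i) om)^2 \<partial>M n) = (\<integral>om. (r n i om)^2 \<partial>M n)"
    by (rule integral_cong_AE) (use rm tower in auto)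
  finally show ?g2 .
qed

lemma sum_R_minus_r: "n \<ge> 1 ==> (\<Sum>i=1..n. \<integral>om. (R n i om - r n i om)^2 \<partial>M n) = real n * (varrho n - rho n)"
  by (simp add: R_minus_r(2) sum_subtractf varrho_n_def rho_n_def right_diff_distrib)

lemma sum_R: "n \<ge> 1 ==> (\<Sum>i=1..n. \<integral>om. (R n i om)^2 \<partial>M n) = real n * varrho n"
  and sum_r: "n \<ge> 1 ==> (\<Sum>i=1..n. \<integral>om. (r n i om)^2 \<partial>M n) = real n * rho n"
  and sum_Q: "n \<ge> 1 ==> (\<Sum>i=1..n. \<integral>om. (norm (Q n i om))^2 \<partial>M n) = real n * chi n"
  by (simp_all add: varrho_n_def rho_n_def chi_n_def)

lemma varrho_ge_rho: "rho n \<le> varrho n"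
proof (cases "n \<ge> 1")
  case True
  have "0 \<le> (\<Sum>i=1..n. \<integral>om. (R n i om - r n i om)^2 \<partial>M n)" by (intro sum_nonneg) auto
  then show ?thesis unfolding sum_R_minus_r[OF True] using True by (simp add: zero_le_mult_iff)
next
  case False
  then have "n = 0" by simp
  then show ?thesis by (simp add: varrho_n_def rho_n_def)
qed

text \<open>The three summands of the hypothesis on rates are nonnegative, so each of them vanishes.\<close>

lemma rates:
  shows "(\<lambda>n. varrho n) \<longlonglongrightarrow> 0" (is ?g1) "(\<lambda>n. real n * (varrho n - rho n)) \<longlonglongrightarrow> 0" (is ?g2)
    "(\<lambda>n. real n * chi n * varrho n) \<longlonglongrightarrow> 0" (is ?g3) "(\<lambda>n. rho n) \<longlonglongrightarrow> 0" (is ?g4)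
proof -
  define t1 where "t1 n = varrho n" for n
  define t2 where "t2 n = real n * (varrho n - rho n)" for n
  define t3 where "t3 n = real n * chi n * varrho n" for n
  have nn: "0 \<le> t1 n" "0 \<le> t2 n" "0 \<le> t3 n" for n
    unfolding t1_def t2_def t3_def using varrho_nonneg chi_nonneg varrho_ge_rho by auto
  have lim: "(\<lambda>n. t1 n + t2 n + t3 n) \<longlonglongrightarrow> 0"
    using smalloD_tendsto[OF approx_rho] by (simp add: t1_def t2_def t3_def)
  have s: "f \<longlonglongrightarrow> 0" if "\<And>n. 0 \<le> f n" "\<And>n. f n \<le> t1 n + t2 n + t3 n" for f :: "nat => real"
    by (rule tendsto_sandwich[OF _ _ tendsto_const lim]) (use that in auto)
  show 1: ?g1 unfolding t1_def[symmetric] by (rule s) (use nn in auto)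
  show ?g2 unfolding t2_def[symmetric] by (rule s) (use nn in auto)
  show ?g3 unfolding t3_def[symmetric] by (rule s) (use nn in auto)
  show ?g4
    by (rule tendsto_sandwich[OF _ _ tendsto_const 1]) (use rho_nonneg varrho_ge_rho in auto)
qed

lemma chi_over_n: "(\<lambda>n. C * chi n / real n) \<longlonglongrightarrow> 0"
proof -
  obtain c where "\<forall>\<^sub>F n in sequentially. norm (chi n) \<le> c * norm (1 :: real)"
    using approx_chi by (elim landau_o.bigE) blast
  then have b: "\<forall>\<^sub>F n in sequentially. norm (C * chi n / real n) \<le> \<bar>C\<bar> * c / real n"
    by eventually_elim (auto simp: abs_mult intro!: divide_right_mono mult_left_mono)
  have "(\<lambda>n. \<bar>C\<bar> * c / real n) \<longlonglongrightarrow> 0" by (rule lim_const_over_n)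
  then show ?thesis by (rule Lim_null_comparison[OF b])
qed

section \<open>Second moment matrices of the residualised regressors\<close>

lemma V_product_centered:
  assumes p: "p \<in> pairs n"
  shows "centered (M n) (F n) (\<lambda>om. Pp n p om * zV n a b p om)"
proof -
  interpret prob_space "M n" by (rule prob)
  obtain s t where st: "p = (s, t)" "s \<in> {1..n}" "t \<in> {1..n}" using p by blast
  have "centered (M n) (F n) (zV n a b p)"
  proof (cases "blk n s = blk n t")
    case True
    have "s \<in> T n (blk n t)" using blk(2)[OF st(2)] True by simp
    from VV_rest[OF blk(1)[OF st(3)] blk(2)[OF st(3)] this, of a b]
    have "centered (M n) (rest n (blk n t)) (zV n a b p)"
      unfolding zV_def[abs_def] kap_def by (simp add: True st(1))
    then show ?thesis by (rule centered_mono) (rule cond_indep_blocks.F_le_rest[OF blocks])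
  next
    case False
    have "centered (M n) (rest n (blk n s)) (\<lambda>om. V n t om $ b * V n s om $ a)"
    proof (rule centered_cmult[OF cond_indep_blocks.subalgebra_rest[OF blocks] V_rest[OF blk[OF st(2)]]])
      show "(\<lambda>om. V n t om $ b) \<in> borel_measurable (rest n (blk n s))"
        by (rule measurable_vec_component[OF V_rest_other]) (use st False in auto)
      show "integrable (M n) (\<lambda>om. V n t om $ b * V n s om $ a)" by (intro L2_prod V_L2 st)
    qed
    then have "centered (M n) (rest n (blk n s)) (zV n a b p)"
      unfolding zV_def[abs_def] using False by (simp add: st(1) mult.commute)
    then show ?thesis by (rule centered_mono) (rule cond_indep_blocks.F_le_rest[OF blocks])
  qed
  moreover have "integrable (M n) (\<lambda>om. Pp n p om * zV n a b p om)"
  proof (rule Bochner_Integration.integrable_bound)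
    show i: "integrable (M n) (zV n a b p)" using calculation by (simp add: centered_def)
    show "(\<lambda>om. Pp n p om * zV n a b p om) \<in> borel_measurable (M n)"
      using F_M[OF P_F[OF st(2,3)]] i by (auto simp: st)
    show "AE om in M n. norm (Pp n p om * zV n a b p om) \<le> norm (zV n a b p om)"
      using P_bound[OF st(2,3)] by (intro AE_I2) (simp add: abs_mult mult_left_le_one_le st)
  qed
  ultimately show ?thesis
    by (intro centered_cmult subalg) (use P_F[OF st(2,3)] st in auto)
qed

lemma kap_integrable: "p \<in> pairs n ==> integrable (M n) (kap n a b p)"
proof -
  assume p: "p \<in> pairs n"
  interpret prob_space "M n" by (rule prob)
  interpret S: sigma_finite_subalgebra "M n" "F n" by (rule sigma_finite_subalgebraI[OF subalg])
  show ?thesis unfolding kap_def[abs_def] by (intro S.real_cond_exp_int(1) L2_prod V_L2) (use p in auto)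
qed

lemma V_tilde_Pr:
  assumes "\<forall>i\<in>{1..n}. \<forall>j\<in>{1..n}. annih K w n i j om = P n i j om" "i \<in> {1..n}"
  shows "Vtilde n i om = Pr n om (\<lambda>j. V n j om) i"
  unfolding V_tilde_def Pr_def using assms by (intro sum.cong refl) simp

lemma Gamma_tilde_quad:
  assumes "\<forall>i\<in>{1..n}. \<forall>j\<in>{1..n}. annih K w n i j om = P n i j om"
  shows "Gammatilde n om $ a $ b = (1 / real n) * (\<Sum>p\<in>pairs n. Pp n p om * (V n (fst p) om $ a * V n (snd p) om $ b))" (is ?g1)
proof -
  interpret projection "{1..n}" "\<lambda>i j. P n i j om" by (rule P_projection)
  note vt = V_tilde_Pr[OF assms]
  have "(\<Sum>i=1..n. outer (Vtilde n i om) (Vtilde n i om)) $ a $ b = (\<Sum>i=1..n. ap (\<lambda>j. V n j om $ a) i * ap (\<lambda>j. V n j om $ b) i)"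
    unfolding sum_component by (intro sum.cong refl) (simp only: outer_def vt vec_lambda_beta ap_component)
  also have "\<dots> = (\<Sum>p\<in>pairs n. Pp n p om * (V n (fst p) om $ a * V n (snd p) om $ b))"
    unfolding ap_prod quad_form ..
  finally show ?g1
    by (simp add: Gamma_tilde_def)
qed

lemma measurable_annih_M: "i \<in> {1..n} ==> j \<in> {1..n} ==> annih K w n i j \<in> borel_measurable (M n)"
  by (rule measurable_annih) (use w_meas w_dim in auto)

lemma measurable_Gamma_tilde: "(\<lambda>om. Gammatilde n om $ a $ b) \<in> borel_measurable (M n)"
proof -
  have "(\<lambda>om. Vtilde n i om $ c) \<in> borel_measurable (M n)" if "i \<in> {1..n}" for i c
    unfolding V_tilde_def sum_component vector_scaleR_component real_scaleR_def
    by (intro borel_measurable_sum borel_measurable_times measurable_annih_M measurable_vec_component V_M that)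
  then show ?thesis
    unfolding Gamma_tilde_def vector_scaleR_component real_scaleR_def sum_component outer_def vec_lambda_beta
    by (intro borel_measurable_sum borel_measurable_times borel_measurable_const)
qed

text \<open>The weights are known to \<open>F\<close>, so conditioning acts on the products of errors, leaving the within-block means \<open>kap\<close>.\<close>

lemma Gamma_tilde_cond_exp:
  "AE om in M n. Gammatilde n om $ a $ b - matrix_cond_exp (M n) (F n) (Gammatilde n) om $ a $ b
    = (1 / real n) * (\<Sum>p\<in>pairs n. Pp n p om * zV n a b p om)"
proof -
  interpret prob_space "M n" by (rule prob)
  let ?J = "pairs n"
  let ?k = "\<lambda>p om. if blk n (fst p) = blk n (snd p) then kap n a b p om else 0"
  let ?Y = "\<lambda>om. (1 / real n) * (\<Sum>p\<in>?J. Pp n p om * zV n a b p om)"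
  let ?f = "\<lambda>om. (1 / real n) * (\<Sum>p\<in>?J. Pp n p om * ?k p om)"
  have cs: "centered (M n) (F n) (\<lambda>om. \<Sum>p\<in>?J. Pp n p om * zV n a b p om)"
    by (rule centered_sum) (auto intro: V_product_centered subalg)
  have cY: "centered (M n) (F n) ?Y"
    by (rule centered_cmult[OF subalg cs]) (use cs in \<open>auto simp: centered_def\<close>)
  have fF: "?f \<in> borel_measurable (F n)"
  proof (intro borel_measurable_times borel_measurable_const borel_measurable_sum)
    fix p assume "p \<in> ?J"
    then show "Pp n p \<in> borel_measurable (F n)" using P_F by auto
    show "?k p \<in> borel_measurable (F n)" unfolding kap_def by (cases "blk n (fst p) = blk n (snd p)") simp_all
  qed
  have fint: "integrable (M n) ?f"
  proof (intro integrable_mult_right Bochner_Integration.integrable_sum)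
    fix p assume p: "p \<in> ?J"
    have ki: "integrable (M n) (?k p)" using kap_integrable[OF p] by (cases "blk n (fst p) = blk n (snd p)") simp_all
    show "integrable (M n) (\<lambda>om. Pp n p om * ?k p om)"
    proof (rule Bochner_Integration.integrable_bound[OF ki])
      show "(\<lambda>om. Pp n p om * ?k p om) \<in> borel_measurable (M n)"
        using F_M[OF P_F[of "fst p" n "snd p"]] ki p by auto
      show "AE om in M n. norm (Pp n p om * ?k p om) \<le> norm (?k p om)"
        using P_bound[of "fst p" n "snd p"] p unfolding real_norm_def abs_mult by (intro AE_I2 mult_left_le_one_le) auto
    qed
  qed
  have eq: "AE om in M n. Gammatilde n om $ a $ b = ?Y om + ?f om"
    using AE_P
  proof eventually_elim
    case (elim om)
    show ?case unfolding Gamma_tilde_quad[OF elim] distrib_left[symmetric] sum.distrib[symmetric]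
      by (intro arg_cong2[where f="(*)"] refl sum.cong) (simp add: zV_def algebra_simps)
  qed
  from cond_exp_eqI[OF subalg cY fF fint measurable_Gamma_tilde eq] eq
  show ?thesis by eventually_elim (simp add: matrix_cond_exp_def)
qed

lemma const_over_n_le:
  assumes "0 \<le> S" "S \<le> C * real n" "n \<ge> 1"
  shows "(1 / real n)^2 * S \<le> C / real n"
proof -
  have "(1 / real n)^2 * S \<le> (1 / real n)^2 * (C * real n)" using assms by (intro mult_left_mono) auto
  also have "\<dots> = C / real n" using assms by (simp add: power2_eq_square)
  finally show ?thesis .
qed

lemma whp_Gamma_tilde:
  assumes B: "0 \<le> B" and d: "0 < d"
  shows "whp M (\<lambda>n om. EV B n om \<longrightarrow> \<bar>Gammatilde n om $ a $ b - matrix_cond_exp (M n) (F n) (Gammatilde n) om $ a $ b\<bar> \<le> d)"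
proof -
  obtain c where c: "\<forall>\<^sub>F n in sequentially. small_blocks c n"
    using block_bound unfolding small_blocks_def by blast
  define C where "C = real (2 * c^2) * (2 * B + 2 * (1 + 2 * B)^2)"
  define X where "X n om = (1 / real n) * (\<Sum>p\<in>pairs n. iV B n om * Pp n p om * zV n a b p om)" for n om
  have "\<forall>\<^sub>F n in sequentially. integrable (M n) (\<lambda>om. (X n om)^2) \<and> (\<integral>om. (X n om)^2 \<partial>M n) \<le> C / real n"
    using c eventually_ge_at_top[of 1]
  proof eventually_elim
    case (elim n)
    note q = quadratic_V_bound[OF elim(1) B, of a b]
    show ?case unfolding X_def power_mult_distrib
      using q(1) const_over_n_le[OF _ q(2)[folded C_def] elim(2)] by simp
  qed
  then have w: "whp M (\<lambda>n om. \<bar>X n om\<bar> \<le> d)"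
    by (rule whp_second_moment[OF prob _ lim_const_over_n d])
  have ae: "whp M (\<lambda>n om. Gammatilde n om $ a $ b - matrix_cond_exp (M n) (F n) (Gammatilde n) om $ a $ b
    = (1 / real n) * (\<Sum>p\<in>pairs n. Pp n p om * zV n a b p om))"
    unfolding whp_def using prob_space.with_prob_AE[OF prob Gamma_tilde_cond_exp] by auto
  show ?thesis
    by (rule whp_mono[OF whp_conj[OF prob w ae]], rule always_eventually) (auto simp: X_def iV_1)
qed

lemma sum_Qt_bound:
  assumes n: "n \<ge> 1"
  shows "(\<Sum>i=1..n. \<integral>om. (Pr n om (\<lambda>j. Q n j om $ a) i)^2 \<partial>M n) \<le> chi n * real n"
proof -
  have "(\<Sum>i=1..n. \<integral>om. (Pr n om (\<lambda>j. Q n j om $ a) i)^2 \<partial>M n) \<le> (\<Sum>i=1..n. \<integral>om. (Q n i om $ a)^2 \<partial>M n)"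
    by (rule Pr_contraction_int) (rule Q_L2)
  also have "\<dots> \<le> (\<Sum>i=1..n. \<integral>om. (norm (Q n i om))^2 \<partial>M n)"
  proof (rule sum_mono)
    fix i assume i: "i \<in> {1..n}"
    have n2: "(norm (v :: real ^ 'd))^2 = (\<Sum>a\<in>UNIV. (v $ a)^2)" for v
      unfolding power2_norm_eq_inner inner_vec_def by (simp add: power2_eq_square)
    have int: "integrable (M n) (\<lambda>om. (norm (Q n i om))^2)"
      unfolding n2 by (intro Bochner_Integration.integrable_sum L2_int Q_L2 i)
    show "(\<integral>om. (Q n i om $ a)^2 \<partial>M n) \<le> (\<integral>om. (norm (Q n i om))^2 \<partial>M n)"
    proof (rule integral_mono[OF L2_int[OF Q_L2[OF i]] int])
      show "(Q n i om $ a)^2 \<le> (norm (Q n i om))^2" for om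
        using component_le_norm_cart[of "Q n i om" a] by (metis abs_le_square_iff abs_norm_cancel)
    qed
  qed
  also have "\<dots> = chi n * real n" using sum_Q[OF n] by simp
  finally show ?thesis .
qed

text \<open>The weights are the residualised \<open>Q\<close>, known to \<open>F\<close>; the variance is of order \<open>chi / n\<close>.\<close>

lemma whp_cross:
  assumes B: "0 \<le> B" and d: "0 < d"
  shows "whp M (\<lambda>n om. EV B n om \<longrightarrow> \<bar>(1 / real n) * (\<Sum>i=1..n. Pr n om (\<lambda>j. Q n j om $ a) i * V n i om $ b)\<bar> \<le> d)"
proof -
  obtain c where c: "\<forall>\<^sub>F n in sequentially. small_blocks c n"
    using block_bound unfolding small_blocks_def by blast
  define X where "X n om = (1 / real n) * (\<Sum>i=1..n. (iV B n om * Pr n om (\<lambda>j. Q n j om $ a) i) * V n i om $ b)" for n om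
  have "\<forall>\<^sub>F n in sequentially. integrable (M n) (\<lambda>om. (X n om)^2) \<and> (\<integral>om. (X n om)^2 \<partial>M n) \<le> (real c * (1 + B)) * chi n / real n"
    using c eventually_ge_at_top[of 1]
  proof eventually_elim
    case (elim n)
    have hF: "(\<lambda>om. Pr n om (\<lambda>j. Q n j om $ a) i) \<in> borel_measurable (F n)" if "i \<in> {1..n}" for i
      by (rule Pr_F[OF measurable_vec_component[OF Q_F] that])
    have hL: "L2 (M n) (\<lambda>om. Pr n om (\<lambda>j. Q n j om $ a) i)" if "i \<in> {1..n}" for i
      by (rule Pr_L2[OF Q_L2 that])
    note q = linear_V_bound[OF elim(1) B hF hL, where b=b]
    have "(\<integral>om. (\<Sum>i=1..n. (iV B n om * Pr n om (\<lambda>j. Q n j om $ a) i) * V n i om $ b)^2 \<partial>M n) \<le> real c * (1 + B) * (chi n * real n)"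
      by (rule order_trans[OF q(2)]) (use B sum_Qt_bound[OF elim(2)] in \<open>auto intro!: mult_left_mono\<close>)
    then have s: "(\<integral>om. (\<Sum>i=1..n. (iV B n om * Pr n om (\<lambda>j. Q n j om $ a) i) * V n i om $ b)^2 \<partial>M n) \<le> ((real c * (1 + B)) * chi n) * real n"
      by (simp only: mult.assoc)
    show ?case unfolding X_def power_mult_distrib
      using q(1) const_over_n_le[OF _ s elim(2)] by simp
  qed
  then have w: "whp M (\<lambda>n om. \<bar>X n om\<bar> \<le> d)"
    by (rule whp_second_moment[OF prob _ chi_over_n d])
  show ?thesis
    by (rule whp_mono[OF w], rule always_eventually) (auto simp: X_def iV_1)
qed

end

lemma ennreal_reciprocal_bound:
  assumes "1 / q \<le> ennreal B" "0 < B"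
  shows "ennreal (1 / B) \<le> q"
proof (cases q)
  case (real r)
  show ?thesis
  proof (cases "r = 0")
    case True
    then have "1 / q = \<top>" using real by (simp add: ennreal_divide_zero)
    then show ?thesis using assms(1) by (simp add: top_unique)
  next
    case False
    then have r: "0 < r" using real by simp
    have "1 / q = ennreal (1 / r)" using real r by (simp add: divide_ennreal flip: ennreal_1)
    then have "1 / r \<le> B" using assms by (simp add: ennreal_le_iff)
    then have "1 / B \<le> r" using r assms(2) by (simp add: field_simps)
    then show ?thesis using real by (simp add: ennreal_leI)
  qed
qed simp

lemma quadratic_entries_bound:
  fixes x :: "real ^ 'd" and E :: "'d => 'd => real"
  assumes "\<And>a b. \<bar>E a b\<bar> \<le> d" "0 \<le> d"
  shows "\<bar>\<Sum>a\<in>UNIV. \<Sum>b\<in>UNIV. x $ a * x $ b * E a b\<bar> \<le> d * (real CARD('d))^2 * (x \<bullet> x)"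
proof -
  have t: "\<bar>x $ a * x $ b * E a b\<bar> \<le> (x \<bullet> x) * d" for a b
  proof -
    have "\<bar>x $ a * x $ b\<bar> \<le> norm x * norm x"
      unfolding abs_mult by (intro mult_mono component_le_norm_cart) auto
    then have "\<bar>x $ a * x $ b\<bar> \<le> x \<bullet> x" by (simp add: power2_norm_eq_inner[symmetric] power2_eq_square)
    then show ?thesis unfolding abs_mult[of "x $ a * x $ b"] using assms by (intro mult_mono) auto
  qed
  have "\<bar>\<Sum>a\<in>UNIV. \<Sum>b\<in>UNIV. x $ a * x $ b * E a b\<bar> \<le> (\<Sum>a\<in>UNIV. \<Sum>b\<in>UNIV. \<bar>x $ a * x $ b * E a b\<bar>)"
    by (rule order_trans[OF sum_abs]) (intro sum_mono sum_abs)
  also have "\<dots> \<le> (\<Sum>a\<in>(UNIV::'d set). \<Sum>b\<in>(UNIV::'d set). (x \<bullet> x) * d)" by (intro sum_mono t)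
  also have "\<dots> = d * (real CARD('d))^2 * (x \<bullet> x)" by (simp add: power2_eq_square)
  finally show ?thesis .
qed

lemma quadratic_form_entries:
  fixes A :: "real ^ 'd ^ 'd"
  shows "x \<bullet> (A *v x) = (\<Sum>a\<in>UNIV. \<Sum>b\<in>UNIV. x $ a * x $ b * A $ a $ b)"
  by (simp add: inner_vec_def matrix_vector_mult_def sum_distrib_left mult_ac)

lemma quadratic_form_outer:
  fixes v :: "nat => real ^ 'd"
  shows "x \<bullet> ((c *\<^sub>R (\<Sum>i\<in>J. outer (v i) (v i))) *v x) = c * (\<Sum>i\<in>J. (x \<bullet> v i)^2)"
  by (simp add: scaleR_matrix_vector_assoc[symmetric] sum_outer_mult_vec inner_sum_right power2_eq_square inner_commute)

context many_covariates
begin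

lemma matrix_cond_exp_entry [simp]:
  "matrix_cond_exp (M n) (F n) X om $ a $ b = EF n (\<lambda>om. X om $ a $ b) om"
  by (simp add: matrix_cond_exp_def)

abbreviation EG :: "nat => 'a => real ^ 'd ^ 'd" where
  "EG n \<equiv> matrix_cond_exp (M n) (F n) (Gammatilde n)"

lemma EG_symmetric: "symmetric (EG n om)"
proof (rule symmetricI)
  fix a b
  have "Gammatilde n om $ a $ b = Gammatilde n om $ b $ a" for om
    by (simp add: Gamma_tilde_def outer_def sum_component mult.commute)
  then show "EG n om $ a $ b = EG n om $ b $ a" by simp
qed

lemma C_n_measurable:
  assumes n: "1 \<le> n"
  shows "Cn n \<in> borel_measurable (M n)"
proof -
  let ?f = "\<lambda>i om. NXF n (\<lambda>om. ennreal ((U n i om) ^ 4)) om +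
        NF n (\<lambda>om. ennreal ((norm (V n i om)) ^ 4)) om +
        1 / NXF n (\<lambda>om. ennreal ((U n i om)^2)) om"
  have "(MAX i\<in>{1..n}. ?f i om) = (SUP i\<in>{1..n}. ?f i om)" for om
    by (rule cSup_eq_Max[symmetric]) (use n in auto)
  moreover have "(\<lambda>om. SUP i\<in>{1..n}. ?f i om) \<in> borel_measurable (M n)" by measurable
  ultimately have 1: "(\<lambda>om. MAX i\<in>{1..n}. ?f i om) \<in> borel_measurable (M n)" by (simp only:)
  have "EG n \<in> borel_measurable (M n)" by (rule measurable_matrixI) simp
  then have 2: "(\<lambda>om. min_eigenvalue (EG n om)) \<in> borel_measurable (M n)"
    by (rule measurable_min_eigenvalue) (rule EG_symmetric)
  show ?thesis unfolding C_n_def[abs_def] using 1 2 by measurable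
qed

definition good :: "real => nat => 'a => bool" where
  "good B n om \<longleftrightarrow> EU B n om \<and> EV B n om \<and> 1 / B \<le> min_eigenvalue (EG n om) \<and>
    (\<forall>i\<in>{1..n}. ennreal (1 / B) \<le> NXF n (\<lambda>om. ennreal ((U n i om)^2)) om)"

lemma C_n_good:
  assumes n: "1 \<le> n" and B: "0 < B" and C: "Cn n om \<le> ennreal B"
  shows "good B n om"
proof -
  let ?f = "\<lambda>i. NXF n (\<lambda>om. ennreal ((U n i om) ^ 4)) om +
        NF n (\<lambda>om. ennreal ((norm (V n i om)) ^ 4)) om +
        1 / NXF n (\<lambda>om. ennreal ((U n i om)^2)) om"
  let ?e = "1 / ennreal (min_eigenvalue (EG n om))"
  have sum: "(MAX i\<in>{1..n}. ?f i) + ?e \<le> ennreal B" using C by (simp only: C_n_def)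
  have "?e \<le> (MAX i\<in>{1..n}. ?f i) + ?e" by simp
  then have e: "?e \<le> ennreal B" using sum by (rule order_trans)
  have f: "?f i \<le> ennreal B" if "i \<in> {1..n}" for i
  proof -
    have "?f i \<le> (MAX i\<in>{1..n}. ?f i)" using that by (intro Max_ge) auto
    also have "\<dots> \<le> (MAX i\<in>{1..n}. ?f i) + ?e" by simp
    finally show ?thesis using sum by (rule order_trans)
  qed
  have parts: "a \<le> c \<and> b \<le> c \<and> d \<le> c" if "a + b + d \<le> c" for a b c d :: ennreal
  proof -
    have "a \<le> a + b + d" by (simp add: add.assoc)
    moreover have "b \<le> a + b + d" by (simp add: add.commute[of a] add.assoc)
    moreover have "d \<le> a + b + d" by (simp add: add.commute[of _ d])
    ultimately show ?thesis using that by (meson order_trans)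
  qed
  note p = parts[OF f]
  have "ennreal (1 / B) \<le> ennreal (min_eigenvalue (EG n om))" by (rule ennreal_reciprocal_bound[OF e B])
  then have m: "1 / B \<le> min_eigenvalue (EG n om)" using B
    by (cases "0 \<le> min_eigenvalue (EG n om)") (auto simp: ennreal_le_iff ennreal_neg)
  show ?thesis unfolding good_def EU_def EV_def
    using p m ennreal_reciprocal_bound[OF _ B] by blast
qed

lemma good_event:
  assumes e: "0 < e"
  shows "\<exists>B\<ge>1. \<forall>\<^sub>F n in sequentially. with_prob (M n) e (good B n)"
proof -
  obtain B0 where B0: "\<forall>\<^sub>F n in sequentially. measure (M n) {om \<in> space (M n). Cn n om > ennreal B0} < e"
    using design_C e unfolding bounded_in_prob_def by blast
  define B where "B = max 1 B0"
  have "\<forall>\<^sub>F n in sequentially. with_prob (M n) e (good B n)"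
    using B0 eventually_ge_at_top[of 1]
  proof eventually_elim
    case (elim n)
    interpret prob_space "M n" by (rule prob)
    note C_n_measurable[OF elim(2), measurable]
    have "with_prob (M n) e (\<lambda>om. \<not> (Cn n om > ennreal B0))"
      by (rule with_prob_measure) (use elim(1) in auto)
    then show ?case
    proof (rule with_prob_mono)
      fix om assume "\<not> (Cn n om > ennreal B0)"
      then have "Cn n om \<le> ennreal B0" by simp
      also have "\<dots> \<le> ennreal B" by (rule ennreal_leI) (simp add: B_def)
      finally show "good B n om" by (intro C_n_good elim(2)) (simp add: B_def)
    qed simp
  qed
  then show ?thesis by (intro exI[of _ B]) (simp add: B_def)
qed

text \<open>On the good event the conditional variance lies between \<open>1 / B\<close> and \<open>1 + 2 B\<close>. It is not random, so one
  sample point of that event suffices.\<close>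

lemma sigma_bounds: "\<exists>s0>0. \<exists>s1>0. \<forall>\<^sub>F n in sequentially. s0 \<le> (\<sigma> n)^2 \<and> (\<sigma> n)^2 \<le> s1"
proof -
  obtain B where B: "1 \<le> B" "\<forall>\<^sub>F n in sequentially. with_prob (M n) (1 / 2) (good B n)"
    using good_event[of "1 / 2"] by auto
  have "\<forall>\<^sub>F n in sequentially. 1 / B \<le> (\<sigma> n)^2 \<and> (\<sigma> n)^2 \<le> 1 + 2 * B"
    using B(2) eventually_ge_at_top[of 1]
  proof eventually_elim
    case (elim n)
    interpret prob_space "M n" by (rule prob)
    interpret S: sigma_finite_subalgebra "M n" "XF n" by (rule sigma_finite_subalgebraI[OF subalg_XF])
    obtain i where i: "i \<in> {1..n}" using elim(2) by force
    let ?N = "NXF n (\<lambda>om. ennreal ((U n i om)^2))"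
    have Um [measurable]: "U n i \<in> borel_measurable (M n)" by (rule L2_meas[OF U_L2[OF i]])
    have Um2: "(\<lambda>om. ennreal ((U n i om)^2)) \<in> borel_measurable (M n)" using Um by simp
    have "(\<integral>\<^sup>+ om. ?N om \<partial>M n) = (\<integral>\<^sup>+ om. ennreal ((U n i om)^2) \<partial>M n)"
      using S.nn_cond_exp_intg[of "\<lambda>_. 1" "\<lambda>om. ennreal ((U n i om)^2)"] Um2 by simp
    also have "\<dots> < \<infinity>" using nn_integral_eq_integral[OF L2_int[OF U_L2[OF i]]] by simp
    finally have fin: "AE om in M n. ?N om \<noteq> \<infinity>" by (intro nn_integral_PInf_AE) auto
    have z: "AE om in M n. 0 = NXF n (\<lambda>om. ennreal (- (U n i om)\<^sup>2)) om"
    proof -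
      have "AE om in M n. 0 = NXF n (\<lambda>om. 0) om"
        by (rule S.nn_cond_exp_F_meas) simp
      moreover have "(\<lambda>om. ennreal (- (U n i om)\<^sup>2)) = (\<lambda>om. 0)" by (simp add: ennreal_neg)
      ultimately show ?thesis by (simp only:)
    qed
    have ub: "AE om in M n. EU B n om \<longrightarrow> \<bar>EXF n (\<lambda>om. U n i om * U n i om) om\<bar> \<le> 1 + 2 * B"
    proof -
      have B0: "0 \<le> B" using B(1) by simp
      have "AE om in M n. NXF n (\<lambda>om. ennreal (U n i om ^ 4)) om \<le> ennreal B \<longrightarrow> NXF n (\<lambda>om. ennreal (U n i om ^ 4)) om \<le> ennreal B \<longrightarrow> \<bar>EXF n (\<lambda>om. U n i om * U n i om) om\<bar> \<le> 1 + 2 * B"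
        using cond_exp_product_bound[OF subalg_XF U_L2[OF i, THEN L2_meas] U_L2[OF i, THEN L2_meas] B0] by eventually_elim blast
      then show ?thesis by eventually_elim (use i in \<open>auto simp: EU_def\<close>)
    qed
    have "AE om in M n. good B n om \<longrightarrow> 1 / B \<le> (\<sigma> n)^2 \<and> (\<sigma> n)^2 \<le> 1 + 2 * B"
      using fin z ub homoskedastic[OF i]
    proof eventually_elim
      case (elim om)
      show ?case
      proof
        assume g: "good B n om"
        have "(\<sigma> n)^2 = enn2real (?N om)"
          using elim(4) elim(2)[symmetric] by (simp add: real_cond_exp_def)
        moreover have "1 / B \<le> enn2real (?N om)"
        proof -
          have "ennreal (1 / B) \<le> ?N om" using g i by (auto simp: good_def)
          then have "enn2real (ennreal (1 / B)) \<le> enn2real (?N om)" using elim(1) by (intro enn2real_mono) (auto simp: less_top)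
          then show ?thesis using B(1) by simp
        qed
        moreover have "(\<sigma> n)^2 \<le> 1 + 2 * B"
          using elim(3) elim(4) g by (simp add: good_def power2_eq_square)
        ultimately show "1 / B \<le> (\<sigma> n)^2 \<and> (\<sigma> n)^2 \<le> 1 + 2 * B" by simp
      qed
    qed
    from with_prob_witness[OF elim(1) _ this]
    show ?case by auto
  qed
  then show ?thesis using B(1) by (intro exI[of _ "1 / B"] exI[of _ "1 + 2 * B"] conjI) auto
qed

text \<open>Expanding \<open>v = P V + P Q\<close> in the form \<open>z'G z\<close>, the square of the \<open>Q\<close> part may be dropped. Each entrywise error is
  below \<open>d\<close>, chosen so that the concentration error and twice the cross term cost at most half of the eigenvalue bound.\<close>

lemma whp_Gamma_hat_pd:
  assumes B: "1 \<le> B"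
  shows "whp M (\<lambda>n om. good B n om \<longrightarrow> matrix_pd (1 / (2 * B)) (Gammahat n om))"
proof -
  let ?D = "(real CARD('d))^2"
  define d where "d = 1 / (6 * B * ?D)"
  have D: "?D > 0" by simp
  have d: "d > 0" using B by (simp add: d_def)
  have B0: "0 \<le> B" using B by simp
  let ?G = "\<lambda>n om a b. Gammatilde n om $ a $ b - EG n om $ a $ b"
  let ?X = "\<lambda>n om a b. (1 / real n) * (\<Sum>i=1..n. Pr n om (\<lambda>j. Q n j om $ b) i * V n i om $ a)"
  have g: "whp M (\<lambda>n om. \<forall>a\<in>UNIV. \<forall>b\<in>UNIV. EV B n om \<longrightarrow> \<bar>?G n om a b\<bar> \<le> d)"
    by (intro whp_ball[OF prob] finite whp_Gamma_tilde[OF B0 d])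
  have c: "whp M (\<lambda>n om. \<forall>a\<in>UNIV. \<forall>b\<in>UNIV. EV B n om \<longrightarrow> \<bar>?X n om a b\<bar> \<le> d)"
    by (intro whp_ball[OF prob] finite whp_cross[OF B0 d])
  show ?thesis
  proof (rule whp_mono[OF whp_conj[OF prob whp_regular whp_conj[OF prob g c]]])
    show "\<forall>\<^sub>F n in sequentially. \<forall>om\<in>space (M n).
      (regular n om \<and> (\<forall>a\<in>UNIV. \<forall>b\<in>UNIV. EV B n om \<longrightarrow> \<bar>?G n om a b\<bar> \<le> d) \<and> (\<forall>a\<in>UNIV. \<forall>b\<in>UNIV. EV B n om \<longrightarrow> \<bar>?X n om a b\<bar> \<le> d)) \<longrightarrow>
      (good B n om \<longrightarrow> matrix_pd (1 / (2 * B)) (Gammahat n om))"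
      using eventually_ge_at_top[of 1]
    proof (eventually_elim, intro ballI impI, elim conjE)
      fix n :: nat and om assume n: "1 \<le> n" and r: "regular n om" and good: "good B n om"
        and g: "\<forall>a\<in>UNIV. \<forall>b\<in>UNIV. EV B n om \<longrightarrow> \<bar>?G n om a b\<bar> \<le> d" and c: "\<forall>a\<in>UNIV. \<forall>b\<in>UNIV. EV B n om \<longrightarrow> \<bar>?X n om a b\<bar> \<le> d"
      have EV: "EV B n om" and me: "1 / B \<le> min_eigenvalue (EG n om)" using good by (auto simp: good_def)
      interpret projection "{1..n}" "\<lambda>i j. P n i j om" by (rule P_projection)
      have eqP: "\<forall>i\<in>{1..n}. \<forall>j\<in>{1..n}. annih K w n i j om = P n i j om" using r unfolding regular_def by blast
      let ?v = "ap (\<lambda>j. V n j om)" and ?q = "ap (\<lambda>j. Q n j om)"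
      show "matrix_pd (1 / (2 * B)) (Gammahat n om)"
        unfolding matrix_pd_def
      proof (intro conjI allI)
        show "symmetric (Gammahat n om)"
          unfolding Gamma_hat_def by (rule symmetric_scaleR[OF symmetric_sum_outer])
        fix z :: "real ^ 'd"
        have s1: "z \<bullet> (Gammahat n om *v z) = (1 / real n) * (\<Sum>i=1..n. (z \<bullet> (?v i + ?q i))^2)"
          unfolding Gamma_hat_def quadratic_form_outer using regular_v_hat(2)[OF r] by simp
        have s2: "z \<bullet> (Gammatilde n om *v z) = (1 / real n) * (\<Sum>i=1..n. (z \<bullet> ?v i)^2)"
          unfolding Gamma_tilde_def quadratic_form_outer using V_tilde_Pr[OF eqP] by simp
        have cr: "(1 / real n) * (\<Sum>i=1..n. (z \<bullet> ?v i) * (z \<bullet> ?q i)) = (\<Sum>a\<in>UNIV. \<Sum>b\<in>UNIV. z $ a * z $ b * ?X n om a b)"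
        proof -
          have "(\<Sum>i=1..n. (z \<bullet> ?v i) * (z \<bullet> ?q i)) = (\<Sum>i=1..n. \<Sum>a\<in>UNIV. \<Sum>b\<in>UNIV. z $ a * z $ b * (?v i $ a * ?q i $ b))"
            by (simp add: inner_vec_def sum_product mult_ac)
          also have "\<dots> = (\<Sum>a\<in>UNIV. \<Sum>b\<in>UNIV. \<Sum>i=1..n. z $ a * z $ b * (?v i $ a * ?q i $ b))"
            by (subst sum.swap, rule sum.cong[OF refl], rule sum.swap)
          also have "\<dots> = (\<Sum>a\<in>UNIV. \<Sum>b\<in>UNIV. z $ a * z $ b * (\<Sum>i=1..n. ap (\<lambda>j. Q n j om $ b) i * V n i om $ a))"
          proof (intro sum.cong refl)
            fix a b
            have "(\<Sum>i=1..n. ?v i $ a * ?q i $ b) = (\<Sum>i=1..n. V n i om $ a * ap (\<lambda>j. Q n j om $ b) i)"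
              unfolding ap_component ap_prod ..
            then show "(\<Sum>i=1..n. z $ a * z $ b * (?v i $ a * ?q i $ b)) = z $ a * z $ b * (\<Sum>i=1..n. ap (\<lambda>j. Q n j om $ b) i * V n i om $ a)"
              by (simp only: sum_distrib_left[symmetric] mult.commute)
          qed
          finally show ?thesis by (simp only: sum_distrib_left mult_ac)
        qed
        have "(1 / real n) * (\<Sum>i=1..n. (z \<bullet> ?v i)^2 + 2 * ((z \<bullet> ?v i) * (z \<bullet> ?q i))) \<le> (1 / real n) * (\<Sum>i=1..n. (z \<bullet> (?v i + ?q i))^2)"
          by (intro mult_left_mono sum_mono) (auto simp: inner_add_right power2_sum)
        then have low: "z \<bullet> (Gammatilde n om *v z) + 2 * (\<Sum>a\<in>UNIV. \<Sum>b\<in>UNIV. z $ a * z $ b * ?X n om a b) \<le> z \<bullet> (Gammahat n om *v z)"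
          unfolding s1 s2 cr[symmetric] by (simp add: sum.distrib distrib_left sum_distrib_left mult_ac)
        have b1: "\<bar>\<Sum>a\<in>UNIV. \<Sum>b\<in>UNIV. z $ a * z $ b * ?X n om a b\<bar> \<le> d * ?D * (z \<bullet> z)"
          by (rule quadratic_entries_bound) (use c EV d in auto)
        have b2: "\<bar>\<Sum>a\<in>UNIV. \<Sum>b\<in>UNIV. z $ a * z $ b * ?G n om a b\<bar> \<le> d * ?D * (z \<bullet> z)"
          by (rule quadratic_entries_bound) (use g EV d in auto)
        have b3: "z \<bullet> (Gammatilde n om *v z) = z \<bullet> (EG n om *v z) + (\<Sum>a\<in>UNIV. \<Sum>b\<in>UNIV. z $ a * z $ b * ?G n om a b)"
          unfolding quadratic_form_entries by (simp only: right_diff_distrib sum_subtractf)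
        have b4: "(1 / B) * (z \<bullet> z) \<le> z \<bullet> (EG n om *v z)"
          using min_eigenvalue_rayleigh(1)[OF EG_symmetric, of n om z] me
          by (meson inner_ge_zero mult_right_mono order_trans)
        have "d * ?D = 1 / (6 * B)" using D by (simp add: d_def)
        then have b5: "d * ?D * (z \<bullet> z) = (1 / (6 * B)) * (z \<bullet> z)" by simp
        have b6: "(1 / B) * (z \<bullet> z) - 3 * ((1 / (6 * B)) * (z \<bullet> z)) = 1 / (2 * B) * (z \<bullet> z)"
          using B by (simp add: field_simps)
        show "1 / (2 * B) * (z \<bullet> z) \<le> z \<bullet> (Gammahat n om *v z)"
          using low b1 b2 b3 b4 b5 b6 by linarith
      qed
    qed
  qed
qed

section \<open>The approximation error and the residual variance\<close>

lemma truncated_V_second_moment: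
  assumes B: "0 \<le> B" and i: "i \<in> {1..n}"
  shows "integrable (M n) (\<lambda>om. iV B n om * (V n i om $ a)^2)" (is ?g1) "(\<integral>om. iV B n om * (V n i om $ a)^2 \<partial>M n) \<le> 1 + B" (is ?g2)
proof -
  interpret prob_space "M n" by (rule prob)
  have iV0: "0 \<le> iV B n om" "iV B n om \<le> 1" for om by (simp_all add: iV_def indicator_def)
  have Vm: "(\<lambda>om. V n i om $ a) \<in> borel_measurable (M n)" by (rule L2_meas[OF V_L2[OF i]])
  have iVM: "iV B n \<in> borel_measurable (M n)" by (rule F_M[OF iV_F])
  have iVint: "integrable (M n) (iV B n)" by (rule integrable_const_bound[where B=1]) (use iV_bound iVM in auto)
  have md: "AE om in M n. iV B n om \<noteq> 0 \<longrightarrow> NF n (\<lambda>om. ennreal ((V n i om $ a) ^ 4)) om \<le> ennreal B"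
    using EV_component[OF i, of B a] by eventually_elim (use iV_nonzero in auto)
  have m4: "(\<lambda>om. (V n i om $ a) ^ 4) \<in> borel_measurable (M n)" using Vm by simp
  note mb = integral_cond_moment_bound[OF subalg iV_F iV0(1) iVint m4 _ md B]
  have mb1: "integrable (M n) (\<lambda>om. iV B n om * (V n i om $ a) ^ 4)" by (rule mb(1)) auto
  have mb2: "(\<integral>om. iV B n om * (V n i om $ a) ^ 4 \<partial>M n) \<le> B * (\<integral>om. iV B n om \<partial>M n)" by (rule mb(2)) auto
  have int1: "(\<integral>om. iV B n om \<partial>M n) \<le> 1"
  proof -
    have "(\<integral>om. iV B n om \<partial>M n) \<le> (\<integral>om. 1 \<partial>M n)" by (rule integral_mono[OF iVint]) (use iV0 in auto)
    then show ?thesis by (simp add: prob_space)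
  qed
  have le: "iV B n om * (V n i om $ a)^2 \<le> iV B n om + iV B n om * (V n i om $ a) ^ 4" for om
  proof -
    have "iV B n om * (V n i om $ a)^2 \<le> iV B n om * (1 + (V n i om $ a) ^ 4)" by (intro mult_left_mono square_le_fourth iV0)
    then show ?thesis by (simp add: distrib_left)
  qed
  have dom: "integrable (M n) (\<lambda>om. iV B n om + iV B n om * (V n i om $ a) ^ 4)" using iVint mb1 by simp
  show int: ?g1
  proof (rule Bochner_Integration.integrable_bound[OF dom])
    show "AE om in M n. norm (iV B n om * (V n i om $ a)^2) \<le> norm (iV B n om + iV B n om * (V n i om $ a) ^ 4)"
      using le iV0 by (intro AE_I2) (auto simp: abs_mult intro: order_trans[OF _ abs_ge_self])
  qed (use iVM Vm in simp)
  have "(\<integral>om. iV B n om * (V n i om $ a)^2 \<partial>M n) \<le> (\<integral>om. iV B n om + iV B n om * (V n i om $ a) ^ 4 \<partial>M n)"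
    by (rule integral_mono[OF int dom le])
  also have "\<dots> \<le> 1 + B * 1" using iVint mb1 mb2 int1 mult_left_mono[OF int1 B] by simp
  finally show ?g2 by simp
qed

text \<open>Three terms: \<open>P V\<close> against \<open>R - r\<close> and \<open>P Q\<close> against \<open>R\<close> by Cauchy-Schwarz, and \<open>P V\<close> against \<open>r\<close>
  as a linear form in \<open>V\<close>, the projection being moved onto \<open>r\<close>.\<close>

lemma whp_remainder:
  assumes B: "0 \<le> B" and d: "0 < d"
  shows "whp M (\<lambda>n om. EV B n om \<longrightarrow> \<bar>(1 / sqrt (real n)) * (\<Sum>i=1..n. vhat n i om $ a * R n i om)\<bar> \<le> d)"
proof -
  obtain c where c: "\<forall>\<^sub>F n in sequentially. small_blocks c n"
    using block_bound unfolding small_blocks_def by blast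
  define d3 where "d3 = d / 3"
  have d3: "0 < d3" using d by (simp add: d3_def)
  define X where "X n om = (1 / sqrt (real n)) * (\<Sum>i=1..n. (iV B n om * Pr n om (\<lambda>j. r n j om) i) * V n i om $ a)" for n om
  have "\<forall>\<^sub>F n in sequentially. integrable (M n) (\<lambda>om. (X n om)^2) \<and> (\<integral>om. (X n om)^2 \<partial>M n) \<le> (real c * (1 + B)) * rho n"
    using c eventually_ge_at_top[of 1]
  proof eventually_elim
    case (elim n)
    have hF: "(\<lambda>om. Pr n om (\<lambda>j. r n j om) i) \<in> borel_measurable (F n)" if "i \<in> {1..n}" for i
      by (rule Pr_F[OF r_F that])
    have hL: "L2 (M n) (\<lambda>om. Pr n om (\<lambda>j. r n j om) i)" if "i \<in> {1..n}" for i
      by (rule Pr_L2[OF r_L2 that])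
    note q = linear_V_bound[OF elim(1) B hF hL, where b=a]
    have sr: "(\<Sum>i=1..n. \<integral>om. (Pr n om (\<lambda>j. r n j om) i)^2 \<partial>M n) \<le> real n * rho n"
      unfolding sum_r[OF elim(2), symmetric] by (rule Pr_contraction_int[OF r_L2])
    have "(\<integral>om. (\<Sum>i=1..n. (iV B n om * Pr n om (\<lambda>j. r n j om) i) * V n i om $ a)^2 \<partial>M n) \<le> real c * (1 + B) * (real n * rho n)"
      by (rule order_trans[OF q(2)]) (use B sr in \<open>auto intro!: mult_left_mono\<close>)
    then have "(1 / real n) * (\<integral>om. (\<Sum>i=1..n. (iV B n om * Pr n om (\<lambda>j. r n j om) i) * V n i om $ a)^2 \<partial>M n) \<le> (1 / real n) * (real c * (1 + B) * (real n * rho n))"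
      by (intro mult_left_mono) auto
    also have "\<dots> = (real c * (1 + B)) * rho n" using elim(2) by simp
    finally show ?case unfolding X_def power_mult_distrib
      using q(1) by (simp add: power_divide)
  qed
  moreover have "(\<lambda>n. (real c * (1 + B)) * rho n) \<longlonglongrightarrow> 0" using tendsto_mult_right_zero[OF rates(4)] by simp
  ultimately have w1: "whp M (\<lambda>n om. \<bar>X n om\<bar> \<le> d3)" by (rule whp_second_moment[OF prob _ _ d3])
  let ?A2 = "\<lambda>n om. (1 / real n) * (\<Sum>i=1..n. iV B n om * (V n i om $ a)^2)"
  let ?B2 = "\<lambda>n om. \<Sum>i=1..n. (R n i om - r n i om)^2"
  have w2: "whp M (\<lambda>n om. ?A2 n om * ?B2 n om \<le> d3^2)"
  proof (rule whp_product[OF prob])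
    show "\<forall>\<^sub>F n in sequentially. integrable (M n) (?A2 n) \<and> (\<integral>om. ?A2 n om \<partial>M n) \<le> 1 + B"
      using eventually_ge_at_top[of 1]
    proof eventually_elim
      case (elim n)
      have "(\<integral>om. ?A2 n om \<partial>M n) = (1 / real n) * (\<Sum>i=1..n. \<integral>om. iV B n om * (V n i om $ a)^2 \<partial>M n)"
        using truncated_V_second_moment(1)[OF B] by (subst Bochner_Integration.integral_mult_right_zero, subst Bochner_Integration.integral_sum) auto
      also have "\<dots> \<le> (1 / real n) * (\<Sum>i=1..n. 1 + B)"
        by (intro mult_left_mono sum_mono truncated_V_second_moment(2) B) auto
      also have "\<dots> = 1 + B" using elim by simp
      finally show ?case
        using truncated_V_second_moment(1)[OF B] by (intro conjI integrable_mult_right Bochner_Integration.integrable_sum)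
    qed
    show "\<forall>\<^sub>F n in sequentially. integrable (M n) (?B2 n) \<and> (\<integral>om. ?B2 n om \<partial>M n) \<le> real n * (varrho n - rho n)"
      using eventually_ge_at_top[of 1]
    proof eventually_elim
      case (elim n)
      have "(\<integral>om. ?B2 n om \<partial>M n) = (\<Sum>i=1..n. \<integral>om. (R n i om - r n i om)^2 \<partial>M n)"
        by (rule Bochner_Integration.integral_sum) (rule L2_int[OF R_minus_r(1)])
      then show ?case unfolding sum_R_minus_r[OF elim]
        by (intro conjI Bochner_Integration.integrable_sum L2_int[OF R_minus_r(1)]) auto
    qed
    show "(\<lambda>n. (1 + B) * (real n * (varrho n - rho n))) \<longlonglongrightarrow> 0"
      using tendsto_mult_right_zero[OF rates(2)] by simp
    show "0 \<le> ?A2 n om" for n om by (intro mult_nonneg_nonneg sum_nonneg) (auto simp: iV_def)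
  qed (use d3 in \<open>auto intro: sum_nonneg\<close>)
  let ?A3 = "\<lambda>n om. (1 / real n) * (\<Sum>i=1..n. (Pr n om (\<lambda>j. Q n j om $ a) i)^2)"
  let ?B3 = "\<lambda>n om. \<Sum>i=1..n. (R n i om)^2"
  have w3: "whp M (\<lambda>n om. ?A3 n om * ?B3 n om \<le> d3^2)"
  proof (rule whp_product[OF prob])
    have i3: "integrable (M n) (\<lambda>om. (Pr n om (\<lambda>j. Q n j om $ a) i)^2)" if "i \<in> {1..n}" for i n
      by (rule L2_int[OF Pr_L2[OF Q_L2 that]])
    show "\<forall>\<^sub>F n in sequentially. integrable (M n) (?A3 n) \<and> (\<integral>om. ?A3 n om \<partial>M n) \<le> chi n"
      using eventually_ge_at_top[of 1]
    proof eventually_elim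
      case (elim n)
      have "(\<integral>om. ?A3 n om \<partial>M n) = (1 / real n) * (\<Sum>i=1..n. \<integral>om. (Pr n om (\<lambda>j. Q n j om $ a) i)^2 \<partial>M n)"
        using i3 by (subst Bochner_Integration.integral_mult_right_zero, subst Bochner_Integration.integral_sum) auto
      also have "\<dots> \<le> (1 / real n) * (chi n * real n)"
        by (intro mult_left_mono sum_Qt_bound elim) auto
      also have "\<dots> = chi n" using elim by simp
      finally show ?case using i3 by (intro conjI integrable_mult_right Bochner_Integration.integrable_sum)
    qed
    show "\<forall>\<^sub>F n in sequentially. integrable (M n) (?B3 n) \<and> (\<integral>om. ?B3 n om \<partial>M n) \<le> real n * varrho n"
      using eventually_ge_at_top[of 1]
    proof eventually_elim
      case (elim n)
      have "(\<integral>om. ?B3 n om \<partial>M n) = (\<Sum>i=1..n. \<integral>om. (R n i om)^2 \<partial>M n)"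
        by (rule Bochner_Integration.integral_sum) (rule L2_int[OF R_L2])
      then show ?case unfolding sum_R[OF elim]
        by (intro conjI Bochner_Integration.integrable_sum L2_int[OF R_L2]) auto
    qed
    show "(\<lambda>n. chi n * (real n * varrho n)) \<longlonglongrightarrow> 0"
      using rates(3) by (simp only: mult_ac)
    show "0 \<le> ?A3 n om" for n om by (intro mult_nonneg_nonneg sum_nonneg) auto
  qed (use d3 in \<open>auto intro: sum_nonneg\<close>)
  show ?thesis
  proof (rule whp_mono[OF whp_conj[OF prob whp_regular whp_conj[OF prob w1 whp_conj[OF prob w2 w3]]]])
    show "\<forall>\<^sub>F n in sequentially. \<forall>om\<in>space (M n).
      (regular n om \<and> \<bar>X n om\<bar> \<le> d3 \<and> ?A2 n om * ?B2 n om \<le> d3^2 \<and> ?A3 n om * ?B3 n om \<le> d3^2) \<longrightarrow>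
      (EV B n om \<longrightarrow> \<bar>(1 / sqrt (real n)) * (\<Sum>i=1..n. vhat n i om $ a * R n i om)\<bar> \<le> d)"
      using eventually_ge_at_top[of 1]
    proof (eventually_elim, intro ballI impI, elim conjE)
      fix n :: nat and om assume n: "1 \<le> n" and sp: "om \<in> space (M n)" and r: "regular n om" and EV: "EV B n om"
        and x1: "\<bar>X n om\<bar> \<le> d3" and x2: "?A2 n om * ?B2 n om \<le> d3^2" and x3: "?A3 n om * ?B3 n om \<le> d3^2"
      interpret projection "{1..n}" "\<lambda>i j. P n i j om" by (rule P_projection)
      have iV: "iV B n om = 1" by (rule iV_1[OF sp EV])
      let ?v = "ap (\<lambda>j. V n j om $ a)" and ?q = "ap (\<lambda>j. Q n j om $ a)"
      have cs: "\<bar>(1 / sqrt (real n)) * (\<Sum>i=1..n. f i * h i)\<bar> \<le> d3"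
        if "(1 / real n) * (\<Sum>i=1..n. (f i)^2) * (\<Sum>i=1..n. (h i)^2) \<le> d3^2" for f h :: "nat => real"
      proof -
        have "((1 / sqrt (real n)) * (\<Sum>i=1..n. f i * h i))^2 = (1 / real n) * (\<Sum>i=1..n. f i * h i)^2"
          by (simp add: power_mult_distrib power_divide)
        also have "\<dots> \<le> (1 / real n) * ((\<Sum>i=1..n. (f i)^2) * (\<Sum>i=1..n. (h i)^2))"
          by (intro mult_left_mono Cauchy_Schwarz_ineq_sum) auto
        also have "\<dots> \<le> d3^2" using that by (simp only: mult.assoc)
        finally show ?thesis using d3 by (metis abs_le_square_iff abs_of_pos)
      qed
      have vh: "vhat n i om $ a = ?v i + ?q i" if "i \<in> {1..n}" for i
        using regular_v_hat(2)[OF r that] by (simp only: vector_add_component ap_component)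
      have "(\<Sum>i=1..n. vhat n i om $ a * R n i om) = (\<Sum>i=1..n. ?v i * (R n i om - r n i om) + ?v i * r n i om + ?q i * R n i om)"
        by (intro sum.cong refl) (simp only: vh algebra_simps)
      also have "\<dots> = (\<Sum>i=1..n. ?v i * (R n i om - r n i om)) + (\<Sum>i=1..n. ?v i * r n i om) + (\<Sum>i=1..n. ?q i * R n i om)"
        by (simp only: sum.distrib)
      also have "(\<Sum>i=1..n. ?v i * r n i om) = (\<Sum>i=1..n. (iV B n om * ap (\<lambda>j. r n j om) i) * V n i om $ a)"
        unfolding ap_adjoint iV by (intro sum.cong refl) simp
      finally have eq: "(1 / sqrt (real n)) * (\<Sum>i=1..n. vhat n i om $ a * R n i om)
        = (1 / sqrt (real n)) * (\<Sum>i=1..n. ?v i * (R n i om - r n i om)) + X n om + (1 / sqrt (real n)) * (\<Sum>i=1..n. ?q i * R n i om)"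
        unfolding X_def by (simp only: distrib_left)
      have t1: "\<bar>(1 / sqrt (real n)) * (\<Sum>i=1..n. ?v i * (R n i om - r n i om))\<bar> \<le> d3"
      proof (rule cs)
        have "(1 / real n) * (\<Sum>i=1..n. (?v i)^2) * ?B2 n om \<le> ?A2 n om * ?B2 n om"
          unfolding iV mult_1 by (intro mult_right_mono mult_left_mono ap_contraction sum_nonneg) auto
        then show "(1 / real n) * (\<Sum>i=1..n. (?v i)^2) * ?B2 n om \<le> d3^2" using x2 by linarith
      qed
      have t2: "\<bar>(1 / sqrt (real n)) * (\<Sum>i=1..n. ?q i * R n i om)\<bar> \<le> d3"
        by (rule cs) (rule x3)
      show "\<bar>(1 / sqrt (real n)) * (\<Sum>i=1..n. vhat n i om $ a * R n i om)\<bar> \<le> d"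
        using t1 t2 x1 unfolding eq d3_def by linarith
    qed
  qed
qed

lemma whp_sum_R:
  assumes d: "0 < d"
  shows "whp M (\<lambda>n om. (\<Sum>i=1..n. (R n i om)^2) \<le> d * real n)"
proof -
  have "whp M (\<lambda>n om. (1 / real n) * (\<Sum>i=1..n. (R n i om)^2) * 1 \<le> d)"
  proof (rule whp_product[OF prob])
    show "\<forall>\<^sub>F n in sequentially. integrable (M n) (\<lambda>om. (1 / real n) * (\<Sum>i=1..n. (R n i om)^2)) \<and> (\<integral>om. (1 / real n) * (\<Sum>i=1..n. (R n i om)^2) \<partial>M n) \<le> varrho n"
      using eventually_ge_at_top[of 1]
    proof eventually_elim
      case (elim n)
      have i: "integrable (M n) (\<lambda>om. (R n i om)^2)" if "i \<in> {1..n}" for i by (rule L2_int[OF R_L2[OF that]])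
      have "(\<integral>om. (1 / real n) * (\<Sum>i=1..n. (R n i om)^2) \<partial>M n) = varrho n"
        unfolding varrho_n_def using i by (subst Bochner_Integration.integral_mult_right_zero, subst Bochner_Integration.integral_sum) auto
      then show ?case using i by (intro conjI integrable_mult_right Bochner_Integration.integrable_sum) auto
    qed
    show "\<forall>\<^sub>F n in sequentially. integrable (M n) (\<lambda>om. 1 :: real) \<and> (\<integral>om. 1 \<partial>M n) \<le> (1 :: real)"
    proof (intro always_eventually allI)
      fix n interpret prob_space "M n" by (rule prob)
      show "integrable (M n) (\<lambda>om. 1 :: real) \<and> (\<integral>om. 1 \<partial>M n) \<le> (1 :: real)" by (simp add: prob_space)
    qed
    show "(\<lambda>n. varrho n * 1) \<longlonglongrightarrow> 0" using rates(1) by simp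
    show "0 \<le> (1 / real n) * (\<Sum>i=1..n. (R n i om)^2)" for n om by (intro mult_nonneg_nonneg sum_nonneg) auto
  qed (use d in auto)
  then show ?thesis
    by (rule whp_mono, intro eventually_mono[OF eventually_ge_at_top[of 1]]) (auto simp: field_simps)
qed

text \<open>The diagonal of \<open>P\<close> sums to \<open>n - K\<close>, which gives the centring; the fluctuation has variance of order \<open>n\<close>.\<close>

lemma whp_U_quadratic:
  assumes B: "0 \<le> B" and d: "0 < d"
  shows "whp M (\<lambda>n om. EU B n om \<longrightarrow> \<bar>(\<Sum>i=1..n. U n i om * Pr n om (\<lambda>j. U n j om) i) - (\<sigma> n)\<^sup>2 * (real n - real (K n))\<bar> \<le> d * real n)"
proof -
  obtain c where c: "\<forall>\<^sub>F n in sequentially. small_blocks c n"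
    using block_bound unfolding small_blocks_def by blast
  obtain s0 s1 where s: "0 < s0" "0 < s1" "\<forall>\<^sub>F n in sequentially. s0 \<le> (\<sigma> n)^2 \<and> (\<sigma> n)^2 \<le> s1" using sigma_bounds by blast
  define C where "C = real (2 * c^2) * (2 * B + 2 * s1^2)"
  define X where "X n om = (1 / real n) * (\<Sum>p\<in>pairs n. iU B n om * Pp n p om * (U n (fst p) om * U n (snd p) om - (\<sigma> n)\<^sup>2 * of_bool (fst p = snd p)))" for n om
  have "\<forall>\<^sub>F n in sequentially. integrable (M n) (\<lambda>om. (X n om)^2) \<and> (\<integral>om. (X n om)^2 \<partial>M n) \<le> C / real n"
    using c s(3) eventually_ge_at_top[of 1]
  proof eventually_elim
    case (elim n)
    note q = quadratic_U_bound[OF elim(1) B]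
    have "((\<sigma> n)^2)^2 \<le> s1^2" using elim(2) by (intro power_mono) auto
    then have "real (2 * c^2) * (2 * B + 2 * ((\<sigma> n)^2)^2) * real n \<le> C * real n"
      unfolding C_def by (intro mult_right_mono mult_left_mono add_mono) auto
    from order_trans[OF q(2) this] show ?case unfolding X_def power_mult_distrib
      using q(1) const_over_n_le[OF _ _ elim(3)] by simp
  qed
  then have w: "whp M (\<lambda>n om. \<bar>X n om\<bar> \<le> d)"
    by (rule whp_second_moment[OF prob _ lim_const_over_n d])
  show ?thesis
  proof (rule whp_mono[OF whp_conj[OF prob whp_regular w]])
    show "\<forall>\<^sub>F n in sequentially. \<forall>om\<in>space (M n). regular n om \<and> \<bar>X n om\<bar> \<le> d \<longrightarrow>
      (EU B n om \<longrightarrow> \<bar>(\<Sum>i=1..n. U n i om * Pr n om (\<lambda>j. U n j om) i) - (\<sigma> n)\<^sup>2 * (real n - real (K n))\<bar> \<le> d * real n)"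
      using eventually_ge_at_top[of 1]
    proof (eventually_elim, intro ballI impI, elim conjE)
      fix n :: nat and om assume n: "1 \<le> n" and sp: "om \<in> space (M n)" and r: "regular n om" and EU: "EU B n om" and x: "\<bar>X n om\<bar> \<le> d"
      interpret projection "{1..n}" "\<lambda>i j. P n i j om" by (rule P_projection)
      have tr: "(\<Sum>p\<in>pairs n. Pp n p om * ((\<sigma> n)^2 * of_bool (fst p = snd p))) = (\<sigma> n)^2 * (real n - real (K n))"
      proof -
        have "(\<Sum>p\<in>pairs n. Pp n p om * ((\<sigma> n)^2 * of_bool (fst p = snd p))) = (\<Sum>i=1..n. \<Sum>j=1..n. if i = j then (\<sigma> n)^2 * P n i i om else 0)"
          unfolding sum.cartesian_product by (intro sum.cong refl) (auto simp: split_beta)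
        also have "\<dots> = (\<Sum>i=1..n. (\<sigma> n)^2 * P n i i om)" by (intro sum.cong refl) simp
        finally show ?thesis unfolding sum_distrib_left[symmetric] regular_trace[OF r] .
      qed
      have "real n * X n om = (\<Sum>p\<in>pairs n. Pp n p om * (U n (fst p) om * U n (snd p) om)) - (\<Sum>p\<in>pairs n. Pp n p om * ((\<sigma> n)^2 * of_bool (fst p = snd p)))"
        unfolding X_def iU_1[OF sp EU] sum_subtractf[symmetric] using n by (simp add: right_diff_distrib del: One_nat_def)
      also have "\<dots> = (\<Sum>i=1..n. U n i om * ap (\<lambda>j. U n j om) i) - (\<sigma> n)\<^sup>2 * (real n - real (K n))"
        unfolding tr quad_form ..
      finally have "\<bar>(\<Sum>i=1..n. U n i om * ap (\<lambda>j. U n j om) i) - (\<sigma> n)\<^sup>2 * (real n - real (K n))\<bar> = real n * \<bar>X n om\<bar>"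
        by (metis abs_mult abs_of_nat)
      also have "\<dots> \<le> real n * d" by (intro mult_left_mono x) simp
      finally show "\<bar>(\<Sum>i=1..n. U n i om * ap (\<lambda>j. U n j om) i) - (\<sigma> n)\<^sup>2 * (real n - real (K n))\<bar> \<le> d * real n" by (simp only: mult.commute)
    qed
  qed
qed

end

section \<open>The central limit theorem\<close>

lemma abs_sum_cube_le:
  fixes f :: "'i => real"
  assumes "finite I" "card I \<le> c"
  shows "\<bar>\<Sum>i\<in>I. f i\<bar> ^ 3 \<le> real c ^ 3 * (\<Sum>i\<in>I. \<bar>f i\<bar> ^ 3)"
proof (cases "I = {}")
  case False
  define m where "m = Max ((\<lambda>i. \<bar>f i\<bar>) ` I)"
  have le: "\<bar>f i\<bar> \<le> m" if "i \<in> I" for i unfolding m_def using that assms(1) by (intro Max_ge) auto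
  have "m \<in> (\<lambda>i. \<bar>f i\<bar>) ` I" unfolding m_def using False assms(1) by (intro Max_in) auto
  then obtain j where j: "j \<in> I" "m = \<bar>f j\<bar>" by blast
  have "\<bar>\<Sum>i\<in>I. f i\<bar> \<le> (\<Sum>i\<in>I. \<bar>f i\<bar>)" by (rule sum_abs)
  also have "\<dots> \<le> (\<Sum>i\<in>I. m)" by (intro sum_mono le)
  also have "\<dots> = real (card I) * m" by simp
  also have "\<dots> \<le> real c * m" using assms(2) j by (intro mult_right_mono) auto
  finally have "\<bar>\<Sum>i\<in>I. f i\<bar> ^ 3 \<le> (real c * m) ^ 3" by (intro power_mono) auto
  also have "\<dots> = real c ^ 3 * \<bar>f j\<bar> ^ 3" unfolding power_mult_distrib j(2) ..
  also have "\<dots> \<le> real c ^ 3 * (\<Sum>i\<in>I. \<bar>f i\<bar> ^ 3)"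
    using j assms(1) by (intro mult_left_mono member_le_sum) auto
  finally show ?thesis .
qed simp

context many_covariates
begin

text \<open>If the weights are at most \<open>b\<close>, the third absolute moment and the squared variance of a block are \<open>b\<close> and \<open>b^2\<close> times
  its sum of squared weights, up to constants. The total error is thus small with \<open>b\<close>.\<close>

lemma char_linear_U:
  assumes c: "small_blocks c n" and B: "0 \<le> B" and b: "0 \<le> b"
    and h: "\<And>t. t \<in> {1..n} ==> h t \<in> borel_measurable (XF n)" "\<And>t om. t \<in> {1..n} ==> \<bar>h t om\<bar> \<le> b"
    and nz: "\<And>t om. t \<in> {1..n} ==> h t om \<noteq> 0 ==> EU B n om"
  shows "cmod ((\<integral>om. iexp (\<Sum>t=1..n. h t om * U n t om) \<partial>M n) - (\<integral>om. complex_of_real (exp (- (\<Sum>t=1..n. (\<sigma> n)^2 * (h t om)^2) / 2)) \<partial>M n))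
    \<le> (real c ^ 3 * (1 + B) * b + ((\<sigma> n)^2)^2 * real c * b^2) * (\<Sum>t=1..n. \<integral>om. (h t om)^2 \<partial>M n)"
proof -
  interpret prob_space "M n" by (rule prob)
  let ?s2 = "(\<sigma> n)^2"
  have hM: "h t \<in> borel_measurable (M n)" if "t \<in> {1..n}" for t by (rule XF_M[OF h(1)[OF that]])
  have UM: "U n t \<in> borel_measurable (M n)" if "t \<in> {1..n}" for t by (rule L2_meas[OF U_L2[OF that]])
  have h2: "integrable (M n) (\<lambda>om. (h t om)^2)" if "t \<in> {1..n}" for t
  proof (rule integrable_const_bound[where B="b^2"])
    have "(h t om)^2 \<le> b^2" for om using h(2)[OF that] by (rule abs_le_square_iff[THEN iffD1, OF order_trans]) (simp add: b)
    then show "AE om in M n. norm ((h t om)^2) \<le> b^2" by simp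
  qed (use hM[OF that] in simp)
  have cube: "\<bar>h t om\<bar> ^ 3 \<le> b * (h t om)^2" if "t \<in> {1..n}" for t om
  proof -
    have "\<bar>h t om\<bar> ^ 3 = \<bar>h t om\<bar> * (h t om)^2" by (simp add: power3_eq_cube power2_eq_square abs_mult_self_eq mult.assoc)
    also have "\<dots> \<le> b * (h t om)^2" using h(2)[OF that] by (intro mult_right_mono) auto
    finally show ?thesis .
  qed
  have h3: "integrable (M n) (\<lambda>om. \<bar>h t om\<bar> ^ 3)" if "t \<in> {1..n}" for t
    by (rule integrable_dominated[where g="\<lambda>om. b * (h t om)^2"]) (use h2[OF that] hM[OF that] cube[OF that] in auto)
  have third: "integrable (M n) (\<lambda>om. \<bar>h t om * U n t om\<bar> ^ 3)" "(\<integral>om. \<bar>h t om * U n t om\<bar> ^ 3 \<partial>M n) \<le> (1 + B) * b * (\<integral>om. (h t om)^2 \<partial>M n)" if t: "t \<in> {1..n}" for t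
  proof -
    have U4: "(\<lambda>om. U n t om ^ 4) \<in> borel_measurable (M n)" using UM[OF t] by simp
    have XFm: "(\<lambda>om. \<bar>h t om\<bar> ^ 3) \<in> borel_measurable (XF n)" using h(1)[OF t] by simp
    have bd: "AE om in M n. \<bar>h t om\<bar> ^ 3 \<noteq> 0 \<longrightarrow> NXF n (\<lambda>om. ennreal (U n t om ^ 4)) om \<le> ennreal B"
    proof (intro AE_I2 impI)
      fix om assume "\<bar>h t om\<bar> ^ 3 \<noteq> 0"
      then have "EU B n om" using nz[OF t, of om] by auto
      then show "NXF n (\<lambda>om. ennreal (U n t om ^ 4)) om \<le> ennreal B" using t by (simp only: EU_def)
    qed
    note m = integral_cond_moment_bound[OF subalg_XF XFm _ h3[OF t] U4 _ bd B]
    have m1: "integrable (M n) (\<lambda>om. \<bar>h t om\<bar> ^ 3 * U n t om ^ 4)" by (rule m(1)) simp_all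
    have m2: "(\<integral>om. \<bar>h t om\<bar> ^ 3 * U n t om ^ 4 \<partial>M n) \<le> B * (\<integral>om. \<bar>h t om\<bar> ^ 3 \<partial>M n)" by (rule m(2)) simp_all
    have pt: "\<bar>h t om * U n t om\<bar> ^ 3 \<le> \<bar>h t om\<bar> ^ 3 + \<bar>h t om\<bar> ^ 3 * U n t om ^ 4" for om
      using mult_left_mono[OF abs_cube_le_fourth[of "U n t om"], of "\<bar>h t om\<bar> ^ 3"]
      by (simp add: abs_mult power_mult_distrib distrib_left)
    have ii: "integrable (M n) (\<lambda>om. \<bar>h t om\<bar> ^ 3 + \<bar>h t om\<bar> ^ 3 * U n t om ^ 4)" using m1 h3[OF t] by simp
    show i: "integrable (M n) (\<lambda>om. \<bar>h t om * U n t om\<bar> ^ 3)"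
      by (rule integrable_dominated[OF ii]) (use hM[OF t] UM[OF t] pt in auto)
    have "(\<integral>om. \<bar>h t om * U n t om\<bar> ^ 3 \<partial>M n) \<le> (\<integral>om. \<bar>h t om\<bar> ^ 3 + \<bar>h t om\<bar> ^ 3 * U n t om ^ 4 \<partial>M n)"
      by (rule integral_mono[OF i ii]) (rule pt)
    also have "\<dots> = (\<integral>om. \<bar>h t om\<bar> ^ 3 \<partial>M n) + (\<integral>om. \<bar>h t om\<bar> ^ 3 * U n t om ^ 4 \<partial>M n)" by (rule Bochner_Integration.integral_add[OF h3[OF t] m1])
    also have "\<dots> \<le> (1 + B) * (\<integral>om. \<bar>h t om\<bar> ^ 3 \<partial>M n)" using m2 by (simp add: distrib_right)
    also have "\<dots> \<le> (1 + B) * (\<integral>om. b * (h t om)^2 \<partial>M n)"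
      by (intro mult_left_mono integral_mono h3 t cube) (use B h2[OF t] in auto)
    finally show "(\<integral>om. \<bar>h t om * U n t om\<bar> ^ 3 \<partial>M n) \<le> (1 + B) * b * (\<integral>om. (h t om)^2 \<partial>M n)" by simp
  qed
  have pt3: "\<bar>\<Sum>t\<in>T n k. h t om * U n t om\<bar> ^ 3 \<le> real c ^ 3 * (\<Sum>t\<in>T n k. \<bar>h t om * U n t om\<bar> ^ 3)" if k: "k \<in> {1..N n}" for k om
    by (rule abs_sum_cube_le[OF finite_T[OF k]]) (use c k in \<open>simp add: small_blocks_def\<close>)
  have ib: "integrable (M n) (\<lambda>om. real c ^ 3 * (\<Sum>t\<in>T n k. \<bar>h t om * U n t om\<bar> ^ 3))" if k: "k \<in> {1..N n}" for k
    by (intro integrable_mult_right Bochner_Integration.integrable_sum third(1) T_imp[OF k])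
  have i3: "integrable (M n) (\<lambda>om. \<bar>\<Sum>t\<in>T n k. h t om * U n t om\<bar> ^ 3)" if k: "k \<in> {1..N n}" for k
  proof (rule integrable_dominated[OF ib[OF k]])
    have "(\<lambda>om. \<Sum>t\<in>T n k. h t om * U n t om) \<in> borel_measurable (M n)"
      by (intro borel_measurable_sum borel_measurable_times hM UM T_imp[OF k])
    then show "(\<lambda>om. \<bar>\<Sum>t\<in>T n k. h t om * U n t om\<bar> ^ 3) \<in> borel_measurable (M n)" by simp
  qed (use pt3[OF k] in simp)
  have e1: "(\<integral>om. \<bar>\<Sum>t\<in>T n k. h t om * U n t om\<bar> ^ 3 \<partial>M n) \<le> real c ^ 3 * (1 + B) * b * (\<Sum>t\<in>T n k. \<integral>om. (h t om)^2 \<partial>M n)" if k: "k \<in> {1..N n}" for k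
  proof -
    have "(\<integral>om. \<bar>\<Sum>t\<in>T n k. h t om * U n t om\<bar> ^ 3 \<partial>M n) \<le> (\<integral>om. real c ^ 3 * (\<Sum>t\<in>T n k. \<bar>h t om * U n t om\<bar> ^ 3) \<partial>M n)"
      by (rule integral_mono[OF i3[OF k] ib[OF k]]) (rule pt3[OF k])
    also have "\<dots> = real c ^ 3 * (\<Sum>t\<in>T n k. \<integral>om. \<bar>h t om * U n t om\<bar> ^ 3 \<partial>M n)"
      by (subst Bochner_Integration.integral_mult_right_zero, subst Bochner_Integration.integral_sum) (use third(1)[OF T_imp[OF k]] in simp_all)
    also have "\<dots> \<le> real c ^ 3 * (\<Sum>t\<in>T n k. (1 + B) * b * (\<integral>om. (h t om)^2 \<partial>M n))"
      by (intro mult_left_mono sum_mono third(2) T_imp[OF k]) auto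
    finally show ?thesis by (simp only: sum_distrib_left[symmetric] mult.assoc)
  qed
  have e2: "(\<integral>om. (?s2 * (\<Sum>t\<in>T n k. (h t om)^2))^2 \<partial>M n) \<le> ?s2^2 * real c * b^2 * (\<Sum>t\<in>T n k. \<integral>om. (h t om)^2 \<partial>M n)" if k: "k \<in> {1..N n}" for k
  proof -
    have ih: "integrable (M n) (\<lambda>om. ?s2^2 * real c * b^2 * (\<Sum>t\<in>T n k. (h t om)^2))"
      by (intro integrable_mult_right Bochner_Integration.integrable_sum h2 T_imp[OF k])
    have "(?s2 * (\<Sum>t\<in>T n k. (h t om)^2))^2 \<le> ?s2^2 * real c * b^2 * (\<Sum>t\<in>T n k. (h t om)^2)" for om
    proof -
      let ?q = "\<Sum>t\<in>T n k. (h t om)^2"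
      have q0: "0 \<le> ?q" by (intro sum_nonneg) simp
      have "(h t om)^2 \<le> b^2" if "t \<in> T n k" for t
        using h(2)[OF T_imp[OF k that], of om] b by (metis abs_le_square_iff abs_of_nonneg)
      then have "?q \<le> (\<Sum>t\<in>T n k. b^2)" by (rule sum_mono)
      also have "\<dots> = real (card (T n k)) * b^2" by simp
      also have "\<dots> \<le> real c * b^2" using c k by (intro mult_right_mono) (auto simp: small_blocks_def)
      finally have "?q * ?q \<le> (real c * b^2) * ?q" using q0 by (intro mult_right_mono)
      then have "?s2^2 * (?q * ?q) \<le> ?s2^2 * ((real c * b^2) * ?q)" by (intro mult_left_mono) auto
      then show ?thesis unfolding power_mult_distrib power2_eq_square[of ?q] by (simp only: mult.assoc)
    qed
    then have "(\<integral>om. (?s2 * (\<Sum>t\<in>T n k. (h t om)^2))^2 \<partial>M n) \<le> (\<integral>om. ?s2^2 * real c * b^2 * (\<Sum>t\<in>T n k. (h t om)^2) \<partial>M n)"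
      by (intro integral_mono'[OF ih] mult_nonneg_nonneg sum_nonneg) auto
    also have "\<dots> = ?s2^2 * real c * b^2 * (\<Sum>t\<in>T n k. \<integral>om. (h t om)^2 \<partial>M n)"
      by (subst Bochner_Integration.integral_mult_right_zero, subst Bochner_Integration.integral_sum) (use h2[OF T_imp[OF k]] in simp_all)
    finally show ?thesis .
  qed
  have nn: "0 \<le> (\<Sum>t\<in>T n k. \<integral>om. (h t om)^2 \<partial>M n)" for k by (intro sum_nonneg Bochner_Integration.integral_nonneg) auto
  have sb: "(\<Sum>k=1..N n. \<Sum>t\<in>T n k. h t om * U n t om) = (\<Sum>t=1..n. h t om * U n t om)" for om
    by (rule sum_blocks)
  have sb2: "(\<Sum>k=1..N n. ?s2 * (\<Sum>t\<in>T n k. (h t om)^2)) = (\<Sum>t=1..n. ?s2 * (h t om)^2)" for om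
    unfolding sum_distrib_left by (rule sum_blocks)
  have "cmod ((\<integral>om. iexp (\<Sum>k=1..N n. \<Sum>t\<in>T n k. h t om * U n t om) \<partial>M n) - (\<integral>om. complex_of_real (exp (- (\<Sum>k=1..N n. ?s2 * (\<Sum>t\<in>T n k. (h t om)^2)) / 2)) \<partial>M n))
    \<le> (\<Sum>k=1..N n. (\<integral>om. \<bar>\<Sum>t\<in>T n k. h t om * U n t om\<bar> ^ 3 \<partial>M n) / 6 + (\<integral>om. (?s2 * (\<Sum>t\<in>T n k. (h t om)^2))^2 \<partial>M n) / 4)"
  proof (rule char_block_sum_bound[where F="XF n" and H="HU n" and b=b])
    fix j k t assume jk: "j \<in> {1..N n}" "k \<in> {1..N n}" "j \<noteq> k" and t: "t \<in> T n j"
    show "U n t \<in> borel_measurable (HU n k)"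
      by (rule measurable_from_subalg[OF rest_le_HU[OF jk(2)] UV_rest(1)[OF jk(1,3) t]])
  next
    fix k t assume kt: "k \<in> {1..N n}" "t \<in> T n k"
    show "h t \<in> borel_measurable (XF n)" by (rule h(1)[OF T_imp[OF kt]])
    show "\<bar>h t om\<bar> \<le> b" for om by (rule h(2)[OF T_imp[OF kt]])
  qed (rule finite_T subalg_XF subalg_HU XF_le_HU U_HU UU_HU i3; assumption | simp)+
  also have "\<dots> \<le> (\<Sum>k=1..N n. (real c ^ 3 * (1 + B) * b + ?s2^2 * real c * b^2) * (\<Sum>t\<in>T n k. \<integral>om. (h t om)^2 \<partial>M n))"
  proof (rule sum_mono)
    fix k assume k: "k \<in> {1..N n}"
    let ?S = "\<Sum>t\<in>T n k. \<integral>om. (h t om)^2 \<partial>M n"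
    have "0 \<le> real c ^ 3 * (1 + B) * b * ?S" "0 \<le> ?s2^2 * real c * b^2 * ?S" using b B nn[of k] by simp_all
    then show "(\<integral>om. \<bar>\<Sum>t\<in>T n k. h t om * U n t om\<bar> ^ 3 \<partial>M n) / 6 + (\<integral>om. (?s2 * (\<Sum>t\<in>T n k. (h t om)^2))^2 \<partial>M n) / 4
      \<le> (real c ^ 3 * (1 + B) * b + ?s2^2 * real c * b^2) * ?S"
      using e1[OF k] e2[OF k] unfolding distrib_right by linarith
  qed
  also have "\<dots> = (real c ^ 3 * (1 + B) * b + ?s2^2 * real c * b^2) * (\<Sum>t=1..n. \<integral>om. (h t om)^2 \<partial>M n)"
    unfolding sum_distrib_left[symmetric] sum_blocks ..
  finally show ?thesis unfolding sb sb2 .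
qed

text \<open>Versions of the residualised regressors and of their second moment matrix that are functions of the regressors and of \<open>F\<close>
  at every sample point. \<open>Z\<close> is \<open>W (\<Sum> U v) / (|\<sigma>| sqrt n)\<close>.\<close>

definition vP :: "nat => nat => 'a => real ^ 'd" where "vP n t om = Pr n om (\<lambda>j. x n j om) t"

definition GP :: "nat => 'a => real ^ 'd ^ 'd" where
  "GP n om = (1 / real n) *\<^sub>R (\<Sum>t=1..n. outer (vP n t om) (vP n t om))"

definition WP :: "nat => 'a => real ^ 'd ^ 'd" where "WP n om = matrix_inv (matrix_sqrt (GP n om))"

definition zc :: "nat => nat => 'a => real ^ 'd" where
  "zc n t om = (1 / (\<bar>\<sigma> n\<bar> * sqrt (real n))) *\<^sub>R (WP n om *v vP n t om)"

definition Z :: "nat => 'a => real ^ 'd" where "Z n om = (\<Sum>t=1..n. U n t om *\<^sub>R zc n t om)"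

definition small_design :: "real => real => real => nat => 'a => bool" where
  "small_design \<kappa> \<delta> B n om \<longleftrightarrow> EU B n om \<and> matrix_pd \<kappa> (GP n om) \<and> (\<forall>t\<in>{1..n}. norm (vP n t om) \<le> \<delta> * sqrt (real n))"

lemma GP_symmetric: "symmetric (GP n om)"
  unfolding GP_def by (rule symmetric_scaleR[OF symmetric_sum_outer])

lemma vP_XF: "t \<in> {1..n} ==> vP n t \<in> borel_measurable (XF n)"
  unfolding vP_def[abs_def] Pr_def by (intro borel_measurable_sum borel_measurable_scaleR F_XF P_F x_XF)

lemma GP_XF: "GP n \<in> borel_measurable (XF n)"
proof (rule measurable_matrixI)
  fix a b
  show "(\<lambda>om. GP n om $ a $ b) \<in> borel_measurable (XF n)"
    unfolding GP_def vector_scaleR_component real_scaleR_def sum_component outer_def vec_lambda_beta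
    by (intro borel_measurable_sum borel_measurable_times borel_measurable_const measurable_vec_component vP_XF)
qed

lemma WP_XF: "WP n \<in> borel_measurable (XF n)"
  unfolding WP_def[abs_def] using GP_XF by measurable

lemma zc_XF: "t \<in> {1..n} ==> zc n t \<in> borel_measurable (XF n)"
proof (rule measurable_vecI)
  fix a assume t: "t \<in> {1..n}"
  have WPm: "(\<lambda>om. WP n om $ a $ b) \<in> borel_measurable (XF n)" for b
  proof (rule measurable_compose[OF WP_XF])
    show "(\<lambda>A :: real ^ 'd ^ 'd. A $ a $ b) \<in> borel_measurable borel"
      by (intro borel_measurable_continuous_onI continuous_intros)
  qed
  then show "(\<lambda>om. zc n t om $ a) \<in> borel_measurable (XF n)"
    unfolding zc_def vector_scaleR_component real_scaleR_def matrix_vector_mult_def vec_lambda_beta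
    by (intro borel_measurable_sum borel_measurable_times borel_measurable_const measurable_vec_component[OF vP_XF[OF t]] WPm)
qed

lemma Z_M: "Z n \<in> borel_measurable (M n)"
  unfolding Z_def[abs_def] by (intro borel_measurable_sum borel_measurable_scaleR L2_meas[OF U_L2] XF_M[OF zc_XF])

text \<open>Positive definiteness quantifies over all vectors; the least eigenvalue expresses it by one measurable inequality.\<close>

lemma small_design_XF: "{om \<in> space (XF n). small_design \<kappa> \<delta> B n om} \<in> sets (XF n)"
proof -
  have "matrix_pd \<kappa> (GP n om) \<longleftrightarrow> \<kappa> \<le> min_eigenvalue (GP n om)" for om
  proof
    assume pd: "matrix_pd \<kappa> (GP n om)"
    obtain v where v: "norm v = 1" "GP n om *v v = min_eigenvalue (GP n om) *\<^sub>R v"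
      using min_eigenvalue_rayleigh(2)[OF GP_symmetric] by blast
    have "\<kappa> * (v \<bullet> v) \<le> v \<bullet> (GP n om *v v)" using pd by (simp add: matrix_pd_def)
    then show "\<kappa> \<le> min_eigenvalue (GP n om)" unfolding v(2) using v(1) by (simp add: norm_eq_1)
  next
    assume k: "\<kappa> \<le> min_eigenvalue (GP n om)"
    show "matrix_pd \<kappa> (GP n om)" unfolding matrix_pd_def
      using GP_symmetric min_eigenvalue_rayleigh(1)[OF GP_symmetric] k
      by (meson inner_ge_zero mult_right_mono order_trans)
  qed
  moreover have m [measurable]: "(\<lambda>om. min_eigenvalue (GP n om)) \<in> borel_measurable (XF n)"
    by (rule measurable_min_eigenvalue[OF GP_XF GP_symmetric])
  moreover have "{om \<in> space (XF n). \<forall>t\<in>{1..n}. norm (vP n t om) \<le> \<delta> * sqrt (real n)} \<in> sets (XF n)"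
    by (rule sets.sets_Collect_finite_All) (use vP_XF in \<open>auto simp del: One_nat_def intro!: borel_measurable_le\<close>)
  moreover have "{om \<in> space (XF n). \<kappa> \<le> min_eigenvalue (GP n om)} \<in> sets (XF n)" by measurable
  ultimately show ?thesis unfolding small_design_def using EU_XF[of n B]
    by (simp only:) (intro sets.sets_Collect_conj)
qed

context
  fixes \<kappa> \<delta> B n om
  assumes \<kappa>: "0 < \<kappa>" and sd: "small_design \<kappa> \<delta> B n om" and n: "1 \<le> n" and \<sigma>: "\<sigma> n \<noteq> 0"
begin

lemma pd_GP: "pd_matrix \<kappa> (GP n om)"
  using \<kappa> sd by (intro pd_matrix.intro) (simp_all add: small_design_def)

lemma WP_W: "WP n om = pd_matrix.W (GP n om)"
  by (simp add: WP_def pd_matrix.W_def[OF pd_GP] pd_matrix.S_def[OF pd_GP])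

lemma zc_bound:
  assumes t: "t \<in> {1..n}"
  shows "(norm (zc n t om))^2 \<le> \<delta>^2 / ((\<sigma> n)^2 * \<kappa>)"
proof -
  have v: "norm (vP n t om) \<le> \<delta> * sqrt (real n)" using sd t unfolding small_design_def by blast
  have "(norm (zc n t om))^2 = (1 / ((\<sigma> n)^2 * real n)) * (norm (WP n om *v vP n t om))^2"
    by (simp add: zc_def power_mult_distrib power_divide)
  also have "\<dots> \<le> (1 / ((\<sigma> n)^2 * real n)) * ((norm (vP n t om))^2 / \<kappa>)"
    unfolding WP_W by (intro mult_left_mono pd_matrix.W_norm[OF pd_GP]) simp
  also have "\<dots> \<le> (1 / ((\<sigma> n)^2 * real n)) * ((\<delta> * sqrt (real n))^2 / \<kappa>)"
    using \<kappa> by (intro mult_left_mono divide_right_mono power_mono v) auto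
  also have "\<dots> = \<delta>^2 / ((\<sigma> n)^2 * \<kappa>)" using n by (simp add: power_mult_distrib)
  finally show ?thesis .
qed

text \<open>This is \<open>W G W = I\<close>, the reason why the limit has identity covariance whatever the design.\<close>

lemma zc_isometry: "(\<Sum>t=1..n. (\<sigma> n)^2 * (s \<bullet> zc n t om)^2) = s \<bullet> s"
proof -
  let ?y = "WP n om *v s"
  have "(\<sigma> n)^2 * (s \<bullet> zc n t om)^2 = (1 / real n) * (?y \<bullet> vP n t om)^2" for t
  proof -
    have "s \<bullet> zc n t om = (1 / (\<bar>\<sigma> n\<bar> * sqrt (real n))) * (?y \<bullet> vP n t om)"
      unfolding zc_def WP_W by (simp add: pd_matrix.W_inner[OF pd_GP])
    then show ?thesis using \<sigma> by (simp add: power_mult_distrib power_divide)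
  qed
  then have "(\<Sum>t=1..n. (\<sigma> n)^2 * (s \<bullet> zc n t om)^2) = (1 / real n) * (\<Sum>t=1..n. (?y \<bullet> vP n t om)^2)"
    by (simp add: sum_distrib_left)
  also have "\<dots> = ?y \<bullet> (GP n om *v ?y)" unfolding GP_def quadratic_form_outer ..
  also have "\<dots> = s \<bullet> s" unfolding WP_W by (rule pd_matrix.W_isometry[OF pd_GP])
  finally show ?thesis .
qed

end

lemma v_hat_M: "i \<in> {1..n} ==> vhat n i \<in> borel_measurable (M n)"
  unfolding v_hat_def[abs_def] by (intro borel_measurable_sum borel_measurable_scaleR measurable_annih_M x_meas)

lemma whp_v_hat:
  assumes \<delta>: "0 < \<delta>"
  shows "whp M (\<lambda>n om. \<forall>i\<in>{1..n}. norm (vhat n i om) \<le> \<delta> * sqrt (real n))"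
  unfolding whp_def
proof (intro allI impI)
  fix e :: real assume e: "0 < e"
  have "(\<lambda>n. measure (M n) {om \<in> space (M n). \<bar>(MAX i\<in>{1..n}. norm (vhat n i om)) / sqrt (real n)\<bar> > \<delta>}) \<longlonglongrightarrow> 0"
    using approx_v \<delta> unfolding vanishes_in_prob_def by blast
  from order_tendstoD(2)[OF this e] eventually_ge_at_top[of 1]
  show "\<forall>\<^sub>F n in sequentially. with_prob (M n) e (\<lambda>om. \<forall>i\<in>{1..n}. norm (vhat n i om) \<le> \<delta> * sqrt (real n))"
  proof eventually_elim
    case (elim n)
    interpret prob_space "M n" by (rule prob)
    have s: "0 < sqrt (real n)" using elim(2) by simp
    let ?A = "{om \<in> space (M n). \<bar>(MAX i\<in>{1..n}. norm (vhat n i om)) / sqrt (real n)\<bar> > \<delta>}"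
    let ?B = "{om \<in> space (M n). \<not> (\<forall>i\<in>{1..n}. norm (vhat n i om) \<le> \<delta> * sqrt (real n))}"
    have "\<bar>(MAX i\<in>{1..n}. norm (vhat n i om)) / sqrt (real n)\<bar> > \<delta> \<longleftrightarrow> \<not> (\<forall>i\<in>{1..n}. norm (vhat n i om) \<le> \<delta> * sqrt (real n))" for om
    proof -
      let ?m = "MAX i\<in>{1..n}. norm (vhat n i om)"
      have ne: "finite ((\<lambda>i. norm (vhat n i om)) ` {1..n})" "(\<lambda>i. norm (vhat n i om)) ` {1..n} \<noteq> {}" using elim(2) by auto
      then have "?m \<in> (\<lambda>i. norm (vhat n i om)) ` {1..n}" by (rule Max_in)
      then have "0 \<le> ?m" by auto
      then have "\<bar>?m / sqrt (real n)\<bar> > \<delta> \<longleftrightarrow> ?m > \<delta> * sqrt (real n)" using s by (simp add: field_simps del: One_nat_def)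
      also have "\<dots> \<longleftrightarrow> (\<exists>i\<in>{1..n}. norm (vhat n i om) > \<delta> * sqrt (real n))"
        unfolding Max_gr_iff[OF ne] by blast
      finally show ?thesis by (simp only: not_le[symmetric]) blast
    qed
    then have AB: "?A = ?B" by (simp only:)
    have "{om \<in> space (M n). \<forall>i\<in>{1..n}. norm (vhat n i om) \<le> \<delta> * sqrt (real n)} \<in> sets (M n)"
    proof (rule sets.sets_Collect_finite_All)
      fix i assume "i \<in> {1..n}"
      from v_hat_M[OF this] show "{om \<in> space (M n). norm (vhat n i om) \<le> \<delta> * sqrt (real n)} \<in> sets (M n)"
        by measurable
    qed simp
    then have "?B \<in> sets (M n)" by (rule sets.sets_Collect_neg)
    then show ?case by (rule with_prob_measure) (use elim(1) AB in simp)
  qed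
qed

lemma regular_vP: "regular n om ==> t \<in> {1..n} ==> vhat n t om = vP n t om"
  unfolding vP_def by (rule regular_v_hat(1))

lemma regular_GP: "regular n om ==> Gammahat n om = GP n om"
  unfolding Gamma_hat_def GP_def by (intro arg_cong[where f="\<lambda>A. (1 / real n) *\<^sub>R A"] sum.cong refl) (simp only: regular_vP)

lemma whp_small_design:
  assumes B: "1 \<le> B" and \<delta>: "0 < \<delta>"
  shows "whp M (\<lambda>n om. good B n om \<longrightarrow> small_design (1 / (2 * B)) \<delta> B n om)"
proof (rule whp_mono[OF whp_conj[OF prob whp_regular whp_conj[OF prob whp_v_hat[OF \<delta>] whp_Gamma_hat_pd[OF B]]]])
  show "\<forall>\<^sub>F n in sequentially. \<forall>om\<in>space (M n). regular n om \<and> (\<forall>i\<in>{1..n}. norm (vhat n i om) \<le> \<delta> * sqrt (real n)) \<and>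
     (good B n om \<longrightarrow> matrix_pd (1 / (2 * B)) (Gammahat n om)) \<longrightarrow> (good B n om \<longrightarrow> small_design (1 / (2 * B)) \<delta> B n om)"
  proof (intro always_eventually allI ballI impI, elim conjE)
    fix n om assume r: "regular n om" and v: "\<forall>i\<in>{1..n}. norm (vhat n i om) \<le> \<delta> * sqrt (real n)"
      and pd: "good B n om \<longrightarrow> matrix_pd (1 / (2 * B)) (Gammahat n om)" and g: "good B n om"
    have "norm (vP n t om) \<le> \<delta> * sqrt (real n)" if "t \<in> {1..n}" for t using v that regular_vP[OF r that] by metis
    then show "small_design (1 / (2 * B)) \<delta> B n om"
      unfolding small_design_def using pd g regular_GP[OF r] by (auto simp: good_def)
  qed
qed

lemma small_design_event:
  assumes e: "0 < e"
  shows "\<exists>B\<ge>1. \<forall>\<delta>>0. \<forall>\<^sub>F n in sequentially. with_prob (M n) e (small_design (1 / (2 * B)) \<delta> B n)"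
proof -
  obtain B where B: "1 \<le> B" "\<forall>\<^sub>F n in sequentially. with_prob (M n) (e / 2) (good B n)"
    using good_event[of "e / 2"] e by auto
  have "\<forall>\<^sub>F n in sequentially. with_prob (M n) e (small_design (1 / (2 * B)) \<delta> B n)" if d: "0 < \<delta>" for \<delta>
  proof -
    have "\<forall>\<^sub>F n in sequentially. with_prob (M n) (e / 2) (\<lambda>om. good B n om \<longrightarrow> small_design (1 / (2 * B)) \<delta> B n om)"
      using whp_small_design[OF B(1) d] e unfolding whp_def by simp
    then show ?thesis using B(2)
    proof eventually_elim
      case (elim n)
      from prob_space.with_prob_conj[OF prob elim] show ?case by (rule with_prob_mono) auto
    qed
  qed
  then show ?thesis using B(1) by blast
qed

definition iD where "iD \<kappa> \<delta> B n om = (indicator {om \<in> space (XF n). small_design \<kappa> \<delta> B n om} om :: real)"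

lemma iD_XF: "iD \<kappa> \<delta> B n \<in> borel_measurable (XF n)" unfolding iD_def[abs_def] using small_design_XF by simp

lemma iD_cases: "iD \<kappa> \<delta> B n om = 0 \<or> iD \<kappa> \<delta> B n om = 1 \<and> small_design \<kappa> \<delta> B n om"
  by (auto simp: iD_def indicator_def)

lemma iD_1: "om \<in> space (M n) ==> small_design \<kappa> \<delta> B n om ==> iD \<kappa> \<delta> B n om = 1"
  by (simp add: iD_def space_XF)

text \<open>Off the event \<open>small_design\<close> the weights are set to zero, so that the bounds hold at every sample point.\<close>

lemma truncated_weights:
  fixes s :: "real ^ 'd" and B :: real
  assumes \<kappa>: "0 < \<kappa>" and n: "1 \<le> n" and s0: "0 < s0" "s0 \<le> (\<sigma> n)^2" and \<delta>: "0 \<le> \<delta>"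
  defines "h \<equiv> \<lambda>t om. iD \<kappa> \<delta> B n om * (s \<bullet> zc n t om)"
  shows "\<And>t. t \<in> {1..n} ==> h t \<in> borel_measurable (XF n)"
    and "\<And>t om. t \<in> {1..n} ==> \<bar>h t om\<bar> \<le> norm s * (\<delta> / sqrt (s0 * \<kappa>))"
    and "\<And>t om. h t om \<noteq> 0 ==> EU B n om"
    and "\<And>om. (\<Sum>t=1..n. (\<sigma> n)^2 * (h t om)^2) = iD \<kappa> \<delta> B n om * (s \<bullet> s)"
    and "\<And>t. t \<in> {1..n} ==> integrable (M n) (\<lambda>om. (h t om)^2)"
    and "(\<Sum>t=1..n. \<integral>om. (h t om)^2 \<partial>M n) \<le> (s \<bullet> s) / s0" (is ?g1)
proof -
  interpret prob_space "M n" by (rule prob)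
  have \<sigma>: "\<sigma> n \<noteq> 0" using s0 by auto
  show 1: "h t \<in> borel_measurable (XF n)" if "t \<in> {1..n}" for t
    unfolding h_def using iD_XF[of \<kappa> \<delta> B n] zc_XF[OF that] by measurable
  show 2: "\<bar>h t om\<bar> \<le> norm s * (\<delta> / sqrt (s0 * \<kappa>))" if t: "t \<in> {1..n}" for t om
  proof (cases "iD \<kappa> \<delta> B n om = 0")
    case True
    then show ?thesis using \<delta> \<kappa> s0 by (simp add: h_def)
  next
    case False
    then have D: "iD \<kappa> \<delta> B n om = 1" "small_design \<kappa> \<delta> B n om" using iD_cases by blast+
    have "(norm (zc n t om))^2 \<le> \<delta>^2 / ((\<sigma> n)^2 * \<kappa>)" by (rule zc_bound[OF \<kappa> D(2) n \<sigma> t])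
    also have "\<dots> \<le> \<delta>^2 / (s0 * \<kappa>)" using s0 \<kappa> by (intro divide_left_mono mult_right_mono mult_pos_pos) auto
    also have "\<dots> = (\<delta> / sqrt (s0 * \<kappa>))^2" using s0 \<kappa> by (simp add: power_divide)
    finally have z: "norm (zc n t om) \<le> \<delta> / sqrt (s0 * \<kappa>)"
      by (rule power2_le_imp_le) (use \<delta> \<kappa> s0 in simp)
    have "\<bar>h t om\<bar> \<le> norm s * norm (zc n t om)" unfolding h_def D(1) mult_1 by (rule Cauchy_Schwarz_ineq2)
    also have "\<dots> \<le> norm s * (\<delta> / sqrt (s0 * \<kappa>))" using z by (intro mult_left_mono) auto
    finally show ?thesis .
  qed
  show 3: "EU B n om" if "h t om \<noteq> 0" for t om
    using that iD_cases[of \<kappa> \<delta> B n om] by (auto simp: h_def small_design_def)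
  show 4: "(\<Sum>t=1..n. (\<sigma> n)^2 * (h t om)^2) = iD \<kappa> \<delta> B n om * (s \<bullet> s)" for om
  proof (cases "iD \<kappa> \<delta> B n om = 0")
    case False
    then have D: "iD \<kappa> \<delta> B n om = 1" "small_design \<kappa> \<delta> B n om" using iD_cases by blast+
    show ?thesis unfolding h_def D(1) mult_1 by (rule zc_isometry[OF \<kappa> D(2) n \<sigma>])
  qed (simp add: h_def)
  show 5: "integrable (M n) (\<lambda>om. (h t om)^2)" if t: "t \<in> {1..n}" for t
  proof (rule integrable_const_bound[where B="(norm s * (\<delta> / sqrt (s0 * \<kappa>)))^2"])
    have "(h t om)^2 \<le> (norm s * (\<delta> / sqrt (s0 * \<kappa>)))^2" for om
      unfolding abs_le_square_iff[symmetric] using 2[OF t, of om] by linarith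
    then show "AE om in M n. norm ((h t om)^2) \<le> (norm s * (\<delta> / sqrt (s0 * \<kappa>)))^2" by simp
  qed (use XF_M[OF 1[OF t]] in simp)
  have "s0 * (\<Sum>t=1..n. (h t om)^2) \<le> s \<bullet> s" for om
  proof -
    have "s0 * (\<Sum>t=1..n. (h t om)^2) \<le> (\<sigma> n)^2 * (\<Sum>t=1..n. (h t om)^2)"
      using s0 by (intro mult_right_mono sum_nonneg) auto
    also have "\<dots> = iD \<kappa> \<delta> B n om * (s \<bullet> s)" unfolding 4[symmetric] sum_distrib_left ..
    also have "\<dots> \<le> s \<bullet> s" using iD_cases[of \<kappa> \<delta> B n om] by auto
    finally show ?thesis .
  qed
  then have le: "(\<Sum>t=1..n. (h t om)^2) \<le> (s \<bullet> s) / s0" for om using s0(1) by (simp add: pos_le_divide_eq mult.commute)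
  have "(\<Sum>t=1..n. \<integral>om. (h t om)^2 \<partial>M n) = (\<integral>om. (\<Sum>t=1..n. (h t om)^2) \<partial>M n)"
    by (rule Bochner_Integration.integral_sum[symmetric]) (rule 5)
  also have "\<dots> \<le> (\<integral>om. (s \<bullet> s) / s0 \<partial>M n)"
    by (intro integral_mono Bochner_Integration.integrable_sum 5 le) auto
  also have "\<dots> = (s \<bullet> s) / s0" by (simp add: prob_space)
  finally show ?g1 .
qed

lemma inner_Z: "s \<bullet> Z n om = (\<Sum>t=1..n. (s \<bullet> zc n t om) * U n t om)"
  unfolding Z_def inner_sum_right by (simp add: mult.commute)

lemma Z_bounded:
  assumes e: "0 < e"
  shows "\<exists>L>0. \<forall>\<^sub>F n in sequentially. with_prob (M n) e (\<lambda>om. norm (Z n om) \<le> L)"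
proof -
  obtain c where c: "\<forall>\<^sub>F n in sequentially. small_blocks c n"
    using block_bound unfolding small_blocks_def by blast
  obtain s0 s1 where s: "0 < s0" "0 < s1" "\<forall>\<^sub>F n in sequentially. s0 \<le> (\<sigma> n)^2 \<and> (\<sigma> n)^2 \<le> s1" using sigma_bounds by blast
  obtain B where B: "1 \<le> B" "\<And>\<delta>. 0 < \<delta> ==> \<forall>\<^sub>F n in sequentially. with_prob (M n) (e / 2) (small_design (1 / (2 * B)) \<delta> B n)"
    using small_design_event[of "e / 2"] e by auto
  let ?\<kappa> = "1 / (2 * B)"
  define m where "m = real CARD('d) * (real c * (1 + B) * (1 / s0))"
  define L where "L = sqrt (m / (e / 2)) + 1"
  have m0: "0 \<le> m" using B s by (simp add: m_def)
  have L: "0 < L" using m0 e by (simp add: L_def add_nonneg_pos)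
  have one: "0 < (1 :: real)" by simp
  have "\<forall>\<^sub>F n in sequentially. with_prob (M n) e (\<lambda>om. norm (Z n om) \<le> L)"
    using c s(3) B(2)[OF one] eventually_ge_at_top[of 1]
  proof eventually_elim
    case (elim n)
    interpret prob_space "M n" by (rule prob)
    have kp: "0 < ?\<kappa>" "0 \<le> B" using B(1) by auto
    have s0n: "s0 \<le> (\<sigma> n)^2" using elim(2) by blast
    let ?h = "\<lambda>a t om. iD ?\<kappa> 1 B n om * (axis a 1 \<bullet> zc n t om)"
    let ?X = "\<lambda>a om. (\<Sum>t=1..n. ?h a t om * U n t om)^2"
    note tw = truncated_weights[OF kp(1) elim(4) s(1) s0n less_imp_le[OF one], where B=B]
    have i: "integrable (M n) (?X a)" for a
      by (rule linear_U_bound(1)[OF elim(1) kp(2)]) (rule tw; assumption)+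
    have b: "(\<integral>om. ?X a om \<partial>M n) \<le> real c * (1 + B) * (1 / s0)" for a
    proof -
      have "(\<integral>om. ?X a om \<partial>M n) \<le> real c * (1 + B) * (\<Sum>t=1..n. \<integral>om. (?h a t om)^2 \<partial>M n)"
        by (rule linear_U_bound(2)[OF elim(1) kp(2)]) (rule tw; assumption)+
      also have "\<dots> \<le> real c * (1 + B) * ((axis a 1 \<bullet> (axis a 1 :: real ^ 'd)) / s0)"
        using kp by (intro mult_left_mono tw(6)) auto
      finally show ?thesis by (simp add: inner_axis_axis)
    qed
    have "(\<integral>om. (\<Sum>a\<in>UNIV. ?X a om) \<partial>M n) = (\<Sum>a\<in>UNIV. \<integral>om. ?X a om \<partial>M n)"
      by (rule Bochner_Integration.integral_sum) (rule i)
    also have "\<dots> \<le> (\<Sum>a\<in>(UNIV :: 'd set). real c * (1 + B) * (1 / s0))" by (intro sum_mono b)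
    also have "\<dots> = m" by (simp add: m_def)
    finally have le: "(\<integral>om. (\<Sum>a\<in>UNIV. ?X a om) \<partial>M n) \<le> m" .
    have "with_prob (M n) (e / 2) (\<lambda>om. (\<Sum>a\<in>UNIV. ?X a om) \<le> m / (e / 2))"
      by (rule with_prob_markov[OF _ _ le]) (use e in \<open>auto intro!: Bochner_Integration.integrable_sum i sum_nonneg simp del: One_nat_def\<close>)
    from with_prob_conj[OF this elim(3)] show ?case
    proof (rule with_prob_mono)
      fix om assume sp: "om \<in> space (M n)" and a: "(\<Sum>a\<in>UNIV. ?X a om) \<le> m / (e / 2) \<and> small_design ?\<kappa> 1 B n om"
      then have iD: "iD ?\<kappa> 1 B n om = 1" by (intro iD_1) auto
      have "?X a om = (Z n om $ a)^2" for a
        unfolding iD mult_1 inner_Z[symmetric] by (simp add: inner_axis')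
      then have "(\<Sum>a\<in>UNIV. ?X a om) = (norm (Z n om))^2"
        unfolding power2_norm_eq_inner inner_vec_def by (simp add: power2_eq_square)
      then have "(norm (Z n om))^2 \<le> m / (e / 2)" using a by simp
      then have "norm (Z n om) \<le> sqrt (m / (e / 2))" by (rule real_le_rsqrt)
      then show "norm (Z n om) \<le> L" by (simp add: L_def)
    qed simp
  qed
  then show ?thesis using L by blast
qed

lemma (in prob_space) cmod_expectation_diff:
  fixes f g :: "'a => complex"
  assumes [measurable]: "f \<in> borel_measurable M" "g \<in> borel_measurable M" and D: "D \<in> sets M" "measure M (space M - D) \<le> e"
    and f1: "\<And>om. cmod (f om) \<le> 1" "\<And>om. cmod (g om) \<le> 1" and eq: "\<And>om. om \<in> D ==> f om = g om"
  shows "cmod ((\<integral>om. f om \<partial>M) - (\<integral>om. g om \<partial>M)) \<le> 2 * e"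
proof -
  have i: "integrable M f" "integrable M g" by (rule integrable_const_bound[where B=1], use f1 in auto)+
  have iD: "integrable M (\<lambda>om. 2 * indicator (space M - D) om :: real)" using D(1) by (simp add: emeasure_eq_measure)
  have "cmod ((\<integral>om. f om \<partial>M) - (\<integral>om. g om \<partial>M)) = cmod (\<integral>om. f om - g om \<partial>M)" using i by simp
  also have "\<dots> \<le> (\<integral>om. cmod (f om - g om) \<partial>M)" by (rule integral_norm_bound)
  also have "\<dots> \<le> (\<integral>om. 2 * indicator (space M - D) om \<partial>M)"
  proof (rule integral_mono)
    fix om assume "om \<in> space M"
    have "cmod (f om - g om) \<le> cmod (f om) + cmod (g om)" by (rule norm_triangle_ineq4)
    also have "\<dots> \<le> 2" using f1[of om] by linarith
    finally show "cmod (f om - g om) \<le> 2 * indicator (space M - D) om"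
      using eq[of om] \<open>om \<in> space M\<close> by (cases "om \<in> D") auto
  qed (use i iD in auto)
  also have "\<dots> = 2 * measure M (space M - D)" using D(1) by simp
  also have "\<dots> \<le> 2 * e" using D(2) by simp
  finally show ?thesis .
qed

text \<open>Outside a set of small probability \<open>Z\<close> equals its truncated version, and both characteristic functions move little.
  The bound on the weights is proportional to \<open>\<delta>\<close>, which is chosen after \<open>B\<close>.\<close>

lemma char_Z: "(\<lambda>n. \<integral>om. iexp (s \<bullet> Z n om) \<partial>M n) \<longlonglongrightarrow> complex_of_real (exp (- (s \<bullet> s) / 2))"
proof (rule tendstoI)
  fix \<epsilon> :: real assume \<epsilon>: "0 < \<epsilon>"
  obtain c where c: "\<forall>\<^sub>F n in sequentially. small_blocks c n"
    using block_bound unfolding small_blocks_def by blast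
  obtain s0 s1 where s: "0 < s0" "0 < s1" "\<forall>\<^sub>F n in sequentially. s0 \<le> (\<sigma> n)^2 \<and> (\<sigma> n)^2 \<le> s1" using sigma_bounds by blast
  obtain B where B: "1 \<le> B" "\<And>\<delta>. 0 < \<delta> ==> \<forall>\<^sub>F n in sequentially. with_prob (M n) (\<epsilon> / 16) (small_design (1 / (2 * B)) \<delta> B n)"
    using small_design_event[of "\<epsilon> / 16"] \<epsilon> by auto
  define \<kappa> where "\<kappa> = 1 / (2 * B)"
  have kp: "0 < \<kappa>" "0 \<le> B" using B(1) by (auto simp: \<kappa>_def)
  \<comment> \<open>\<open>C b\<close> bounds the error of the Gaussian replacement, and \<open>\<delta>\<close> makes the weights at most \<open>b\<close>\<close>
  define C where "C = (real c ^ 3 * (1 + B) + s1^2 * real c) * ((s \<bullet> s) / s0)"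
  define b where "b = min 1 (\<epsilon> / (2 * (C + 1)))"
  define \<delta> where "\<delta> = b * sqrt (s0 * \<kappa>) / (norm s + 1)"
  have C: "0 \<le> C" using kp s by (simp add: C_def)
  have b: "0 < b" "b \<le> 1" "b \<le> \<epsilon> / (2 * (C + 1))" using \<epsilon> C by (auto simp: b_def)
  have Cb: "C * b \<le> \<epsilon> / 2"
  proof -
    have "C * b \<le> (C + 1) * (\<epsilon> / (2 * (C + 1)))" using C b by (intro mult_mono) auto
    also have "\<dots> = \<epsilon> / 2" using C by (simp add: divide_simps) (simp add: algebra_simps)?
    finally show ?thesis .
  qed
  have n1: "0 < norm s + 1" by (rule add_nonneg_pos) auto
  have \<delta>: "0 < \<delta>" unfolding \<delta>_def using b kp s n1 by simp
  have sb: "norm s * (\<delta> / sqrt (s0 * \<kappa>)) \<le> b"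
  proof -
    have "norm s * (\<delta> / sqrt (s0 * \<kappa>)) = b * (norm s / (norm s + 1))" using s kp by (simp add: \<delta>_def)
    also have "\<dots> \<le> b * 1" using b n1 by (intro mult_left_mono) auto
    finally show ?thesis by simp
  qed
  show "\<forall>\<^sub>F n in sequentially. dist (\<integral>om. iexp (s \<bullet> Z n om) \<partial>M n) (complex_of_real (exp (- (s \<bullet> s) / 2))) < \<epsilon>"
    using c s(3) B(2)[OF \<delta>] eventually_ge_at_top[of 1]
  proof eventually_elim
    case (elim n)
    interpret prob_space "M n" by (rule prob)
    have s0n: "s0 \<le> (\<sigma> n)^2" and s1n: "(\<sigma> n)^2 \<le> s1" using elim(2) by auto
    note tw = truncated_weights[OF kp(1) elim(4) s(1) s0n less_imp_le[OF \<delta>], where B=B and s=s]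
    let ?D = "{om \<in> space (M n). small_design \<kappa> \<delta> B n om}"
    let ?h = "\<lambda>t om. iD \<kappa> \<delta> B n om * (s \<bullet> zc n t om)"
    have DM: "?D \<in> sets (M n)" using small_design_XF[of n \<kappa> \<delta> B] subalg_XF[of n] unfolding space_XF subalgebra_def by blast
    obtain S where S: "S \<in> sets (M n)" "measure (M n) S \<le> \<epsilon> / 16" "{om \<in> space (M n). \<not> small_design \<kappa> \<delta> B n om} \<subseteq> S"
      using elim(3) unfolding with_prob_def \<kappa>_def by blast
    have "measure (M n) (space (M n) - ?D) \<le> measure (M n) S"
      by (rule finite_measure_mono) (use S in auto)
    then have Dm: "measure (M n) (space (M n) - ?D) \<le> \<epsilon> / 16" using S by linarith
    have hM: "?h t \<in> borel_measurable (M n)" if "t \<in> {1..n}" for t by (rule XF_M[OF tw(1)[OF that]])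
    have sumM: "(\<lambda>om. \<Sum>t=1..n. ?h t om * U n t om) \<in> borel_measurable (M n)"
      by (intro borel_measurable_sum borel_measurable_times hM L2_meas[OF U_L2])
    have ZM: "(\<lambda>om. s \<bullet> Z n om) \<in> borel_measurable (M n)" using Z_M[of n] by measurable
    have 1: "cmod ((\<integral>om. iexp (s \<bullet> Z n om) \<partial>M n) - (\<integral>om. iexp (\<Sum>t=1..n. ?h t om * U n t om) \<partial>M n)) \<le> 2 * (\<epsilon> / 16)"
    proof (rule cmod_expectation_diff[OF _ _ DM Dm])
      show "(\<lambda>om. iexp (s \<bullet> Z n om)) \<in> borel_measurable (M n)" using ZM by measurable
      show "(\<lambda>om. iexp (\<Sum>t=1..n. ?h t om * U n t om)) \<in> borel_measurable (M n)" using sumM by measurable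
      show "iexp (s \<bullet> Z n om) = iexp (\<Sum>t=1..n. ?h t om * U n t om)" if "om \<in> ?D" for om
        using iD_1[of om n \<kappa> \<delta> B] that by (simp add: inner_Z)
    qed (simp_all add: norm_exp_eq_Re)
    let ?g = "\<lambda>om. complex_of_real (exp (- (\<Sum>t=1..n. (\<sigma> n)^2 * (?h t om)^2) / 2))"
    have 2: "cmod ((\<integral>om. ?g om \<partial>M n) - (\<integral>om. complex_of_real (exp (- (s \<bullet> s) / 2)) \<partial>M n)) \<le> 2 * (\<epsilon> / 16)"
      unfolding tw(4)
    proof (rule cmod_expectation_diff[OF _ _ DM Dm])
      show "(\<lambda>om. complex_of_real (exp (- (iD \<kappa> \<delta> B n om * (s \<bullet> s)) / 2))) \<in> borel_measurable (M n)"
        using XF_M[OF iD_XF[of \<kappa> \<delta> B n]] by measurable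
      show "complex_of_real (exp (- (iD \<kappa> \<delta> B n om * (s \<bullet> s)) / 2)) = complex_of_real (exp (- (s \<bullet> s) / 2))" if "om \<in> ?D" for om
        using iD_1[of om n \<kappa> \<delta> B] that by simp
      show "cmod (complex_of_real (exp (- (iD \<kappa> \<delta> B n om * (s \<bullet> s)) / 2))) \<le> 1" for om
        using iD_cases[of \<kappa> \<delta> B n om] by auto
    qed simp_all
    have 3: "cmod ((\<integral>om. iexp (\<Sum>t=1..n. ?h t om * U n t om) \<partial>M n) - (\<integral>om. ?g om \<partial>M n)) \<le> \<epsilon> / 2"
    proof -
      let ?I = "\<Sum>t=1..n. \<integral>om. (?h t om)^2 \<partial>M n"
      have I0: "0 \<le> ?I" by (intro sum_nonneg Bochner_Integration.integral_nonneg) auto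
      have "cmod ((\<integral>om. iexp (\<Sum>t=1..n. ?h t om * U n t om) \<partial>M n) - (\<integral>om. ?g om \<partial>M n))
        \<le> (real c ^ 3 * (1 + B) * b + ((\<sigma> n)^2)^2 * real c * b^2) * ?I"
      proof (rule char_linear_U[OF elim(1) kp(2) less_imp_le[OF b(1)]])
        show "\<bar>?h t om\<bar> \<le> b" if "t \<in> {1..n}" for t om using tw(2)[OF that, of om] sb by linarith
      qed (rule tw; assumption)+
      also have "\<dots> \<le> ((real c ^ 3 * (1 + B) + s1^2 * real c) * b) * ?I"
      proof (rule mult_right_mono[OF _ I0])
        have "((\<sigma> n)^2)^2 * real c * b^2 \<le> s1^2 * real c * b"
        proof (intro mult_mono power_mono s1n)
          show "b^2 \<le> b" using b by (simp add: power2_eq_square mult_left_le)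
        qed (use b s in auto)
        then show "real c ^ 3 * (1 + B) * b + ((\<sigma> n)^2)^2 * real c * b^2 \<le> (real c ^ 3 * (1 + B) + s1^2 * real c) * b"
          by (simp add: distrib_right)
      qed
      also have "\<dots> \<le> ((real c ^ 3 * (1 + B) + s1^2 * real c) * b) * ((s \<bullet> s) / s0)"
        using b kp by (intro mult_left_mono tw(6)) auto
      also have "\<dots> = C * b" by (simp add: C_def mult_ac)
      also have "\<dots> \<le> \<epsilon> / 2" by (rule Cb)
      finally show ?thesis .
    qed
    have tri: "dist p q < \<epsilon>" if "cmod (p - p1) \<le> 2 * (\<epsilon> / 16)" "cmod (p1 - p2) \<le> \<epsilon> / 2" "cmod (p2 - q) \<le> 2 * (\<epsilon> / 16)" for p p1 p2 q
    proof -
      have "dist p q \<le> cmod (p - p1) + cmod (p1 - p2) + cmod (p2 - q)"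
        unfolding dist_norm using norm_triangle_ineq[of "p - p1" "p1 - q"] norm_triangle_ineq[of "p1 - p2" "p2 - q"] by simp
      then show ?thesis using that \<epsilon> by linarith
    qed
    show ?case using tri[OF 1 3 2] by (simp add: prob_space)
  qed
qed

section \<open>The variance estimator and studentisation\<close>

lemma residual_degrees: "\<exists>c>0. \<forall>\<^sub>F n in sequentially. c * real n \<le> real n - real CARD('d) - real (K n)"
proof -
  obtain r where r: "limsup (\<lambda>n. ereal (real (K n) / real n)) < ereal r" "ereal r < 1"
    using ereal_dense2[OF design_dim] by blast
  have r1: "r < 1" using r(2) by simp
  \<comment> \<open>half of the gap \<open>1 - r\<close> is left to absorb the fixed dimension\<close>
  define c where "c = (1 - r) / 2"
  have c: "0 < c" using r1 by (simp add: c_def)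
  obtain m :: nat where m: "real CARD('d) \<le> c * real m" using reals_Archimedean3[OF c] by (metis less_imp_le mult.commute)
  have "\<forall>\<^sub>F n in sequentially. c * real n \<le> real n - real CARD('d) - real (K n)"
    using Limsup_lessD[OF r(1)] eventually_ge_at_top[of 1] eventually_ge_at_top[of m]
  proof eventually_elim
    case (elim n)
    have "real (K n) / real n < r" using elim(1) by simp
    then have k: "real (K n) \<le> r * real n" using elim(2) by (simp add: field_simps)
    have "c * real m \<le> c * real n" using c elim(3) by simp
    then have "real CARD('d) \<le> c * real n" using m by linarith
    moreover have "2 * (c * real n) = real n - r * real n" by (simp add: c_def left_diff_distrib)
    ultimately show ?case using k by linarith
  qed
  then show ?thesis using c by blast
qed

definition sU :: "nat => 'a => real ^ 'd" where "sU n om = (1 / sqrt (real n)) *\<^sub>R (\<Sum>i=1..n. U n i om *\<^sub>R vP n i om)"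
definition sR :: "nat => 'a => real ^ 'd" where "sR n om = (1 / sqrt (real n)) *\<^sub>R (\<Sum>i=1..n. R n i om *\<^sub>R vP n i om)"

lemma Z_sU: "\<sigma> n \<noteq> 0 ==> \<bar>\<sigma> n\<bar> *\<^sub>R Z n om = WP n om *v sU n om"
  unfolding Z_def sU_def zc_def
  by (simp add: scaleR_sum_right matrix_vector_mult_scaleR linear_sum[OF matrix_vector_mul_linear] mult.commute divide_simps)

text \<open>All random inputs of the final comparison; what follows on this event is deterministic.\<close>

definition well_behaved :: "real => real => real => nat => 'a => bool" where
  "well_behaved \<kappa> L d n om \<longleftrightarrow> om \<in> space (M n) \<and> regular n om \<and> matrix_pd \<kappa> (GP n om) \<and> norm (Z n om) \<le> L \<and> norm (WP n om *v sR n om) \<le> d \<and>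
    \<bar>(\<Sum>i=1..n. U n i om * Pr n om (\<lambda>j. U n j om) i) - (\<sigma> n)\<^sup>2 * (real n - real (K n))\<bar> \<le> d * real n \<and>
    (\<Sum>i=1..n. (R n i om)^2) \<le> d * real n"

lemma well_behaved_event:
  assumes e: "0 < e"
  shows "\<exists>\<kappa>>0. \<exists>L>0. \<forall>d>0. \<forall>\<^sub>F n in sequentially. with_prob (M n) e (well_behaved \<kappa> L d n)"
proof -
  obtain B where B: "1 \<le> B" "\<forall>\<^sub>F n in sequentially. with_prob (M n) (e / 4) (good B n)"
    using good_event[of "e / 4"] e by auto
  obtain L where L: "0 < L" "\<forall>\<^sub>F n in sequentially. with_prob (M n) (e / 4) (\<lambda>om. norm (Z n om) \<le> L)"
    using Z_bounded[of "e / 4"] e by auto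
  define \<kappa> where "\<kappa> = 1 / (2 * B)"
  have \<kappa>: "0 < \<kappa>" and B0: "0 \<le> B" using B(1) by (auto simp: \<kappa>_def)
  have "\<forall>\<^sub>F n in sequentially. with_prob (M n) e (well_behaved \<kappa> L d n)" if d: "0 < d" for d
  proof -
    define d' where "d' = d * sqrt \<kappa> / real CARD('d)"
    have d': "0 < d'" using d \<kappa> by (simp add: d'_def)
    let ?R = "\<lambda>a n om. EV B n om \<longrightarrow> \<bar>(1 / sqrt (real n)) * (\<Sum>i=1..n. vhat n i om $ a * R n i om)\<bar> \<le> d'"
    have "whp M (\<lambda>n om. \<forall>a\<in>UNIV. ?R a n om)"
      by (rule whp_ball[OF prob]) (use whp_remainder[OF B0 d'] in auto)
    note w = whp_conj[OF prob whp_conj[OF prob whp_regular whp_Gamma_hat_pd[OF B(1)]] whp_conj[OF prob this whp_conj[OF prob whp_U_quadratic[OF B0 d] whp_sum_R[OF d]]]]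
    have "\<forall>\<^sub>F n in sequentially. with_prob (M n) (e / 2) (\<lambda>om. (regular n om \<and> (good B n om \<longrightarrow> matrix_pd (1 / (2 * B)) (Gammahat n om))) \<and>
      (\<forall>a\<in>UNIV. ?R a n om) \<and> (EU B n om \<longrightarrow> \<bar>(\<Sum>i=1..n. U n i om * Pr n om (\<lambda>j. U n j om) i) - (\<sigma> n)\<^sup>2 * (real n - real (K n))\<bar> \<le> d * real n) \<and>
      (\<Sum>i=1..n. (R n i om)^2) \<le> d * real n)"
      using w[unfolded whp_def, rule_format, of "e / 2"] e by simp
    then show ?thesis using B(2) L(2)
    proof eventually_elim
      case (elim n)
      interpret prob_space "M n" by (rule prob)
      from with_prob_conj[OF elim(1) with_prob_conj[OF elim(2,3)]] show ?case
      proof (rule with_prob_mono, elim conjE)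
        fix om assume sp: "om \<in> space (M n)" and r: "regular n om" and g: "good B n om" and Z: "norm (Z n om) \<le> L"
          and pd: "good B n om \<longrightarrow> matrix_pd (1 / (2 * B)) (Gammahat n om)"
          and R: "\<forall>a\<in>UNIV. ?R a n om"
          and Uq: "EU B n om \<longrightarrow> \<bar>(\<Sum>i=1..n. U n i om * Pr n om (\<lambda>j. U n j om) i) - (\<sigma> n)\<^sup>2 * (real n - real (K n))\<bar> \<le> d * real n"
          and R2: "(\<Sum>i=1..n. (R n i om)^2) \<le> d * real n"
        have pd': "matrix_pd \<kappa> (GP n om)" using pd g regular_GP[OF r] by (simp add: \<kappa>_def)
        interpret pd_matrix \<kappa> "GP n om" by (intro pd_matrix.intro \<kappa> pd')
        have WP: "WP n om = W" by (simp add: WP_def W_def S_def)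
        have "\<bar>sR n om $ a\<bar> \<le> d'" for a
        proof -
          have "sR n om $ a = (1 / sqrt (real n)) * (\<Sum>i=1..n. vhat n i om $ a * R n i om)"
            unfolding sR_def vector_scaleR_component real_scaleR_def sum_component
            by (intro arg_cong[where f="\<lambda>c. (1 / sqrt (real n)) * c"] sum.cong refl) (simp only: regular_vP[OF r] mult.commute)
          moreover have "EV B n om" using g by (simp add: good_def)
          ultimately show ?thesis using R by simp
        qed
        then have "(\<Sum>a\<in>UNIV. \<bar>sR n om $ a\<bar>) \<le> (\<Sum>a\<in>(UNIV :: 'd set). d')" by (intro sum_mono)
        then have "norm (sR n om) \<le> d * sqrt \<kappa>"
          using norm_le_l1_cart[of "sR n om"] by (simp add: d'_def)
        then have "(norm (sR n om))^2 \<le> (d * sqrt \<kappa>)^2" by (intro power_mono) auto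
        then have "(norm (sR n om))^2 / \<kappa> \<le> d^2" using \<kappa> by (simp add: power_mult_distrib divide_simps)
        then have "(norm (WP n om *v sR n om))^2 \<le> d^2" using W_norm[of "sR n om"] unfolding WP by linarith
        then have "norm (WP n om *v sR n om) \<le> d" by (rule power2_le_imp_le) (use d in simp)
        then show "well_behaved \<kappa> L d n om" unfolding well_behaved_def using sp r pd' Z Uq R2 g by (simp add: good_def)
      qed simp
    qed
  qed
  then show ?thesis using \<kappa> L(1) by blast
qed

abbreviation "studentized n om \<equiv> matrix_inv (matrix_sqrt (Omegahat n om)) *v (sqrt (real n) *\<^sub>R (betahat n om - \<beta>))"

context
  fixes \<kappa> L d n om
  assumes \<kappa>: "0 < \<kappa>" and wb: "well_behaved \<kappa> L d n om" and n: "1 \<le> n" and \<sigma>: "\<sigma> n \<noteq> 0"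
begin

interpretation proj: projection "{1..n}" "\<lambda>i j. P n i j om" by (rule P_projection)

interpretation pd: pd_matrix \<kappa> "GP n om"
  using wb by (intro pd_matrix.intro \<kappa>) (simp add: well_behaved_def)

lemma r: "regular n om" and sp: "om \<in> space (M n)"
  using wb by (simp_all add: well_behaved_def)

lemma WP: "WP n om = pd.W" by (simp add: WP_def pd.W_def pd.S_def)

lemma s_split: "(1 / sqrt (real n)) *\<^sub>R (\<Sum>i=1..n. u n i om *\<^sub>R vP n i om) = sU n om + sR n om"
proof -
  have "(\<Sum>i=1..n. u n i om *\<^sub>R vP n i om) = (\<Sum>i=1..n. U n i om *\<^sub>R vP n i om + R n i om *\<^sub>R vP n i om)"
    using r by (intro sum.cong refl) (simp only: regular_def scaleR_add_left)
  then show ?thesis unfolding sU_def sR_def by (simp only: sum.distrib scaleR_add_right)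
qed

lemma Ws: "WP n om *v (sU n om + sR n om) = \<bar>\<sigma> n\<bar> *\<^sub>R Z n om + WP n om *v sR n om"
  unfolding Z_sU[OF \<sigma>] by (simp add: matrix_vector_right_distrib)

lemma Ws_bound: "norm (WP n om *v (sU n om + sR n om)) \<le> \<bar>\<sigma> n\<bar> * L + d"
proof -
  have "norm (\<bar>\<sigma> n\<bar> *\<^sub>R Z n om + WP n om *v sR n om) \<le> \<bar>\<sigma> n\<bar> * norm (Z n om) + norm (WP n om *v sR n om)"
    using norm_triangle_ineq[of "\<bar>\<sigma> n\<bar> *\<^sub>R Z n om"] by simp
  also have "\<dots> \<le> \<bar>\<sigma> n\<bar> * L + d" using wb by (intro add_mono mult_left_mono) (auto simp: well_behaved_def)
  finally show ?thesis unfolding Ws .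
qed

lemma ols:
  shows "sqrt (real n) *\<^sub>R (betahat n om - \<beta>) = matrix_inv (GP n om) *v (sU n om + sR n om)"
    and "(\<Sum>i=1..n. (uhat n i om)^2) = (\<Sum>i=1..n. u n i om * proj.ap (\<lambda>j. u n j om) i) - (norm (WP n om *v (sU n om + sR n om)))^2" (is ?g1)
proof -
  let ?bh = "betahat n om"
  have n0: "0 < real n" using n by simp
  have y: "y n i om = \<beta> \<bullet> x n i om + g_dot n (wF n i om) + u n i om" if i: "i \<in> {1..n}" for i
  proof -
    have "w n i om = wF n i om" using r i unfolding regular_def by blast
    then show ?thesis using model[OF i sp] g_dot[OF w_dim[OF i sp]] by simp
  qed
  have g: "proj.ap (\<lambda>j. g_dot n (wF n j om)) i = 0" if "i \<in> {1..n}" for i by (rule regular_kills(1)[OF r that])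
  have A: "GP n om = (1 / real n) *\<^sub>R (\<Sum>i=1..n. outer (proj.ap (\<lambda>j. x n j om) i) (proj.ap (\<lambda>j. x n j om) i))"
    unfolding GP_def vP_def ..
  have v: "vhat n i om = proj.ap (\<lambda>j. x n j om) i" if "i \<in> {1..n}" for i by (rule regular_v_hat(1)[OF r that])
  have bh: "?bh = matrix_inv (\<Sum>i=1..n. outer (proj.ap (\<lambda>j. x n j om) i) (proj.ap (\<lambda>j. x n j om) i)) *v (\<Sum>i=1..n. y n i om *\<^sub>R proj.ap (\<lambda>j. x n j om) i)"
  proof -
    have "(\<Sum>i=1..n. outer (vhat n i om) (vhat n i om)) = (\<Sum>i=1..n. outer (proj.ap (\<lambda>j. x n j om) i) (proj.ap (\<lambda>j. x n j om) i))"
      by (intro sum.cong refl) (simp only: v)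
    moreover have "(\<Sum>i=1..n. y n i om *\<^sub>R vhat n i om) = (\<Sum>i=1..n. y n i om *\<^sub>R proj.ap (\<lambda>j. x n j om) i)"
      by (intro sum.cong refl) (simp only: v)
    ultimately show ?thesis unfolding beta_hat_def by (simp only:)
  qed
  have s: "sU n om + sR n om = (1 / sqrt (real n)) *\<^sub>R (\<Sum>i=1..n. u n i om *\<^sub>R proj.ap (\<lambda>j. x n j om) i)"
    unfolding s_split[symmetric] vP_def ..
  note o = proj.ols_error[of "\<lambda>i. y n i om" \<beta> "\<lambda>i. x n i om" "\<lambda>i. g_dot n (wF n i om)" "\<lambda>i. u n i om", OF y g n0 A pd.pd_matrix_axioms bh s]
  show "sqrt (real n) *\<^sub>R (?bh - \<beta>) = matrix_inv (GP n om) *v (sU n om + sR n om)" by (rule o(1)) assumption+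
  have uh: "uhat n i om = proj.ap (\<lambda>j. y n j om - ?bh \<bullet> x n j om) i" if i: "i \<in> {1..n}" for i
    unfolding u_hat_def proj.ap_real using r i by (intro sum.cong refl) (simp add: regular_def)
  have "(\<Sum>i=1..n. (uhat n i om)^2) = (\<Sum>i=1..n. (proj.ap (\<lambda>j. y n j om - ?bh \<bullet> x n j om) i)^2)"
    by (intro sum.cong refl) (simp only: uh)
  also have "\<dots> = (\<Sum>i=1..n. u n i om * proj.ap (\<lambda>j. u n j om) i) - (sU n om + sR n om) \<bullet> (matrix_inv (GP n om) *v (sU n om + sR n om))"
    by (rule o(2)) assumption+
  also have "(sU n om + sR n om) \<bullet> (matrix_inv (GP n om) *v (sU n om + sR n om)) = (norm (WP n om *v (sU n om + sR n om)))^2"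
    by (simp only: WP pd.WW_vec[symmetric] pd.W_inner power2_norm_eq_inner)
  finally show ?g1 .
qed

text \<open>With \<open>u = U + R\<close>, the mixed term is split by the inequality between arithmetic and geometric mean with weight
  \<open>sqrt d\<close>, which balances \<open>U'P U\<close> of order \<open>n\<close> against \<open>R'P R \<le> d n\<close>.\<close>

lemma u_quadratic:
  assumes d: "0 < d" "d \<le> 1" and \<sigma>1: "(\<sigma> n)^2 \<le> s1"
  shows "\<bar>(\<Sum>i=1..n. u n i om * proj.ap (\<lambda>j. u n j om) i) - (\<sigma> n)\<^sup>2 * (real n - real (K n))\<bar> \<le> sqrt d * (s1 + 4) * real n"
proof -
  let ?Q = "\<lambda>z. \<Sum>i=1..n. (proj.ap z i)^2"
  let ?U = "\<lambda>i. U n i om" and ?R = "\<lambda>i. R n i om"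
  let ?c = "\<Sum>i=1..n. proj.ap ?R i * proj.ap ?U i"
  have q: "(\<Sum>i=1..n. z i * proj.ap z i) = ?Q z" for z :: "nat => real"
    by (simp only: power2_eq_square proj.ap_prod)
  have uUR: "proj.ap (\<lambda>j. u n j om) i = proj.ap ?U i + proj.ap ?R i" for i
    unfolding proj.ap_add[symmetric] using r by (intro proj.ap_cong) (simp only: regular_def)
  have uQ: "?Q (\<lambda>j. u n j om) = ?Q ?U + ?Q ?R + 2 * ?c"
    unfolding uUR power2_sum by (simp add: sum.distrib sum_distrib_left mult_ac)
  have c: "\<bar>2 * ?c\<bar> \<le> sqrt d * ?Q ?U + (1 / sqrt d) * ?Q ?R"
  proof -
    have pt: "\<bar>2 * (a * b)\<bar> \<le> sqrt d * b^2 + (1 / sqrt d) * a^2" for a b :: real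
    proof -
      define g where "g = sqrt d"
      have g: "0 < g" using d by (simp add: g_def)
      have "0 \<le> (g * \<bar>b\<bar> - \<bar>a\<bar>)^2" by simp
      then have "2 * g * (\<bar>a\<bar> * \<bar>b\<bar>) \<le> g^2 * b^2 + a^2" by (simp add: power2_diff power_mult_distrib mult_ac)
      then have "(1 / g) * (2 * g * (\<bar>a\<bar> * \<bar>b\<bar>)) \<le> (1 / g) * (g^2 * b^2 + a^2)" using g by (intro mult_left_mono) auto
      then have "2 * (\<bar>a\<bar> * \<bar>b\<bar>) \<le> g * b^2 + (1 / g) * a^2" using g by (simp add: distrib_left power2_eq_square)
      then show ?thesis by (simp add: g_def abs_mult)
    qed
    have "\<bar>2 * ?c\<bar> \<le> (\<Sum>i=1..n. \<bar>2 * (proj.ap ?R i * proj.ap ?U i)\<bar>)" unfolding sum_distrib_left by (rule sum_abs)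
    also have "\<dots> \<le> (\<Sum>i=1..n. sqrt d * (proj.ap ?U i)^2 + (1 / sqrt d) * (proj.ap ?R i)^2)" by (intro sum_mono pt)
    also have "\<dots> = sqrt d * ?Q ?U + (1 / sqrt d) * ?Q ?R" by (simp only: sum.distrib sum_distrib_left)
    finally show ?thesis .
  qed
  have QR: "?Q ?R \<le> d * real n" "0 \<le> ?Q ?R"
    using proj.ap_contraction[of ?R] wb by (auto simp: well_behaved_def intro!: sum_nonneg simp del: One_nat_def)
  have QU: "\<bar>?Q ?U - (\<sigma> n)\<^sup>2 * (real n - real (K n))\<bar> \<le> d * real n"
    using wb unfolding well_behaved_def q by (elim conjE)
  have "(\<sigma> n)^2 * (real n - real (K n)) \<le> (\<sigma> n)^2 * real n" by (intro mult_left_mono) auto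
  moreover have "(\<sigma> n)^2 * real n \<le> s1 * real n" by (intro mult_right_mono \<sigma>1) auto
  moreover have "d * real n \<le> real n" using d by (simp add: mult_left_le_one_le)
  ultimately have QU1: "?Q ?U \<le> (s1 + 1) * real n" using QU unfolding distrib_right by linarith
  have g: "d \<le> sqrt d" "sqrt d \<le> 1" "0 < sqrt d" using d by (auto intro: real_le_rsqrt simp: power2_eq_square mult_left_le)
  have t1: "sqrt d * ?Q ?U \<le> sqrt d * ((s1 + 1) * real n)" using QU1 g by (intro mult_left_mono) auto
  have "(1 / sqrt d) * ?Q ?R \<le> (1 / sqrt d) * (d * real n)" using QR g by (intro mult_left_mono) auto
  also have "\<dots> = sqrt d * real n" using d by (simp add: field_simps) (simp add: mult.assoc[symmetric])?
  finally have t2: "(1 / sqrt d) * ?Q ?R \<le> sqrt d * real n" .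
  have t3: "d * real n \<le> sqrt d * real n" using g by (intro mult_right_mono) auto
  have "sqrt d * (s1 + 4) * real n = sqrt d * ((s1 + 1) * real n) + 3 * (sqrt d * real n)" by (simp add: algebra_simps)
  then show ?thesis unfolding q using uQ c t1 t2 t3 QR QU by linarith
qed

lemma sigma2_bound:
  assumes d: "0 < d" "d \<le> 1" and \<sigma>1: "(\<sigma> n)^2 \<le> s1" and L: "0 < L"
    and deg: "0 < c" "c * real n \<le> real n - real CARD('d) - real (K n)"
    and big: "s1 * real CARD('d) + ((s1 + 1) * L + 1)^2 \<le> sqrt d * real n"
  shows "\<bar>sigmahat2 n om - (\<sigma> n)\<^sup>2\<bar> \<le> sqrt d * (s1 + 5) / c"
proof -
  define m where "m = real n - real CARD('d) - real (K n)"
  let ?q = "\<Sum>i=1..n. u n i om * proj.ap (\<lambda>j. u n j om) i"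
  let ?W = "(norm (WP n om *v (sU n om + sR n om)))^2"
  have m: "c * real n \<le> m" using deg by (simp add: m_def)
  have n0: "0 < real n" using n by simp
  have cn: "0 < c * real n" using deg(1) n0 by simp
  have m0: "0 < m" using m cn by linarith
  have s1: "0 \<le> s1" using order_trans[OF zero_le_power2 \<sigma>1] .
  have "\<bar>\<sigma> n\<bar> \<le> s1 + 1" using sum_squares_bound[of "\<bar>\<sigma> n\<bar>" 1] \<sigma>1 s1 by simp
  then have "\<bar>\<sigma> n\<bar> * L + d \<le> (s1 + 1) * L + 1" using L d by (intro add_mono mult_right_mono) auto
  then have W: "?W \<le> ((s1 + 1) * L + 1)^2" by (intro power_mono order_trans[OF Ws_bound]) auto
  have mm: "m * sigmahat2 n om = ?q - ?W"
    unfolding sigma2_hat_def ols(2) m_def[symmetric] using m0 by simp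
  have sd: "(\<sigma> n)^2 * real CARD('d) \<le> s1 * real CARD('d)" by (intro mult_right_mono \<sigma>1) auto
  have ms: "m * (\<sigma> n)^2 = (\<sigma> n)^2 * (real n - real (K n)) - (\<sigma> n)\<^sup>2 * real CARD('d)" by (simp add: m_def algebra_simps)
  have z: "0 \<le> ?W" "0 \<le> (\<sigma> n)^2 * real CARD('d)" by simp_all
  have "\<bar>m * sigmahat2 n om - m * (\<sigma> n)^2\<bar> \<le> sqrt d * (s1 + 4) * real n + sqrt d * real n"
    using u_quadratic[OF d \<sigma>1] W sd big z unfolding mm ms by linarith
  also have "\<dots> = sqrt d * (s1 + 5) * real n" by (simp add: algebra_simps)
  finally have "m * \<bar>sigmahat2 n om - (\<sigma> n)\<^sup>2\<bar> \<le> sqrt d * (s1 + 5) * real n"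
    using m0 by (simp add: right_diff_distrib[symmetric] abs_mult)
  moreover have "c * real n * \<bar>sigmahat2 n om - (\<sigma> n)\<^sup>2\<bar> \<le> m * \<bar>sigmahat2 n om - (\<sigma> n)\<^sup>2\<bar>"
    by (intro mult_right_mono m) auto
  ultimately have "(c * \<bar>sigmahat2 n om - (\<sigma> n)\<^sup>2\<bar>) * real n \<le> sqrt d * (s1 + 5) * real n" by (simp only: mult_ac)
  then have "c * \<bar>sigmahat2 n om - (\<sigma> n)\<^sup>2\<bar> \<le> sqrt d * (s1 + 5)" using n0 by (rule mult_right_le_imp_le)
  then show ?thesis using deg(1) by (simp add: pos_le_divide_eq mult.commute)
qed

lemma studentized:
  assumes pos: "0 < sigmahat2 n om"
  shows "studentized n om
    = (1 / sqrt (sigmahat2 n om)) *\<^sub>R (\<bar>\<sigma> n\<bar> *\<^sub>R Z n om + WP n om *v sR n om)"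
proof -
  define t where "t = sqrt (sigmahat2 n om)"
  have t: "0 < t" "t^2 = sigmahat2 n om" using pos by (simp_all add: t_def)
  have O: "Omegahat n om = matrix_inv (GP n om) ** (t^2 *\<^sub>R GP n om) ** matrix_inv (GP n om)"
    unfolding Omega_hat_def Sigma_HO_def regular_GP[OF r] t(2) ..
  show ?thesis
    unfolding O ols(1) pd.sqrt_inv_sandwich[OF t(1)] Ws[symmetric] unfolding t_def WP pd.WW_vec[symmetric] pd.SW_vec ..
qed

text \<open>The difference is \<open>(|\<sigma>| / t - 1) Z + (W sR) / t\<close> with \<open>t\<close> the estimated standard deviation.\<close>

lemma studentized_close:
  assumes close: "\<bar>sigmahat2 n om - (\<sigma> n)\<^sup>2\<bar> \<le> h" and h: "h \<le> s0 / 2" and s0: "0 < s0" "s0 \<le> (\<sigma> n)^2" and L: "0 < L" and d: "0 \<le> d"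
  shows "norm (studentized n om - Z n om)
    \<le> 2 * h / s0 * L + d / sqrt (s0 / 2)"
proof -
  define q where "q = sigmahat2 n om"
  define t where "t = sqrt q"
  have q: "s0 / 2 \<le> q" using close h s0 unfolding q_def by linarith
  then have q0: "0 < q" using s0 by linarith
  have t: "0 < t" "t^2 = q" using q0 by (simp_all add: t_def)
  have ts: "sqrt (s0 / 2) \<le> t" unfolding t_def using q by simp
  have h0: "0 \<le> h" using close by linarith
  have r1: "\<bar>\<bar>\<sigma> n\<bar> / t - 1\<bar> \<le> 2 * h / s0"
  proof -
    have "(\<bar>\<sigma> n\<bar> - t) * (\<bar>\<sigma> n\<bar> + t) = (\<sigma> n)^2 - q" using t(2) by (simp add: algebra_simps power2_eq_square)
    then have "\<bar>\<bar>\<sigma> n\<bar> - t\<bar> * (\<bar>\<sigma> n\<bar> + t) = \<bar>(\<sigma> n)^2 - q\<bar>" using t(1) by (metis abs_mult abs_of_nonneg add_nonneg_nonneg abs_ge_zero less_imp_le)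
    moreover have "\<bar>\<bar>\<sigma> n\<bar> - t\<bar> * t \<le> \<bar>\<bar>\<sigma> n\<bar> - t\<bar> * (\<bar>\<sigma> n\<bar> + t)" by (intro mult_left_mono) auto
    ultimately have a: "\<bar>\<bar>\<sigma> n\<bar> - t\<bar> * t \<le> h" using close unfolding q_def by linarith
    have "\<bar>\<sigma> n\<bar> / t - 1 = (\<bar>\<sigma> n\<bar> - t) * t / q" using t by (simp add: t(2)[symmetric] power2_eq_square field_simps)
    then have "\<bar>\<bar>\<sigma> n\<bar> / t - 1\<bar> = \<bar>\<bar>\<sigma> n\<bar> - t\<bar> * t / q" using t q0 by (simp add: abs_mult)
    also have "\<dots> \<le> h / (s0 / 2)" using a q s0 h0 by (intro frac_le) auto
    also have "\<dots> = 2 * h / s0" by simp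
    finally show ?thesis .
  qed
  have "(1 / t) *\<^sub>R (\<bar>\<sigma> n\<bar> *\<^sub>R Z n om + WP n om *v sR n om) - Z n om = (\<bar>\<sigma> n\<bar> / t - 1) *\<^sub>R Z n om + (1 / t) *\<^sub>R (WP n om *v sR n om)"
    by (simp add: scaleR_add_right scaleR_diff_left)
  then have "norm ((1 / t) *\<^sub>R (\<bar>\<sigma> n\<bar> *\<^sub>R Z n om + WP n om *v sR n om) - Z n om) \<le> \<bar>\<bar>\<sigma> n\<bar> / t - 1\<bar> * norm (Z n om) + (1 / t) * norm (WP n om *v sR n om)"
    using norm_triangle_ineq[of "(\<bar>\<sigma> n\<bar> / t - 1) *\<^sub>R Z n om" "(1 / t) *\<^sub>R (WP n om *v sR n om)"] t by simp
  also have "\<dots> \<le> 2 * h / s0 * L + (1 / sqrt (s0 / 2)) * d"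
  proof (rule add_mono)
    show "\<bar>\<bar>\<sigma> n\<bar> / t - 1\<bar> * norm (Z n om) \<le> 2 * h / s0 * L"
      using wb h0 s0 by (intro mult_mono r1) (auto simp: well_behaved_def)
    have "1 / t \<le> 1 / sqrt (s0 / 2)" using ts s0 by (intro divide_left_mono mult_pos_pos t) auto
    then show "(1 / t) * norm (WP n om *v sR n om) \<le> (1 / sqrt (s0 / 2)) * d"
      using wb s0 by (intro mult_mono) (auto simp: well_behaved_def)
  qed
  finally show ?thesis unfolding studentized[OF q0[unfolded q_def]] by (simp add: t_def q_def)
qed

end

lemma studentized_limit:
  assumes d: "0 < d"
  shows "whp M (\<lambda>n om. norm (studentized n om - Z n om) \<le> d)"
  unfolding whp_def
proof (intro allI impI)
  fix e :: real assume e: "0 < e"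
  obtain s0 s1 where s: "0 < s0" "0 < s1" "\<forall>\<^sub>F n in sequentially. s0 \<le> (\<sigma> n)^2 \<and> (\<sigma> n)^2 \<le> s1" using sigma_bounds by blast
  obtain c where c: "0 < c" "\<forall>\<^sub>F n in sequentially. c * real n \<le> real n - real CARD('d) - real (K n)" using residual_degrees by blast
  obtain \<kappa> L where kL: "0 < \<kappa>" "0 < L" "\<And>d. 0 < d ==> \<forall>\<^sub>F n in sequentially. with_prob (M n) e (well_behaved \<kappa> L d n)"
    using well_behaved_event[OF e] by blast
  \<comment> \<open>\<open>h\<close> is the admissible error of the variance estimator, \<open>\<eta>\<close> that of the quantities entering it\<close>
  define h where "h = min (s0 / 2) (d * s0 / (4 * L))"
  have h: "0 < h" "h \<le> s0 / 2" "2 * h / s0 * L \<le> d / 2"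
  proof -
    show "0 < h" using s kL d by (simp add: h_def)
    show "h \<le> s0 / 2" by (simp add: h_def)
    have "h \<le> d * s0 / (4 * L)" by (simp add: h_def)
    then show "2 * h / s0 * L \<le> d / 2" using s kL by (simp add: field_simps)
  qed
  define g where "g = min 1 (min (h * c / (s1 + 5)) (d / 2 * sqrt (s0 / 2)))"
  define \<eta> where "\<eta> = g^2"
  have g: "0 < g" "g \<le> 1" "g \<le> h * c / (s1 + 5)" "g \<le> d / 2 * sqrt (s0 / 2)"
    unfolding g_def using h(1) s(1,2) c(1) d by (simp_all only: min.cobounded1 min.coboundedI2 min.cobounded2 min_less_iff_conj) simp_all
  have \<eta>: "0 < \<eta>" "\<eta> \<le> 1" "sqrt \<eta> = g" "\<eta> \<le> g" using g(1,2) by (auto simp: \<eta>_def power_le_one) (simp add: power2_eq_square mult_left_le)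
  have hc: "sqrt \<eta> * (s1 + 5) / c \<le> h" using g(3) s c unfolding \<eta>(3) by (simp add: field_simps)
  have dd: "\<eta> / sqrt (s0 / 2) \<le> d / 2"
  proof -
    have "\<eta> \<le> d / 2 * sqrt (s0 / 2)" using \<eta> g by linarith
    then show ?thesis using s by (subst pos_divide_le_eq) auto
  qed
  obtain m :: nat where m: "s1 * real CARD('d) + ((s1 + 1) * L + 1)^2 < real m * sqrt \<eta>"
    using reals_Archimedean3[of "sqrt \<eta>"] \<eta> by auto
  show "\<forall>\<^sub>F n in sequentially. with_prob (M n) e (\<lambda>om. norm (studentized n om - Z n om) \<le> d)"
    using s(3) c(2) kL(3)[OF \<eta>(1)] eventually_ge_at_top[of 1] eventually_ge_at_top[of m]
  proof eventually_elim
    case (elim n)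
    have s0n: "s0 \<le> (\<sigma> n)^2" and s1n: "(\<sigma> n)^2 \<le> s1" using elim(1) by auto
    have \<sigma>: "\<sigma> n \<noteq> 0" using s0n s(1) by auto
    have "real m * sqrt \<eta> \<le> sqrt \<eta> * real n" using elim(5) \<eta> by (simp add: mult.commute)
    then have big: "s1 * real CARD('d) + ((s1 + 1) * L + 1)^2 \<le> sqrt \<eta> * real n" using m by linarith
    from elim(3) show ?case
    proof (rule with_prob_mono)
      fix om assume wb: "well_behaved \<kappa> L \<eta> n om"
      have "\<bar>sigmahat2 n om - (\<sigma> n)\<^sup>2\<bar> \<le> sqrt \<eta> * (s1 + 5) / c"
        by (rule sigma2_bound[OF kL(1) wb elim(4) \<sigma> \<eta>(1,2) s1n kL(2) c(1) elim(2) big])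
      then have "\<bar>sigmahat2 n om - (\<sigma> n)\<^sup>2\<bar> \<le> h" using hc by linarith
      from studentized_close[OF kL(1) wb elim(4) \<sigma> this h(2) s(1) s0n kL(2) less_imp_le[OF \<eta>(1)]]
      show "norm (studentized n om - Z n om) \<le> d"
        using h(3) dd by linarith
    qed simp
  qed
qed

lemma studentized_measurable:
  "(\<lambda>om. studentized n om) \<in> borel_measurable (M n)"
proof -
  have yM: "y n i \<in> borel_measurable (M n)" if "i \<in> {1..n}" for i by (rule L2_meas[OF y_L2[OF that]])
  have so: "(\<lambda>om. \<Sum>i=1..n. outer (vhat n i om) (vhat n i om)) \<in> borel_measurable (M n)"
    by (rule measurable_sum_outer) (rule v_hat_M)
  have sy: "(\<lambda>om. \<Sum>i=1..n. y n i om *\<^sub>R vhat n i om) \<in> borel_measurable (M n)"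
    by (intro borel_measurable_sum borel_measurable_scaleR yM v_hat_M)
  have G: "Gammahat n \<in> borel_measurable (M n)"
    unfolding Gamma_hat_def[abs_def] by (intro borel_measurable_scaleR borel_measurable_const so)
  have inv: "(\<lambda>om. matrix_inv (A om)) \<in> borel_measurable (M n)" if "A \<in> borel_measurable (M n)" for A :: "'a => real ^ 'd ^ 'd"
    using that by measurable
  have bh: "betahat n \<in> borel_measurable (M n)"
    unfolding beta_hat_def[abs_def] by (rule measurable_matrix_vector_mult[OF inv[OF so] sy])
  have uh: "uhat n i \<in> borel_measurable (M n)" if i: "i \<in> {1..n}" for i
    unfolding u_hat_def[abs_def]
    by (intro borel_measurable_sum borel_measurable_times borel_measurable_diff borel_measurable_inner measurable_annih_M yM bh x_meas i)
  have s2: "sigmahat2 n \<in> borel_measurable (M n)"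
    unfolding sigma2_hat_def[abs_def] by (intro borel_measurable_sum borel_measurable_times borel_measurable_const borel_measurable_power uh)
  have Om: "Omegahat n \<in> borel_measurable (M n)"
    unfolding Omega_hat_def[abs_def] Sigma_HO_def
    by (intro measurable_matrix_mult inv G borel_measurable_scaleR s2)
  have "(\<lambda>om. matrix_sqrt (Omegahat n om)) \<in> borel_measurable (M n)" using Om by measurable
  then show ?thesis
    by (intro measurable_matrix_vector_mult inv borel_measurable_scaleR borel_measurable_const borel_measurable_diff bh)
qed

lemma studentized_normal:
  "weak_conv_vec
    (\<lambda>n. distr (M n) borel
      (\<lambda>om. matrix_inv (matrix_sqrt (Omega_hat K w x (Sigma_HO K w x y) n om)) *v
        (sqrt (real n) *\<^sub>R (beta_hat K w x y n om - \<beta>))))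
    std_normal_vec"
  by (rule weak_conv_vec_of_char[OF prob Z_M studentized_measurable char_Z studentized_limit])

end

theorem theorem2:
  fixes M F :: "nat \<Rightarrow> 'a measure"
    and K N :: "nat \<Rightarrow> nat"
    and x :: "nat \<Rightarrow> nat \<Rightarrow> 'a \<Rightarrow> real ^ 'd"
    and w :: "nat \<Rightarrow> nat \<Rightarrow> 'a \<Rightarrow> real Matrix.vec"
    and y u :: "nat \<Rightarrow> nat \<Rightarrow> 'a \<Rightarrow> real"
    and \<beta> :: "real ^ 'd"
    and \<gamma> :: "nat \<Rightarrow> real Matrix.vec"
    and T :: "nat \<Rightarrow> nat \<Rightarrow> nat set"
    and \<sigma> :: "nat \<Rightarrow> real"
  assumes prob: "\<And>n. prob_space (M n)"
    and subalg: "\<And>n. subalgebra (M n) (F n)"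
    and x_meas: "\<And>n i. i \<in> {1..n} \<Longrightarrow> x n i \<in> borel_measurable (M n)"
    and u_meas: "\<And>n i. i \<in> {1..n} \<Longrightarrow> u n i \<in> borel_measurable (M n)"
    and w_dim: "\<And>n i \<omega>. i \<in> {1..n} \<Longrightarrow> \<omega> \<in> space (M n) \<Longrightarrow> w n i \<omega> \<in> carrier_vec (K n)"
    and w_meas: "\<And>n i k. i \<in> {1..n} \<Longrightarrow> k < K n \<Longrightarrow>
      (\<lambda>\<omega>. vec_index (w n i \<omega>) k) \<in> borel_measurable (M n)"
    and \<gamma>_dim: "\<And>n. \<gamma> n \<in> carrier_vec (K n)"
    and model: "\<And>n i \<omega>. i \<in> {1..n} \<Longrightarrow> \<omega> \<in> space (M n) \<Longrightarrow>
      y n i \<omega> = \<beta> \<bullet> x n i \<omega> + scalar_prod (\<gamma> n) (w n i \<omega>) + u n i \<omega>"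
    and x_moment: "\<And>n i. i \<in> {1..n} \<Longrightarrow> integrable (M n) (\<lambda>\<omega>. (norm (x n i \<omega>))\<^sup>2)"
    and u_moment: "\<And>n i. i \<in> {1..n} \<Longrightarrow> integrable (M n) (\<lambda>\<omega>. (u n i \<omega>)\<^sup>2)"
    and w_moment: "\<And>n i k. i \<in> {1..n} \<Longrightarrow> k < K n \<Longrightarrow>
      integrable (M n) (\<lambda>\<omega>. (vec_index (w n i \<omega>) k)\<^sup>2)"
    and pop_inverse: "\<And>n. n \<ge> 1 \<Longrightarrow> invertible_mat (pop_gram M K w n)"
    and w_cond: "\<And>n i k. i \<in> {1..n} \<Longrightarrow> k < K n \<Longrightarrow> AE \<omega> in M n.
      real_cond_exp (M n) (F n) (\<lambda>\<omega>. vec_index (w n i \<omega>) k) \<omega> = vec_index (w n i \<omega>) k"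
    and sampling_cov: "\<And>n i j. i \<in> {1..n} \<Longrightarrow> j \<in> {1..n} \<Longrightarrow> i \<noteq> j \<Longrightarrow> AE \<omega> in M n.
      cond_cov (M n) (XW M F x n) (U_err M F x y n i) (U_err M F x y n j) \<omega> = 0"
    and sampling_partition: "\<And>n. partition_on {1..n} (T n ` {1..N n})" "\<And>n. inj_on (T n) {1..N n}"
    and sampling_card: "(\<lambda>n. real (MAX i\<in>{1..N n}. card (T n i))) \<in> O(\<lambda>_. 1)"
    and sampling_indep: "\<And>n. cond_indep_vars (M n) (F n)
      (\<lambda>i. Pi\<^sub>M (T n i) (\<lambda>_. borel \<Otimes>\<^sub>M borel))
      (\<lambda>i \<omega>. \<lambda>t\<in>T n i. (U_err M F x y n t \<omega>, V_err M F x n t \<omega>)) {1..N n}"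
    and design_rank: "(\<lambda>n. measure (M n)
      {\<omega> \<in> space (M n). min_eigenvalue_mat (gram K w n \<omega>) > 0}) \<longlonglongrightarrow> 1"
    and design_dim: "limsup (\<lambda>n. ereal (real (K n) / real n)) < 1"
    and design_C: "bounded_in_prob M (C_n M F K w x y)"
    and approx_chi: "chi_n M F K w x \<in> O(\<lambda>_. 1)"
    and approx_rho: "(\<lambda>n. varrho_n M F x u n
        + real n * (varrho_n M F x u n - rho_n M F u n)
        + real n * chi_n M F K w x n * varrho_n M F x u n) \<in> o(\<lambda>_. 1)"
    and approx_v: "vanishes_in_prob M
      (\<lambda>n \<omega>. (MAX i\<in>{1..n}. norm (v_hat K w x n i \<omega>)) / sqrt (real n))"
    and homoskedastic: "\<And>n i. i \<in> {1..n} \<Longrightarrow> AE \<omega> in M n.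
      real_cond_exp (M n) (XW M F x n) (\<lambda>\<omega>. (U_err M F x y n i \<omega>)\<^sup>2) \<omega> = (\<sigma> n)\<^sup>2"
  shows "weak_conv_vec
    (\<lambda>n. distr (M n) borel
      (\<lambda>\<omega>. matrix_inv (matrix_sqrt (Omega_hat K w x (Sigma_HO K w x y) n \<omega>)) *v
        (sqrt (real n) *\<^sub>R (beta_hat K w x y n \<omega> - \<beta>))))
    std_normal_vec"
proof -
  interpret many_covariates M F K N x w y u \<beta> \<gamma> T \<sigma>
    by (rule many_covariates.intro; fact assms)
  show ?thesis by (rule studentized_normal)
qed

end
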